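(* Let $\mathscr A$ be a finitary abelian category and let $E$ be an object of $\mathscr A$ such that $\mathrm{Ext}^1_{\mathscr A}(E,E)=0$ and $\mathrm{End}_{\mathscr A}E$ is a field; put $q_E=|\mathrm{End}_{\mathscr A}E|$. Let ${}^{\perp}E$ (respectively $E^{\perp}$) be the full subcategory of $\mathscr A$ of objects $C$ with $\mathrm{Ext}^1_{\mathscr A}(C,E)=0$ (respectively $\mathrm{Ext}^1_{\mathscr A}(E,C)=0$), and let $$\mathcal S_E=\{1+(q_E-1)q_E^j[E]\,:\,j\in\mathbb Z\}\subset H_{{}^\perp E}\cap H_{E^\perp}.$$ Then the assignment $$x\mapsto \exp_{q_E}([E])\cdot x\cdot \exp_{q_E}([E])^{-1}$$ defines an automorphism of the localized algebra $H_{{}^\perp E}[\mathcal S_E^{-1}]$ and an automorphism of the localized algebra $H_{E^\perp}[\mathcal S_E^{-1}]$.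
   Context: An (essentially small) abelian category $\mathscr A$ is finitary if $\mathrm{Hom}_{\mathscr A}(M,N)$ and $\mathrm{Ext}^1_{\mathscr A}(M,N)$ are finite sets for all objects $M,N$. The Hall algebra $H_{\mathscr A}$ is the $\mathbb Q$-vector space with basis the isomorphism classes $[M]$ of objects of $\mathscr A$ and multiplication $[M][N]=\sum_{[K]}F_{MN}^K[K]$, where $F_{MN}^K$ is the number of subobjects $U\subset K$ with $U\cong N$, $K/U\cong M$. For a full subcategory $\mathscr B$ closed under extensions, $H_{\mathscr B}$ is the subalgebra of $H_{\mathscr A}$ spanned by the classes of objects of $\mathscr B$ (the subcategories ${}^\perp E$ and $E^\perp$ are closed under extensions). $H_{\mathscr A}$ is graded by $K_0(\mathscr A)$ and $\widehat H_{\mathscr A}=\prod_{\gamma\in K_0(\mathscr A)}H_{\mathscr A,\gamma}$ is its completion; products with $\exp_{q_E}([E])$ are taken there. Here $\exp_q(x)=\sum_{n\ge0}x^n/[n]_q!$ with $[n]_q!=[1]_q\cdots[n]_q$, $[k]_q=1+q+\cdots+q^{k-1}$. For a ring $R$ and a set $S=\{a_\iota\}_{\iota\in I}$ of pairwise commuting regular elements (non-zero-divisors) of $R$, the localization $R[S^{-1}]$ is the quotient of the free product $R*\mathbb Z[x_\iota:\iota\in I]$ by the ideal generated by $a_\iota*x_\iota-1$ and $x_\iota*a_\iota-1$, $\iota\in I$. *)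

theory Defs
  imports "HOL-Algebra.QuotRing" "HOL-Algebra.Free_Abelian_Groups" "HOL-Algebra.Generated_Groups"
begin

section \<open>Abelian categories\<close>

text \<open>
  Categories enriched over abelian groups. \<open>Comp C g f\<close> is the composite of \<open>f : A \<rightarrow> B\<close> followed by
  \<open>g : B \<rightarrow> D\<close>; \<open>Null C A B\<close> is the zero morphism from \<open>A\<close> to \<open>B\<close>.
\<close>

record ('o, 'm) category =
  Obj :: "'o set"
  Hom :: "'o \<Rightarrow> 'o \<Rightarrow> 'm set"
  Comp :: "'m \<Rightarrow> 'm \<Rightarrow> 'm"
  Ident :: "'o \<Rightarrow> 'm"
  Add :: "'m \<Rightarrow> 'm \<Rightarrow> 'm"
  Null :: "'o \<Rightarrow> 'o \<Rightarrow> 'm"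

definition Hom_group :: "('o, 'm) category \<Rightarrow> 'o \<Rightarrow> 'o \<Rightarrow> 'm monoid" where
  "Hom_group C A B = \<lparr>carrier = Hom C A B, monoid.mult = Add C, monoid.one = Null C A B\<rparr>"

locale preadditive_category =
  fixes C :: "('o, 'm) category"
  assumes Hom_objects: "f \<in> Hom C A B \<Longrightarrow> A \<in> Obj C \<and> B \<in> Obj C"
    and Hom_disjoint: "\<lbrakk>f \<in> Hom C A B; f \<in> Hom C A' B'\<rbrakk> \<Longrightarrow> A = A' \<and> B = B'"
    and Comp_closed: "\<lbrakk>f \<in> Hom C A B; g \<in> Hom C B D\<rbrakk> \<Longrightarrow> Comp C g f \<in> Hom C A D"
    and Comp_assoc: "\<lbrakk>f \<in> Hom C A B; g \<in> Hom C B D; h \<in> Hom C D F\<rbrakk>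
          \<Longrightarrow> Comp C (Comp C h g) f = Comp C h (Comp C g f)"
    and Ident_closed: "A \<in> Obj C \<Longrightarrow> Ident C A \<in> Hom C A A"
    and Comp_Ident: "f \<in> Hom C A B \<Longrightarrow> Comp C f (Ident C A) = f"
    and Ident_Comp: "f \<in> Hom C A B \<Longrightarrow> Comp C (Ident C B) f = f"
    and Hom_comm_group: "\<lbrakk>A \<in> Obj C; B \<in> Obj C\<rbrakk> \<Longrightarrow> comm_group (Hom_group C A B)"
    and Comp_Add_right: "\<lbrakk>f \<in> Hom C A B; f' \<in> Hom C A B; g \<in> Hom C B D\<rbrakk>
          \<Longrightarrow> Comp C g (Add C f f') = Add C (Comp C g f) (Comp C g f')"
    and Comp_Add_left: "\<lbrakk>f \<in> Hom C A B; g \<in> Hom C B D; g' \<in> Hom C B D\<rbrakk>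
          \<Longrightarrow> Comp C (Add C g g') f = Add C (Comp C g f) (Comp C g' f)"

definition is_mono :: "('o, 'm) category \<Rightarrow> 'o \<Rightarrow> 'o \<Rightarrow> 'm \<Rightarrow> bool" where
  "is_mono C A B f \<longleftrightarrow> f \<in> Hom C A B \<and>
     (\<forall>X\<in>Obj C. \<forall>g\<in>Hom C X A. \<forall>h\<in>Hom C X A. Comp C f g = Comp C f h \<longrightarrow> g = h)"

definition is_epi :: "('o, 'm) category \<Rightarrow> 'o \<Rightarrow> 'o \<Rightarrow> 'm \<Rightarrow> bool" where
  "is_epi C A B f \<longleftrightarrow> f \<in> Hom C A B \<and>
     (\<forall>X\<in>Obj C. \<forall>g\<in>Hom C B X. \<forall>h\<in>Hom C B X. Comp C g f = Comp C h f \<longrightarrow> g = h)"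

definition is_iso :: "('o, 'm) category \<Rightarrow> 'o \<Rightarrow> 'o \<Rightarrow> 'm \<Rightarrow> bool" where
  "is_iso C A B f \<longleftrightarrow> f \<in> Hom C A B \<and>
     (\<exists>g\<in>Hom C B A. Comp C g f = Ident C A \<and> Comp C f g = Ident C B)"

definition isomorphic :: "('o, 'm) category \<Rightarrow> 'o \<Rightarrow> 'o \<Rightarrow> bool" where
  "isomorphic C A B \<longleftrightarrow> (\<exists>f. is_iso C A B f)"

text \<open>\<open>is_kernel C A B f U k\<close>: the morphism \<open>k : U \<rightarrow> A\<close> is a kernel of \<open>f : A \<rightarrow> B\<close>.\<close>

definition is_kernel :: "('o, 'm) category \<Rightarrow> 'o \<Rightarrow> 'o \<Rightarrow> 'm \<Rightarrow> 'o \<Rightarrow> 'm \<Rightarrow> bool" where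
  "is_kernel C A B f U k \<longleftrightarrow> f \<in> Hom C A B \<and> k \<in> Hom C U A \<and> Comp C f k = Null C U B \<and>
     (\<forall>X\<in>Obj C. \<forall>g\<in>Hom C X A. Comp C f g = Null C X B
        \<longrightarrow> (\<exists>!h. h \<in> Hom C X U \<and> Comp C k h = g))"

text \<open>\<open>is_cokernel C A B f Q p\<close>: the morphism \<open>p : B \<rightarrow> Q\<close> is a cokernel of \<open>f : A \<rightarrow> B\<close>.\<close>

definition is_cokernel :: "('o, 'm) category \<Rightarrow> 'o \<Rightarrow> 'o \<Rightarrow> 'm \<Rightarrow> 'o \<Rightarrow> 'm \<Rightarrow> bool" where
  "is_cokernel C A B f Q p \<longleftrightarrow> f \<in> Hom C A B \<and> p \<in> Hom C B Q \<and> Comp C p f = Null C A Q \<and>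
     (\<forall>X\<in>Obj C. \<forall>g\<in>Hom C B X. Comp C g f = Null C A X
        \<longrightarrow> (\<exists>!h. h \<in> Hom C Q X \<and> Comp C h p = g))"

definition is_zero_object :: "('o, 'm) category \<Rightarrow> 'o \<Rightarrow> bool" where
  "is_zero_object C Z \<longleftrightarrow> Z \<in> Obj C \<and>
     (\<forall>A\<in>Obj C. (\<exists>!f. f \<in> Hom C A Z) \<and> (\<exists>!f. f \<in> Hom C Z A))"

definition is_biproduct ::
  "('o, 'm) category \<Rightarrow> 'o \<Rightarrow> 'o \<Rightarrow> 'o \<Rightarrow> 'm \<Rightarrow> 'm \<Rightarrow> 'm \<Rightarrow> 'm \<Rightarrow> bool" where
  "is_biproduct C A B S i j p q \<longleftrightarrow>
     i \<in> Hom C A S \<and> j \<in> Hom C B S \<and> p \<in> Hom C S A \<and> q \<in> Hom C S B \<and>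
     Comp C p i = Ident C A \<and> Comp C q j = Ident C B \<and>
     Comp C p j = Null C B A \<and> Comp C q i = Null C A B \<and>
     Add C (Comp C i p) (Comp C j q) = Ident C S"

locale abelian_category = preadditive_category +
  assumes zero_object_exists: "\<exists>Z. is_zero_object C Z"
    and biproduct_exists: "\<lbrakk>A \<in> Obj C; B \<in> Obj C\<rbrakk> \<Longrightarrow> \<exists>S i j p q. is_biproduct C A B S i j p q"
    and kernel_exists: "f \<in> Hom C A B \<Longrightarrow> \<exists>U k. is_kernel C A B f U k"
    and cokernel_exists: "f \<in> Hom C A B \<Longrightarrow> \<exists>Q p. is_cokernel C A B f Q p"
    and mono_normal: "is_mono C A B f \<Longrightarrow> \<exists>D g. is_kernel C B D g A f"
    and epi_normal: "is_epi C A B f \<Longrightarrow> \<exists>D g. is_cokernel C D A g B f"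


section \<open>Extensions\<close>

text \<open>
  An extension of \<open>M\<close> by \<open>N\<close> is a triple \<open>(K, f, g)\<close> forming a short exact sequence
  \<open>0 \<rightarrow> N \<rightarrow> K \<rightarrow> M \<rightarrow> 0\<close>.
  \<open>Ext1 C M N\<close> is the set of Yoneda equivalence classes of such extensions; the neutral element of
  its group structure (Baer sum) is the class of split extensions.
\<close>

definition extensions :: "('o, 'm) category \<Rightarrow> 'o \<Rightarrow> 'o \<Rightarrow> ('o \<times> 'm \<times> 'm) set" where
  "extensions C M N = {(K, f, g). is_kernel C K M g N f \<and> is_cokernel C N K f M g}"

definition extension_equiv ::
  "('o, 'm) category \<Rightarrow> 'o \<Rightarrow> 'o \<Rightarrow> (('o \<times> 'm \<times> 'm) \<times> ('o \<times> 'm \<times> 'm)) set" where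
  "extension_equiv C M N =
     {((K, f, g), (K', f', g')). (K, f, g) \<in> extensions C M N \<and> (K', f', g') \<in> extensions C M N \<and>
        (\<exists>h. is_iso C K K' h \<and> Comp C h f = f' \<and> Comp C g' h = g)}"

definition Ext1 :: "('o, 'm) category \<Rightarrow> 'o \<Rightarrow> 'o \<Rightarrow> ('o \<times> 'm \<times> 'm) set set" where
  "Ext1 C M N = extensions C M N // extension_equiv C M N"

definition Ext1_zero :: "('o, 'm) category \<Rightarrow> 'o \<Rightarrow> 'o \<Rightarrow> ('o \<times> 'm \<times> 'm) set" where
  "Ext1_zero C M N =
     {(K, f, g). (K, f, g) \<in> extensions C M N \<and> (\<exists>s\<in>Hom C M K. Comp C g s = Ident C M)}"

definition Ext1_vanishes :: "('o, 'm) category \<Rightarrow> 'o \<Rightarrow> 'o \<Rightarrow> bool" where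
  "Ext1_vanishes C M N \<longleftrightarrow> Ext1 C M N = {Ext1_zero C M N}"

locale finitary_abelian_category = abelian_category +
  assumes finite_Hom: "\<lbrakk>M \<in> Obj C; N \<in> Obj C\<rbrakk> \<Longrightarrow> finite (Hom C M N)"
    and finite_Ext1: "\<lbrakk>M \<in> Obj C; N \<in> Obj C\<rbrakk> \<Longrightarrow> finite (Ext1 C M N)"

definition End_ring :: "('o, 'm) category \<Rightarrow> 'o \<Rightarrow> 'm ring" where
  "End_ring C E = \<lparr>carrier = Hom C E E, monoid.mult = Comp C, monoid.one = Ident C E,
                   ring.zero = Null C E E, ring.add = Add C\<rparr>"

definition perp_left :: "('o, 'm) category \<Rightarrow> 'o \<Rightarrow> 'o set" where
  "perp_left C E = {M \<in> Obj C. Ext1_vanishes C M E}"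

definition perp_right :: "('o, 'm) category \<Rightarrow> 'o \<Rightarrow> 'o set" where
  "perp_right C E = {M \<in> Obj C. Ext1_vanishes C E M}"


section \<open>Hall algebras\<close>

definition iso_class :: "('o, 'm) category \<Rightarrow> 'o \<Rightarrow> 'o set" where
  "iso_class C M = {N \<in> Obj C. isomorphic C M N}"

definition iso_classes :: "('o, 'm) category \<Rightarrow> 'o set set" where
  "iso_classes C = iso_class C ` Obj C"

definition subobject_equiv :: "('o, 'm) category \<Rightarrow> 'o \<Rightarrow> (('o \<times> 'm) \<times> ('o \<times> 'm)) set" where
  "subobject_equiv C K =
     {((U, i), (U', i')). is_mono C U K i \<and> is_mono C U' K i' \<and>
        (\<exists>h. is_iso C U U' h \<and> Comp C i' h = i)}"

definition subobjects :: "('o, 'm) category \<Rightarrow> 'o \<Rightarrow> ('o \<times> 'm) set set" where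
  "subobjects C K = {(U, i). is_mono C U K i} // subobject_equiv C K"

text \<open>
  The Hall number \<open>F\<^sup>K\<^sub>M\<^sub>N\<close>, indexed by isomorphism classes \<open>m = [M]\<close>, \<open>n = [N]\<close>, \<open>k = [K]\<close>:
  subobjects of a representative of \<open>k\<close> lying in \<open>n\<close> whose quotient lies in \<open>m\<close>.
\<close>

definition hall_number :: "('o, 'm) category \<Rightarrow> 'o set \<Rightarrow> 'o set \<Rightarrow> 'o set \<Rightarrow> nat" where
  "hall_number C m n k =
     (let K = (SOME K. K \<in> k) in
      card {S \<in> subobjects C K. \<exists>(U, i)\<in>S. U \<in> n \<and> (\<exists>Q\<in>m. \<exists>p. is_cokernel C U K i Q p)})"

text \<open>
  Formal (possibly infinite) rational combinations of isomorphism classes, as coefficient functions.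
  The product extends \<open>[M][N] = \<Sum>\<^sub>K F\<^sup>K\<^sub>M\<^sub>N [K]\<close>; the coefficient at \<open>k\<close> is meaningful when only
  finitely many pairs contribute to it (and is \<open>0\<close> by convention otherwise). So this record is not
  a ring in general, but it contains the Hall algebra \<open>hall_algebra\<close> and its completion
  \<open>hall_completion\<close> below.
\<close>

definition hall_mult :: "('o, 'm) category \<Rightarrow> ('o set \<Rightarrow> rat) \<Rightarrow> ('o set \<Rightarrow> rat) \<Rightarrow> 'o set \<Rightarrow> rat" where
  "hall_mult C f g = (\<lambda>k. if k \<in> iso_classes C
     then \<Sum>(m, n) \<in> {(m, n). m \<in> iso_classes C \<and> n \<in> iso_classes C \<and>
                               f m * g n * of_nat (hall_number C m n k) \<noteq> 0}.
            f m * g n * of_nat (hall_number C m n k)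
     else 0)"

definition hall_basis :: "('o, 'm) category \<Rightarrow> 'o \<Rightarrow> 'o set \<Rightarrow> rat" where
  "hall_basis C M = (\<lambda>k. if k = iso_class C M then 1 else 0)"

definition hall_formal :: "('o, 'm) category \<Rightarrow> ('o set \<Rightarrow> rat) ring" where
  "hall_formal C = \<lparr>carrier = {f. \<forall>k. f k \<noteq> 0 \<longrightarrow> k \<in> iso_classes C},
     monoid.mult = hall_mult C, monoid.one = hall_basis C (SOME Z. is_zero_object C Z),
     ring.zero = (\<lambda>_. 0), ring.add = (\<lambda>f g k. f k + g k)\<rparr>"

definition hall_algebra :: "('o, 'm) category \<Rightarrow> ('o set \<Rightarrow> rat) ring" where
  "hall_algebra C =
     (hall_formal C)\<lparr>carrier := {f \<in> carrier (hall_formal C). finite {k. f k \<noteq> 0}}\<rparr>"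

text \<open>\<open>B\<close> is the class of objects of a full subcategory closed under isomorphisms and extensions.\<close>

definition hall_subalgebra :: "('o, 'm) category \<Rightarrow> 'o set \<Rightarrow> ('o set \<Rightarrow> rat) ring" where
  "hall_subalgebra C B =
     (hall_algebra C)\<lparr>carrier := {f \<in> carrier (hall_algebra C). \<forall>k. f k \<noteq> 0 \<longrightarrow> k \<subseteq> B}\<rparr>"

definition K0_relations :: "('o, 'm) category \<Rightarrow> ('o set \<Rightarrow>\<^sub>0 int) set" where
  "K0_relations C =
     {frag_of (iso_class C K) - frag_of (iso_class C M) - frag_of (iso_class C N) | K M N f g.
        (K, f, g) \<in> extensions C M N}"

definition K0 :: "('o, 'm) category \<Rightarrow> ('o set \<Rightarrow>\<^sub>0 int) set monoid" where
  "K0 C = free_Abelian_group (iso_classes C)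
            Mod generate (free_Abelian_group (iso_classes C)) (K0_relations C)"

definition K0_class :: "('o, 'm) category \<Rightarrow> 'o set \<Rightarrow> ('o set \<Rightarrow>\<^sub>0 int) set" where
  "K0_class C k = r_coset (free_Abelian_group (iso_classes C))
     (generate (free_Abelian_group (iso_classes C)) (K0_relations C)) (frag_of k)"

text \<open>
  The product over \<open>\<gamma> \<in> K\<^sub>0\<close> of the graded components: an element is a formal combination with
  finitely many terms in each degree \<open>\<gamma>\<close>.
\<close>

definition hall_completion :: "('o, 'm) category \<Rightarrow> ('o set \<Rightarrow> rat) ring" where
  "hall_completion C = (hall_formal C)\<lparr>carrier :=
     {f \<in> carrier (hall_formal C).
        \<forall>\<gamma>\<in>carrier (K0 C). finite {k. f k \<noteq> 0 \<and> K0_class C k = \<gamma>}}\<rparr>"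


section \<open>The q-exponential\<close>

definition q_int :: "nat \<Rightarrow> nat \<Rightarrow> nat" where
  "q_int q k = (\<Sum>i<k. q ^ i)"

definition q_fact :: "nat \<Rightarrow> nat \<Rightarrow> nat" where
  "q_fact q n = (\<Prod>k=1..n. q_int q k)"

text \<open>Coefficientwise sum of \<open>x\<^sup>n / [n]\<^sub>q!\<close>, for \<open>x\<close> with only finitely many powers involving each class.\<close>

definition q_exp :: "('o, 'm) category \<Rightarrow> nat \<Rightarrow> ('o set \<Rightarrow> rat) \<Rightarrow> 'o set \<Rightarrow> rat" where
  "q_exp C q x = (\<lambda>k. \<Sum>n \<in> {n::nat. (x [^]\<^bsub>hall_formal C\<^esub> n) k \<noteq> 0}.
                        (x [^]\<^bsub>hall_formal C\<^esub> n) k / of_nat (q_fact q n))"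

definition q_obj :: "('o, 'm) category \<Rightarrow> 'o \<Rightarrow> nat" where
  "q_obj C E = card (Hom C E E)"

text \<open>The family \<open>1 + (q\<^sub>E - 1) q\<^sub>E\<^sup>j [E]\<close>, \<open>j \<in> \<int>\<close>.\<close>

definition S_elem :: "('o, 'm) category \<Rightarrow> 'o \<Rightarrow> int \<Rightarrow> 'o set \<Rightarrow> rat" where
  "S_elem C E j = (\<lambda>k. \<one>\<^bsub>hall_formal C\<^esub> k +
     (of_nat (q_obj C E) - 1) * (of_nat (q_obj C E) powi j) * hall_basis C E k)"


section \<open>Localization of noncommutative rings\<close>

text \<open>The free unital ring on \<open>X\<close>: integer combinations of words, multiplied by concatenation.\<close>

definition free_ring :: "'x set \<Rightarrow> ('x list \<Rightarrow>\<^sub>0 int) ring" where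
  "free_ring X = \<lparr>carrier = {f. \<forall>w\<in>Poly_Mapping.keys f. set w \<subseteq> X},
     monoid.mult = (\<lambda>f g. \<Sum>u\<in>Poly_Mapping.keys f. \<Sum>v\<in>Poly_Mapping.keys g.
               Poly_Mapping.single (u @ v) (Poly_Mapping.lookup f u * Poly_Mapping.lookup g v)),
     monoid.one = Poly_Mapping.single [] 1, ring.zero = 0, ring.add = (+)\<rparr>"

definition fr_var :: "'x \<Rightarrow> 'x list \<Rightarrow>\<^sub>0 int" where
  "fr_var x = Poly_Mapping.single [x] 1"

text \<open>
  The free product (coproduct of unital rings) of \<open>R\<close> and \<open>T\<close>: the free ring on the disjoint union
  of the carriers modulo the relations making both inclusions unital ring homomorphisms.
\<close>

definition hom_relations :: "'x set \<Rightarrow> ('r \<Rightarrow> 'x) \<Rightarrow> 'r ring \<Rightarrow> ('x list \<Rightarrow>\<^sub>0 int) set" where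
  "hom_relations X i R =
     {fr_var (i (a \<oplus>\<^bsub>R\<^esub> b)) - (fr_var (i a) + fr_var (i b)) | a b. a \<in> carrier R \<and> b \<in> carrier R} \<union>
     {fr_var (i (a \<otimes>\<^bsub>R\<^esub> b)) - (fr_var (i a) \<otimes>\<^bsub>free_ring X\<^esub> fr_var (i b)) | a b.
        a \<in> carrier R \<and> b \<in> carrier R} \<union>
     {fr_var (i \<one>\<^bsub>R\<^esub>) - \<one>\<^bsub>free_ring X\<^esub>}"

definition free_product_ideal :: "'r ring \<Rightarrow> 't ring \<Rightarrow> (('r + 't) list \<Rightarrow>\<^sub>0 int) set" where
  "free_product_ideal R T = (let X = Sum_Type.Plus (carrier R) (carrier T) in
     Idl\<^bsub>free_ring X\<^esub> (hom_relations X Inl R \<union> hom_relations X Inr T))"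

definition free_product :: "'r ring \<Rightarrow> 't ring \<Rightarrow> (('r + 't) list \<Rightarrow>\<^sub>0 int) set ring" where
  "free_product R T = free_ring (Sum_Type.Plus (carrier R) (carrier T)) Quot free_product_ideal R T"

definition fp_left :: "'r ring \<Rightarrow> 't ring \<Rightarrow> 'r \<Rightarrow> (('r + 't) list \<Rightarrow>\<^sub>0 int) set" where
  "fp_left R T r =
     free_product_ideal R T +>\<^bsub>free_ring (Sum_Type.Plus (carrier R) (carrier T))\<^esub> fr_var (Inl r)"

definition fp_right :: "'r ring \<Rightarrow> 't ring \<Rightarrow> 't \<Rightarrow> (('r + 't) list \<Rightarrow>\<^sub>0 int) set" where
  "fp_right R T t =
     free_product_ideal R T +>\<^bsub>free_ring (Sum_Type.Plus (carrier R) (carrier T))\<^esub> fr_var (Inr t)"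

text \<open>The polynomial ring over the integers in commuting variables indexed by the type \<open>'i\<close>.\<close>

definition int_mpoly_ring :: "(('i \<Rightarrow>\<^sub>0 nat) \<Rightarrow>\<^sub>0 int) ring" where
  "int_mpoly_ring = \<lparr>carrier = UNIV, monoid.mult = (*), monoid.one = 1, ring.zero = 0, ring.add = (+)\<rparr>"

definition mpoly_var :: "'i \<Rightarrow> (('i \<Rightarrow>\<^sub>0 nat) \<Rightarrow>\<^sub>0 int)" where
  "mpoly_var i = Poly_Mapping.single (Poly_Mapping.single i 1) 1"

definition localization_ideal ::
  "'r ring \<Rightarrow> ('i \<Rightarrow> 'r) \<Rightarrow> (('r + (('i \<Rightarrow>\<^sub>0 nat) \<Rightarrow>\<^sub>0 int)) list \<Rightarrow>\<^sub>0 int) set set" where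
  "localization_ideal R a =
    (let P = free_product R int_mpoly_ring;
         l = fp_left R int_mpoly_ring;
         x = (\<lambda>i. fp_right R int_mpoly_ring (mpoly_var i))
     in Idl\<^bsub>P\<^esub> (range (\<lambda>i. l (a i) \<otimes>\<^bsub>P\<^esub> x i \<ominus>\<^bsub>P\<^esub> \<one>\<^bsub>P\<^esub>) \<union> range (\<lambda>i. x i \<otimes>\<^bsub>P\<^esub> l (a i) \<ominus>\<^bsub>P\<^esub> \<one>\<^bsub>P\<^esub>)))"

definition localization ::
  "'r ring \<Rightarrow> ('i \<Rightarrow> 'r) \<Rightarrow> (('r + (('i \<Rightarrow>\<^sub>0 nat) \<Rightarrow>\<^sub>0 int)) list \<Rightarrow>\<^sub>0 int) set set ring" where
  "localization R a = free_product R int_mpoly_ring Quot localization_ideal R a"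

definition localization_map ::
  "'r ring \<Rightarrow> ('i \<Rightarrow> 'r) \<Rightarrow> 'r \<Rightarrow> (('r + (('i \<Rightarrow>\<^sub>0 nat) \<Rightarrow>\<^sub>0 int)) list \<Rightarrow>\<^sub>0 int) set set" where
  "localization_map R a r =
     localization_ideal R a +>\<^bsub>free_product R int_mpoly_ring\<^esub> fp_left R int_mpoly_ring r"

definition regular_element :: "'r ring \<Rightarrow> 'r \<Rightarrow> bool" where
  "regular_element R a \<longleftrightarrow> a \<in> carrier R \<and>
     (\<forall>x\<in>carrier R. (a \<otimes>\<^bsub>R\<^esub> x = \<zero>\<^bsub>R\<^esub> \<longrightarrow> x = \<zero>\<^bsub>R\<^esub>) \<and> (x \<otimes>\<^bsub>R\<^esub> a = \<zero>\<^bsub>R\<^esub> \<longrightarrow> x = \<zero>\<^bsub>R\<^esub>))"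

definition commuting_regular_family :: "'r ring \<Rightarrow> ('i \<Rightarrow> 'r) \<Rightarrow> bool" where
  "commuting_regular_family R a \<longleftrightarrow>
     (\<forall>i. regular_element R (a i)) \<and> (\<forall>i j. a i \<otimes>\<^bsub>R\<^esub> a j = a j \<otimes>\<^bsub>R\<^esub> a i)"

end

theory Submission
  imports Defs "HOL-Algebra.Subrings" "HOL-Computational_Algebra.Formal_Power_Series"
begin

text \<open>
  Let \<open>C\<close> be an object with \<open>Ext\<^sup>1(C,E) = 0\<close>. Up to a power of \<open>q\<close>, the products \<open>[E][C]\<close> and \<open>[C][E]\<close> have
  the same coefficient at \<open>C \<oplus> E\<close>, and the other terms \<open>[K]\<close> of \<open>[E][C]\<close> come from nonsplit extensions,
  for which \<open>Ext\<^sup>1(E,K)\<close> is strictly smaller than \<open>Ext\<^sup>1(E,C)\<close>. Hence the iterated q-commutators of \<open>x = [E]\<close>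
  with \<open>[C]\<close> vanish eventually, and the q-binomial theorem turns \<open>f(x)[C]\<close>, for a power series \<open>f\<close>, into a finite
  sum of products of an element of the Hall algebra with a power series in \<open>x\<close>. This yields the Ore condition
  for \<open>1 + (q - 1) q\<^sup>j x\<close>; for \<open>f = exp\<^sub>q\<close> the series which arise are \<open>exp\<^sub>q(q\<^sup>i x)\<close>, and
  \<open>exp\<^sub>q(q\<^sup>i x) exp\<^sub>q(x)\<^sup>-\<^sup>1\<close> is a product of elements \<open>1 + (q - 1) q\<^sup>j x\<close> and their inverses. So conjugation by
  \<open>exp\<^sub>q(x)\<close> and by its inverse preserve the localization, which embeds into the ring of formal
  series with finitely many relevant terms in each product. The case of \<open>E\<^sup>\<bottom>\<close> is dual.
\<close>

section \<open>Duality\<close>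

text \<open>The degree behind the q-commutators is not an Euler form, since higher Ext groups are
  not controlled. It is the exponent i with |Hom(M,E)| = q^i |Hom(E,M)|. Adjoining E on top of M by
  a nonsplit extension multiplies the first count by q, because Ext^1(E,E) = 0, and keeps the
  second, because End E is a division ring. So each q-commutator raises i by exactly one: the k-th
  step uses the parameter q^(i+k), and [k]_q! divides out. Two obstacles shape the rest. The
  localization is given by generators and relations, so its elements have no normal form until the
  Ore condition supplies denominators; only then can the map to series be shown injective. Secondly,
  degrees in K_0 cannot organize the series, since nothing prevents the class of E from having
  finite order there. Finiteness of products is read off the Hom counts instead, and since formal
  combinations do not associate in general, each rebracketing rests on a finiteness condition for
  the factors (\<open>subfin\<close>, \<open>bifin\<close>).\<close>

definition op_cat :: "('o, 'm) category \<Rightarrow> ('o, 'm) category" where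
  "op_cat C = \<lparr>Obj = Obj C, Hom = (\<lambda>A B. Hom C B A), Comp = (\<lambda>g f. Comp C f g),
     Ident = Ident C, Add = Add C, Null = (\<lambda>A B. Null C B A)\<rparr>"

lemma op_cat_simps [simp]:
  "Obj (op_cat C) = Obj C" "Hom (op_cat C) A B = Hom C B A" "Comp (op_cat C) g f = Comp C f g"
  "Ident (op_cat C) = Ident C" "Add (op_cat C) = Add C" "Null (op_cat C) A B = Null C B A"
  by (simp_all add: op_cat_def)

lemma op_cat_op_cat [simp]: "op_cat (op_cat C) = C"
  by (simp add: op_cat_def)

lemma Hom_group_op_cat [simp]: "Hom_group (op_cat C) A B = Hom_group C B A"
  by (simp add: Hom_group_def)

lemma is_mono_op_cat [simp]: "is_mono (op_cat C) A B f \<longleftrightarrow> is_epi C B A f"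
  by (simp add: is_mono_def is_epi_def)

lemma is_epi_op_cat [simp]: "is_epi (op_cat C) A B f \<longleftrightarrow> is_mono C B A f"
  by (simp add: is_mono_def is_epi_def)

lemma is_iso_op_cat [simp]: "is_iso (op_cat C) A B f \<longleftrightarrow> is_iso C B A f"
  by (auto simp: is_iso_def)

lemma is_kernel_op_cat [simp]: "is_kernel (op_cat C) A B f U k \<longleftrightarrow> is_cokernel C B A f U k"
  by (simp add: is_kernel_def is_cokernel_def)

lemma is_cokernel_op_cat [simp]: "is_cokernel (op_cat C) A B f U k \<longleftrightarrow> is_kernel C B A f U k"
  by (simp add: is_kernel_def is_cokernel_def)

lemma is_zero_object_op_cat [simp]: "is_zero_object (op_cat C) Z \<longleftrightarrow> is_zero_object C Z"
  by (auto simp: is_zero_object_def)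

lemma is_biproduct_op_cat [simp]:
  "is_biproduct (op_cat C) A B S i j p q \<longleftrightarrow> is_biproduct C A B S p q i j"
  by (auto simp: is_biproduct_def)

lemma preadditive_category_op_cat:
  assumes "preadditive_category C"
  shows "preadditive_category (op_cat C)"
proof -
  interpret preadditive_category C by fact
  show ?thesis
    by (rule preadditive_category.intro)
      (auto intro: Comp_closed Ident_closed Hom_comm_group Comp_Add_left Comp_Add_right
        simp: Comp_Ident Ident_Comp Comp_assoc dest: Hom_objects Hom_disjoint)
qed

lemma abelian_category_op_cat:
  assumes "abelian_category C"
  shows "abelian_category (op_cat C)"
proof -
  interpret abelian_category C by fact
  interpret op: preadditive_category "op_cat C"
    by (rule preadditive_category_op_cat) unfold_locales
  show ?thesis
    by unfold_locales
      (simp_all add: zero_object_exists kernel_exists cokernel_exists mono_normal epi_normal,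
        meson biproduct_exists)
qed

section \<open>Morphisms in preadditive categories\<close>

definition arr :: "('o, 'm) category \<Rightarrow> 'm \<Rightarrow> bool" where
  "arr C f \<longleftrightarrow> (\<exists>A B. f \<in> Hom C A B)"

text \<open>\<open>Hom_disjoint\<close> gives every arrow a single source and target. As functions
  they turn composability into equations between objects, which simplification can
  discharge.\<close>

definition dm :: "('o, 'm) category \<Rightarrow> 'm \<Rightarrow> 'o" where
  "dm C f = (THE A. \<exists>B. f \<in> Hom C A B)"

definition cd :: "('o, 'm) category \<Rightarrow> 'm \<Rightarrow> 'o" where
  "cd C f = (THE B. \<exists>A. f \<in> Hom C A B)"

definition ng :: "('o, 'm) category \<Rightarrow> 'm \<Rightarrow> 'm" where
  "ng C f = inv\<^bsub>Hom_group C (dm C f) (cd C f)\<^esub> f"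

text \<open>In an additive setting cancellation has to be tested against the zero arrow only;
  \<open>is_mono_iff_monic\<close> recovers the usual notion.\<close>

definition monic :: "('o, 'm) category \<Rightarrow> 'm \<Rightarrow> bool" where
  "monic C f \<longleftrightarrow> arr C f \<and> (\<forall>x. arr C x \<and> cd C x = dm C f \<and> Comp C f x = Null C (dm C x) (cd C f)
     \<longrightarrow> x = Null C (dm C x) (dm C f))"

definition epic :: "('o, 'm) category \<Rightarrow> 'm \<Rightarrow> bool" where
  "epic C f \<longleftrightarrow> arr C f \<and> (\<forall>x. arr C x \<and> dm C x = cd C f \<and> Comp C x f = Null C (dm C f) (cd C x)
     \<longrightarrow> x = Null C (cd C f) (cd C x))"

definition ses :: "('o, 'm) category \<Rightarrow> 'o \<Rightarrow> 'm \<Rightarrow> 'o \<Rightarrow> 'm \<Rightarrow> 'o \<Rightarrow> bool" where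
  "ses C N f K g M \<longleftrightarrow> is_kernel C K M g N f \<and> is_cokernel C N K f M g"

lemma extensions_iff_ses: "(K, f, g) \<in> extensions C M N \<longleftrightarrow> ses C N f K g M"
  by (simp add: extensions_def ses_def)

lemma arr_op_cat [simp]: "arr (op_cat C) f \<longleftrightarrow> arr C f"
  by (auto simp: arr_def)

lemma dm_op_cat [simp]: "dm (op_cat C) f = cd C f" and cd_op_cat [simp]: "cd (op_cat C) f = dm C f"
  by (simp_all add: dm_def cd_def)

lemma monic_op_cat [simp]: "monic (op_cat C) f \<longleftrightarrow> epic C f"
  and epic_op_cat [simp]: "epic (op_cat C) f \<longleftrightarrow> monic C f"
  by (simp_all add: monic_def epic_def)

lemma ses_op_cat [simp]: "ses (op_cat C) N f K g M \<longleftrightarrow> ses C M g K f N"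
  by (auto simp: ses_def)

context preadditive_category
begin

abbreviation comp (infixr "\<bullet>" 75) where "g \<bullet> f \<equiv> Comp C g f"
abbreviation plus (infixl "\<boxplus>" 65) where "f \<boxplus> g \<equiv> Add C f g"
abbreviation hom where "hom \<equiv> Hom C"

section \<open>Additive calculus of arrows\<close>

lemma arr_dm_cd: "f \<in> hom A B \<Longrightarrow> arr C f \<and> dm C f = A \<and> cd C f = B"
  unfolding arr_def dm_def cd_def
  by (auto intro!: the_equality dest: Hom_disjoint)

lemma hom_iff [simp]: "f \<in> hom A B \<longleftrightarrow> arr C f \<and> dm C f = A \<and> cd C f = B"
  using arr_dm_cd by (auto simp: arr_def)

lemma dm_obj [simp]: "arr C f \<Longrightarrow> dm C f \<in> Obj C"
  and cd_obj [simp]: "arr C f \<Longrightarrow> cd C f \<in> Obj C"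
  using Hom_objects[of f "dm C f" "cd C f"] by auto

lemma comp_arr [simp]:
  assumes "arr C f" "arr C g" "dm C g = cd C f"
  shows "arr C (g \<bullet> f)" "dm C (g \<bullet> f) = dm C f" "cd C (g \<bullet> f) = cd C g"
  using Comp_closed[of f "dm C f" "cd C f" g "cd C g"] assms by auto

lemma comp_assoc [simp]:
  "arr C f \<Longrightarrow> arr C g \<Longrightarrow> arr C h \<Longrightarrow> dm C g = cd C f \<Longrightarrow> dm C h = cd C g \<Longrightarrow>
   (h \<bullet> g) \<bullet> f = h \<bullet> g \<bullet> f"
  using Comp_assoc[of f "dm C f" "cd C f" g "cd C g" h "cd C h"] by auto

text \<open>Composites are kept nested to the right by \<open>comp_assoc\<close>, which hides a
  factor p i inside p (i x); this form makes a known equation for p i applicable there.\<close>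

lemma reassoc:
  "p \<bullet> i = w \<Longrightarrow> arr C p \<Longrightarrow> arr C i \<Longrightarrow> arr C x \<Longrightarrow> dm C p = cd C i \<Longrightarrow> dm C i = cd C x \<Longrightarrow>
   p \<bullet> i \<bullet> x = w \<bullet> x"
  using comp_assoc by metis

lemma ident_arr [simp]:
  assumes "A \<in> Obj C"
  shows "arr C (Ident C A)" "dm C (Ident C A) = A" "cd C (Ident C A) = A"
  using Ident_closed[OF assms] by auto

lemma comp_ident [simp]: "arr C f \<Longrightarrow> dm C f = A \<Longrightarrow> f \<bullet> Ident C A = f"
  and ident_comp [simp]: "arr C f \<Longrightarrow> cd C f = A \<Longrightarrow> Ident C A \<bullet> f = f"
  using Comp_Ident[of f "dm C f" "cd C f"] Ident_Comp[of f "dm C f" "cd C f"] by auto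

lemma null_arr [simp]:
  assumes "A \<in> Obj C" "B \<in> Obj C"
  shows "arr C (Null C A B)" "dm C (Null C A B) = A" "cd C (Null C A B) = B"
proof -
  interpret comm_group "Hom_group C A B" using assms by (rule Hom_comm_group)
  have "Null C A B \<in> hom A B" using one_closed by (simp add: Hom_group_def)
  then show "arr C (Null C A B)" "dm C (Null C A B) = A" "cd C (Null C A B) = B" by auto
qed

lemma add_arr [simp]:
  assumes "arr C f" "arr C g" "dm C f = dm C g" "cd C f = cd C g"
  shows "arr C (f \<boxplus> g)" "dm C (f \<boxplus> g) = dm C g" "cd C (f \<boxplus> g) = cd C g"
proof -
  interpret comm_group "Hom_group C (dm C g) (cd C g)" using assms by (intro Hom_comm_group) auto
  have "f \<boxplus> g \<in> hom (dm C g) (cd C g)" using m_closed[of f g] assms by (simp add: Hom_group_def)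
  then show "arr C (f \<boxplus> g)" "dm C (f \<boxplus> g) = dm C g" "cd C (f \<boxplus> g) = cd C g" by auto
qed

lemma add_null [simp]:
  assumes "arr C f" "dm C f = A" "cd C f = B"
  shows "f \<boxplus> Null C A B = f" "Null C A B \<boxplus> f = f"
proof -
  interpret comm_group "Hom_group C (dm C f) (cd C f)" using assms by (intro Hom_comm_group) auto
  show "f \<boxplus> Null C A B = f" "Null C A B \<boxplus> f = f"
    using r_one[of f] l_one[of f] assms by (simp_all add: Hom_group_def)
qed

lemma add_comm:
  assumes "arr C f" "arr C g" "dm C f = dm C g" "cd C f = cd C g"
  shows "f \<boxplus> g = g \<boxplus> f"
proof -
  interpret comm_group "Hom_group C (dm C g) (cd C g)" using assms by (intro Hom_comm_group) auto
  show ?thesis using m_comm[of f g] assms by (simp add: Hom_group_def)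
qed

lemma add_assoc:
  assumes "arr C f" "arr C g" "arr C h" "dm C f = dm C g" "cd C f = cd C g" "dm C h = dm C g" "cd C h = cd C g"
  shows "(f \<boxplus> g) \<boxplus> h = f \<boxplus> (g \<boxplus> h)"
proof -
  interpret comm_group "Hom_group C (dm C g) (cd C g)" using assms by (intro Hom_comm_group) auto
  show ?thesis using m_assoc[of f g h] assms by (simp add: Hom_group_def)
qed

lemma add_cancel:
  assumes "arr C f" "arr C g" "arr C h" "dm C f = dm C g" "cd C f = cd C g" "dm C h = dm C g" "cd C h = cd C g"
    and "f \<boxplus> g = f \<boxplus> h"
  shows "g = h"
proof -
  interpret comm_group "Hom_group C (dm C g) (cd C g)" using assms by (intro Hom_comm_group) auto
  have "f \<in> Units (Hom_group C (dm C g) (cd C g))"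
    unfolding Units_eq using assms by (simp add: Hom_group_def)
  moreover have "g \<in> carrier (Hom_group C (dm C g) (cd C g))" "h \<in> carrier (Hom_group C (dm C g) (cd C g))"
    using assms by (simp_all add: Hom_group_def)
  moreover have "f \<otimes>\<^bsub>Hom_group C (dm C g) (cd C g)\<^esub> g = f \<otimes>\<^bsub>Hom_group C (dm C g) (cd C g)\<^esub> h"
    using assms(8) by (simp add: Hom_group_def)
  ultimately show ?thesis using Units_l_cancel by blast
qed

lemma ng_arr [simp]:
  assumes "arr C f"
  shows "arr C (ng C f)" "dm C (ng C f) = dm C f" "cd C (ng C f) = cd C f"
proof -
  interpret comm_group "Hom_group C (dm C f) (cd C f)" using assms by (intro Hom_comm_group) auto
  have "ng C f \<in> hom (dm C f) (cd C f)" using inv_closed[of f] assms by (simp add: Hom_group_def ng_def)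
  then show "arr C (ng C f)" "dm C (ng C f) = dm C f" "cd C (ng C f) = cd C f" by auto
qed

lemma add_ng [simp]:
  assumes "arr C f"
  shows "f \<boxplus> ng C f = Null C (dm C f) (cd C f)" "ng C f \<boxplus> f = Null C (dm C f) (cd C f)"
proof -
  interpret comm_group "Hom_group C (dm C f) (cd C f)" using assms by (intro Hom_comm_group) auto
  show "f \<boxplus> ng C f = Null C (dm C f) (cd C f)" "ng C f \<boxplus> f = Null C (dm C f) (cd C f)"
    using r_inv[of f] l_inv[of f] assms by (simp_all add: Hom_group_def ng_def)
qed

lemma comp_add [simp]:
  assumes "arr C f" "arr C f'" "arr C g" "dm C f = dm C f'" "cd C f = cd C f'" "dm C g = cd C f'"
  shows "g \<bullet> (f \<boxplus> f') = g \<bullet> f \<boxplus> g \<bullet> f'"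
  using Comp_Add_right[of f "dm C f" "cd C f" f' g "cd C g"] assms by auto

lemma add_comp [simp]:
  assumes "arr C f" "arr C g" "arr C g'" "dm C g = dm C g'" "cd C g = cd C g'" "dm C g' = cd C f"
  shows "(g \<boxplus> g') \<bullet> f = g \<bullet> f \<boxplus> g' \<bullet> f"
  using Comp_Add_left[of f "dm C f" "cd C f" g "cd C g" g'] assms by auto

lemma comp_null [simp]:
  assumes "arr C g" "A \<in> Obj C" "dm C g = B"
  shows "g \<bullet> Null C A B = Null C A (cd C g)"
proof -
  let ?n = "Null C A B"
  have *: "B \<in> Obj C" using assms by auto
  have "g \<bullet> ?n \<boxplus> g \<bullet> ?n = g \<bullet> (?n \<boxplus> ?n)" using assms * by (subst comp_add) auto
  also have "\<dots> = g \<bullet> ?n \<boxplus> Null C A (cd C g)" using assms * by simp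
  finally have eq: "g \<bullet> ?n \<boxplus> g \<bullet> ?n = g \<bullet> ?n \<boxplus> Null C A (cd C g)" .
  show ?thesis by (rule add_cancel[OF _ _ _ _ _ _ _ eq]) (use assms * in auto)
qed

lemma null_comp [simp]:
  assumes "arr C f" "B \<in> Obj C" "cd C f = A"
  shows "Null C A B \<bullet> f = Null C (dm C f) B"
proof -
  let ?n = "Null C A B"
  have *: "A \<in> Obj C" using assms by auto
  have "?n \<bullet> f \<boxplus> ?n \<bullet> f = (?n \<boxplus> ?n) \<bullet> f" using assms * by (subst add_comp) auto
  also have "\<dots> = ?n \<bullet> f \<boxplus> Null C (dm C f) B" using assms * by simp
  finally have eq: "?n \<bullet> f \<boxplus> ?n \<bullet> f = ?n \<bullet> f \<boxplus> Null C (dm C f) B" .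
  show ?thesis by (rule add_cancel[OF _ _ _ _ _ _ _ eq]) (use assms * in auto)
qed

lemma comp_ng [simp]:
  assumes "arr C f" "arr C g" "dm C g = cd C f"
  shows "g \<bullet> ng C f = ng C (g \<bullet> f)"
proof (rule add_cancel[of "g \<bullet> f"])
  have "g \<bullet> f \<boxplus> g \<bullet> ng C f = g \<bullet> (f \<boxplus> ng C f)" using assms by (subst comp_add) auto
  then show "g \<bullet> f \<boxplus> g \<bullet> ng C f = g \<bullet> f \<boxplus> ng C (g \<bullet> f)" using assms by simp
qed (use assms in auto)

lemma ng_comp [simp]:
  assumes "arr C f" "arr C g" "dm C g = cd C f"
  shows "ng C g \<bullet> f = ng C (g \<bullet> f)"
proof (rule add_cancel[of "g \<bullet> f"])
  have "g \<bullet> f \<boxplus> ng C g \<bullet> f = (g \<boxplus> ng C g) \<bullet> f" using assms by (subst add_comp) auto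
  then show "g \<bullet> f \<boxplus> ng C g \<bullet> f = g \<bullet> f \<boxplus> ng C (g \<bullet> f)" using assms by simp
qed (use assms in auto)

lemma diff_eq_null:
  assumes "arr C f" "arr C g" "dm C f = dm C g" "cd C f = cd C g"
    and "f \<boxplus> ng C g = Null C (dm C g) (cd C g)"
  shows "f = g"
proof -
  have eq: "ng C g \<boxplus> f = ng C g \<boxplus> g" using assms add_comm[of f "ng C g"] by simp
  show ?thesis by (rule add_cancel[OF _ _ _ _ _ _ _ eq]) (use assms(1-4) in simp_all)
qed

lemma monic_cancel:
  assumes "monic C f" "arr C x" "arr C y" "cd C x = dm C f" "cd C y = dm C f" "dm C x = dm C y"
    and "f \<bullet> x = f \<bullet> y"
  shows "x = y"
proof -
  have f: "arr C f" using assms by (simp add: monic_def)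
  have "f \<bullet> (x \<boxplus> ng C y) = Null C (dm C y) (cd C f)" using assms f by simp
  then have "x \<boxplus> ng C y = Null C (dm C y) (dm C f)"
    using assms(1) assms f unfolding monic_def by (auto dest: spec[of _ "x \<boxplus> ng C y"])
  from diff_eq_null[OF assms(2,3) _ _ this[folded assms(5)]] show ?thesis using assms by simp
qed

lemma is_mono_iff_monic: "is_mono C A B f \<longleftrightarrow> f \<in> hom A B \<and> monic C f"
proof
  assume *: "is_mono C A B f"
  then have f: "arr C f" "dm C f = A" "cd C f = B" by (auto simp: is_mono_def)
  have "x = Null C (dm C x) A" if "arr C x" "cd C x = A" "f \<bullet> x = Null C (dm C x) B" for x
  proof -
    have "f \<bullet> x = f \<bullet> Null C (dm C x) A" using that f by auto
    moreover have "Null C (dm C x) A \<in> hom (dm C x) A" using that f by auto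
    moreover have "dm C x \<in> Obj C" "x \<in> hom (dm C x) A" using that by auto
    ultimately show ?thesis using * unfolding is_mono_def by blast
  qed
  then show "f \<in> hom A B \<and> monic C f" using f by (auto simp: monic_def)
next
  assume "f \<in> hom A B \<and> monic C f"
  then show "is_mono C A B f" unfolding is_mono_def using monic_cancel by auto
qed

end

lemma (in preadditive_category) op_preadditive: "preadditive_category (op_cat C)"
  by (rule preadditive_category_op_cat) unfold_locales

context preadditive_category
begin

interpretation op: preadditive_category "op_cat C"
  by (rule op_preadditive)

lemma epic_cancel:
  assumes "epic C f" "arr C x" "arr C y" "dm C x = cd C f" "dm C y = cd C f" "cd C x = cd C y"
    and "x \<bullet> f = y \<bullet> f"
  shows "x = y"
  using op.monic_cancel[of f x y] assms by simp

lemma monicD: "monic C f \<Longrightarrow> arr C f" and epicD: "epic C f \<Longrightarrow> arr C f"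
  by (simp_all add: monic_def epic_def)

lemma monic_null:
  assumes "monic C f" "arr C x" "cd C x = dm C f" "dm C x = X" "dm C f = A" "f \<bullet> x = Null C X (cd C f)"
  shows "x = Null C X A"
  using assms unfolding monic_def by metis

lemma epic_null:
  assumes "epic C f" "arr C x" "dm C x = cd C f" "cd C x = X" "cd C f = B" "x \<bullet> f = Null C (dm C f) X"
  shows "x = Null C B X"
  using assms unfolding epic_def by metis

section \<open>Kernels, cokernels and short exact sequences\<close>

lemma kernel_monic: "is_kernel C A B f U k \<Longrightarrow> monic C k"
proof -
  assume k: "is_kernel C A B f U k"
  then have t: "arr C f" "dm C f = A" "cd C f = B" "arr C k" "dm C k = U" "cd C k = A" "f \<bullet> k = Null C U B"
    by (auto simp: is_kernel_def)
  have "x = Null C (dm C x) U" if x: "arr C x" "cd C x = U" "k \<bullet> x = Null C (dm C x) A" for x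
  proof -
    let ?n = "Null C (dm C x) U"
    have o: "dm C x \<in> Obj C" "U \<in> Obj C" "A \<in> Obj C" using x t by auto
    have "\<exists>!h. h \<in> hom (dm C x) U \<and> k \<bullet> h = Null C (dm C x) A"
      using k o t unfolding is_kernel_def by (auto simp del: hom_iff simp: hom_iff[of "Null C (dm C x) A"])
    moreover have "x \<in> hom (dm C x) U \<and> k \<bullet> x = Null C (dm C x) A" using x by simp
    moreover have "?n \<in> hom (dm C x) U \<and> k \<bullet> ?n = Null C (dm C x) A" using t o by auto
    ultimately show ?thesis by blast
  qed
  then show ?thesis using t by (auto simp: monic_def)
qed

text \<open>Uniqueness of the factorization is split off as \<open>monic C k\<close>, which leaves a
  bare existence statement for lifts.\<close>

lemma is_kernel_iff:
  "is_kernel C A B f U k \<longleftrightarrow> f \<in> hom A B \<and> k \<in> hom U A \<and> f \<bullet> k = Null C U B \<and> monic C k \<and>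
    (\<forall>x. arr C x \<and> cd C x = A \<and> f \<bullet> x = Null C (dm C x) B \<longrightarrow> (\<exists>y. arr C y \<and> dm C y = dm C x \<and> cd C y = U \<and> k \<bullet> y = x))"
  (is "?l \<longleftrightarrow> ?r")
proof
  assume l: ?l
  have "\<exists>y. arr C y \<and> dm C y = dm C x \<and> cd C y = U \<and> k \<bullet> y = x"
    if "arr C x" "cd C x = A" "f \<bullet> x = Null C (dm C x) B" for x
  proof -
    have "dm C x \<in> Obj C" "x \<in> hom (dm C x) A" using that by auto
    then have "\<exists>!h. h \<in> hom (dm C x) U \<and> k \<bullet> h = x" using l that(3) unfolding is_kernel_def by blast
    then show ?thesis by auto
  qed
  then show ?r using l kernel_monic[OF l] by (auto simp: is_kernel_def)
next
  assume r: ?r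
  have "\<exists>!h. h \<in> hom X U \<and> k \<bullet> h = g" if g: "X \<in> Obj C" "g \<in> hom X A" "f \<bullet> g = Null C X B" for X g
  proof -
    obtain y where y: "arr C y" "dm C y = X" "cd C y = U" "k \<bullet> y = g" using r g by auto
    show ?thesis
    proof (rule ex1I[of _ y])
      fix h assume "h \<in> hom X U \<and> k \<bullet> h = g"
      then show "h = y" using y r monic_cancel[of k h y] by simp
    qed (use y in auto)
  qed
  then show ?l using r unfolding is_kernel_def by blast
qed

lemma is_cokernel_iff:
  "is_cokernel C A B f Q p \<longleftrightarrow> f \<in> hom A B \<and> p \<in> hom B Q \<and> p \<bullet> f = Null C A Q \<and> epic C p \<and>
    (\<forall>x. arr C x \<and> dm C x = B \<and> x \<bullet> f = Null C A (cd C x) \<longrightarrow> (\<exists>y. arr C y \<and> cd C y = cd C x \<and> dm C y = Q \<and> y \<bullet> p = x))"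
  using preadditive_category.is_kernel_iff[OF op_preadditive, of B A f Q p] by auto

lemma cokernel_desc:
  assumes "is_cokernel C A B f Q p" "arr C x" "dm C x = B" "x \<bullet> f = Null C A (cd C x)"
  obtains y where "arr C y" "dm C y = Q" "cd C y = cd C x" "y \<bullet> p = x"
  using assms unfolding is_cokernel_iff by blast

lemma ses_arr:
  assumes "ses C N f K g M"
  shows "arr C f" "dm C f = N" "cd C f = K" "arr C g" "dm C g = K" "cd C g = M" "g \<bullet> f = Null C N M"
    "monic C f" "epic C g"
  using assms unfolding ses_def is_kernel_iff is_cokernel_iff by simp_all

lemma ses_lift:
  assumes "ses C N f K g M" "arr C x" "cd C x = K" "g \<bullet> x = Null C (dm C x) M"
  obtains y where "arr C y" "dm C y = dm C x" "cd C y = N" "f \<bullet> y = x"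
  using assms unfolding ses_def is_kernel_iff by auto

lemma ses_desc:
  assumes "ses C N f K g M" "arr C x" "dm C x = K" "x \<bullet> f = Null C N (cd C x)"
  obtains y where "arr C y" "dm C y = M" "cd C y = cd C x" "y \<bullet> g = x"
  using assms unfolding ses_def is_cokernel_iff by auto

lemma ng_null [simp]: "A \<in> Obj C \<Longrightarrow> B \<in> Obj C \<Longrightarrow> ng C (Null C A B) = Null C A B"
  by (metis add_ng(1) add_null(2) ng_arr null_arr)

section \<open>Biproducts and isomorphisms\<close>

lemma biproduct_facts:
  assumes "is_biproduct C A B S i j p q"
  shows "arr C i" "arr C j" "arr C p" "arr C q" "dm C i = A" "cd C i = S" "dm C j = B" "cd C j = S"
    "dm C p = S" "cd C p = A" "dm C q = S" "cd C q = B"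
    "p \<bullet> i = Ident C A" "q \<bullet> j = Ident C B" "p \<bullet> j = Null C B A" "q \<bullet> i = Null C A B"
    "i \<bullet> p \<boxplus> j \<bullet> q = Ident C S"
    "A \<in> Obj C" "B \<in> Obj C" "S \<in> Obj C"
  using assms unfolding is_biproduct_def
  by (simp_all, auto)

lemma biproduct_comp:
  assumes b: "is_biproduct C A B S i j p q" and x: "arr C x"
  shows "cd C x = A \<Longrightarrow> p \<bullet> i \<bullet> x = x" "cd C x = B \<Longrightarrow> q \<bullet> j \<bullet> x = x"
    "cd C x = B \<Longrightarrow> p \<bullet> j \<bullet> x = Null C (dm C x) A" "cd C x = A \<Longrightarrow> q \<bullet> i \<bullet> x = Null C (dm C x) B"
    "cd C x = S \<Longrightarrow> i \<bullet> p \<bullet> x \<boxplus> j \<bullet> q \<bullet> x = x"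
    "dm C x = S \<Longrightarrow> x \<bullet> i \<bullet> p \<boxplus> x \<bullet> j \<bullet> q = x"
proof -
  note [simp] = biproduct_facts[OF b] x
  show "cd C x = A \<Longrightarrow> p \<bullet> i \<bullet> x = x" "cd C x = B \<Longrightarrow> q \<bullet> j \<bullet> x = x"
    "cd C x = B \<Longrightarrow> p \<bullet> j \<bullet> x = Null C (dm C x) A" "cd C x = A \<Longrightarrow> q \<bullet> i \<bullet> x = Null C (dm C x) B"
    by (subst reassoc, rule biproduct_facts[OF b]; simp)+
  show "i \<bullet> p \<bullet> x \<boxplus> j \<bullet> q \<bullet> x = x" if "cd C x = S"
  proof -
    have "(i \<bullet> p \<boxplus> j \<bullet> q) \<bullet> x = x" using that by simp
    then show ?thesis using that by (subst (asm) add_comp) (simp_all del: biproduct_facts(17)[OF b])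
  qed
  show "x \<bullet> i \<bullet> p \<boxplus> x \<bullet> j \<bullet> q = x" if "dm C x = S"
  proof -
    have "x \<bullet> (i \<bullet> p \<boxplus> j \<bullet> q) = x" using that by simp
    then show ?thesis using that by (subst (asm) comp_add) (simp_all del: biproduct_facts(17)[OF b])
  qed
qed

lemma is_isoI: "arr C h \<Longrightarrow> arr C k \<Longrightarrow> k \<bullet> h = Ident C A \<Longrightarrow> h \<bullet> k = Ident C B \<Longrightarrow> dm C h = A \<Longrightarrow>
    cd C h = B \<Longrightarrow> dm C k = B \<Longrightarrow> cd C k = A \<Longrightarrow> is_iso C A B h"
  unfolding is_iso_def by auto

lemma is_isoD:
  assumes "is_iso C A B h"
  shows "arr C h" "dm C h = A" "cd C h = B" "monic C h" "epic C h"
    and "\<exists>k. is_iso C B A k \<and> k \<bullet> h = Ident C A \<and> h \<bullet> k = Ident C B"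
proof -
  obtain k where k: "arr C k" "dm C k = B" "cd C k = A" "k \<bullet> h = Ident C A" "h \<bullet> k = Ident C B"
    using assms by (auto simp: is_iso_def)
  show h: "arr C h" "dm C h = A" "cd C h = B" using assms by (auto simp: is_iso_def)
  show "\<exists>k. is_iso C B A k \<and> k \<bullet> h = Ident C A \<and> h \<bullet> k = Ident C B"
    using is_isoI[of k h B A] k h by blast
  have "x = Null C (dm C x) A" if "arr C x" "cd C x = A" "h \<bullet> x = Null C (dm C x) B" for x
  proof -
    have "x = k \<bullet> h \<bullet> x" using reassoc[OF k(4), of x] k h that by simp
    then show ?thesis using that k h by simp
  qed
  then show "monic C h" using h by (auto simp: monic_def)
  have "x = Null C B (cd C x)" if "arr C x" "dm C x = B" "x \<bullet> h = Null C A (cd C x)" for x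
  proof -
    have "x = (x \<bullet> h) \<bullet> k" using k h that(1,2) by simp
    then show ?thesis using that k h by simp
  qed
  then show "epic C h" using h by (auto simp: epic_def)
qed

lemma is_iso_comp:
  assumes "is_iso C A B h" "is_iso C B D k"
  shows "is_iso C A D (k \<bullet> h)"
proof -
  obtain h' k' where *: "is_iso C B A h'" "h' \<bullet> h = Ident C A" "h \<bullet> h' = Ident C B"
    "is_iso C D B k'" "k' \<bullet> k = Ident C B" "k \<bullet> k' = Ident C D"
    using is_isoD(6)[OF assms(1)] is_isoD(6)[OF assms(2)] by auto
  note [simp] = is_isoD(1-3)[OF assms(1)] is_isoD(1-3)[OF assms(2)] is_isoD(1-3)[OF *(1)] is_isoD(1-3)[OF *(4)]
  have "A \<in> Obj C" "B \<in> Obj C" "D \<in> Obj C"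
    using dm_obj[of h] dm_obj[of k] cd_obj[of k] by simp_all
  then show ?thesis
    using reassoc[OF *(5), of h] reassoc[OF *(3), of k'] *
    by (intro is_isoI[of _ "h' \<bullet> k'"]) (simp_all)
qed

lemma is_iso_Ident: "A \<in> Obj C \<Longrightarrow> is_iso C A A (Ident C A)"
  by (intro is_isoI[of _ "Ident C A"]) auto

lemma isomorphic_refl: "A \<in> Obj C \<Longrightarrow> isomorphic C A A"
  and isomorphic_sym: "isomorphic C A B \<Longrightarrow> isomorphic C B A"
  and isomorphic_trans: "isomorphic C A B \<Longrightarrow> isomorphic C B D \<Longrightarrow> isomorphic C A D"
  unfolding isomorphic_def by (blast intro: is_iso_Ident is_iso_comp dest: is_isoD(6))+

lemma monic_comp:
  assumes "monic C f" "monic C g" "dm C g = cd C f"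
  shows "monic C (g \<bullet> f)"
proof -
  note [simp] = monicD[OF assms(1)] monicD[OF assms(2)] assms(3)
  have "x = Null C (dm C x) (dm C f)" if "arr C x" "cd C x = dm C f" "g \<bullet> f \<bullet> x = Null C (dm C x) (cd C g)" for x
  proof -
    have fx: "f \<bullet> x = Null C (dm C x) (dm C g)" by (rule monic_null[OF assms(2)]) (use that in simp_all)
    show ?thesis by (rule monic_null[OF assms(1)]) (use that(1,2) fx assms(3) in simp_all)
  qed
  then show ?thesis by (auto simp: monic_def)
qed

lemma monic_left:
  assumes "monic C (g \<bullet> f)" "arr C f" "arr C g" "dm C g = cd C f"
  shows "monic C f"
proof -
  have "x = Null C (dm C x) (dm C f)" if "arr C x" "cd C x = dm C f" "f \<bullet> x = Null C (dm C x) (cd C f)" for x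
    by (rule monic_null[OF assms(1)]) (use assms that in simp_all)
  then show ?thesis using assms by (auto simp: monic_def)
qed

lemma epic_comp:
  assumes "epic C f" "epic C g" "dm C g = cd C f"
  shows "epic C (g \<bullet> f)"
  using preadditive_category.monic_comp[OF op_preadditive, of g f] assms by simp

lemma epic_right:
  assumes "epic C (g \<bullet> f)" "arr C f" "arr C g" "dm C g = cd C f"
  shows "epic C g"
  using preadditive_category.monic_left[OF op_preadditive, of f g] assms by simp

end

lemma (in abelian_category) op_abelian: "abelian_category (op_cat C)"
  by (rule abelian_category_op_cat) unfold_locales

context abelian_category
begin

text \<open>By axiom a mono f is the kernel of some g, and g factors through the cokernel p of f. So
  whatever p kills is killed by g and lifts through f.\<close>

lemma monic_kernel:
  assumes "monic C f" "is_cokernel C A B f Q p"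
  shows "is_kernel C B Q p A f"
proof -
  have p: "arr C f" "dm C f = A" "cd C f = B" "arr C p" "dm C p = B" "cd C p = Q" "p \<bullet> f = Null C A Q"
    using assms(2) by (auto simp: is_cokernel_iff)
  note [simp] = p
  obtain D g where g: "is_kernel C B D g A f"
    using mono_normal[of A B f] assms(1) by (auto simp: is_mono_iff_monic)
  then have g': "arr C g" "dm C g = B" "cd C g = D" "g \<bullet> f = Null C A D" by (auto simp: is_kernel_iff)
  note [simp] = g'
  obtain r where r: "arr C r" "cd C r = D" "dm C r = Q" "r \<bullet> p = g"
    using cokernel_desc[OF assms(2), of g] by auto
  have "\<exists>y. arr C y \<and> dm C y = dm C x \<and> cd C y = A \<and> f \<bullet> y = x"
    if "arr C x" "cd C x = B" "p \<bullet> x = Null C (dm C x) Q" for x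
  proof -
    have "g \<bullet> x = r \<bullet> p \<bullet> x" using reassoc[OF r(4), of x] r that by simp
    then have "g \<bullet> x = Null C (dm C x) D" using r that by simp
    then show ?thesis using g that unfolding is_kernel_iff by auto
  qed
  then show ?thesis using assms by (auto simp: is_kernel_iff)
qed

lemma epic_cokernel:
  assumes "epic C f" "is_kernel C A B f U k"
  shows "is_cokernel C U A k B f"
  using abelian_category.monic_kernel[OF op_abelian, of f B A U k] assms by simp

lemma ses_monicI: "monic C f \<Longrightarrow> is_cokernel C A B f Q p \<Longrightarrow> ses C A f B p Q"
  by (simp add: ses_def monic_kernel)

lemma ses_epicI: "epic C f \<Longrightarrow> is_kernel C A B f U k \<Longrightarrow> ses C U k A f B"
  by (simp add: ses_def epic_cokernel)

lemma ses_cokernel: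
  assumes "monic C f"
  obtains Q p where "ses C (dm C f) f (cd C f) p Q"
proof -
  obtain Q p where "is_cokernel C (dm C f) (cd C f) f Q p"
    using cokernel_exists[of f "dm C f" "cd C f"] assms monicD by auto
  then show ?thesis using that ses_monicI[OF assms] by blast
qed

lemma ses_kernel:
  assumes "epic C f"
  obtains U k where "ses C U k (dm C f) f (cd C f)"
proof -
  obtain Q p where "is_kernel C (dm C f) (cd C f) f Q p"
    using kernel_exists[of f "dm C f" "cd C f"] assms epicD by auto
  then show ?thesis using that ses_epicI[OF assms] by blast
qed

lemma sesI:
  assumes "arr C f" "dm C f = N" "cd C f = K" "arr C g" "dm C g = K" "cd C g = M" "g \<bullet> f = Null C N M"
    "monic C f" "epic C g"
    "\<And>x. arr C x \<Longrightarrow> cd C x = K \<Longrightarrow> g \<bullet> x = Null C (dm C x) M \<Longrightarrow>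
      \<exists>y. arr C y \<and> dm C y = dm C x \<and> cd C y = N \<and> f \<bullet> y = x"
  shows "ses C N f K g M"
  by (rule ses_epicI[OF assms(9)]) (use assms in \<open>simp add: is_kernel_iff\<close>)

lemma sesI':
  assumes "arr C f" "dm C f = N" "cd C f = K" "arr C g" "dm C g = K" "cd C g = M" "g \<bullet> f = Null C N M"
    "monic C f" "epic C g"
    "\<And>x. arr C x \<Longrightarrow> dm C x = K \<Longrightarrow> x \<bullet> f = Null C N (cd C x) \<Longrightarrow>
      \<exists>y. arr C y \<and> cd C y = cd C x \<and> dm C y = M \<and> y \<bullet> g = x"
  shows "ses C N f K g M"
  using abelian_category.sesI[OF op_abelian, of g M K f N] assms by simp

text \<open>The cokernel arrow p of an epimorphism is zero, so the identity of the target is killed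
  by p and lifts through f; the lift is the inverse.\<close>

lemma monic_epic_iso:
  assumes "monic C f" "epic C f"
  shows "is_iso C (dm C f) (cd C f) f"
proof -
  have [simp]: "arr C f" using assms monicD by auto
  obtain Q p where s: "ses C (dm C f) f (cd C f) p Q" using ses_cokernel[OF assms(1)] .
  note [simp] = ses_arr(4-7)[OF s]
  have "Q \<in> Obj C" using cd_obj[of p] by simp
  have p: "p = Null C (cd C f) Q" by (rule epic_null[OF assms(2)]) simp_all
  obtain y where y: "arr C y" "dm C y = cd C f" "cd C y = dm C f" "f \<bullet> y = Ident C (cd C f)"
    using ses_lift[OF s, of "Ident C (cd C f)"] p \<open>Q \<in> Obj C\<close> by auto
  have fy: "f \<bullet> (y \<bullet> f) = f \<bullet> Ident C (dm C f)" using reassoc[OF y(4), of f] y by simp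
  have "y \<bullet> f = Ident C (dm C f)" by (rule monic_cancel[OF assms(1)]) (use fy y(1-3) in simp_all)
  then show ?thesis using y by (intro is_isoI[of f y]) simp_all
qed

section \<open>Transport of short exact sequences along isomorphisms\<close>

lemma ses_iso_middle:
  assumes s: "ses C N f K g M" and h: "is_iso C K K' h" and k: "k \<bullet> h = Ident C K" "h \<bullet> k = Ident C K'" "is_iso C K' K k"
  shows "ses C N (h \<bullet> f) K' (g \<bullet> k) M"
proof -
  note [simp] = ses_arr(1-7)[OF s] is_isoD(1-3)[OF h] is_isoD(1-3)[OF k(3)]
  have o [simp]: "N \<in> Obj C" "K' \<in> Obj C" "M \<in> Obj C"
    using dm_obj[of f] cd_obj[of h] cd_obj[of g] by simp_all
  show ?thesis
  proof (rule sesI)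
    show "(g \<bullet> k) \<bullet> h \<bullet> f = Null C N M" using reassoc[OF k(1), of f] by simp
    fix x assume x: "arr C x" "cd C x = K'" "(g \<bullet> k) \<bullet> x = Null C (dm C x) M"
    then have "g \<bullet> (k \<bullet> x) = Null C (dm C (k \<bullet> x)) M" by simp
    with x obtain y where y: "arr C y" "dm C y = dm C x" "cd C y = N" "f \<bullet> y = k \<bullet> x"
      using ses_lift[OF s, of "k \<bullet> x"] by auto
    have "(h \<bullet> f) \<bullet> y = x" using y x reassoc[OF k(2), of x] by simp
    then show "\<exists>y. arr C y \<and> dm C y = dm C x \<and> cd C y = N \<and> (h \<bullet> f) \<bullet> y = x" using y by auto
  next
    show "monic C (h \<bullet> f)" using ses_arr(8)[OF s] is_isoD(4)[OF h] by (intro monic_comp) simp_all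
    show "epic C (g \<bullet> k)" using ses_arr(9)[OF s] is_isoD(5)[OF k(3)] by (intro epic_comp) simp_all
  qed simp_all
qed

lemma ses_iso_right:
  assumes s: "ses C N f K g M" and h: "is_iso C M M' h"
  shows "ses C N f K (h \<bullet> g) M'"
proof -
  note [simp] = ses_arr(1-7)[OF s] is_isoD(1-3)[OF h]
  have o [simp]: "N \<in> Obj C" "K \<in> Obj C" "M \<in> Obj C"
    using dm_obj[of f] cd_obj[of f] cd_obj[of g] by simp_all
  show ?thesis
  proof (rule sesI)
    fix x assume x: "arr C x" "cd C x = K" "(h \<bullet> g) \<bullet> x = Null C (dm C x) M'"
    have "g \<bullet> x = Null C (dm C x) M" by (rule monic_null[OF is_isoD(4)[OF h]]) (use x in simp_all)
    then show "\<exists>y. arr C y \<and> dm C y = dm C x \<and> cd C y = N \<and> f \<bullet> y = x"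
      using ses_lift[OF s, of x] x by metis
  next
    show "monic C f" using ses_arr(8)[OF s] .
    show "epic C (h \<bullet> g)" using ses_arr(9)[OF s] is_isoD(5)[OF h] by (intro epic_comp) simp_all
  qed simp_all
qed

lemma ses_iso_left:
  assumes s: "ses C N f K g M" and h: "is_iso C N' N h"
  shows "ses C N' (f \<bullet> h) K g M"
  using abelian_category.ses_iso_right[OF op_abelian, of M g K f N N' h] assms by simp

lemma cokernel_unique:
  assumes s: "ses C N f K g M" and s': "ses C N f K g' M'"
  obtains h where "is_iso C M M' h" "h \<bullet> g = g'"
proof -
  note [simp] = ses_arr(1-7)[OF s] ses_arr(1-7)[OF s']
  obtain h where h [simp]: "arr C h" "dm C h = M" "cd C h = M'" "h \<bullet> g = g'"
    using ses_desc[OF s, of g'] by auto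
  obtain k where k [simp]: "arr C k" "dm C k = M'" "cd C k = M" "k \<bullet> g' = g"
    using ses_desc[OF s', of g] by auto
  have "k \<bullet> h = Ident C M"
    by (rule epic_cancel[OF ses_arr(9)[OF s]]) (use cd_obj[of g] in simp_all)
  moreover have "h \<bullet> k = Ident C M'"
    by (rule epic_cancel[OF ses_arr(9)[OF s']]) (use cd_obj[of g'] in simp_all)
  ultimately have "is_iso C M M' h" by (intro is_isoI[of h k]) simp_all
  then show ?thesis using that by simp
qed

text \<open>The pullback object is the kernel of m = c p - b q on the biproduct of the two sources,
  and k, t are its projections. That m is epic, which follows from m i = c, is what makes t
  epic.\<close>

lemma pullback:
  assumes c: "epic C c" and b: "arr C b" "cd C b = cd C c"
  obtains k t where "arr C k" "arr C t" "cd C k = dm C c" "dm C t = dm C k" "cd C t = dm C b"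
    "c \<bullet> k = b \<bullet> t" "epic C t"
    "\<And>x y. arr C x \<Longrightarrow> arr C y \<Longrightarrow> dm C x = dm C y \<Longrightarrow> cd C x = dm C c \<Longrightarrow> cd C y = dm C b \<Longrightarrow>
       c \<bullet> x = b \<bullet> y \<Longrightarrow> \<exists>z. arr C z \<and> dm C z = dm C y \<and> cd C z = dm C k \<and> k \<bullet> z = x \<and> t \<bullet> z = y"
    "\<And>x. arr C x \<Longrightarrow> cd C x = dm C k \<Longrightarrow> k \<bullet> x = Null C (dm C x) (dm C c) \<Longrightarrow>
       t \<bullet> x = Null C (dm C x) (dm C b) \<Longrightarrow> x = Null C (dm C x) (dm C k)"
proof -
  note [simp] = epicD[OF c] b
  define K where "K = dm C c"
  define B where "B = dm C b"
  define Q where "Q = cd C c"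
  have [simp]: "dm C c = K" "dm C b = B" "cd C c = Q" "K \<in> Obj C" "B \<in> Obj C" "Q \<in> Obj C"
    by (simp_all add: K_def B_def Q_def)
  obtain S i j p q where bp: "is_biproduct C K B S i j p q"
    using biproduct_exists[of K B] by auto
  note [simp] = biproduct_facts(1-16,18-20)[OF bp] biproduct_comp[OF bp]
  define m where "m = c \<bullet> p \<boxplus> ng C (b \<bullet> q)"
  have m [simp]: "arr C m" "dm C m = S" "cd C m = Q" by (simp_all add: m_def)
  have mi: "m \<bullet> i = c" by (simp add: m_def)
  have "epic C (m \<bullet> i)" using c mi by simp
  then have me: "epic C m" by (rule epic_right) simp_all
  obtain U u where s: "ses C U u S m Q" using ses_kernel[OF me] by auto
  note [simp] = ses_arr(1-6)[OF s]
  have mx: "m \<bullet> x = c \<bullet> p \<bullet> x \<boxplus> ng C (b \<bullet> q \<bullet> x)" if "arr C x" "cd C x = S" for x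
    using that by (simp add: m_def)
  have eq: "c \<bullet> p \<bullet> u \<boxplus> ng C (b \<bullet> q \<bullet> u) = Null C U Q" using mx[of u] ses_arr(7)[OF s] by simp
  have sq: "c \<bullet> p \<bullet> u = b \<bullet> q \<bullet> u"
    by (rule diff_eq_null) (use eq in simp_all)
  \<comment> \<open>The projection t = q u is epic: if w kills it, then w q factors through m as v
    m. Restricting along i gives v c = 0, so v = 0, and restricting along j gives w = 0.\<close>
  have "w = Null C B (cd C w)" if w: "arr C w" "dm C w = B" "w \<bullet> q \<bullet> u = Null C U (cd C w)" for w
  proof -
    have [simp]: "cd C w \<in> Obj C" using w by simp
    have "(w \<bullet> q) \<bullet> u = Null C U (cd C (w \<bullet> q))" using w by simp
    then obtain v where v: "arr C v" "dm C v = Q" "cd C v = cd C w" "v \<bullet> m = w \<bullet> q"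
      using ses_desc[OF s, of "w \<bullet> q"] w by auto
    have "v \<bullet> c = (v \<bullet> m) \<bullet> i" using v(1-3) mi by simp
    also have "\<dots> = Null C K (cd C w)" using w by (simp add: v(4))
    finally have vc: "v \<bullet> c = Null C K (cd C w)" .
    have "v = Null C Q (cd C w)" by (rule epic_null[OF c]) (use v(1-3) vc in simp_all)
    then have "w \<bullet> q = Null C S (cd C w)" using v by simp
    then have "(w \<bullet> q) \<bullet> j = Null C B (cd C w)" by simp
    then show ?thesis using w by simp
  qed
  then have et: "epic C (q \<bullet> u)" by (auto simp: epic_def)
  have up: "\<exists>z. arr C z \<and> dm C z = dm C y \<and> cd C z = U \<and> (p \<bullet> u) \<bullet> z = x \<and> (q \<bullet> u) \<bullet> z = y"
    if x: "arr C x" "arr C y" "dm C x = dm C y" "cd C x = K" "cd C y = B" "c \<bullet> x = b \<bullet> y" for x y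
  proof -
    define s' where "s' = i \<bullet> x \<boxplus> j \<bullet> y"
    have s' [simp]: "arr C s'" "dm C s' = dm C y" "cd C s' = S" using x by (simp_all add: s'_def)
    have o: "dm C y \<in> Obj C" using x by simp
    have ps: "p \<bullet> s' = x" "q \<bullet> s' = y" using x o by (simp_all add: s'_def)
    have "m \<bullet> s' = Null C (dm C y) Q" using mx[of s'] ps x by simp
    then obtain z where "arr C z" "dm C z = dm C s'" "cd C z = U" "u \<bullet> z = s'"
      using ses_lift[OF s, of s'] by auto
    then show ?thesis using ps by auto
  qed
  have un: "x = Null C (dm C x) U"
    if x: "arr C x" "cd C x = U" "p \<bullet> u \<bullet> x = Null C (dm C x) K" "q \<bullet> u \<bullet> x = Null C (dm C x) B" for x
  proof -
    have "u \<bullet> x = i \<bullet> p \<bullet> u \<bullet> x \<boxplus> j \<bullet> q \<bullet> u \<bullet> x"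
      using biproduct_comp(5)[OF bp, of "u \<bullet> x"] x(1,2) by simp
    then have "u \<bullet> x = Null C (dm C x) S" unfolding x(3,4) using x(1) by simp
    then show ?thesis using x(1,2) ses_arr(8)[OF s] unfolding monic_def by simp
  qed
  show ?thesis
    by (rule that[of "p \<bullet> u" "q \<bullet> u"]) (use sq et up un in simp_all)
qed

lemma pushout:
  assumes c: "monic C c" and b: "arr C b" "dm C b = dm C c"
  obtains k t where "arr C k" "arr C t" "dm C k = cd C c" "cd C t = cd C k" "dm C t = cd C b"
    "k \<bullet> c = t \<bullet> b" "monic C t"
    "\<And>x y. arr C x \<Longrightarrow> arr C y \<Longrightarrow> cd C x = cd C y \<Longrightarrow> dm C x = cd C c \<Longrightarrow> dm C y = cd C b \<Longrightarrow>
       x \<bullet> c = y \<bullet> b \<Longrightarrow> \<exists>z. arr C z \<and> cd C z = cd C y \<and> dm C z = cd C k \<and> z \<bullet> k = x \<and> z \<bullet> t = y"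
    "\<And>x. arr C x \<Longrightarrow> dm C x = cd C k \<Longrightarrow> x \<bullet> k = Null C (cd C c) (cd C x) \<Longrightarrow>
       x \<bullet> t = Null C (cd C b) (cd C x) \<Longrightarrow> x = Null C (cd C k) (cd C x)"
  using abelian_category.pullback[OF op_abelian, of c b] assms by auto

end

section \<open>Extensions and vanishing of Ext\<close>

context abelian_category
begin

text \<open>An arrow x with h x = 0 comes from N, where h acts as the mono f', and dually for the
  cokernel. Yoneda equivalences can thus be built from any arrow of extensions.\<close>

lemma short_five:
  assumes s: "ses C N f K g M" and s': "ses C N f' K' g' M"
    and h: "arr C h" "dm C h = K" "cd C h = K'" "h \<bullet> f = f'" "g' \<bullet> h = g"
  shows "is_iso C K K' h"
proof -
  note [simp] = ses_arr(1-7)[OF s] ses_arr(1-7)[OF s'] h(1-3)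
  have o [simp]: "N \<in> Obj C" "K \<in> Obj C" "M \<in> Obj C" "K' \<in> Obj C"
    using dm_obj[of f] cd_obj[of f] cd_obj[of g] cd_obj[of f'] by simp_all
  have "x = Null C (dm C x) K" if x: "arr C x" "cd C x = K" "h \<bullet> x = Null C (dm C x) K'" for x
  proof -
    have dx [simp]: "dm C x \<in> Obj C" using x by simp
    have "g \<bullet> x = g' \<bullet> h \<bullet> x" using reassoc[OF h(5), of x] x(1,2) by simp
    then have "g \<bullet> x = Null C (dm C x) M" unfolding x(3) by simp
    then obtain y where y: "arr C y" "dm C y = dm C x" "cd C y = N" "f \<bullet> y = x"
      using ses_lift[OF s, of x] x by auto
    have fy: "f' \<bullet> y = Null C (dm C x) K'" using reassoc[OF h(4), of y] y x by simp
    have "y = Null C (dm C x) N" by (rule monic_null[OF ses_arr(8)[OF s']]) (use y(1-3) fy in simp_all)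
    then show ?thesis using y(4) by simp
  qed
  then have m: "monic C h" by (auto simp: monic_def)
  have "x = Null C K' (cd C x)" if x: "arr C x" "dm C x = K'" "x \<bullet> h = Null C K (cd C x)" for x
  proof -
    have dx [simp]: "cd C x \<in> Obj C" using x by simp
    have "x \<bullet> f' = (x \<bullet> h) \<bullet> f" using h(4) x(1,2) by simp
    then have "x \<bullet> f' = Null C N (cd C x)" unfolding x(3) by simp
    then obtain y where y: "arr C y" "dm C y = M" "cd C y = cd C x" "y \<bullet> g' = x"
      using ses_desc[OF s', of x] x by auto
    have "y \<bullet> g = (y \<bullet> g') \<bullet> h" using h(5) y(1-3) by simp
    then have yg: "y \<bullet> g = Null C K (cd C x)" using y(4) x by simp
    have "y = Null C M (cd C x)" by (rule epic_null[OF ses_arr(9)[OF s]]) (use y(1-3) yg in simp_all)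
    then show ?thesis using y(4) by simp
  qed
  then have "epic C h" by (auto simp: epic_def)
  with m show ?thesis using monic_epic_iso[of h] by simp
qed

text \<open>The idempotent 1 - j g is killed by g, so it lifts through f; the lift is the projection
  onto N.\<close>

lemma section_biproduct:
  assumes s: "ses C N f K g M" and j: "arr C j" "dm C j = M" "cd C j = K" "g \<bullet> j = Ident C M"
  obtains r where "is_biproduct C N M K f j r g"
proof -
  note [simp] = ses_arr(1-7)[OF s] j
  have o [simp]: "N \<in> Obj C" "K \<in> Obj C" "M \<in> Obj C"
    using dm_obj[of f] cd_obj[of f] cd_obj[of g] by simp_all
  have jx: "g \<bullet> j \<bullet> x = x" if "arr C x" "cd C x = M" for x
    using reassoc[OF j(4), of x] that by simp
  have fx: "g \<bullet> f \<bullet> x = Null C (dm C x) M" if "arr C x" "cd C x = N" for x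
    using reassoc[OF ses_arr(7)[OF s], of x] that by simp
  define e where "e = Ident C K \<boxplus> ng C (j \<bullet> g)"
  have e [simp]: "arr C e" "dm C e = K" "cd C e = K" by (simp_all add: e_def)
  have "g \<bullet> e = Null C K M" by (simp add: e_def jx)
  then obtain r where r: "arr C r" "dm C r = K" "cd C r = N" "f \<bullet> r = e"
    using ses_lift[OF s, of e] by auto
  note [simp] = r(1-3)
  have 1: "f \<bullet> r \<bullet> f = f \<bullet> Ident C N" using reassoc[OF r(4), of f] by (simp add: e_def)
  have rf: "r \<bullet> f = Ident C N" by (rule monic_cancel[OF ses_arr(8)[OF s]]) (use 1 in simp_all)
  have 2: "f \<bullet> r \<bullet> j = f \<bullet> Null C M N" using reassoc[OF r(4), of j] by (simp add: e_def)
  have rj: "r \<bullet> j = Null C M N" by (rule monic_cancel[OF ses_arr(8)[OF s]]) (use 2 in simp_all)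
  have "f \<bullet> r \<boxplus> j \<bullet> g = Ident C K" by (simp add: r(4) e_def add_assoc)
  then have "is_biproduct C N M K f j r g" using rf rj by (simp add: is_biproduct_def)
  then show ?thesis using that by simp
qed

lemma biproduct_ses:
  assumes "is_biproduct C N M K f j r g"
  shows "ses C N f K g M"
proof -
  note [simp] = biproduct_facts(1-16,18-20)[OF assms] biproduct_comp[OF assms]
  have "x = Null C (dm C x) N" if x: "arr C x" "cd C x = N" "f \<bullet> x = Null C (dm C x) K" for x
  proof -
    have "x = r \<bullet> f \<bullet> x" using x(1,2) by simp
    then show ?thesis unfolding x(3) using x(1) by simp
  qed
  then have m: "monic C f" by (simp add: monic_def)
  have "x = Null C M (cd C x)" if x: "arr C x" "dm C x = M" "x \<bullet> g = Null C K (cd C x)" for x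
  proof -
    have "x = (x \<bullet> g) \<bullet> j" using x(1,2) by simp
    then show ?thesis unfolding x(3) using x(1) by simp
  qed
  then have e: "epic C g" by (simp add: epic_def)
  show ?thesis
  proof (rule sesI)
    fix x assume x: "arr C x" "cd C x = K" "g \<bullet> x = Null C (dm C x) M"
    have "f \<bullet> r \<bullet> x = x" using biproduct_comp(5)[OF assms, of x] x by simp
    then show "\<exists>y. arr C y \<and> dm C y = dm C x \<and> cd C y = N \<and> f \<bullet> y = x" using x by (intro exI[of _ "r \<bullet> x"]) simp
  qed (use m e in simp_all)
qed

lemma is_biproduct_swap: "is_biproduct C A B S i j p q \<Longrightarrow> is_biproduct C B A S j i q p"
  unfolding is_biproduct_def using add_comm[of "i \<bullet> p" "j \<bullet> q"] by auto

section \<open>Yoneda equivalence and vanishing of Ext^1\<close>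

lemma extension_equiv_iff:
  "((K, f, g), (K', f', g')) \<in> extension_equiv C M N \<longleftrightarrow> ses C N f K g M \<and> ses C N f' K' g' M \<and>
    (\<exists>h. arr C h \<and> dm C h = K \<and> cd C h = K' \<and> h \<bullet> f = f' \<and> g' \<bullet> h = g)"
  unfolding extension_equiv_def extensions_iff_ses using short_five is_isoD(1-3) by blast

lemma equiv_extension_equiv: "equiv (extensions C M N) (extension_equiv C M N)"
proof (rule equivI)
  show "extension_equiv C M N \<subseteq> extensions C M N \<times> extensions C M N"
    by (auto simp: extension_equiv_def)
  show "refl_on (extensions C M N) (extension_equiv C M N)"
  proof (rule refl_onI)
    fix x assume x: "x \<in> extensions C M N"
    obtain K f g where [simp]: "x = (K, f, g)" by (cases x) auto
    have s: "ses C N f K g M" using x by (simp add: extensions_iff_ses)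
    have "K \<in> Obj C" using cd_obj[of f] ses_arr(1,3)[OF s] by simp
    then show "(x, x) \<in> extension_equiv C M N"
      using s ses_arr[OF s] by (auto simp: extension_equiv_iff intro!: exI[of _ "Ident C K"])
  qed
  show "sym (extension_equiv C M N)"
  proof (rule symI)
    fix x y assume *: "(x, y) \<in> extension_equiv C M N"
    obtain K f g K' f' g' where [simp]: "x = (K, f, g)" "y = (K', f', g')" by (cases x, cases y) auto
    obtain h where s: "ses C N f K g M" "ses C N f' K' g' M" and h: "is_iso C K K' h" "h \<bullet> f = f'" "g' \<bullet> h = g"
      using * unfolding extension_equiv_def extensions_iff_ses by auto
    obtain k where k: "is_iso C K' K k" "k \<bullet> h = Ident C K" "h \<bullet> k = Ident C K'" using is_isoD(6)[OF h(1)] by auto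
    note a = ses_arr(1-6)[OF s(1)] ses_arr(1-6)[OF s(2)] is_isoD(1-3)[OF h(1)] is_isoD(1-3)[OF k(1)]
    have "k \<bullet> f' = f" using reassoc[OF k(2), of f] a h(2) by simp
    moreover have "g \<bullet> k = g'" using a h(3)[symmetric] k(3) by simp
    ultimately show "(y, x) \<in> extension_equiv C M N"
      using s is_isoD(1-3)[OF k(1)] unfolding \<open>x = _\<close> \<open>y = _\<close> extension_equiv_iff by blast
  qed
  show "trans (extension_equiv C M N)"
  proof (rule transI)
    fix x y z assume *: "(x, y) \<in> extension_equiv C M N" "(y, z) \<in> extension_equiv C M N"
    obtain K f g K' f' g' K'' f'' g'' where [simp]: "x = (K, f, g)" "y = (K', f', g')" "z = (K'', f'', g'')"
      by (cases x, cases y, cases z) auto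
    obtain h where s: "ses C N f K g M" "ses C N f' K' g' M"
      and h: "arr C h" "dm C h = K" "cd C h = K'" "h \<bullet> f = f'" "g' \<bullet> h = g"
      using *(1) by (auto simp: extension_equiv_iff)
    obtain k where t: "ses C N f'' K'' g'' M"
      and k: "arr C k" "dm C k = K'" "cd C k = K''" "k \<bullet> f' = f''" "g'' \<bullet> k = g'"
      using *(2) by (auto simp: extension_equiv_iff)
    note a = ses_arr(1-6)[OF s(1)] ses_arr(1-6)[OF s(2)] ses_arr(1-6)[OF t] h(1-3) k(1-3)
    have "(k \<bullet> h) \<bullet> f = f''" "g'' \<bullet> k \<bullet> h = g"
      using a h(4) k(4) reassoc[OF k(5), of h] h(5) by simp_all
    moreover have "arr C (k \<bullet> h)" "dm C (k \<bullet> h) = K" "cd C (k \<bullet> h) = K''" using a by simp_all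
    ultimately show "(x, z) \<in> extension_equiv C M N" using s t unfolding \<open>x = _\<close> \<open>z = _\<close> extension_equiv_iff by blast
  qed
qed

lemma split_extension_equiv:
  assumes s: "ses C N f K g M" and s': "ses C N f' K' g' M"
    and j: "arr C j" "dm C j = M" "cd C j = K" "g \<bullet> j = Ident C M"
    and j': "arr C j'" "dm C j' = M" "cd C j' = K'" "g' \<bullet> j' = Ident C M"
  shows "((K, f, g), (K', f', g')) \<in> extension_equiv C M N"
proof -
  obtain r where r: "is_biproduct C N M K f j r g" using section_biproduct[OF s j] .
  obtain r' where r': "is_biproduct C N M K' f' j' r' g'" using section_biproduct[OF s' j'] .
  note [simp] = biproduct_facts(1-16,18-20)[OF r] biproduct_comp[OF r] biproduct_facts(1-16,18-20)[OF r'] biproduct_comp[OF r']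
  show ?thesis
    unfolding extension_equiv_iff using s s' by (auto intro!: exI[of _ "f' \<bullet> r \<boxplus> j' \<bullet> g"])
qed

text \<open>All split extensions are equivalent and the biproduct provides one. Hence the split
  class is the only class exactly when every extension has a section.\<close>

lemma Ext1_vanishes_iff_section:
  assumes "M \<in> Obj C" "N \<in> Obj C"
  shows "Ext1_vanishes C M N \<longleftrightarrow>
    (\<forall>K f g. ses C N f K g M \<longrightarrow> (\<exists>j. arr C j \<and> dm C j = M \<and> cd C j = K \<and> g \<bullet> j = Ident C M))"
    (is "?l \<longleftrightarrow> ?r")
proof
  assume l: ?l
  show ?r
  proof (intro allI impI)
    fix K f g assume s: "ses C N f K g M"
    then have x: "(K, f, g) \<in> extensions C M N" by (simp add: extensions_iff_ses)
    then have "extension_equiv C M N `` {(K, f, g)} \<in> Ext1 C M N"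
      unfolding Ext1_def by (rule quotientI)
    then have "extension_equiv C M N `` {(K, f, g)} = Ext1_zero C M N" using l by (simp add: Ext1_vanishes_def)
    then have "(K, f, g) \<in> Ext1_zero C M N" using equiv_class_self[OF equiv_extension_equiv x] by simp
    then show "\<exists>j. arr C j \<and> dm C j = M \<and> cd C j = K \<and> g \<bullet> j = Ident C M" by (auto simp: Ext1_zero_def)
  qed
next
  assume r: ?r
  have "\<exists>j\<in>hom M K. g \<bullet> j = Ident C M" if "ses C N f K g M" for K f g
    using r that by (metis hom_iff)
  then have z: "Ext1_zero C M N = extensions C M N" by (auto simp: Ext1_zero_def extensions_iff_ses)
  have cl: "extension_equiv C M N `` {x} = extensions C M N" if x: "x \<in> extensions C M N" for x
  proof -
    have "(x, y) \<in> extension_equiv C M N" if y: "y \<in> extensions C M N" for y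
    proof -
      obtain K f g K' f' g' where [simp]: "x = (K, f, g)" "y = (K', f', g')" by (cases x, cases y) auto
      have "ses C N f K g M" "ses C N f' K' g' M" using x y by (simp_all add: extensions_iff_ses)
      then show ?thesis using r split_extension_equiv by (metis \<open>x = _\<close> \<open>y = _\<close>)
    qed
    then show ?thesis by (auto simp: extension_equiv_def)
  qed
  obtain S i j p q where "is_biproduct C N M S i j p q" using biproduct_exists assms by blast
  then have "(S, i, q) \<in> extensions C M N" by (simp add: extensions_iff_ses biproduct_ses)
  then have "Ext1 C M N = {extensions C M N}"
    unfolding Ext1_def quotient_def using cl by auto
  then show ?l by (simp add: Ext1_vanishes_def z)
qed

lemma Ext1_vanishes_section:
  assumes "Ext1_vanishes C M N" "ses C N f K g M"
  obtains j where "arr C j" "dm C j = M" "cd C j = K" "g \<bullet> j = Ident C M"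
proof -
  have "N \<in> Obj C" "M \<in> Obj C" using dm_obj[of f] cd_obj[of g] ses_arr[OF assms(2)] by auto
  then show ?thesis using that assms Ext1_vanishes_iff_section by blast
qed

lemma Ext1_vanishes_retraction:
  assumes "Ext1_vanishes C M N" "ses C N f K g M"
  obtains r where "arr C r" "dm C r = K" "cd C r = N" "r \<bullet> f = Ident C N"
proof -
  obtain j where "arr C j" "dm C j = M" "cd C j = K" "g \<bullet> j = Ident C M" using Ext1_vanishes_section[OF assms] .
  then obtain r where r: "is_biproduct C N M K f j r g" using section_biproduct[OF assms(2)] by blast
  show ?thesis using that biproduct_facts[OF r] by blast
qed

lemma Ext1_vanishesI_retraction:
  assumes "M \<in> Obj C" "N \<in> Obj C"
    and "\<And>K f g. ses C N f K g M \<Longrightarrow> \<exists>r. arr C r \<and> dm C r = K \<and> cd C r = N \<and> r \<bullet> f = Ident C N"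
  shows "Ext1_vanishes C M N"
  unfolding Ext1_vanishes_iff_section[OF assms(1,2)]
proof (intro allI impI)
  fix K f g assume s: "ses C N f K g M"
  then obtain r where r: "arr C r" "dm C r = K" "cd C r = N" "r \<bullet> f = Ident C N" using assms(3) by blast
  have "ses (op_cat C) M g K f N" using s by simp
  then obtain j where "is_biproduct (op_cat C) M N K g r j f"
    using abelian_category.section_biproduct[OF op_abelian, of M g K f N r] r by auto
  then have b: "is_biproduct C M N K j f g r" by simp
  show "\<exists>j. arr C j \<and> dm C j = M \<and> cd C j = K \<and> g \<bullet> j = Ident C M" using biproduct_facts[OF b] by blast
qed

text \<open>This is the surjectivity of Hom(B,N) \<rightarrow> Hom(A,N). Pushing the sequence out
  along u yields an extension of M by N; it has a retraction, and composing that with the arrow from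
  B extends u.\<close>

lemma Ext1_vanishes_extend:
  assumes v: "Ext1_vanishes C M N" and s: "ses C A f B g M" and u: "arr C u" "dm C u = A" "cd C u = N"
  obtains w where "arr C w" "dm C w = B" "cd C w = N" "w \<bullet> f = u"
proof -
  note [simp] = ses_arr(1-7)[OF s] u
  have o [simp]: "A \<in> Obj C" "B \<in> Obj C" "M \<in> Obj C" "N \<in> Obj C"
    using dm_obj[of f] cd_obj[of f] cd_obj[of g] cd_obj[of u] by simp_all
  have "dm C u = dm C f" by simp
  then obtain k t where kt: "arr C k" "arr C t" "dm C k = cd C f" "cd C t = cd C k" "dm C t = cd C u"
      "k \<bullet> f = t \<bullet> u" "monic C t"
    and up: "\<And>x y. arr C x \<Longrightarrow> arr C y \<Longrightarrow> cd C x = cd C y \<Longrightarrow> dm C x = cd C f \<Longrightarrow> dm C y = cd C u \<Longrightarrow>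
       x \<bullet> f = y \<bullet> u \<Longrightarrow> \<exists>z. arr C z \<and> cd C z = cd C y \<and> dm C z = cd C k \<and> z \<bullet> k = x \<and> z \<bullet> t = y"
    and un: "\<And>x. arr C x \<Longrightarrow> dm C x = cd C k \<Longrightarrow> x \<bullet> k = Null C (cd C f) (cd C x) \<Longrightarrow>
       x \<bullet> t = Null C (cd C u) (cd C x) \<Longrightarrow> x = Null C (cd C k) (cd C x)"
    by (rule pushout[OF ses_arr(8)[OF s] u(1)]) (rule that, assumption+)
  obtain Y where Y: "cd C k = Y" by simp
  have Yo [simp]: "Y \<in> Obj C" using Y kt by auto
  note [simp] = kt(1,2) Y
  have [simp]: "dm C k = B" "dm C t = N" "cd C t = Y" using kt by simp_all
  have "g \<bullet> f = Null C N M \<bullet> u" by simp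
  then obtain z where z [simp]: "arr C z" "cd C z = M" "dm C z = Y" "z \<bullet> k = g" "z \<bullet> t = Null C N M"
    using up[of g "Null C N M"] by auto
  have "epic C (z \<bullet> k)" using ses_arr(9)[OF s] by simp
  then have ez: "epic C z" by (rule epic_right) simp_all
  have "ses C N t Y z M"
  proof (rule sesI')
    fix x assume x: "arr C x" "dm C x = Y" "x \<bullet> t = Null C N (cd C x)"
    have co: "cd C x \<in> Obj C" using x by simp
    have "(x \<bullet> k) \<bullet> f = (x \<bullet> t) \<bullet> u" using x(1,2) kt(6) by simp
    then have "(x \<bullet> k) \<bullet> f = Null C A (cd C (x \<bullet> k))" unfolding x(3) using x(1,2) co by simp
    then obtain y where y: "arr C y" "dm C y = M" "cd C y = cd C x" "y \<bullet> g = x \<bullet> k"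
      using ses_desc[OF s, of "x \<bullet> k"] x by auto
    have "y \<bullet> z \<boxplus> ng C x = Null C Y (cd C (y \<bullet> z \<boxplus> ng C x))"
    proof (rule un[unfolded Y])
      show "(y \<bullet> z \<boxplus> ng C x) \<bullet> k = Null C (cd C f) (cd C (y \<bullet> z \<boxplus> ng C x))"
        using x y by simp
      show "(y \<bullet> z \<boxplus> ng C x) \<bullet> t = Null C (cd C u) (cd C (y \<bullet> z \<boxplus> ng C x))"
        using x y co by simp
    qed (use x y in simp_all)
    then have e: "y \<bullet> z \<boxplus> ng C x = Null C (dm C x) (cd C x)" using x y by simp
    have "y \<bullet> z = x" by (rule diff_eq_null[OF _ _ _ _ e]) (use x y in simp_all)
    then show "\<exists>y. arr C y \<and> cd C y = cd C x \<and> dm C y = M \<and> y \<bullet> z = x" using y by auto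
  qed (use ez kt(7) in simp_all)
  then obtain r where r [simp]: "arr C r" "dm C r = Y" "cd C r = N" "r \<bullet> t = Ident C N"
    using Ext1_vanishes_retraction[OF v] by metis
  have "(r \<bullet> k) \<bullet> f = (r \<bullet> t) \<bullet> u" using kt(6) by (simp del: r(4))
  then have "(r \<bullet> k) \<bullet> f = u" by simp
  then show ?thesis using that[of "r \<bullet> k"] by simp
qed

lemma op_Ext1_vanishes:
  assumes "M \<in> Obj C" "N \<in> Obj C"
  shows "Ext1_vanishes (op_cat C) N M \<longleftrightarrow> Ext1_vanishes C M N"
proof -
  have *: "Ext1_vanishes (op_cat C) N M" if "abelian_category C" "Ext1_vanishes C M N" "M \<in> Obj C" "N \<in> Obj C" for C :: "('a, 'b) category" and M N
  proof -
    note op = abelian_category.op_abelian[OF that(1)]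
    show ?thesis
    proof (rule abelian_category.Ext1_vanishesI_retraction[OF op])
      fix K f g assume "ses (op_cat C) M f K g N"
      then have "ses C N g K f M" by simp
      from abelian_category.Ext1_vanishes_section[OF that(1,2) this]
      show "\<exists>r. arr (op_cat C) r \<and> dm (op_cat C) r = K \<and> cd (op_cat C) r = M \<and>
          Comp (op_cat C) r f = Ident (op_cat C) M" by simp metis
    qed (use that in simp_all)
  qed
  show ?thesis using *[of C M N] *[OF op_abelian, of N M] assms abelian_category_axioms by auto
qed

lemma Ext1_vanishes_iso:
  assumes "Ext1_vanishes C M N" "is_iso C M M' h" "N \<in> Obj C"
  shows "Ext1_vanishes C M' N"
proof (rule Ext1_vanishesI_retraction)
  obtain k where k: "is_iso C M' M k" using is_isoD(6)[OF assms(2)] by auto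
  show "M' \<in> Obj C" using is_isoD[OF assms(2)] by auto
  fix K f g assume s: "ses C N f K g M'"
  from ses_iso_right[OF this k] have "ses C N f K (k \<bullet> g) M" .
  then show "\<exists>r. arr C r \<and> dm C r = K \<and> cd C r = N \<and> r \<bullet> f = Ident C N"
    using Ext1_vanishes_retraction[OF assms(1)] by metis
qed (use assms in simp)

text \<open>An extension X of K by E restricts over the subobject N to an extension U with a
  retraction onto E. Since U is a subobject of X with quotient M, the vanishing of Ext^1(M,E)
  extends this retraction to X.\<close>

lemma Ext1_vanishes_extension:
  assumes s: "ses C N f K g M" and vM: "Ext1_vanishes C M E" and vN: "Ext1_vanishes C N E" and E: "E \<in> Obj C"
  shows "Ext1_vanishes C K E"
proof (rule Ext1_vanishesI_retraction)
  note [simp] = ses_arr(1-7)[OF s] E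
  have o [simp]: "N \<in> Obj C" "K \<in> Obj C" "M \<in> Obj C"
    using dm_obj[of f] cd_obj[of f] cd_obj[of g] by simp_all
  show "K \<in> Obj C" by simp
  fix X a b assume sX: "ses C E a X b K"
  note [simp] = ses_arr(1-7)[OF sX]
  have Xo [simp]: "X \<in> Obj C" using cd_obj[of a] by simp
  have "cd C f = cd C b" by simp
  then obtain k t where kt: "arr C k" "arr C t" "cd C k = dm C b" "dm C t = dm C k" "cd C t = dm C f"
      "b \<bullet> k = f \<bullet> t" "epic C t"
    and up: "\<And>x y. arr C x \<Longrightarrow> arr C y \<Longrightarrow> dm C x = dm C y \<Longrightarrow> cd C x = dm C b \<Longrightarrow> cd C y = dm C f \<Longrightarrow>
       b \<bullet> x = f \<bullet> y \<Longrightarrow> \<exists>z. arr C z \<and> dm C z = dm C y \<and> cd C z = dm C k \<and> k \<bullet> z = x \<and> t \<bullet> z = y"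
    and un: "\<And>x. arr C x \<Longrightarrow> cd C x = dm C k \<Longrightarrow> k \<bullet> x = Null C (dm C x) (dm C b) \<Longrightarrow>
       t \<bullet> x = Null C (dm C x) (dm C f) \<Longrightarrow> x = Null C (dm C x) (dm C k)"
    by (rule pullback[OF ses_arr(9)[OF sX] ses_arr(1)[OF s]]) (rule that, assumption+)
  obtain U where U: "dm C k = U" by simp
  have Uo [simp]: "U \<in> Obj C" using U kt by auto
  note [simp] = kt(1,2) U
  have [simp]: "cd C k = X" "cd C t = N" "dm C t = U" using kt by simp_all
  have mk: "monic C k"
    unfolding monic_def
  proof (intro conjI allI impI)
    fix x assume x: "arr C x \<and> cd C x = dm C k \<and> k \<bullet> x = Null C (dm C x) (cd C k)"
    have "f \<bullet> t \<bullet> x = b \<bullet> k \<bullet> x" using reassoc[OF kt(6), of x] x by simp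
    then have ft: "f \<bullet> t \<bullet> x = Null C (dm C x) K" using x by simp
    have "t \<bullet> x = Null C (dm C x) N" by (rule monic_null[OF ses_arr(8)[OF s]]) (use x ft in simp_all)
    then show "x = Null C (dm C x) (dm C k)" using un[of x] x by simp
  qed simp
  obtain a' where a' [simp]: "arr C a'" "dm C a' = E" "cd C a' = U" "k \<bullet> a' = a" "t \<bullet> a' = Null C E N"
    using up[of a "Null C E N"] by auto
  have "monic C (k \<bullet> a')" using ses_arr(8)[OF sX] by simp
  then have ma: "monic C a'" by (rule monic_left) simp_all
  have s1: "ses C E a' U t N"
  proof (rule sesI)
    fix x assume x: "arr C x" "cd C x = U" "t \<bullet> x = Null C (dm C x) N"
    have "b \<bullet> k \<bullet> x = Null C (dm C x) K" using reassoc[OF kt(6), of x] x by simp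
    then obtain y where y: "arr C y" "dm C y = dm C x" "cd C y = E" "a \<bullet> y = k \<bullet> x"
      using ses_lift[OF sX, of "k \<bullet> x"] x by auto
    have ka: "k \<bullet> a' \<bullet> y = k \<bullet> x" using reassoc[OF a'(4), of y] y by simp
    have "a' \<bullet> y = x" by (rule monic_cancel[OF mk]) (use x(1,2) y(1-3) ka in simp_all)
    then show "\<exists>y. arr C y \<and> dm C y = dm C x \<and> cd C y = E \<and> a' \<bullet> y = x" using y by auto
  qed (use ma kt(7) in simp_all)
  obtain r where r [simp]: "arr C r" "dm C r = U" "cd C r = E" "r \<bullet> a' = Ident C E"
    using Ext1_vanishes_retraction[OF vN s1] .
  have s2: "ses C U k X (g \<bullet> b) M"
  proof (rule sesI)
    have "(g \<bullet> b) \<bullet> k = (g \<bullet> f) \<bullet> t" using kt(6) by (simp del: ses_arr(7)[OF s])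
    then show "(g \<bullet> b) \<bullet> k = Null C U M" by simp
    show "epic C (g \<bullet> b)" by (rule epic_comp) (use ses_arr(9)[OF s] ses_arr(9)[OF sX] in simp_all)
    fix x assume x: "arr C x" "cd C x = X" "(g \<bullet> b) \<bullet> x = Null C (dm C x) M"
    then have "g \<bullet> (b \<bullet> x) = Null C (dm C (b \<bullet> x)) M" by simp
    then obtain y where y: "arr C y" "dm C y = dm C x" "cd C y = N" "f \<bullet> y = b \<bullet> x"
      using ses_lift[OF s, of "b \<bullet> x"] x by auto
    then show "\<exists>y. arr C y \<and> dm C y = dm C x \<and> cd C y = U \<and> k \<bullet> y = x"
      using up[of x y] x by auto
  qed (use mk in simp_all)
  obtain w where w: "arr C w" "dm C w = X" "cd C w = E" "w \<bullet> k = r"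
    using Ext1_vanishes_extend[OF vM s2 r(1-3)] .
  have "w \<bullet> a = (w \<bullet> k) \<bullet> a'" using w(1-3) by simp
  then have "w \<bullet> a = Ident C E" using w(4) by simp
  then show "\<exists>r. arr C r \<and> dm C r = X \<and> cd C r = E \<and> r \<bullet> a = Ident C E" using w by auto
qed (use E in simp)

end

section \<open>Counting in finitary categories\<close>

lemma card_fibres:
  assumes "finite A" "\<And>x. x \<in> A \<Longrightarrow> card {z \<in> A. \<phi> z = \<phi> x} = c"
  shows "card A = card (\<phi> ` A) * c"
proof -
  have "A = (\<Union>y\<in>\<phi> ` A. {z \<in> A. \<phi> z = y})" by auto
  then have "card A = card (\<Union>y\<in>\<phi> ` A. {z \<in> A. \<phi> z = y})" by simp
  also have "\<dots> = (\<Sum>y\<in>\<phi> ` A. card {z \<in> A. \<phi> z = y})"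
    by (rule card_UN_disjoint) (use assms in auto)
  also have "\<dots> = (\<Sum>y\<in>\<phi> ` A. c)" by (rule sum.cong) (use assms in auto)
  finally show ?thesis by simp
qed

text \<open>Only Ext^1 needs an argument: exchanging the two arrows of a triple turns classes of C
  into classes of the opposite category. The direction of the comparison arrow is reversed, which
  symmetry of the equivalence absorbs.\<close>

lemma finitary_abelian_category_op_cat:
  assumes "finitary_abelian_category C"
  shows "finitary_abelian_category (op_cat C)"
proof -
  interpret finitary_abelian_category C by fact
  interpret op: abelian_category "op_cat C" by (rule op_abelian)
  show ?thesis
  proof unfold_locales
    show "finite (Hom (op_cat C) M N)" if "M \<in> Obj (op_cat C)" "N \<in> Obj (op_cat C)" for M N
      using that finite_Hom by simp
    fix M N assume "M \<in> Obj (op_cat C)" "N \<in> Obj (op_cat C)"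
    then have fin: "finite (Ext1 C N M)" using finite_Ext1 by simp
    define sw :: "'a \<times> 'b \<times> 'b \<Rightarrow> 'a \<times> 'b \<times> 'b" where "sw = (\<lambda>(K, f, g). (K, g, f))"
    have sw: "sw (sw x) = x" for x by (cases x) (simp add: sw_def)
    have ext: "x \<in> extensions (op_cat C) M N \<longleftrightarrow> sw x \<in> extensions C N M" for x
      by (cases x) (simp add: sw_def extensions_iff_ses)
    have eq: "(x, y) \<in> extension_equiv (op_cat C) M N \<longleftrightarrow> (sw y, sw x) \<in> extension_equiv C N M" for x y
      by (cases x, cases y) (auto simp: sw_def extension_equiv_iff op.extension_equiv_iff)
    have "extension_equiv (op_cat C) M N `` {x} = sw ` (extension_equiv C N M `` {sw x})" for x
    proof -
      have "y \<in> extension_equiv (op_cat C) M N `` {x} \<longleftrightarrow> y \<in> sw ` (extension_equiv C N M `` {sw x})" for y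
      proof -
        have "y \<in> extension_equiv (op_cat C) M N `` {x} \<longleftrightarrow> (sw x, sw y) \<in> extension_equiv C N M"
          using eq equiv_extension_equiv[of N M] unfolding equiv_def by (auto dest: symD)
        then show ?thesis unfolding image_iff Bex_def Image_singleton_iff by (metis sw)
      qed
      then show ?thesis by blast
    qed
    note cl = this
    have "Ext1 (op_cat C) M N \<subseteq> (\<lambda>S. sw ` S) ` Ext1 C N M"
    proof
      fix c assume "c \<in> Ext1 (op_cat C) M N"
      then obtain x where x: "x \<in> extensions (op_cat C) M N" "c = extension_equiv (op_cat C) M N `` {x}"
        unfolding Ext1_def by (rule quotientE)
      then have "extension_equiv C N M `` {sw x} \<in> Ext1 C N M"
        unfolding Ext1_def using ext by (intro quotientI) blast
      then show "c \<in> (\<lambda>S. sw ` S) ` Ext1 C N M" unfolding x(2) cl by (rule imageI)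
    qed
    then show "finite (Ext1 (op_cat C) M N)" using fin finite_surj by blast
  qed
qed

lemma (in finitary_abelian_category) op_finitary: "finitary_abelian_category (op_cat C)"
  by (rule finitary_abelian_category_op_cat) unfold_locales

context finitary_abelian_category
begin

section \<open>Orders of Hom groups along short exact sequences\<close>

lemma card_hom_le_middle:
  assumes s: "ses C N f K g M" and X: "X \<in> Obj C"
  shows "card (hom X N) \<le> card (hom X K)"
proof (rule card_inj_on_le[of "\<lambda>x. f \<bullet> x"])
  note [simp] = ses_arr(1-7)[OF s]
  show "inj_on (\<lambda>x. f \<bullet> x) (hom X N)"
    by (rule inj_onI) (rule monic_cancel[OF ses_arr(8)[OF s]], auto)
  show "(\<lambda>x. f \<bullet> x) ` hom X N \<subseteq> hom X K" by auto
  have "K \<in> Obj C" using cd_obj[of f] by simp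
  then show "finite (hom X K)" using finite_Hom X by simp
qed

lemma card_hom_le_middle':
  assumes s: "ses C N f K g M" and X: "X \<in> Obj C"
  shows "card (hom M X) \<le> card (hom K X)"
  using finitary_abelian_category.card_hom_le_middle[OF op_finitary, of M g K f N X] assms by simp

text \<open>The fibre through x is the coset of all x + f y, with y uniquely determined because f is
  monic.\<close>

lemma card_hom_fibre:
  assumes s: "ses C N f K g M" and x: "arr C x" "cd C x = K"
  shows "card {z \<in> hom (dm C x) K. g \<bullet> z = g \<bullet> x} = card (hom (dm C x) N)"
proof -
  define X where "X = dm C x"
  have X: "dm C x = X" "X \<in> Obj C" using x by (auto simp: X_def)
  note [simp] = ses_arr(1-7)[OF s] X x
  have o [simp]: "N \<in> Obj C" "K \<in> Obj C" "M \<in> Obj C"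
    using dm_obj[of f] cd_obj[of f] cd_obj[of g] by simp_all
  have fib: "{z \<in> hom X K. g \<bullet> z = g \<bullet> x} = (\<lambda>y. x \<boxplus> f \<bullet> y) ` hom X N" (is "?L = ?R")
  proof
    show "?R \<subseteq> ?L"
    proof
      fix z assume "z \<in> ?R"
      then obtain y where y: "y \<in> hom X N" "z = x \<boxplus> f \<bullet> y" by blast
      then have "g \<bullet> f \<bullet> y = Null C X M" using reassoc[OF ses_arr(7)[OF s], of y] by simp
      then show "z \<in> ?L" using x y by simp
    qed
    show "?L \<subseteq> ?R"
    proof
      fix z assume z: "z \<in> ?L"
      have "g \<bullet> (z \<boxplus> ng C x) = Null C (dm C (z \<boxplus> ng C x)) M" using z x by simp
      then obtain y where y: "arr C y" "dm C y = dm C (z \<boxplus> ng C x)" "cd C y = N" "f \<bullet> y = z \<boxplus> ng C x"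
        using ses_lift[OF s, of "z \<boxplus> ng C x"] z x by auto
      have "x \<boxplus> f \<bullet> y = x \<boxplus> (ng C x \<boxplus> z)" using z x y(4) add_comm[of z "ng C x"] by simp
      also have "\<dots> = z" using z x add_assoc[of x "ng C x" z] by simp
      finally show "z \<in> ?R" using y z x by (intro image_eqI[of _ _ y]) simp_all
    qed
  qed
  have "inj_on (\<lambda>y. x \<boxplus> f \<bullet> y) (hom X N)"
  proof (rule inj_onI)
    fix y z assume yz: "y \<in> hom X N" "z \<in> hom X N" "x \<boxplus> f \<bullet> y = x \<boxplus> f \<bullet> z"
    have fe: "f \<bullet> y = f \<bullet> z" by (rule add_cancel[OF _ _ _ _ _ _ _ yz(3)]) (use x yz(1,2) in simp_all)
    show "y = z" by (rule monic_cancel[OF ses_arr(8)[OF s] _ _ _ _ _ fe]) (use yz(1,2) in simp_all)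
  qed
  then show ?thesis using fib by (simp add: card_image)
qed

lemma card_hom_middle:
  assumes s: "ses C N f K g M" and X: "X \<in> Obj C"
  shows "card (hom X K) = card ((\<lambda>x. g \<bullet> x) ` hom X K) * card (hom X N)"
proof (rule card_fibres)
  have "K \<in> Obj C" using cd_obj[of f] ses_arr[OF s] by simp
  then show "finite (hom X K)" using finite_Hom X by simp
qed (use card_hom_fibre[OF s] in auto)

lemma card_hom_middle':
  assumes s: "ses C N f K g M" and X: "X \<in> Obj C"
  shows "card (hom K X) = card ((\<lambda>x. x \<bullet> f) ` hom K X) * card (hom M X)"
  using finitary_abelian_category.card_hom_middle[OF op_finitary, of M g K f N X] assms by simp

lemma card_hom_pos: "A \<in> Obj C \<Longrightarrow> B \<in> Obj C \<Longrightarrow> card (hom A B) > 0"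
proof -
  assume o: "A \<in> Obj C" "B \<in> Obj C"
  then have "Null C A B \<in> hom A B" by simp
  then show ?thesis using finite_Hom[OF o] by (auto simp: card_gt_0_iff simp del: hom_iff)
qed

definition split_ses :: "'a \<Rightarrow> 'a \<Rightarrow> 'a \<Rightarrow> ('b \<times> 'b) set" where
  "split_ses N K M = {(f, g). ses C N f K g M \<and> (\<exists>j. arr C j \<and> dm C j = M \<and> cd C j = K \<and> g \<bullet> j = Ident C M)}"

text \<open>In a decomposition the projection p is determined by i, j and q. For a fixed split
  sequence (i, q), the sections j form a torsor under Hom(M,N).\<close>

lemma card_biproducts:
  assumes o: "N \<in> Obj C" "K \<in> Obj C" "M \<in> Obj C"
  shows "card {(i, j, p, q). is_biproduct C N M K i j p q} = card (split_ses N K M) * card (hom M N)"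
proof -
  let ?B = "{(i, j, p, q). is_biproduct C N M K i j p q}"
  let ?T = "{(i, j, q). ses C N i K q M \<and> arr C j \<and> dm C j = M \<and> cd C j = K \<and> q \<bullet> j = Ident C M}"
  have inj: "inj_on (\<lambda>(i, j, p, q). (i, j, q)) ?B"
  proof (rule inj_onI, clarsimp)
    fix i j p p' q assume b: "is_biproduct C N M K i j p q" and b': "is_biproduct C N M K i j p' q"
    note [simp] = biproduct_facts(1-16,18-20)[OF b] biproduct_facts(1-16,18-20)[OF b']
    have e: "j \<bullet> q \<boxplus> i \<bullet> p = j \<bullet> q \<boxplus> i \<bullet> p'"
      using biproduct_facts(17)[OF b] biproduct_facts(17)[OF b'] add_comm[of "j \<bullet> q" "i \<bullet> p"] add_comm[of "j \<bullet> q" "i \<bullet> p'"]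
      by simp
    have e2: "i \<bullet> p = i \<bullet> p'" by (rule add_cancel[OF _ _ _ _ _ _ _ e]) simp_all
    show "p = p'"
      by (rule monic_cancel[OF ses_arr(8)[OF biproduct_ses[OF b]] _ _ _ _ _ e2]) simp_all
  qed
  have im: "(\<lambda>(i, j, p, q). (i, j, q)) ` ?B = ?T"
  proof
    show "(\<lambda>(i, j, p, q). (i, j, q)) ` ?B \<subseteq> ?T"
    proof (clarsimp, intro conjI)
      fix i j p q assume b: "is_biproduct C N M K i j p q"
      show "ses C N i K q M" "arr C j" "dm C j = M" "cd C j = K" "q \<bullet> j = Ident C M"
        using biproduct_ses[OF b] biproduct_facts[OF b] by simp_all
    qed
    show "?T \<subseteq> (\<lambda>(i, j, p, q). (i, j, q)) ` ?B"
    proof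
      fix x assume "x \<in> ?T"
      then obtain i j q where x: "x = (i, j, q)" and s: "ses C N i K q M"
        and j: "arr C j" "dm C j = M" "cd C j = K" "q \<bullet> j = Ident C M" by blast
      obtain r where "is_biproduct C N M K i j r q" using section_biproduct[OF s j] by auto
      then show "x \<in> (\<lambda>(i, j, p, q). (i, j, q)) ` ?B" unfolding x by (intro image_eqI[of _ _ "(i, j, r, q)"]) auto
    qed
  qed
  have finT: "finite ?T"
  proof (rule finite_subset)
    show "?T \<subseteq> hom N K \<times> hom M K \<times> hom K M" using ses_arr by auto
    show "finite (hom N K \<times> hom M K \<times> hom K M)" using finite_Hom o by simp
  qed
  have "card ?T = card ((\<lambda>(i, j, q). (i, q)) ` ?T) * card (hom M N)"
  proof (rule card_fibres[OF finT])
    fix x assume "x \<in> ?T"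
    then obtain i j q where x: "x = (i, j, q)" and s: "ses C N i K q M"
      and j: "arr C j" "dm C j = M" "cd C j = K" "q \<bullet> j = Ident C M" by blast
    have "{z \<in> ?T. (case z of (i, j, q) \<Rightarrow> (i, q)) = (case x of (i, j, q) \<Rightarrow> (i, q))}
        = (\<lambda>j. (i, j, q)) ` {j' \<in> hom M K. q \<bullet> j' = Ident C M}"
      unfolding x using s by auto
    also have "{j' \<in> hom M K. q \<bullet> j' = Ident C M} = {z \<in> hom M K. q \<bullet> z = q \<bullet> j}" using j by simp
    finally have e: "{z \<in> ?T. (case z of (i, j, q) \<Rightarrow> (i, q)) = (case x of (i, j, q) \<Rightarrow> (i, q))}
        = (\<lambda>j. (i, j, q)) ` {z \<in> hom M K. q \<bullet> z = q \<bullet> j}" .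
    have "card {z \<in> ?T. (case z of (i, j, q) \<Rightarrow> (i, q)) = (case x of (i, j, q) \<Rightarrow> (i, q))} = card {z \<in> hom M K. q \<bullet> z = q \<bullet> j}"
      unfolding e by (rule card_image) (auto simp: inj_on_def)
    also have "\<dots> = card (hom M N)" using card_hom_fibre[OF s, of j] j by simp
    finally show "card {z \<in> ?T. (case z of (i, j, q) \<Rightarrow> (i, q)) = (case x of (i, j, q) \<Rightarrow> (i, q))} = card (hom M N)" .
  qed
  moreover have "(\<lambda>(i, j, q). (i, q)) ` ?T = split_ses N K M" by (fastforce simp: split_ses_def image_iff)
  moreover have "card ?B = card ?T" using card_image[OF inj] im by simp
  ultimately show ?thesis by simp
qed

lemma card_biproducts_swap:
  "card {(i, j, p, q). is_biproduct C A B K i j p q} = card {(i, j, p, q). is_biproduct C B A K i j p q}"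
proof (rule bij_betw_same_card)
  show "bij_betw (\<lambda>(i, j, p, q). (j, i, q, p)) {(i, j, p, q). is_biproduct C A B K i j p q} {(i, j, p, q). is_biproduct C B A K i j p q}"
    by (rule bij_betw_byWitness[where f' = "\<lambda>(i, j, p, q). (j, i, q, p)"]) (auto dest: is_biproduct_swap)
qed

text \<open>Both sides count the decompositions \<open>K = M \<oplus> N\<close>.\<close>

lemma card_split_ses_symmetric:
  assumes "N \<in> Obj C" "K \<in> Obj C" "M \<in> Obj C"
  shows "card (split_ses N K M) * card (hom M N) = card (split_ses M K N) * card (hom N M)"
  using card_biproducts[of N K M] card_biproducts[of M K N] card_biproducts_swap[of N M K] assms by simp

lemma split_ses_nonempty_swap:
  assumes "(f, g) \<in> split_ses N K M"
  shows "split_ses M K N \<noteq> {}"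
proof -
  obtain j where s: "ses C N f K g M" and j: "arr C j" "dm C j = M" "cd C j = K" "g \<bullet> j = Ident C M"
    using assms by (auto simp: split_ses_def)
  obtain r where b: "is_biproduct C N M K f j r g" using section_biproduct[OF s j] .
  from biproduct_ses[OF is_biproduct_swap[OF b]] biproduct_facts[OF b]
  have "(j, r) \<in> split_ses M K N" by (auto simp: split_ses_def)
  then show ?thesis by auto
qed

end

section \<open>Exceptional objects\<close>

locale exceptional_object = finitary_abelian_category C for C :: "('o, 'm) category" +
  fixes E :: 'o
  assumes E_obj [simp]: "E \<in> Obj C"
    and E_rigid: "Ext1_vanishes C E E"
    and E_nonzero: "Ident C E \<noteq> Null C E E"
    and E_division: "\<lbrakk>arr C u; dm C u = E; cd C u = E; u \<noteq> Null C E E\<rbrakk> \<Longrightarrow> is_iso C E E u"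
begin

lemma op_exceptional: "exceptional_object (op_cat C) E"
proof -
  interpret op: finitary_abelian_category "op_cat C" by (rule op_finitary)
  show ?thesis
    by unfold_locales (use E_rigid op_Ext1_vanishes[of E E] E_nonzero E_division in simp_all)
qed

abbreviation q where "q \<equiv> q_obj C E"

section \<open>Hom groups into and out of the exceptional object\<close>

lemma q_ge_2: "q \<ge> 2"
proof -
  have "card {Ident C E, Null C E E} \<le> card (hom E E)"
    by (rule card_mono) (use finite_Hom[of E E] in auto)
  then show ?thesis using E_nonzero by (simp add: q_obj_def)
qed

text \<open>Hom(A,E) is a vector space over the division ring End E, acting by composition. The
  induction enlarges a subspace W by a vector v outside it, which multiplies the order by q, until W
  is everything.\<close>

lemma card_hom_power:
  assumes A: "A \<in> Obj C"
  shows "\<exists>n. card (hom A E) = q ^ n"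
proof -
  define sub where "sub W \<longleftrightarrow> W \<subseteq> hom A E \<and> Null C A E \<in> W \<and> (\<forall>x\<in>W. \<forall>y\<in>W. x \<boxplus> y \<in> W) \<and>
    (\<forall>u\<in>hom E E. \<forall>x\<in>W. u \<bullet> x \<in> W)" for W
  have fin: "finite (hom A E)" using finite_Hom A by simp
  have "\<exists>n. card (hom A E) = q ^ n * card W" if "sub W" for W
    using that
  proof (induction "card (hom A E) - card W" arbitrary: W rule: less_induct)
    case less
    show ?case
    proof (cases "W = hom A E")
      case True
      then show ?thesis by (intro exI[of _ 0]) simp
    next
      case False
      then obtain v where "v \<in> hom A E" "v \<notin> W"
        using less.prems unfolding sub_def by blast
      then have v: "arr C v" "dm C v = A" "cd C v = E" "v \<notin> W" by auto
      note [simp] = v(1-3) A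
      have Wc: "arr C w \<and> dm C w = A \<and> cd C w = E" if "w \<in> W" for w
        using that less.prems unfolding sub_def by auto
      have ng: "ng C w \<in> W" if "w \<in> W" for w
      proof -
        have "ng C (Ident C E) \<bullet> w = ng C w" using Wc[OF that] by simp
        moreover have "ng C (Ident C E) \<in> hom E E" by simp
        ultimately show ?thesis using less.prems that unfolding sub_def by metis
      qed
      define \<psi> where "\<psi> = (\<lambda>(w, u). w \<boxplus> u \<bullet> v)"
      have inj: "inj_on \<psi> (W \<times> hom E E)"
      proof (rule inj_onI, clarify)
        fix w u w' u' assume w: "w \<in> W" "w' \<in> W" and u: "u \<in> hom E E" "u' \<in> hom E E" and eq: "\<psi> (w, u) = \<psi> (w', u')"
        note [simp] = Wc[OF w(1)] Wc[OF w(2)]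
        have u' [simp]: "arr C u" "dm C u = E" "cd C u = E" "arr C u'" "dm C u' = E" "cd C u' = E" using u by auto
        have e: "w \<boxplus> u \<bullet> v = w' \<boxplus> u' \<bullet> v" using eq by (simp add: \<psi>_def)
        define d where "d = u \<boxplus> ng C u'"
        have d [simp]: "arr C d" "dm C d = E" "cd C d = E" by (simp_all add: d_def)
        have "w \<boxplus> d \<bullet> v = w \<boxplus> (u \<bullet> v \<boxplus> ng C (u' \<bullet> v))" by (simp add: d_def)
        also have "\<dots> = (w \<boxplus> u \<bullet> v) \<boxplus> ng C (u' \<bullet> v)" by (subst add_assoc) simp_all
        also have "\<dots> = (w' \<boxplus> u' \<bullet> v) \<boxplus> ng C (u' \<bullet> v)" by (simp only: e)
        also have "\<dots> = w'" by (subst add_assoc) simp_all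
        finally have wd: "w \<boxplus> d \<bullet> v = w'" .
        have "ng C w \<boxplus> (w \<boxplus> d \<bullet> v) = d \<bullet> v" by (subst add_assoc[symmetric]) simp_all
        then have dv: "d \<bullet> v = ng C w \<boxplus> w'" using wd by simp
        then have dvW: "d \<bullet> v \<in> W" using ng[OF w(1)] w(2) less.prems unfolding sub_def by auto
        \<comment> \<open>Otherwise d is invertible, and d v in W would put v itself into the stable
          subgroup W.\<close>
        have "d = Null C E E"
        proof (rule ccontr)
          assume "d \<noteq> Null C E E"
          then obtain k where k: "is_iso C E E k" "k \<bullet> d = Ident C E" using is_isoD(6)[OF E_division[OF d]] by auto
          have "k \<bullet> d \<bullet> v = v" using reassoc[OF k(2), of v] is_isoD(1-3)[OF k(1)] by simp
          moreover have "k \<bullet> d \<bullet> v \<in> W" using dvW is_isoD(1-3)[OF k(1)] less.prems unfolding sub_def by auto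
          ultimately show False using v(4) by simp
        qed
        then have uu: "u \<boxplus> ng C u' = Null C (dm C u') (cd C u')" by (simp add: d_def)
        have "u = u'" by (rule diff_eq_null[OF _ _ _ _ uu]) simp_all
        moreover have "w = w'" using wd \<open>d = Null C E E\<close> by simp
        ultimately show "w = w' \<and> u = u'" by simp
      qed
      define W' where "W' = \<psi> ` (W \<times> hom E E)"
      have cW': "card W' = q * card W"
        unfolding W'_def card_image[OF inj] by (simp add: card_cartesian_product q_obj_def)
      have mem: "w \<boxplus> u \<bullet> v \<in> W'" if "w \<in> W" "u \<in> hom E E" for w u
        unfolding W'_def \<psi>_def using that by (intro image_eqI[of _ _ "(w, u)"]) auto
      have N: "Null C A E \<in> W" using less.prems unfolding sub_def by auto
      have sub': "sub W'"
        unfolding sub_def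
      proof (intro conjI ballI)
        show "W' \<subseteq> hom A E" using Wc by (auto simp: W'_def \<psi>_def)
        show "Null C A E \<in> W'" using mem[OF N, of "Null C E E"] by simp
        fix x assume "x \<in> W'"
        then obtain w u where x: "x = w \<boxplus> u \<bullet> v" "w \<in> W" "u \<in> hom E E" by (auto simp: W'_def \<psi>_def)
        note xs [simp] = Wc[OF x(2)] x(3)[unfolded hom_iff]
        { fix y assume "y \<in> W'"
          then obtain w' u' where y: "y = w' \<boxplus> u' \<bullet> v" "w' \<in> W" "u' \<in> hom E E" by (auto simp: W'_def \<psi>_def)
          note [simp] = Wc[OF y(2)] y(3)[unfolded hom_iff]
          have "x \<boxplus> y = w \<boxplus> (u \<bullet> v \<boxplus> (w' \<boxplus> u' \<bullet> v))" unfolding x y by (subst add_assoc) simp_all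
          also have "u \<bullet> v \<boxplus> (w' \<boxplus> u' \<bullet> v) = (u \<bullet> v \<boxplus> w') \<boxplus> u' \<bullet> v" by (subst add_assoc) simp_all
          also have "u \<bullet> v \<boxplus> w' = w' \<boxplus> u \<bullet> v" by (rule add_comm) simp_all
          also have "(w' \<boxplus> u \<bullet> v) \<boxplus> u' \<bullet> v = w' \<boxplus> (u \<boxplus> u') \<bullet> v" by (subst add_assoc) simp_all
          also have "w \<boxplus> (w' \<boxplus> (u \<boxplus> u') \<bullet> v) = (w \<boxplus> w') \<boxplus> (u \<boxplus> u') \<bullet> v" by (subst add_assoc) simp_all
          finally show "x \<boxplus> y \<in> W'"
            using mem[of "w \<boxplus> w'" "u \<boxplus> u'"] x(2) y(2) less.prems unfolding sub_def by simp }
        fix s assume s: "s \<in> hom E E"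
        note [simp] = s[unfolded hom_iff]
        have "s \<bullet> x = s \<bullet> w \<boxplus> (s \<bullet> u) \<bullet> v" unfolding x by simp
        moreover have "s \<bullet> w \<in> W" using less.prems s x(2) unfolding sub_def by blast
        ultimately show "s \<bullet> x \<in> W'" using mem[of "s \<bullet> w" "s \<bullet> u"] by simp
      qed
      have "0 < card W" using N less.prems fin unfolding sub_def by (metis card_gt_0_iff empty_iff finite_subset)
      then have lt: "card W < card W'" using cW' q_ge_2 by simp
      have "card W' \<le> card (hom A E)" using sub' fin unfolding sub_def by (intro card_mono) auto
      then have "card (hom A E) - card W' < card (hom A E) - card W" using lt by linarith
      from less.hyps[OF this sub'] obtain n where "card (hom A E) = q ^ n * card W'" by blast
      then show ?thesis unfolding cW' by (intro exI[of _ "Suc n"]) simp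
    qed
  qed
  moreover have "sub {Null C A E}" using A by (simp add: sub_def)
  ultimately obtain n where "card (hom A E) = q ^ n * card {Null C A E}" by blast
  then show ?thesis by auto
qed

lemma card_hom_power':
  assumes "A \<in> Obj C"
  shows "\<exists>n. card (hom E A) = q ^ n"
  using exceptional_object.card_hom_power[OF op_exceptional, of A] assms by (simp add: q_obj_def)

text \<open>Restriction from Hom(K,E) to Hom(M,E) is onto because Ext^1(E,E) = 0, and its kernel is
  a copy of End E, of order q.\<close>

lemma card_hom_to_E:
  assumes s: "ses C M f K g E"
  shows "card (hom K E) = q * card (hom M E)"
proof -
  note [simp] = ses_arr(1-7)[OF s]
  have "(\<lambda>x. x \<bullet> f) ` hom K E = hom M E"
  proof
    show "hom M E \<subseteq> (\<lambda>x. x \<bullet> f) ` hom K E"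
    proof
      fix u assume "u \<in> hom M E"
      then have u: "arr C u" "dm C u = M" "cd C u = E" by auto
      obtain w where "arr C w" "dm C w = K" "cd C w = E" "w \<bullet> f = u" using Ext1_vanishes_extend[OF E_rigid s u] .
      then show "u \<in> (\<lambda>x. x \<bullet> f) ` hom K E" by auto
    qed
  qed auto
  then show ?thesis using card_hom_middle'[OF s E_obj] by (simp add: q_obj_def)
qed

lemma card_hom_from_E:
  assumes s: "ses C E f K g M"
  shows "card (hom E K) = q * card (hom E M)"
  using exceptional_object.card_hom_to_E[OF op_exceptional, of M g K f] s by (simp add: q_obj_def)

text \<open>A section makes composition with g surjective onto End E. Together with
  \<open>card_hom_nonsplit\<close>, the order of Hom(E,K) detects whether a sequence M \<rightarrow>
  K \<rightarrow> E splits.\<close>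

lemma card_hom_split:
  assumes "(f, g) \<in> split_ses M K E"
  shows "card (hom E K) = q * card (hom E M)"
proof -
  obtain j where s: "ses C M f K g E" and j: "arr C j" "dm C j = E" "cd C j = K" "g \<bullet> j = Ident C E"
    using assms by (auto simp: split_ses_def)
  note [simp] = ses_arr(1-7)[OF s] j(1-3)
  have "(\<lambda>x. g \<bullet> x) ` hom E K = hom E E"
  proof
    show "hom E E \<subseteq> (\<lambda>x. g \<bullet> x) ` hom E K"
    proof
      fix u assume u: "u \<in> hom E E"
      then have "g \<bullet> (j \<bullet> u) = u" using reassoc[OF j(4), of u] by simp
      then show "u \<in> (\<lambda>x. g \<bullet> x) ` hom E K" using u by (intro image_eqI[of _ _ "j \<bullet> u"]) auto
    qed
  qed auto
  then show ?thesis using card_hom_middle[OF s E_obj] by (simp add: q_obj_def)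
qed

text \<open>If some arrow from E to K had a nonzero composite with g, that composite would be
  invertible in End E and a section would result. So every arrow from E to K factors through
  M.\<close>

lemma card_hom_nonsplit:
  assumes s: "ses C M f K g E" and ns: "(f, g) \<notin> split_ses M K E"
  shows "card (hom E K) = card (hom E M)"
proof -
  note [simp] = ses_arr(1-7)[OF s]
  have Ko [simp]: "K \<in> Obj C" using cd_obj[of f] by simp
  have 0: "g \<bullet> x = Null C E E" if x: "arr C x" "dm C x = E" "cd C x = K" for x
  proof (rule ccontr)
    assume "g \<bullet> x \<noteq> Null C E E"
    then obtain k where k: "is_iso C E E k" "(g \<bullet> x) \<bullet> k = Ident C E"
      using is_isoD(6)[OF E_division[of "g \<bullet> x"]] x by auto
    note [simp] = is_isoD(1-3)[OF k(1)] x
    have "(f, g) \<in> split_ses M K E" unfolding split_ses_def using s k(2) by (auto intro!: exI[of _ "x \<bullet> k"])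
    with ns show False by simp
  qed
  have "(\<lambda>x. g \<bullet> x) ` hom E K = (\<lambda>x. Null C E E) ` hom E K" by (rule image_cong) (use 0 in auto)
  moreover have "Null C E K \<in> hom E K" by simp
  ultimately have "(\<lambda>x. g \<bullet> x) ` hom E K = {Null C E E}" by (metis image_constant)
  then show ?thesis using card_hom_middle[OF s E_obj] by simp
qed

text \<open>A morphism of extensions over \<open>E\<close> which restricts to \<open>i\<close> exhibits its target as the pushout along \<open>i\<close>.\<close>

lemma pushed_extension_unique:
  assumes i: "arr C i" "dm C i = M" "cd C i = K"
    and s: "ses C M f J g E" and s1: "ses C K f1 J1 g1 E" and s2: "ses C K f2 J2 g2 E"
    and m1: "arr C m1" "dm C m1 = J" "cd C m1 = J1" "m1 \<bullet> f = f1 \<bullet> i" "g1 \<bullet> m1 = g"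
    and m2: "arr C m2" "dm C m2 = J" "cd C m2 = J2" "m2 \<bullet> f = f2 \<bullet> i" "g2 \<bullet> m2 = g"
  shows "((J1, f1, g1), (J2, f2, g2)) \<in> extension_equiv C E K"
proof -
  note [simp] = i ses_arr(1-7)[OF s] ses_arr(1-7)[OF s1] ses_arr(1-7)[OF s2] m1(1-3) m2(1-3)
  have o [simp]: "M \<in> Obj C" "K \<in> Obj C" "J \<in> Obj C" "J1 \<in> Obj C" "J2 \<in> Obj C"
    using dm_obj[of f] cd_obj[of f] cd_obj[of f1] cd_obj[of f2] cd_obj[of i] by simp_all
  obtain S a b p r where bp: "is_biproduct C J K S a b p r" using biproduct_exists[of J K] by auto
  note [simp] = biproduct_facts(1-16,18-20)[OF bp] biproduct_comp[OF bp]
  \<comment> \<open>The epimorphism (m1, f1) from J \<oplus> K presents J1 as a quotient. The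
    comparison with J2 is obtained by showing that (m2, f2) vanishes on its kernel.\<close>
  define e where "e = m1 \<bullet> p \<boxplus> f1 \<bullet> r"
  have e [simp]: "arr C e" "dm C e = S" "cd C e = J1" by (simp_all add: e_def)
  have ea: "e \<bullet> a = m1" and eb: "e \<bullet> b = f1" by (simp_all add: e_def)
  have epi: "epic C e"
    unfolding epic_def
  proof (intro conjI allI impI)
    fix w assume w: "arr C w \<and> dm C w = cd C e \<and> w \<bullet> e = Null C (dm C e) (cd C w)"
    then have w' [simp]: "arr C w" "dm C w = J1" "cd C w \<in> Obj C" by auto
    have "w \<bullet> f1 = (w \<bullet> e) \<bullet> b" using eb by simp
    then have "w \<bullet> f1 = Null C K (cd C w)" using w by simp
    then obtain y where y: "arr C y" "dm C y = E" "cd C y = cd C w" "y \<bullet> g1 = w" using ses_desc[OF s1, of w] by auto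
    have "w \<bullet> m1 = (w \<bullet> e) \<bullet> a" using ea by simp
    then have "w \<bullet> m1 = Null C J (cd C w)" using w by simp
    moreover have "w \<bullet> m1 = y \<bullet> g" using y(1-3) m1(5) unfolding y(4)[symmetric] by simp
    ultimately have yg: "y \<bullet> g = Null C J (cd C w)" by simp
    have "y = Null C E (cd C w)" by (rule epic_null[OF ses_arr(9)[OF s]]) (use y(1-3) yg in simp_all)
    then have "y \<bullet> g1 = Null C J1 (cd C w)" by simp
    then show "w = Null C (cd C e) (cd C w)" using y(4) by simp
  qed simp
  obtain U u where su: "ses C U u S e J1" using ses_kernel[OF epi] by auto
  note [simp] = ses_arr(1-6)[OF su]
  have Uo [simp]: "U \<in> Obj C" using dm_obj[of u] by simp
  define e2 where "e2 = m2 \<bullet> p \<boxplus> f2 \<bullet> r"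
  have e2 [simp]: "arr C e2" "dm C e2 = S" "cd C e2 = J2" by (simp_all add: e2_def)
  define x where "x = p \<bullet> u"
  define y where "y = r \<bullet> u"
  have xy [simp]: "arr C x" "dm C x = U" "cd C x = J" "arr C y" "dm C y = U" "cd C y = K" by (simp_all add: x_def y_def)
  have "e \<bullet> u = m1 \<bullet> x \<boxplus> f1 \<bullet> y" by (simp add: e_def x_def y_def)
  then have eu: "m1 \<bullet> x \<boxplus> f1 \<bullet> y = Null C U J1" using ses_arr(7)[OF su] by simp
  have "g1 \<bullet> (m1 \<bullet> x \<boxplus> f1 \<bullet> y) = g \<bullet> x"
    using reassoc[OF m1(5), of x] reassoc[OF ses_arr(7)[OF s1], of y] by simp
  \<comment> \<open>A kernel element (x, y) has the form (f z, y) with i z + y = 0, and (m2, f2)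
    maps it to f2 (i z + y).\<close>
  then have "g \<bullet> x = Null C (dm C x) E" unfolding eu by simp
  then obtain z where z: "arr C z" "dm C z = U" "cd C z = M" "f \<bullet> z = x" using ses_lift[OF s, of x] by auto
  note [simp] = z(1-3)
  have "f1 \<bullet> (i \<bullet> z \<boxplus> y) = m1 \<bullet> x \<boxplus> f1 \<bullet> y"
    using reassoc[OF m1(4), of z] unfolding z(4)[symmetric] by simp
  then have fz: "f1 \<bullet> (i \<bullet> z \<boxplus> y) = Null C U J1" unfolding eu .
  have iz: "i \<bullet> z \<boxplus> y = Null C U K" by (rule monic_null[OF ses_arr(8)[OF s1]]) (use fz in simp_all)
  have "e2 \<bullet> u = m2 \<bullet> x \<boxplus> f2 \<bullet> y" by (simp add: e2_def x_def y_def)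
  also have "\<dots> = f2 \<bullet> (i \<bullet> z \<boxplus> y)"
    using reassoc[OF m2(4), of z] unfolding z(4)[symmetric] by simp
  also have "\<dots> = Null C U J2" unfolding iz by simp
  finally obtain h where h: "arr C h" "dm C h = J1" "cd C h = J2" "h \<bullet> e = e2"
    using ses_desc[OF su, of e2] by auto
  note [simp] = h(1-3)
  have "h \<bullet> f1 = (h \<bullet> e) \<bullet> b" using eb by simp
  then have hf: "h \<bullet> f1 = f2" unfolding h(4) by (simp add: e2_def)
  have "h \<bullet> m1 = (h \<bullet> e) \<bullet> a" using ea by simp
  then have hm: "h \<bullet> m1 = m2" unfolding h(4) by (simp add: e2_def)
  have ge: "(g2 \<bullet> h) \<bullet> e = g1 \<bullet> e"
    using hf hm m1(5) m2(5) reassoc[OF hf] reassoc[OF hm] reassoc[OF m1(5)] reassoc[OF m2(5)]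
      reassoc[OF ses_arr(7)[OF s1]] reassoc[OF ses_arr(7)[OF s2]] by (simp add: e_def)
  have "g2 \<bullet> h = g1" by (rule epic_cancel[OF epi _ _ _ _ _ ge]) simp_all
  then show ?thesis unfolding extension_equiv_iff using s1 s2 hf by (auto intro!: exI[of _ h])
qed

text \<open>Every extension of E by K is pushed forward along i from one of E by M, since the
  obstruction lies in Ext^1(E,E) = 0. Concretely, p extends from K to an arrow r on J, and the
  kernel of r is the extension sought.\<close>

lemma pushed_extension_exists:
  assumes s: "ses C M i K p E" and t: "ses C K f J g E"
  obtains J' f' g' m where "ses C M f' J' g' E" "arr C m" "dm C m = J'" "cd C m = J" "m \<bullet> f' = f \<bullet> i" "g \<bullet> m = g'"
proof -
  note [simp] = ses_arr(1-7)[OF s] ses_arr(1-7)[OF t]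
  have o [simp]: "M \<in> Obj C" "K \<in> Obj C" "J \<in> Obj C"
    using dm_obj[of i] cd_obj[of i] cd_obj[of f] by simp_all
  obtain r where r: "arr C r" "dm C r = J" "cd C r = E" "r \<bullet> f = p"
    using Ext1_vanishes_extend[OF E_rigid t, of p] by auto
  note [simp] = r(1-3)
  have "epic C (r \<bullet> f)" using r(4) ses_arr(9)[OF s] by simp
  then have er: "epic C r" by (rule epic_right) simp_all
  obtain J' m where sm: "ses C J' m J r E" using ses_kernel[OF er] by auto
  note [simp] = ses_arr(1-7)[OF sm]
  have Jo [simp]: "J' \<in> Obj C" using dm_obj[of m] by simp
  have "r \<bullet> f \<bullet> i = Null C M E" using reassoc[OF r(4), of i] by simp
  then obtain f' where f': "arr C f'" "dm C f' = M" "cd C f' = J'" "m \<bullet> f' = f \<bullet> i"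
    using ses_lift[OF sm, of "f \<bullet> i"] by auto
  note [simp] = f'(1-3)
  have "monic C (f \<bullet> i)" by (rule monic_comp) (use ses_arr(8)[OF s] ses_arr(8)[OF t] in simp_all)
  then have "monic C (m \<bullet> f')" using f'(4) by simp
  then have mf: "monic C f'" by (rule monic_left) simp_all
  have eg: "epic C (g \<bullet> m)"
    unfolding epic_def
  proof (intro conjI allI impI)
    fix w assume w0: "arr C w \<and> dm C w = cd C (g \<bullet> m) \<and> w \<bullet> g \<bullet> m = Null C (dm C (g \<bullet> m)) (cd C w)"
    then have w [simp]: "arr C w" "dm C w = E" "cd C w \<in> Obj C" by auto
    have "(w \<bullet> g) \<bullet> m = Null C J' (cd C (w \<bullet> g))" using w0 by simp
    then obtain w' where w': "arr C w'" "dm C w' = E" "cd C w' = cd C w" "w' \<bullet> r = w \<bullet> g"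
      using ses_desc[OF sm, of "w \<bullet> g"] by auto
    have "w' \<bullet> p = (w' \<bullet> r) \<bullet> f" using r(4) w'(1-3) by simp
    then have wp: "w' \<bullet> p = Null C K (cd C w)" unfolding w'(4) by simp
    have "w' = Null C E (cd C w)" by (rule epic_null[OF ses_arr(9)[OF s]]) (use w'(1-3) wp in simp_all)
    then have wg: "w \<bullet> g = Null C J (cd C w)" using w'(4) by simp
    show "w = Null C (cd C (g \<bullet> m)) (cd C w)" by (rule epic_null[OF ses_arr(9)[OF t]]) (use wg in simp_all)
  qed simp
  have "ses C M f' J' (g \<bullet> m) E"
  proof (rule sesI)
    show "(g \<bullet> m) \<bullet> f' = Null C M E" using f'(4) reassoc[OF ses_arr(7)[OF t], of i] by simp
    fix x assume x: "arr C x" "cd C x = J'" "(g \<bullet> m) \<bullet> x = Null C (dm C x) E"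
    then obtain y where y: "arr C y" "dm C y = dm C x" "cd C y = K" "f \<bullet> y = m \<bullet> x"
      using ses_lift[OF t, of "m \<bullet> x"] by auto
    have "p \<bullet> y = r \<bullet> f \<bullet> y" using reassoc[OF r(4), of y] y(1-3) by simp
    then have "p \<bullet> y = Null C (dm C y) E"
      unfolding y(4) using reassoc[OF ses_arr(7)[OF sm], of x] x(1,2) y(2) by simp
    then obtain z where z: "arr C z" "dm C z = dm C y" "cd C z = M" "i \<bullet> z = y"
      using ses_lift[OF s, of y] y by auto
    have mz: "m \<bullet> f' \<bullet> z = m \<bullet> x" using reassoc[OF f'(4), of z] z y(4) by simp
    have "f' \<bullet> z = x" by (rule monic_cancel[OF ses_arr(8)[OF sm]]) (use mz x(1,2) z(1-3) y(2) in simp_all)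
    then show "\<exists>y. arr C y \<and> dm C y = dm C x \<and> cd C y = M \<and> f' \<bullet> y = x" using z y by auto
  qed (use mf eg in simp_all)
  then show ?thesis using that[of f' J' "g \<bullet> m" m] f'(4) by simp
qed

text \<open>Pushing forward along i maps Ext^1(E,M) onto Ext^1(E,K), but not injectively: the class
  of the given nonsplit extension and the split class both become split.\<close>

lemma card_Ext1_nonsplit:
  assumes s: "ses C M i K p E" and ns: "(i, p) \<notin> split_ses M K E"
  shows "card (Ext1 C E K) < card (Ext1 C E M)"
proof -
  note [simp] = ses_arr(1-7)[OF s]
  have o [simp]: "M \<in> Obj C" "K \<in> Obj C"
    using dm_obj[of i] cd_obj[of i] by simp_all
  \<comment> \<open>This is the graph of the pushforward along i. As a relation it needs no choice
    of representatives before totality on the right (\<open>ex\<close>) and functionality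
    (\<open>uniq\<close>) are known.\<close>
  define rel where "rel d c \<longleftrightarrow> (\<exists>J' f' g' J f g m. d = extension_equiv C E M `` {(J', f', g')} \<and>
    c = extension_equiv C E K `` {(J, f, g)} \<and> ses C M f' J' g' E \<and> ses C K f J g E \<and>
    arr C m \<and> dm C m = J' \<and> cd C m = J \<and> m \<bullet> f' = f \<bullet> i \<and> g \<bullet> m = g')" for d c
  have ex: "\<exists>d\<in>Ext1 C E M. rel d c" if "c \<in> Ext1 C E K" for c
  proof -
    obtain J f g where c: "ses C K f J g E" "c = extension_equiv C E K `` {(J, f, g)}"
      using \<open>c \<in> Ext1 C E K\<close> unfolding Ext1_def by (elim quotientE) (auto simp: extensions_iff_ses)
    obtain J' f' g' m where m: "ses C M f' J' g' E" "arr C m" "dm C m = J'" "cd C m = J" "m \<bullet> f' = f \<bullet> i" "g \<bullet> m = g'"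
      using pushed_extension_exists[OF s c(1)] .
    have "extension_equiv C E M `` {(J', f', g')} \<in> Ext1 C E M"
      unfolding Ext1_def by (rule quotientI) (simp add: extensions_iff_ses m(1))
    moreover have "rel (extension_equiv C E M `` {(J', f', g')}) c" unfolding rel_def using c m by blast
    ultimately show ?thesis by blast
  qed
  have uniq: "c1 = c2" if r: "rel d c1" "rel d c2" for d c1 c2
  proof -
    obtain J' f' g' J1 f1 g1 m1 where 1: "d = extension_equiv C E M `` {(J', f', g')}"
      "c1 = extension_equiv C E K `` {(J1, f1, g1)}" "ses C M f' J' g' E" "ses C K f1 J1 g1 E"
      "arr C m1" "dm C m1 = J'" "cd C m1 = J1" "m1 \<bullet> f' = f1 \<bullet> i" "g1 \<bullet> m1 = g'"
      using r(1) unfolding rel_def by blast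
    obtain J'' f'' g'' J2 f2 g2 m2 where 2: "d = extension_equiv C E M `` {(J'', f'', g'')}"
      "c2 = extension_equiv C E K `` {(J2, f2, g2)}" "ses C M f'' J'' g'' E" "ses C K f2 J2 g2 E"
      "arr C m2" "dm C m2 = J''" "cd C m2 = J2" "m2 \<bullet> f'' = f2 \<bullet> i" "g2 \<bullet> m2 = g''"
      using r(2) unfolding rel_def by blast
    have "((J', f', g'), (J'', f'', g'')) \<in> extension_equiv C E M"
      using 1(1,3) 2(1,3) by (subst equiv_class_eq_iff[OF equiv_extension_equiv]) (auto simp: extensions_iff_ses)
    then obtain h where h: "arr C h" "dm C h = J'" "cd C h = J''" "h \<bullet> f' = f''" "g'' \<bullet> h = g'"
      by (auto simp: extension_equiv_iff)
    note a = ses_arr(1-6)[OF 1(3)] ses_arr(1-6)[OF 2(3)] ses_arr(1-6)[OF 1(4)] ses_arr(1-6)[OF 2(4)]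
    have 3: "(m2 \<bullet> h) \<bullet> f' = f2 \<bullet> i" using h 2(5-8) a by simp
    have 4: "g2 \<bullet> m2 \<bullet> h = g'" using reassoc[OF 2(9), of h] h 2(5-7) a by simp
    have "((J1, f1, g1), (J2, f2, g2)) \<in> extension_equiv C E K"
      by (rule pushed_extension_unique[OF _ _ _ 1(3,4) 2(4) 1(5-9) _ _ _ 3 4]) (use h 2 in simp_all)
    then show ?thesis unfolding 1 2 using equiv_class_eq[OF equiv_extension_equiv] by blast
  qed
  obtain S a b \<pi> \<rho> where bK: "is_biproduct C K E S a b \<pi> \<rho>" using biproduct_exists[of K E] by auto
  obtain S' a' b' \<pi>' \<rho>' where bM: "is_biproduct C M E S' a' b' \<pi>' \<rho>'" using biproduct_exists[of M E] by auto
  note [simp] = biproduct_facts(1-16,18-20)[OF bK] biproduct_comp[OF bK] biproduct_facts(1-16,18-20)[OF bM] biproduct_comp[OF bM]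
  note sK = biproduct_ses[OF bK] and sM = biproduct_ses[OF bM]
  define d0 where "d0 = extension_equiv C E M `` {(K, i, p)}"
  define d1 where "d1 = extension_equiv C E M `` {(S', a', \<rho>')}"
  define c0 where "c0 = extension_equiv C E K `` {(S, a, \<rho>)}"
  have "a \<bullet> Ident C K \<boxplus> b \<bullet> p = a \<boxplus> b \<bullet> p" by simp
  \<comment> \<open>The arrow (1, p) from K to K \<oplus> E shows that the extension becomes split
    when pushed out along its own i.\<close>
  have r0: "rel d0 c0"
    unfolding rel_def d0_def c0_def using s sK by (intro exI[of _ K] exI[of _ i] exI[of _ p] exI[of _ S] exI[of _ a] exI[of _ \<rho>] exI[of _ "a \<boxplus> b \<bullet> p"]) simp
  have r1: "rel d1 c0"
    unfolding rel_def d1_def c0_def using sM sK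
    by (intro exI[of _ S'] exI[of _ a'] exI[of _ \<rho>'] exI[of _ S] exI[of _ a] exI[of _ \<rho>] exI[of _ "a \<bullet> i \<bullet> \<pi>' \<boxplus> b \<bullet> \<rho>'"]) simp
  have m0: "d0 \<in> Ext1 C E M" unfolding d0_def Ext1_def by (rule quotientI) (simp add: extensions_iff_ses s)
  have m1: "d1 \<in> Ext1 C E M" unfolding d1_def Ext1_def by (rule quotientI) (simp add: extensions_iff_ses sM)
  have "d0 \<noteq> d1"
  proof
    assume "d0 = d1"
    then have "((S', a', \<rho>'), (K, i, p)) \<in> extension_equiv C E M"
      unfolding d0_def d1_def using s sM
      by (subst equiv_class_eq_iff[OF equiv_extension_equiv]) (auto simp: extensions_iff_ses)
    then obtain h where h: "arr C h" "dm C h = S'" "cd C h = K" "p \<bullet> h = \<rho>'" by (auto simp: extension_equiv_iff)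
    have "p \<bullet> h \<bullet> b' = Ident C E" using reassoc[OF h(4), of b'] h(1-3) by simp
    then have "(i, p) \<in> split_ses M K E" unfolding split_ses_def using s h(1-3) by (auto intro!: exI[of _ "h \<bullet> b'"])
    then show False using ns by simp
  qed
  \<comment> \<open>A choice of preimages is injective, and it misses one of \<open>d0\<close>,
    \<open>d1\<close>, because both lie over \<open>c0\<close>.\<close>
  obtain \<sigma> where \<sigma>: "\<And>c. c \<in> Ext1 C E K \<Longrightarrow> \<sigma> c \<in> Ext1 C E M \<and> rel (\<sigma> c) c" using ex by metis
  have inj: "inj_on \<sigma> (Ext1 C E K)" by (rule inj_onI) (metis \<sigma> uniq)
  have "\<sigma> ` Ext1 C E K \<subset> Ext1 C E M"
  proof
    show "\<sigma> ` Ext1 C E K \<subseteq> Ext1 C E M" using \<sigma> by blast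
    show "\<sigma> ` Ext1 C E K \<noteq> Ext1 C E M"
    proof
      assume "\<sigma> ` Ext1 C E K = Ext1 C E M"
      then obtain x y where xy: "x \<in> Ext1 C E K" "\<sigma> x = d0" "y \<in> Ext1 C E K" "\<sigma> y = d1" using m0 m1 by (metis imageE)
      then have "x = c0" "y = c0" using \<sigma> uniq r0 r1 by metis+
      then show False using xy \<open>d0 \<noteq> d1\<close> by simp
    qed
  qed
  then have "card (\<sigma> ` Ext1 C E K) < card (Ext1 C E M)" using finite_Ext1[of E M] by (intro psubset_card_mono) simp_all
  then show ?thesis using card_image[OF inj] by simp
qed

section \<open>Extensions of E by M against extensions of M by E\<close>

lemma split_ses_subset: "split_ses A K B \<subseteq> {(f, g). ses C A f K g B}"
  by (auto simp: split_ses_def)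

text \<open>For a fixed middle term K either all sequences M \<rightarrow> K \<rightarrow> E split
  or none does, since |Hom(E,K)| differs by the factor q between the two cases. Sequences E
  \<rightarrow> K \<rightarrow> M always split, by \<open>v\<close>. In the split case
  decompositions of K are counted in two ways.\<close>

lemma exact_count_dichotomy:
  assumes o: "M \<in> Obj C" "K \<in> Obj C" and v: "Ext1_vanishes C M E"
  obtains (split) "card {(f, g). ses C M f K g E} * card (hom E M) = card {(f, g). ses C E f K g M} * card (hom M E)"
  | (nonsplit) "{(f, g). ses C E f K g M} = {}"
      "\<And>f g. ses C M f K g E \<Longrightarrow> card (hom E K) = card (hom E M) \<and> card (Ext1 C E K) < card (Ext1 C E M)"
proof (cases "split_ses M K E = {}")
  case True
  have "ses C M f K g E \<Longrightarrow> card (hom E K) = card (hom E M) \<and> card (Ext1 C E K) < card (Ext1 C E M)" for f g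
    using card_hom_nonsplit[of M f K g] card_Ext1_nonsplit[of M f K g] True by simp
  moreover have "{(f, g). ses C E f K g M} = {}"
  proof (rule ccontr)
    assume "{(f, g). ses C E f K g M} \<noteq> {}"
    then obtain f g where s: "ses C E f K g M" by auto
    then have "(f, g) \<in> split_ses E K M" using Ext1_vanishes_section[OF v s] by (auto simp: split_ses_def)
    then show False using split_ses_nonempty_swap True by blast
  qed
  ultimately show ?thesis using nonsplit by blast
next
  case False
  then obtain f0 g0 where "(f0, g0) \<in> split_ses M K E" by auto
  then have "card (hom E K) = q * card (hom E M)" by (rule card_hom_split)
  moreover have "card (hom E M) > 0" using card_hom_pos o by simp
  ultimately have ne: "card (hom E K) \<noteq> card (hom E M)" using q_ge_2 by simp
  have 1: "{(f, g). ses C M f K g E} = split_ses M K E"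
    using card_hom_nonsplit ne split_ses_subset[of M K E] by blast
  have "(f, g) \<in> split_ses E K M" if s: "ses C E f K g M" for f g
  proof -
    obtain j where "arr C j" "dm C j = M" "cd C j = K" "g \<bullet> j = Ident C M" using Ext1_vanishes_section[OF v s] .
    then show ?thesis using s unfolding split_ses_def by blast
  qed
  then have 2: "{(f, g). ses C E f K g M} = split_ses E K M"
    using split_ses_subset[of E K M] by blast
  show ?thesis using split card_split_ses_symmetric[of M K E] o unfolding 1 2 by simp
qed

end

section \<open>Hall numbers\<close>

definition exact_pairs :: "('o, 'm) category \<Rightarrow> 'o \<Rightarrow> 'o \<Rightarrow> 'o \<Rightarrow> ('m \<times> 'm) set" where
  "exact_pairs C N K M = {(f, g). ses C N f K g M}"

definition autos :: "('o, 'm) category \<Rightarrow> 'o \<Rightarrow> 'm set" where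
  "autos C M = {h. is_iso C M M h}"

definition admissible_monos :: "('o, 'm) category \<Rightarrow> 'o \<Rightarrow> 'o \<Rightarrow> 'o \<Rightarrow> 'm set" where
  "admissible_monos C N K M = {f. \<exists>g. ses C N f K g M}"

definition admissible_epis :: "('o, 'm) category \<Rightarrow> 'o \<Rightarrow> 'o \<Rightarrow> 'o \<Rightarrow> 'm set" where
  "admissible_epis C N K M = {g. \<exists>f. ses C N f K g M}"

lemma autos_op_cat [simp]: "autos (op_cat C) M = autos C M"
  by (simp add: autos_def)

lemma admissible_monos_op_cat [simp]: "admissible_monos (op_cat C) M K N = admissible_epis C N K M"
  by (simp add: admissible_monos_def admissible_epis_def)

lemma exact_pairs_op_cat: "exact_pairs (op_cat C) M K N = prod.swap ` exact_pairs C N K M"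
  by (auto simp: exact_pairs_def image_iff)

lemma card_exact_pairs_op_cat [simp]: "card (exact_pairs (op_cat C) M K N) = card (exact_pairs C N K M)"
  unfolding exact_pairs_op_cat by (rule card_image) simp

context abelian_category
begin

lemma isomorphic_op_cat: "isomorphic (op_cat C) A B \<longleftrightarrow> isomorphic C A B"
  using isomorphic_sym by (auto simp: isomorphic_def)

lemma iso_class_op_cat: "iso_class (op_cat C) = iso_class C"
  by (rule ext) (simp add: iso_class_def isomorphic_op_cat)

lemma iso_classes_op_cat: "iso_classes (op_cat C) = iso_classes C"
  by (simp add: iso_classes_def iso_class_op_cat)

lemma iso_class_eqI: "isomorphic C A B \<Longrightarrow> iso_class C A = iso_class C B"
  using isomorphic_sym isomorphic_trans unfolding iso_class_def by blast

lemma iso_class_self: "A \<in> Obj C \<Longrightarrow> A \<in> iso_class C A"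
  using isomorphic_refl by (simp add: iso_class_def)

lemma iso_class_eqD: "iso_class C A = iso_class C B \<Longrightarrow> B \<in> Obj C \<Longrightarrow> isomorphic C A B"
  using iso_class_self[of B] by (auto simp: iso_class_def)

definition rep :: "'a set \<Rightarrow> 'a" where "rep k = (SOME K. K \<in> k)"

lemma rep:
  assumes "k \<in> iso_classes C"
  shows "rep k \<in> Obj C" "iso_class C (rep k) = k"
proof -
  obtain K where K: "K \<in> Obj C" "k = iso_class C K" using assms by (auto simp: iso_classes_def)
  then have "\<exists>K. K \<in> k" using iso_class_self by blast
  then have "rep k \<in> k" unfolding rep_def by (rule someI_ex)
  then show "rep k \<in> Obj C" "iso_class C (rep k) = k"
    using K iso_class_eqI isomorphic_sym by (auto simp: iso_class_def)
qed

end

context finitary_abelian_category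
begin

section \<open>Automorphism groups and counts of exact sequences\<close>

lemma finite_isos: "A \<in> Obj C \<Longrightarrow> B \<in> Obj C \<Longrightarrow> finite {h. is_iso C A B h}"
  by (rule finite_subset[OF _ finite_Hom[of A B]]) (auto dest: is_isoD)

lemma finite_autos: "M \<in> Obj C \<Longrightarrow> finite (autos C M)"
  unfolding autos_def by (rule finite_isos)

lemma card_autos_pos: "M \<in> Obj C \<Longrightarrow> card (autos C M) > 0"
  using finite_autos is_iso_Ident by (auto simp: card_gt_0_iff autos_def)

lemma finite_exact_pairs:
  assumes "N \<in> Obj C" "K \<in> Obj C" "M \<in> Obj C"
  shows "finite (exact_pairs C N K M)"
proof (rule finite_subset)
  show "exact_pairs C N K M \<subseteq> hom N K \<times> hom K M" by (auto simp: exact_pairs_def ses_arr)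
  show "finite (hom N K \<times> hom K M)" using assms finite_Hom by simp
qed

lemma finite_admissible_monos:
  "N \<in> Obj C \<Longrightarrow> K \<in> Obj C \<Longrightarrow> finite (admissible_monos C N K M)"
  by (rule finite_subset[OF _ finite_Hom[of N K]]) (auto simp: admissible_monos_def ses_arr)

text \<open>The epimorphism that completes a given mono to a sequence ending in M is unique up to a
  unique automorphism of M.\<close>

lemma exact_pairs_monos:
  assumes o: "N \<in> Obj C" "K \<in> Obj C" "M \<in> Obj C"
  shows "card (exact_pairs C N K M) = card (admissible_monos C N K M) * card (autos C M)"
proof -
  have "card (exact_pairs C N K M) = card (fst ` exact_pairs C N K M) * card (autos C M)"
  proof (rule card_fibres[OF finite_exact_pairs[OF o]])
    fix x assume "x \<in> exact_pairs C N K M"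
    then obtain f g where x: "x = (f, g)" and s: "ses C N f K g M" by (auto simp: exact_pairs_def)
    have "{z \<in> exact_pairs C N K M. fst z = fst x} = (\<lambda>h. (f, h \<bullet> g)) ` autos C M" (is "?L = ?R")
    proof
      show "?L \<subseteq> ?R"
      proof
        fix z assume "z \<in> ?L"
        then obtain g' where z: "z = (f, g')" and s': "ses C N f K g' M" by (auto simp: exact_pairs_def x)
        obtain h where "is_iso C M M h" "h \<bullet> g = g'" using cokernel_unique[OF s s'] .
        then show "z \<in> ?R" unfolding z autos_def by blast
      qed
      show "?R \<subseteq> ?L" unfolding x exact_pairs_def autos_def using ses_iso_right[OF s] by auto
    qed
    moreover have "inj_on (\<lambda>h. (f, h \<bullet> g)) (autos C M)"
    proof (rule inj_onI)
      fix h h' assume h: "h \<in> autos C M" "h' \<in> autos C M" "(f, h \<bullet> g) = (f, h' \<bullet> g)"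
      then have i: "is_iso C M M h" "is_iso C M M h'" and e: "h \<bullet> g = h' \<bullet> g" by (auto simp: autos_def)
      show "h = h'"
        by (rule epic_cancel[OF ses_arr(9)[OF s] _ _ _ _ _ e])
          (use is_isoD(1-3)[OF i(1)] is_isoD(1-3)[OF i(2)] ses_arr[OF s] in simp_all)
    qed
    ultimately show "card {z \<in> exact_pairs C N K M. fst z = fst x} = card (autos C M)"
      by (simp add: card_image)
  qed
  moreover have "fst ` exact_pairs C N K M = admissible_monos C N K M"
    by (force simp: exact_pairs_def admissible_monos_def)
  ultimately show ?thesis by simp
qed

lemma exact_pairs_epis:
  assumes o: "N \<in> Obj C" "K \<in> Obj C" "M \<in> Obj C"
  shows "card (exact_pairs C N K M) = card (admissible_epis C N K M) * card (autos C N)"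
  using finitary_abelian_category.exact_pairs_monos[OF op_finitary, of M K N] o by simp

lemma subobject_equiv_iff:
  "((U, i), (U', i')) \<in> subobject_equiv C K \<longleftrightarrow> is_mono C U K i \<and> is_mono C U' K i' \<and>
    (\<exists>h. is_iso C U U' h \<and> i' \<bullet> h = i)"
  by (simp add: subobject_equiv_def)

lemma equiv_subobject_equiv: "equiv {(U, i). is_mono C U K i} (subobject_equiv C K)"
proof (rule equivI)
  show "subobject_equiv C K \<subseteq> {(U, i). is_mono C U K i} \<times> {(U, i). is_mono C U K i}"
    by (auto simp: subobject_equiv_def)
  show "refl_on {(U, i). is_mono C U K i} (subobject_equiv C K)"
  proof (rule refl_onI, clarify)
    fix U i assume m: "is_mono C U K i"
    then have "arr C i" "dm C i = U" by (auto simp: is_mono_iff_monic)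
    then have "is_iso C U U (Ident C U)" "i \<bullet> Ident C U = i" using is_iso_Ident dm_obj by auto
    then show "((U, i), (U, i)) \<in> subobject_equiv C K" using m subobject_equiv_iff by blast
  qed
  show "sym (subobject_equiv C K)"
  proof (rule symI, clarify)
    fix U i U' i' assume *: "((U, i), (U', i')) \<in> subobject_equiv C K"
    then obtain h where h: "is_iso C U U' h" "i' \<bullet> h = i" and m: "is_mono C U K i" "is_mono C U' K i'"
      by (auto simp: subobject_equiv_iff)
    obtain k where k: "is_iso C U' U k" "h \<bullet> k = Ident C U'" using is_isoD(6)[OF h(1)] by auto
    have "i \<bullet> k = i'"
      using m k(2) is_isoD(1-3)[OF h(1)] is_isoD(1-3)[OF k(1)] unfolding h(2)[symmetric]
      by (simp add: is_mono_iff_monic)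
    then show "((U', i'), (U, i)) \<in> subobject_equiv C K" using m k subobject_equiv_iff by blast
  qed
  show "trans (subobject_equiv C K)"
  proof (rule transI, clarify)
    fix U i U' i' U'' i'' assume "((U, i), (U', i')) \<in> subobject_equiv C K" "((U', i'), (U'', i'')) \<in> subobject_equiv C K"
    then obtain h k where h: "is_iso C U U' h" "i' \<bullet> h = i" and k: "is_iso C U' U'' k" "i'' \<bullet> k = i'"
      and m: "is_mono C U K i" "is_mono C U'' K i''"
      by (auto simp: subobject_equiv_iff)
    have "i'' \<bullet> k \<bullet> h = i"
      using reassoc[OF k(2), of h] m h(2) is_isoD(1-3)[OF h(1)] is_isoD(1-3)[OF k(1)] by (simp add: is_mono_iff_monic)
    then show "((U, i), (U'', i'')) \<in> subobject_equiv C K"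
      using m is_iso_comp[OF h(1) k(1)] subobject_equiv_iff by blast
  qed
qed

lemma card_admissible_monos_iso:
  assumes o: "N \<in> Obj C" "M \<in> Obj C" and K: "isomorphic C K K'" "K \<in> Obj C" "K' \<in> Obj C"
  shows "card (exact_pairs C N K M) = card (exact_pairs C N K' M)"
proof -
  obtain h k where h: "is_iso C K K' h" and k: "k \<bullet> h = Ident C K" "h \<bullet> k = Ident C K'" "is_iso C K' K k"
    using K(1) is_isoD(6) unfolding isomorphic_def by metis
  note [simp] = is_isoD(1-3)[OF h] is_isoD(1-3)[OF k(3)] K(2,3)
  have "bij_betw (\<lambda>(f, g). (h \<bullet> f, g \<bullet> k)) (exact_pairs C N K M) (exact_pairs C N K' M)"
  proof (rule bij_betw_byWitness[where f' = "\<lambda>(f, g). (k \<bullet> f, g \<bullet> h)"])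
    show "(\<lambda>(f, g). (h \<bullet> f, g \<bullet> k)) ` exact_pairs C N K M \<subseteq> exact_pairs C N K' M"
      using ses_iso_middle[OF _ h k(1,2,3)] by (auto simp: exact_pairs_def)
    show "(\<lambda>(f, g). (k \<bullet> f, g \<bullet> h)) ` exact_pairs C N K' M \<subseteq> exact_pairs C N K M"
      using ses_iso_middle[OF _ k(3,2,1) h] by (auto simp: exact_pairs_def)
    show "\<forall>a\<in>exact_pairs C N K M. (case case a of (f, g) \<Rightarrow> (h \<bullet> f, g \<bullet> k) of (f, g) \<Rightarrow> (k \<bullet> f, g \<bullet> h)) = a"
    proof
      fix a assume "a \<in> exact_pairs C N K M"
      then obtain f g where a: "a = (f, g)" "ses C N f K g M" by (auto simp: exact_pairs_def)
      show "(case case a of (f, g) \<Rightarrow> (h \<bullet> f, g \<bullet> k) of (f, g) \<Rightarrow> (k \<bullet> f, g \<bullet> h)) = a"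
        using ses_arr(1-6)[OF a(2)] reassoc[OF k(1), of f] k(1) by (simp add: a(1))
    qed
    show "\<forall>a\<in>exact_pairs C N K' M. (case case a of (f, g) \<Rightarrow> (k \<bullet> f, g \<bullet> h) of (f, g) \<Rightarrow> (h \<bullet> f, g \<bullet> k)) = a"
    proof
      fix a assume "a \<in> exact_pairs C N K' M"
      then obtain f g where a: "a = (f, g)" "ses C N f K' g M" by (auto simp: exact_pairs_def)
      show "(case case a of (f, g) \<Rightarrow> (k \<bullet> f, g \<bullet> h) of (f, g) \<Rightarrow> (h \<bullet> f, g \<bullet> k)) = a"
        using ses_arr(1-6)[OF a(2)] reassoc[OF k(2), of f] k(2) by (simp add: a(1))
    qed
  qed
  then show ?thesis by (rule bij_betw_same_card)
qed

text \<open>A subobject isomorphic to N is an orbit of monos from N under Aut N, which acts freely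
  by precomposition. K has to be the very representative that \<open>hall_number\<close>
  selects.\<close>

lemma hall_number_monos:
  assumes o: "M \<in> Obj C" "N \<in> Obj C" "K' \<in> Obj C"
  defines "K \<equiv> (SOME K. K \<in> iso_class C K')"
  shows "card (admissible_monos C N K M)
    = hall_number C (iso_class C M) (iso_class C N) (iso_class C K') * card (autos C N)"
proof -
  have "K \<in> iso_class C K'" unfolding K_def by (rule someI) (rule iso_class_self[OF o(3)])
  then have Ko: "K \<in> Obj C" by (simp add: iso_class_def)
  define \<phi> where "\<phi> f = subobject_equiv C K `` {(N, f)}" for f
  let ?S = "{S \<in> subobjects C K. \<exists>(U, i)\<in>S. U \<in> iso_class C N \<and> (\<exists>Q\<in>iso_class C M. \<exists>p. is_cokernel C U K i Q p)}"
  have mono: "is_mono C N K f" if "f \<in> admissible_monos C N K M" for f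
    using that by (auto simp: admissible_monos_def is_mono_iff_monic ses_arr)
  have "card (admissible_monos C N K M) = card (\<phi> ` admissible_monos C N K M) * card (autos C N)"
  proof (rule card_fibres[OF finite_admissible_monos[OF o(2) Ko]])
    fix f assume f: "f \<in> admissible_monos C N K M"
    then obtain g where s: "ses C N f K g M" by (auto simp: admissible_monos_def)
    have "{f' \<in> admissible_monos C N K M. \<phi> f' = \<phi> f} = (\<lambda>h. f \<bullet> h) ` autos C N" (is "?L = ?R")
    proof
      show "?L \<subseteq> ?R"
      proof
        fix f' assume f': "f' \<in> ?L"
        then have "((N, f'), (N, f)) \<in> subobject_equiv C K"
          unfolding \<phi>_def using mono[OF f] mono[of f']
          by (subst equiv_class_eq_iff[OF equiv_subobject_equiv]) auto
        then show "f' \<in> ?R" by (auto simp: subobject_equiv_iff autos_def)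
      qed
      show "?R \<subseteq> ?L"
      proof
        fix f' assume "f' \<in> ?R"
        then obtain h where h: "is_iso C N N h" "f' = f \<bullet> h" by (auto simp: autos_def)
        have f'a: "f' \<in> admissible_monos C N K M" unfolding admissible_monos_def h(2) using ses_iso_left[OF s h(1)] by blast
        have "((N, f'), (N, f)) \<in> subobject_equiv C K"
          using mono[OF f] mono[OF f'a] h by (auto simp: subobject_equiv_iff)
        then have "\<phi> f' = \<phi> f" unfolding \<phi>_def by (rule equiv_class_eq[OF equiv_subobject_equiv])
        then show "f' \<in> ?L" using f'a by simp
      qed
    qed
    moreover have "inj_on (\<lambda>h. f \<bullet> h) (autos C N)"
    proof (rule inj_onI)
      fix h h' assume h: "h \<in> autos C N" "h' \<in> autos C N" and e: "f \<bullet> h = f \<bullet> h'"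
      then have i: "is_iso C N N h" "is_iso C N N h'" by (auto simp: autos_def)
      show "h = h'"
        by (rule monic_cancel[OF ses_arr(8)[OF s] _ _ _ _ _ e])
          (use is_isoD(1-3)[OF i(1)] is_isoD(1-3)[OF i(2)] ses_arr[OF s] in simp_all)
    qed
    ultimately show "card {f' \<in> admissible_monos C N K M. \<phi> f' = \<phi> f} = card (autos C N)"
      by (simp add: card_image)
  qed
  moreover have "\<phi> ` admissible_monos C N K M = ?S"
  proof
    show "\<phi> ` admissible_monos C N K M \<subseteq> ?S"
    proof
      fix S assume "S \<in> \<phi> ` admissible_monos C N K M"
      then obtain f g where S: "S = \<phi> f" and s: "ses C N f K g M" by (auto simp: admissible_monos_def)
      have m: "is_mono C N K f" using ses_arr[OF s] by (simp add: is_mono_iff_monic)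
      have "S \<in> subobjects C K" unfolding S \<phi>_def subobjects_def by (rule quotientI) (simp add: m)
      moreover have "(N, f) \<in> S" unfolding S \<phi>_def by (rule equiv_class_self[OF equiv_subobject_equiv]) (simp add: m)
      moreover have "is_cokernel C N K f M g" using s by (simp add: ses_def)
      ultimately show "S \<in> ?S" using iso_class_self o by blast
    qed
    show "?S \<subseteq> \<phi> ` admissible_monos C N K M"
    proof
      fix S assume S: "S \<in> ?S"
      then obtain U i Q p where Ui: "(U, i) \<in> S" and U: "U \<in> iso_class C N" and Q: "Q \<in> iso_class C M" and c: "is_cokernel C U K i Q p"
        by blast
      obtain y where y: "y \<in> {(U, i). is_mono C U K i}" "S = subobject_equiv C K `` {y}"
        using S unfolding subobjects_def by (auto elim: quotientE)
      have "is_mono C U K i" using Ui unfolding y(2) by (cases y) (auto simp: subobject_equiv_iff)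
      then have s: "ses C U i K p Q" using ses_monicI c by (auto simp: is_mono_iff_monic)
      obtain h where h: "is_iso C N U h" using U by (auto simp: iso_class_def isomorphic_def)
      obtain k where k: "is_iso C Q M k" using Q isomorphic_sym by (fastforce simp: iso_class_def isomorphic_def)
      have s2: "ses C N (i \<bullet> h) K (k \<bullet> p) M" using ses_iso_right[OF ses_iso_left[OF s h] k] .
      then have a: "i \<bullet> h \<in> admissible_monos C N K M" by (auto simp: admissible_monos_def)
      have "((N, i \<bullet> h), (U, i)) \<in> subobject_equiv C K"
        using mono[OF a] \<open>is_mono C U K i\<close> h by (auto simp: subobject_equiv_iff)
      then have "\<phi> (i \<bullet> h) = subobject_equiv C K `` {(U, i)}"
        unfolding \<phi>_def by (rule equiv_class_eq[OF equiv_subobject_equiv])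
      also have "\<dots> = S" using Ui unfolding y(2)
        by (metis Image_singleton_iff equiv_class_eq[OF equiv_subobject_equiv])
      finally show "S \<in> \<phi> ` admissible_monos C N K M" using a by blast
    qed
  qed
  ultimately show ?thesis unfolding hall_number_def K_def Let_def by simp
qed

text \<open>This form treats M and N symmetrically. It makes the Hall numbers self-dual
  (\<open>F_op_cat\<close>) and gives the coefficients of [E][M] and [M][E] at K the same
  denominator |Aut E| |Aut M|.\<close>

theorem hall_number_exact_pairs:
  assumes o: "M \<in> Obj C" "N \<in> Obj C" "K \<in> Obj C"
  shows "hall_number C (iso_class C M) (iso_class C N) (iso_class C K) * card (autos C M) * card (autos C N)
    = card (exact_pairs C N K M)"
proof -
  let ?K = "SOME K'. K' \<in> iso_class C K"
  have "?K \<in> iso_class C K" by (rule someI) (rule iso_class_self[OF o(3)])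
  then have K: "?K \<in> Obj C" "isomorphic C K ?K" by (simp_all add: iso_class_def)
  have "card (exact_pairs C N K M) = card (exact_pairs C N ?K M)"
    using card_admissible_monos_iso[OF o(2,1) K(2) o(3) K(1)] .
  then show ?thesis using exact_pairs_monos[OF o(2) K(1) o(1)] hall_number_monos[OF o] by simp
qed

text \<open>Extension by zero outside the isomorphism classes lets a nonzero value carry all
  membership facts.\<close>

definition F :: "'a set \<Rightarrow> 'a set \<Rightarrow> 'a set \<Rightarrow> rat" where
  "F m n k = (if m \<in> iso_classes C \<and> n \<in> iso_classes C \<and> k \<in> iso_classes C then of_nat (hall_number C m n k) else 0)"

lemma iso_class_in [simp]: "A \<in> Obj C \<Longrightarrow> iso_class C A \<in> iso_classes C"
  by (simp add: iso_classes_def)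

lemma F_nonneg: "F m n k \<ge> 0"
  by (simp add: F_def)

lemma F_classes: "F m n k \<noteq> 0 \<Longrightarrow> m \<in> iso_classes C \<and> n \<in> iso_classes C \<and> k \<in> iso_classes C"
  by (simp add: F_def split: if_splits)

lemma F_exact_pairs:
  assumes o: "M \<in> Obj C" "N \<in> Obj C" "K \<in> Obj C"
  shows "F (iso_class C M) (iso_class C N) (iso_class C K) * of_nat (card (autos C M)) * of_nat (card (autos C N))
    = of_nat (card (exact_pairs C N K M))"
  using hall_number_exact_pairs[OF o] o unfolding F_def by (simp flip: of_nat_mult)

lemma F_monos:
  assumes o: "M \<in> Obj C" "N \<in> Obj C" "K \<in> Obj C"
  shows "of_nat (card (admissible_monos C N K M)) = F (iso_class C M) (iso_class C N) (iso_class C K) * of_nat (card (autos C N))"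
  using F_exact_pairs[OF o] exact_pairs_monos[OF o(2,3,1)] card_autos_pos[OF o(1)] by simp

lemma F_epis:
  assumes o: "M \<in> Obj C" "N \<in> Obj C" "K \<in> Obj C"
  shows "of_nat (card (admissible_epis C N K M)) = F (iso_class C M) (iso_class C N) (iso_class C K) * of_nat (card (autos C M))"
  using F_exact_pairs[OF o] exact_pairs_epis[OF o(2,3,1)] card_autos_pos[OF o(2)] by simp

lemma F_nonzero_ses:
  assumes o: "M \<in> Obj C" "N \<in> Obj C" "K \<in> Obj C"
  shows "F (iso_class C M) (iso_class C N) (iso_class C K) \<noteq> 0 \<longleftrightarrow> (\<exists>f g. ses C N f K g M)"
proof -
  have "F (iso_class C M) (iso_class C N) (iso_class C K) \<noteq> 0 \<longleftrightarrow> card (exact_pairs C N K M) \<noteq> 0"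
    using F_exact_pairs[OF o] card_autos_pos[OF o(1)] card_autos_pos[OF o(2)] by (metis mult_eq_0_iff of_nat_eq_0_iff less_irrefl)
  also have "\<dots> \<longleftrightarrow> exact_pairs C N K M \<noteq> {}" using finite_exact_pairs[OF o(2,3,1)] by (simp only: card_0_eq)
  finally show ?thesis unfolding exact_pairs_def by blast
qed

lemma F_op_cat: "finitary_abelian_category.F (op_cat C) m n k = F n m k"
proof (cases "m \<in> iso_classes C \<and> n \<in> iso_classes C \<and> k \<in> iso_classes C")
  case True
  interpret op: finitary_abelian_category "op_cat C" by (rule op_finitary)
  obtain M N K where o: "M \<in> Obj C" "N \<in> Obj C" "K \<in> Obj C" and mnk: "m = iso_class C M" "n = iso_class C N" "k = iso_class C K"
    using True by (auto simp: iso_classes_def)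
  have "op.F m n k * of_nat (card (autos C M)) * of_nat (card (autos C N)) = of_nat (card (exact_pairs C M K N))"
    using op.F_exact_pairs[of M N K] o unfolding mnk iso_class_op_cat by simp
  moreover have "F n m k * of_nat (card (autos C N)) * of_nat (card (autos C M)) = of_nat (card (exact_pairs C M K N))"
    using F_exact_pairs[OF o(2,1,3)] unfolding mnk by simp
  ultimately have "op.F m n k * (of_nat (card (autos C M)) * of_nat (card (autos C N))) =
      F n m k * (of_nat (card (autos C M)) * of_nat (card (autos C N)))"
    by (simp add: mult.assoc mult.commute mult.left_commute)
  then show ?thesis using card_autos_pos[OF o(1)] card_autos_pos[OF o(2)] by simp
next
  case False
  interpret op: finitary_abelian_category "op_cat C" by (rule op_finitary)
  show ?thesis using False by (auto simp: F_def op.F_def iso_classes_op_cat)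
qed

text \<open>A nonzero value comes from a mono between two fixed representatives; there are finitely
  many of these, and each determines the class of its cokernel.\<close>

lemma finite_F_left: "finite {m. F m n k \<noteq> 0}"
proof (cases "n \<in> iso_classes C \<and> k \<in> iso_classes C")
  case True
  have "{m. F m n k \<noteq> 0} \<subseteq> (\<lambda>f. iso_class C (SOME M. \<exists>g. ses C (rep n) f (rep k) g M)) ` hom (rep n) (rep k)"
  proof
    fix m assume "m \<in> {m. F m n k \<noteq> 0}"
    then have nz: "F m n k \<noteq> 0" and m: "m \<in> iso_classes C" using F_classes by auto
    obtain f g where s: "ses C (rep n) f (rep k) g (rep m)"
      using F_nonzero_ses[of "rep m" "rep n" "rep k"] rep m True nz by auto
    define M where "M = (SOME M. \<exists>g. ses C (rep n) f (rep k) g M)"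
    have "\<exists>g. ses C (rep n) f (rep k) g M" unfolding M_def by (rule someI) (use s in blast)
    then obtain g' where "ses C (rep n) f (rep k) g' M" by auto
    then obtain h where "is_iso C M (rep m) h" using cokernel_unique s by metis
    then have "iso_class C M = m" using iso_class_eqI[of M "rep m"] rep m by (auto simp: isomorphic_def)
    moreover have "f \<in> hom (rep n) (rep k)" using ses_arr[OF s] by simp
    ultimately show "m \<in> (\<lambda>f. iso_class C (SOME M. \<exists>g. ses C (rep n) f (rep k) g M)) ` hom (rep n) (rep k)"
      unfolding M_def by blast
  qed
  then show ?thesis using finite_Hom[of "rep n" "rep k"] rep True by (meson finite_imageI finite_subset)
next
  case False
  then have "{m. F m n k \<noteq> 0} = {}" using F_classes by blast
  then show ?thesis by simp
qed

lemma finite_F_right: "finite {n. F m n k \<noteq> 0}"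
  using finitary_abelian_category.finite_F_left[OF op_finitary, of m k] by (simp add: F_op_cat)

text \<open>The class of the middle term depends only on the Yoneda class of the extension, and
  Ext^1 is finite.\<close>

lemma finite_F_middle: "finite {k. F m n k \<noteq> 0}"
proof (cases "m \<in> iso_classes C \<and> n \<in> iso_classes C")
  case True
  let ?E = "Ext1 C (rep m) (rep n)"
  have "{k. F m n k \<noteq> 0} \<subseteq> (\<lambda>c. iso_class C (fst (SOME x. x \<in> c))) ` ?E"
  proof
    fix k assume "k \<in> {k. F m n k \<noteq> 0}"
    then have nz: "F m n k \<noteq> 0" and k: "k \<in> iso_classes C" using F_classes by auto
    obtain f g where s: "ses C (rep n) f (rep k) g (rep m)"
      using F_nonzero_ses[of "rep m" "rep n" "rep k"] rep k True nz by auto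
    then have e: "(rep k, f, g) \<in> extensions C (rep m) (rep n)" by (simp add: extensions_iff_ses)
    define c where "c = extension_equiv C (rep m) (rep n) `` {(rep k, f, g)}"
    have c: "c \<in> ?E" unfolding c_def Ext1_def using e by (rule quotientI)
    have "(rep k, f, g) \<in> c" unfolding c_def by (rule equiv_class_self[OF equiv_extension_equiv e])
    then have "(SOME x. x \<in> c) \<in> c" by (rule someI)
    then have "((rep k, f, g), (SOME x. x \<in> c)) \<in> extension_equiv C (rep m) (rep n)" unfolding c_def by simp
    then have "isomorphic C (rep k) (fst (SOME x. x \<in> c))" by (auto simp: extension_equiv_def isomorphic_def)
    then have "iso_class C (fst (SOME x. x \<in> c)) = k" using iso_class_eqI rep k by metis
    then show "k \<in> (\<lambda>c. iso_class C (fst (SOME x. x \<in> c))) ` ?E" using c by blast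
  qed
  then show ?thesis using finite_Ext1[of "rep m" "rep n"] rep True by (meson finite_imageI finite_subset)
next
  case False
  then have "{k. F m n k \<noteq> 0} = {}" using F_classes by blast
  then show ?thesis by simp
qed

end

text \<open>These pairs encode two-step filtrations of K with bottom P, middle factor isomorphic to
  N and top M. The outer factors are trivialized by f and g, whereas the middle one is fixed up to
  isomorphism only.\<close>

definition flags :: "('o, 'm) category \<Rightarrow> 'o \<Rightarrow> 'o \<Rightarrow> 'o \<Rightarrow> 'o \<Rightarrow> ('m \<times> 'm) set" where
  "flags C P K M N = {(f, g). \<exists>Q c h \<kappa>. ses C P f K c Q \<and> ses C N \<kappa> Q h M \<and> g = Comp C h c}"

text \<open>The self-duality of the homology of \<open>P \<rightarrow> K \<rightarrow> M\<close>: the kernel of \<open>coker f \<rightarrow> M\<close> is the cokernel of \<open>P \<rightarrow> ker g\<close>.\<close>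

lemma (in abelian_category) flags_op_cat:
  assumes "(f, g) \<in> flags C P K M N"
  shows "(g, f) \<in> flags (op_cat C) M K P N"
proof -
  obtain Q c h \<kappa> where s: "ses C P f K c Q" and t: "ses C N \<kappa> Q h M" and g: "g = h \<bullet> c"
    using assms by (auto simp: flags_def)
  note [simp] = ses_arr(1-7)[OF s] ses_arr(1-7)[OF t]
  have o [simp]: "P \<in> Obj C" "K \<in> Obj C" "Q \<in> Obj C" "N \<in> Obj C" "M \<in> Obj C"
    using dm_obj[of f] cd_obj[of f] cd_obj[of c] dm_obj[of \<kappa>] cd_obj[of h] by simp_all
  have ga [simp]: "arr C g" "dm C g = K" "cd C g = M" by (simp_all add: g)
  have gx: "g \<bullet> x = h \<bullet> c \<bullet> x" if "arr C x" "cd C x = K" for x using that by (simp add: g)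
  have "epic C g" unfolding g by (rule epic_comp) (use ses_arr(9)[OF s] ses_arr(9)[OF t] in simp_all)
  then obtain U k where u: "ses C U k K g M" using ses_kernel[of g] by auto
  note [simp] = ses_arr(1-3)[OF u]
  have Uo [simp]: "U \<in> Obj C" using dm_obj[of k] by simp
  have "g \<bullet> f = Null C (dm C f) M" by (simp add: gx)
  then obtain f' where f': "arr C f'" "dm C f' = P" "cd C f' = U" "k \<bullet> f' = f" using ses_lift[OF u, of f] by auto
  note [simp] = f'(1-3)
  have "h \<bullet> (c \<bullet> k) = Null C (dm C (c \<bullet> k)) M" using ses_arr(7)[OF u] gx[of k] by simp
  then obtain t' where t': "arr C t'" "dm C t' = U" "cd C t' = N" "\<kappa> \<bullet> t' = c \<bullet> k" using ses_lift[OF t, of "c \<bullet> k"] by auto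
  note [simp] = t'(1-3)
  have kt: "\<kappa> \<bullet> t' \<bullet> x = c \<bullet> k \<bullet> x" if "arr C x" "cd C x = U" for x
    using reassoc[OF t'(4), of x] that by simp
  have "monic C (k \<bullet> f')" using ses_arr(8)[OF s] f'(4) by simp
  then have mf: "monic C f'" by (rule monic_left) simp_all
  have ktf: "\<kappa> \<bullet> t' \<bullet> f' = Null C P Q" using kt[of f'] f'(4) by simp
  have tf: "t' \<bullet> f' = Null C P N" by (rule monic_null[OF ses_arr(8)[OF t]]) (use ktf in simp_all)
  \<comment> \<open>To see that \<open>t'\<close> is epic, the epi c is pulled back along \<kappa>.
    The resulting epi \<open>t2\<close> onto N factors through \<open>t'\<close>.\<close>
  have "cd C \<kappa> = cd C c" by simp
  then obtain k' t2 where kt': "arr C k'" "arr C t2" "cd C k' = dm C c" "dm C t2 = dm C k'" "cd C t2 = dm C \<kappa>"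
      "c \<bullet> k' = \<kappa> \<bullet> t2" "epic C t2"
    by (rule pullback[OF ses_arr(9)[OF s] ses_arr(1)[OF t]]) (rule that, assumption+)
  note [simp] = kt'(1-5)
  have k'o: "dm C k' \<in> Obj C" by simp
  have "g \<bullet> k' = Null C (dm C k') M"
    using gx[of k'] kt'(6) reassoc[OF ses_arr(7)[OF t], of t2] by simp
  then obtain z where z: "arr C z" "dm C z = dm C k'" "cd C z = U" "k \<bullet> z = k'" using ses_lift[OF u, of k'] by auto
  note [simp] = z(1-3)
  have e: "\<kappa> \<bullet> t' \<bullet> z = \<kappa> \<bullet> t2" using kt[of z] z(4) kt'(6) by simp
  have "t' \<bullet> z = t2" by (rule monic_cancel[OF ses_arr(8)[OF t] _ _ _ _ _ e]) simp_all
  then have "epic C (t' \<bullet> z)" using kt'(7) by simp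
  then have et: "epic C t'" by (rule epic_right) simp_all
  have "ses C P f' U t' N"
  proof (rule sesI)
    fix x assume x: "arr C x" "cd C x = U" "t' \<bullet> x = Null C (dm C x) N"
    have xo: "dm C x \<in> Obj C" using x by simp
    have "c \<bullet> k \<bullet> x = Null C (dm C (k \<bullet> x)) Q" using kt[of x] x xo by simp
    then obtain y where y: "arr C y" "dm C y = dm C x" "cd C y = P" "f \<bullet> y = k \<bullet> x"
      using ses_lift[OF s, of "k \<bullet> x"] x by auto
    have ky: "k \<bullet> f' \<bullet> y = k \<bullet> x" using reassoc[OF f'(4), of y] y by simp
    have "f' \<bullet> y = x" by (rule monic_cancel[OF ses_arr(8)[OF u] _ _ _ _ _ ky]) (use x y(1-3) in simp_all)
    then show "\<exists>y. arr C y \<and> dm C y = dm C x \<and> cd C y = P \<and> f' \<bullet> y = x" using y by auto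
  qed (use mf et tf in simp_all)
  then show ?thesis using u f'(4) unfolding flags_def by auto
qed

lemma (in abelian_category) card_flags_op_cat: "card (flags (op_cat C) M K P N) = card (flags C P K M N)"
proof -
  have "flags (op_cat C) M K P N = prod.swap ` flags C P K M N"
  proof
    show "flags (op_cat C) M K P N \<subseteq> prod.swap ` flags C P K M N"
    proof
      fix x assume "x \<in> flags (op_cat C) M K P N"
      then have "prod.swap x \<in> flags C P K M N"
        using abelian_category.flags_op_cat[OF op_abelian, of "fst x" "snd x" M K P N] by (cases x) simp
      then show "x \<in> prod.swap ` flags C P K M N" by (metis image_eqI swap_swap)
    qed
    show "prod.swap ` flags C P K M N \<subseteq> flags (op_cat C) M K P N" using flags_op_cat by auto
  qed
  then show ?thesis by (simp add: card_image)
qed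

section \<open>Associativity of the structure constants\<close>

context finitary_abelian_category
begin

text \<open>The mono f is chosen first, and the flags are grouped by the class l of its cokernel.
  There are F l p k |Aut P| such monos, and F m n l |Aut M| epimorphisms from each cokernel onto M
  with kernel N.\<close>

lemma card_flags:
  assumes o: "P \<in> Obj C" "K \<in> Obj C" "M \<in> Obj C" "N \<in> Obj C"
  defines "m \<equiv> iso_class C M" and "n \<equiv> iso_class C N" and "p \<equiv> iso_class C P" and "k \<equiv> iso_class C K"
  shows "of_nat (card (flags C P K M N)) = of_nat (card (autos C M)) * of_nat (card (autos C P)) *
    (\<Sum>l | F m n l * F l p k \<noteq> 0. F m n l * F l p k)"
proof -
  define mons where "mons = {f \<in> hom P K. monic C f}"
  define co where "co f = (SOME Q. \<exists>c. ses C P f K c Q)" for f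
  define cm where "cm f = (SOME c. ses C P f K c (co f))" for f
  have fin: "finite mons" unfolding mons_def by (rule finite_subset[OF _ finite_Hom[OF o(1,2)]]) auto
  have s: "ses C P f K (cm f) (co f)" if "f \<in> mons" for f
  proof -
    have "monic C f" "dm C f = P" "cd C f = K" using that by (auto simp: mons_def)
    then have "\<exists>Q c. ses C P f K c Q" using ses_cokernel by metis
    then have "\<exists>c. ses C P f K c (co f)" unfolding co_def by (rule someI_ex)
    then show ?thesis unfolding cm_def by (rule someI_ex)
  qed
  have coo: "co f \<in> Obj C" if "f \<in> mons" for f using s[OF that] ses_arr cd_obj by metis
  have fl: "flags C P K M N = Sigma mons (\<lambda>f. (\<lambda>h. h \<bullet> cm f) ` admissible_epis C N (co f) M)" (is "_ = ?R")
  proof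
    show "?R \<subseteq> flags C P K M N" using s unfolding flags_def admissible_epis_def by blast
    show "flags C P K M N \<subseteq> ?R"
    proof
      fix x assume "x \<in> flags C P K M N"
      then obtain f Q c h \<kappa> where x: "x = (f, h \<bullet> c)" and s1: "ses C P f K c Q" and t: "ses C N \<kappa> Q h M"
        by (auto simp: flags_def)
      have f: "f \<in> mons" using ses_arr[OF s1] by (simp add: mons_def)
      obtain i where i: "is_iso C (co f) Q i" "i \<bullet> cm f = c" using cokernel_unique[OF s[OF f] s1] .
      obtain j where j: "is_iso C Q (co f) j" "j \<bullet> i = Ident C (co f)" "i \<bullet> j = Ident C Q" using is_isoD(6)[OF i(1)] by auto
      have "ses C N (j \<bullet> \<kappa>) (co f) (h \<bullet> i) M" using ses_iso_middle[OF t j(1) j(3,2) i(1)] .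
      then have "h \<bullet> i \<in> admissible_epis C N (co f) M" by (auto simp: admissible_epis_def)
      moreover have "(h \<bullet> i) \<bullet> cm f = h \<bullet> c"
        using i ses_arr[OF t] ses_arr[OF s[OF f]] is_isoD(1-3)[OF i(1)] by simp
      ultimately show "x \<in> ?R" using f unfolding x by (metis (no_types, lifting) SigmaI image_eqI)
    qed
  qed
  have finE: "finite (admissible_epis C N (co f) M)" if "f \<in> mons" for f
    using finitary_abelian_category.finite_admissible_monos[OF op_finitary, of M "co f" N] o coo[OF that] by simp
  have ci: "card ((\<lambda>h. h \<bullet> cm f) ` admissible_epis C N (co f) M) = card (admissible_epis C N (co f) M)" if f: "f \<in> mons" for f
  proof (rule card_image, rule inj_onI)
    fix h h' assume h: "h \<in> admissible_epis C N (co f) M" "h' \<in> admissible_epis C N (co f) M" "h \<bullet> cm f = h' \<bullet> cm f"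
    then obtain a a' where a: "ses C N a (co f) h M" "ses C N a' (co f) h' M" by (auto simp: admissible_epis_def)
    show "h = h'"
      by (rule epic_cancel[OF ses_arr(9)[OF s[OF f]] _ _ _ _ _ h(3)])
        (use ses_arr[OF a(1)] ses_arr[OF a(2)] ses_arr[OF s[OF f]] in simp_all)
  qed
  have "card (flags C P K M N) = (\<Sum>f\<in>mons. card (admissible_epis C N (co f) M))"
    unfolding fl using fin finE ci by (subst card_SigmaI) simp_all
  then have "of_nat (card (flags C P K M N)) = (\<Sum>f\<in>mons. F m n (iso_class C (co f)) * of_nat (card (autos C M)))"
    unfolding m_def n_def using F_epis[OF o(3,4)] coo by simp
  also have "\<dots> = (\<Sum>l\<in>(\<lambda>f. iso_class C (co f)) ` mons. \<Sum>f | f \<in> mons \<and> iso_class C (co f) = l. F m n (iso_class C (co f)) * of_nat (card (autos C M)))"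
    using sum.group[OF fin finite_imageI[OF fin] order_refl, of "\<lambda>f. F m n (iso_class C (co f)) * of_nat (card (autos C M))" "\<lambda>f. iso_class C (co f)"]
    by simp
  also have "\<dots> = (\<Sum>l\<in>(\<lambda>f. iso_class C (co f)) ` mons. of_nat (card (autos C M)) * of_nat (card (autos C P)) * (F m n l * F l p k))"
  proof (rule sum.cong[OF refl])
    fix l assume "l \<in> (\<lambda>f. iso_class C (co f)) ` mons"
    then have l: "l \<in> iso_classes C" using coo by auto
    have "{f \<in> mons. iso_class C (co f) = l} = admissible_monos C P K (rep l)"
    proof
      show "{f \<in> mons. iso_class C (co f) = l} \<subseteq> admissible_monos C P K (rep l)"
      proof
        fix f assume f: "f \<in> {f \<in> mons. iso_class C (co f) = l}"
        then obtain i where "is_iso C (co f) (rep l) i"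
          using iso_class_eqD[of "co f" "rep l"] rep[OF l] by (auto simp: isomorphic_def)
        then have "ses C P f K (i \<bullet> cm f) (rep l)" using ses_iso_right s f by blast
        then show "f \<in> admissible_monos C P K (rep l)" by (auto simp: admissible_monos_def)
      qed
      show "admissible_monos C P K (rep l) \<subseteq> {f \<in> mons. iso_class C (co f) = l}"
      proof
        fix f assume "f \<in> admissible_monos C P K (rep l)"
        then obtain g where g: "ses C P f K g (rep l)" by (auto simp: admissible_monos_def)
        then have f: "f \<in> mons" using ses_arr[OF g] by (simp add: mons_def)
        obtain i where "is_iso C (co f) (rep l) i" using cokernel_unique[OF s[OF f] g] by metis
        then have "iso_class C (co f) = l" using iso_class_eqI[of "co f" "rep l"] rep[OF l] by (auto simp: isomorphic_def)
        then show "f \<in> {f \<in> mons. iso_class C (co f) = l}" using f by simp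
      qed
    qed
    then have "of_nat (card {f \<in> mons. iso_class C (co f) = l}) = F l p k * of_nat (card (autos C P))"
      using F_monos[of "rep l" P K] rep[OF l] o by (simp add: p_def k_def)
    then show "(\<Sum>f | f \<in> mons \<and> iso_class C (co f) = l. F m n (iso_class C (co f)) * of_nat (card (autos C M)))
      = of_nat (card (autos C M)) * of_nat (card (autos C P)) * (F m n l * F l p k)"
      by (simp add: algebra_simps)
  qed
  also have "\<dots> = of_nat (card (autos C M)) * of_nat (card (autos C P)) * (\<Sum>l\<in>(\<lambda>f. iso_class C (co f)) ` mons. F m n l * F l p k)"
    by (simp add: sum_distrib_left)
  also have "(\<Sum>l\<in>(\<lambda>f. iso_class C (co f)) ` mons. F m n l * F l p k) = (\<Sum>l | F m n l * F l p k \<noteq> 0. F m n l * F l p k)"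
  proof (rule sum.mono_neutral_right)
    show "finite ((\<lambda>f. iso_class C (co f)) ` mons)" using fin by simp
    show "{l. F m n l * F l p k \<noteq> 0} \<subseteq> (\<lambda>f. iso_class C (co f)) ` mons"
    proof
      fix l assume "l \<in> {l. F m n l * F l p k \<noteq> 0}"
      then have nz: "F l p k \<noteq> 0" and l: "l \<in> iso_classes C" using F_classes by auto
      obtain f g where g: "ses C P f K g (rep l)"
        using F_nonzero_ses[of "rep l" P K] rep[OF l] o nz by (auto simp: p_def k_def)
      then have f: "f \<in> mons" using ses_arr[OF g] by (simp add: mons_def)
      obtain i where "is_iso C (co f) (rep l) i" using cokernel_unique[OF s[OF f] g] by metis
      then have "iso_class C (co f) = l" using iso_class_eqI[of "co f" "rep l"] rep[OF l] by (auto simp: isomorphic_def)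
      then show "l \<in> (\<lambda>f. iso_class C (co f)) ` mons" using f by blast
    qed
  qed simp
  finally show ?thesis .
qed

text \<open>Up to the factor |Aut M| |Aut P| both sides count the same flags. One side groups them
  by the cokernel of P \<rightarrow> K; the other, computed in the opposite category, by the kernel
  of K \<rightarrow> M.\<close>

theorem F_assoc: "(\<Sum>l | F m n l * F l p k \<noteq> 0. F m n l * F l p k) = (\<Sum>l | F n p l * F m l k \<noteq> 0. F n p l * F m l k)"
proof (cases "m \<in> iso_classes C \<and> n \<in> iso_classes C \<and> p \<in> iso_classes C \<and> k \<in> iso_classes C")
  case True
  then obtain M N P K where o: "M \<in> Obj C" "N \<in> Obj C" "P \<in> Obj C" "K \<in> Obj C"
    and c: "m = iso_class C M" "n = iso_class C N" "p = iso_class C P" "k = iso_class C K"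
    by (auto simp: iso_classes_def)
  have "of_nat (card (autos C P)) * of_nat (card (autos C M)) * (\<Sum>l | F n p l * F m l k \<noteq> 0. F n p l * F m l k)
    = (of_nat (card (flags C P K M N)) :: rat)"
    using finitary_abelian_category.card_flags[OF op_finitary, of M K P N] o
    unfolding c card_flags_op_cat iso_class_op_cat F_op_cat by simp
  also have "\<dots> = of_nat (card (autos C M)) * of_nat (card (autos C P)) * (\<Sum>l | F m n l * F l p k \<noteq> 0. F m n l * F l p k)"
    using card_flags[OF o(3,4,1,2)] unfolding c .
  finally show ?thesis using card_autos_pos[OF o(1)] card_autos_pos[OF o(3)] by (simp add: mult.commute)
next
  case False
  then have "{l. F m n l * F l p k \<noteq> 0} = {}" "{l. F n p l * F m l k \<noteq> 0} = {}" using F_classes by auto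
  then show ?thesis by simp
qed

section \<open>The class of zero objects as unit\<close>

definition unit_class :: "'a set" where "unit_class = iso_class C (SOME Z. is_zero_object C Z)"

lemma unit_zero: "is_zero_object C (SOME Z. is_zero_object C Z)"
  using zero_object_exists by (rule someI_ex)

lemma zero_object_hom:
  assumes Z: "is_zero_object C Z" and x: "arr C x"
  shows "dm C x = Z \<Longrightarrow> x = Null C Z (cd C x)" "cd C x = Z \<Longrightarrow> x = Null C (dm C x) Z"
proof -
  have Zo: "Z \<in> Obj C" using Z by (simp add: is_zero_object_def)
  have o: "dm C x \<in> Obj C" "cd C x \<in> Obj C" using x by simp_all
  show "x = Null C Z (cd C x)" if "dm C x = Z"
  proof -
    have "\<exists>!f. f \<in> hom Z (cd C x)" using Z o unfolding is_zero_object_def by blast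
    moreover have "x \<in> hom Z (cd C x)" "Null C Z (cd C x) \<in> hom Z (cd C x)" using x that Zo o by simp_all
    ultimately show ?thesis by blast
  qed
  show "x = Null C (dm C x) Z" if "cd C x = Z"
  proof -
    have "\<exists>!f. f \<in> hom (dm C x) Z" using Z o unfolding is_zero_object_def by blast
    moreover have "x \<in> hom (dm C x) Z" "Null C (dm C x) Z \<in> hom (dm C x) Z" using x that Zo o by simp_all
    ultimately show ?thesis by blast
  qed
qed

lemma ses_zero_iff:
  assumes Z: "is_zero_object C Z"
  shows "(\<exists>g. ses C N f K g Z) \<longleftrightarrow> is_iso C N K f"
proof
  have Zo [simp]: "Z \<in> Obj C" using Z by (simp add: is_zero_object_def)
  assume "\<exists>g. ses C N f K g Z"
  then obtain g where s: "ses C N f K g Z" by auto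
  note [simp] = ses_arr(1-7)[OF s]
  have K: "K \<in> Obj C" using cd_obj[of f] by simp
  have "x = Null C K (cd C x)" if x: "arr C x" "dm C x = K" "x \<bullet> f = Null C N (cd C x)" for x
  proof -
    obtain y where y: "arr C y" "dm C y = Z" "cd C y = cd C x" "y \<bullet> g = x" using ses_desc[OF s x] .
    have "y = Null C Z (cd C x)" using zero_object_hom(1)[OF Z y(1,2)] y(3) by simp
    then have "y \<bullet> g = Null C K (cd C x)" using x by simp
    then show ?thesis using y(4) by simp
  qed
  then have "epic C f" by (auto simp: epic_def)
  then show "is_iso C N K f" using monic_epic_iso[OF ses_arr(8)[OF s]] by simp
next
  have Zo [simp]: "Z \<in> Obj C" using Z by (simp add: is_zero_object_def)
  assume i: "is_iso C N K f"
  note [simp] = is_isoD(1-3)[OF i]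
  obtain k where k: "is_iso C K N k" "f \<bullet> k = Ident C K" using is_isoD(6)[OF i] by auto
  note [simp] = is_isoD(1-3)[OF k(1)]
  have o [simp]: "N \<in> Obj C" "K \<in> Obj C" using dm_obj[of f] cd_obj[of f] by simp_all
  have "ses C N f K (Null C K Z) Z"
  proof (rule sesI)
    show "epic C (Null C K Z)"
      unfolding epic_def using zero_object_hom(1)[OF Z] by auto
    fix x assume x: "arr C x" "cd C x = K"
    then show "\<exists>y. arr C y \<and> dm C y = dm C x \<and> cd C y = N \<and> f \<bullet> y = x"
      using reassoc[OF k(2), of x] by (intro exI[of _ "k \<bullet> x"]) simp
  qed (use is_isoD(4)[OF i] in simp_all)
  then show "\<exists>g. ses C N f K g Z" by blast
qed

lemma unit_class_in [simp]: "unit_class \<in> iso_classes C"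
proof -
  have "(SOME Z. is_zero_object C Z) \<in> Obj C"
    using unit_zero unfolding is_zero_object_def[of C "SOME Z. is_zero_object C Z"] by blast
  then show ?thesis unfolding unit_class_def by simp
qed

lemma card_isos: "isomorphic C N K \<Longrightarrow> card {f. is_iso C N K f} = card (autos C N)"
proof -
  assume "isomorphic C N K"
  then obtain h where h: "is_iso C N K h" by (auto simp: isomorphic_def)
  obtain k where k: "is_iso C K N k" "k \<bullet> h = Ident C N" "h \<bullet> k = Ident C K" using is_isoD(6)[OF h] by auto
  note [simp] = is_isoD(1-3)[OF h] is_isoD(1-3)[OF k(1)]
  have "bij_betw (\<lambda>f. k \<bullet> f) {f. is_iso C N K f} (autos C N)"
  proof (rule bij_betw_byWitness[where f' = "\<lambda>f. h \<bullet> f"])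
    show "\<forall>f\<in>{f. is_iso C N K f}. h \<bullet> k \<bullet> f = f"
    proof clarify
      fix f assume "is_iso C N K f"
      from is_isoD(1-3)[OF this] show "h \<bullet> k \<bullet> f = f" using reassoc[OF k(3), of f] by simp
    qed
    show "\<forall>f\<in>autos C N. k \<bullet> h \<bullet> f = f"
    proof
      fix f assume "f \<in> autos C N"
      then have "is_iso C N N f" by (simp add: autos_def)
      from is_isoD(1-3)[OF this] show "k \<bullet> h \<bullet> f = f" using reassoc[OF k(2), of f] by simp
    qed
    show "(\<lambda>f. k \<bullet> f) ` {f. is_iso C N K f} \<subseteq> autos C N" using is_iso_comp k(1) by (auto simp: autos_def)
    show "(\<lambda>f. h \<bullet> f) ` autos C N \<subseteq> {f. is_iso C N K f}" using is_iso_comp h by (auto simp: autos_def)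
  qed
  then show ?thesis by (rule bij_betw_same_card)
qed

lemma F_unit_left:
  assumes "n \<in> iso_classes C" "k \<in> iso_classes C"
  shows "F unit_class n k = (if n = k then 1 else 0)"
proof -
  let ?Z = "SOME Z. is_zero_object C Z"
  have Zo: "?Z \<in> Obj C" using unit_zero by (simp add: is_zero_object_def)
  obtain N K where o: "N \<in> Obj C" "K \<in> Obj C" and c: "n = iso_class C N" "k = iso_class C K"
    using assms by (auto simp: iso_classes_def)
  have a: "admissible_monos C N K ?Z = {f. is_iso C N K f}"
    unfolding admissible_monos_def using ses_zero_iff[OF unit_zero] by simp
  have e: "of_nat (card {f. is_iso C N K f}) = F unit_class n k * of_nat (card (autos C N))"
    using F_monos[OF Zo o] unfolding a c unit_class_def .
  show ?thesis
  proof (cases "n = k")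
    case True
    then have "isomorphic C N K" using iso_class_eqD o c by simp
    then show ?thesis using e card_isos[of N K] card_autos_pos[OF o(1)] True by simp
  next
    case False
    then have "\<not> isomorphic C N K" using iso_class_eqI c by blast
    then have "{f. is_iso C N K f} = {}" by (auto simp: isomorphic_def)
    then show ?thesis using e card_autos_pos[OF o(1)] False by simp
  qed
qed

lemma unit_class_op_cat: "finitary_abelian_category.unit_class (op_cat C) = unit_class"
  using finitary_abelian_category.unit_class_def[OF op_finitary] by (simp add: unit_class_def iso_class_op_cat)

lemma F_unit_right:
  assumes "m \<in> iso_classes C" "k \<in> iso_classes C"
  shows "F m unit_class k = (if m = k then 1 else 0)"
  using finitary_abelian_category.F_unit_left[OF op_finitary, of m k] assms
  by (simp add: F_op_cat unit_class_op_cat iso_classes_op_cat)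

end

context exceptional_object
begin

text \<open>\<open>hin\<close> and \<open>hout\<close> supply the degree of a class relative to E:
  both are powers of q. \<open>ext\<close> strictly decreases under nonsplit extensions by E, so it
  bounds how often these can be iterated.\<close>

definition hin :: "'o set \<Rightarrow> nat" where "hin k = card (hom (rep k) E)"
definition hout :: "'o set \<Rightarrow> nat" where "hout k = card (hom E (rep k))"
definition ext :: "'o set \<Rightarrow> nat" where "ext k = card (Ext1 C E (rep k))"
definition cls :: "'o set" where "cls = iso_class C E"
definition perp :: "'o set set" where "perp = {k \<in> iso_classes C. k \<subseteq> perp_left C E}"

lemma cls_in [simp]: "cls \<in> iso_classes C"
  by (simp add: cls_def)

lemma perp_iff:
  assumes "k \<in> iso_classes C"
  shows "k \<in> perp \<longleftrightarrow> Ext1_vanishes C (rep k) E"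
proof
  have k: "rep k \<in> Obj C" "iso_class C (rep k) = k" using rep assms by auto
  show "k \<in> perp \<Longrightarrow> Ext1_vanishes C (rep k) E"
    using k iso_class_self[of "rep k"] by (auto simp: perp_def perp_left_def)
  assume v: "Ext1_vanishes C (rep k) E"
  have "M \<in> perp_left C E" if "M \<in> k" for M
  proof -
    have "M \<in> iso_class C (rep k)" using that k by simp
    then obtain h where "is_iso C (rep k) M h" "M \<in> Obj C" by (auto simp: iso_class_def isomorphic_def)
    then show ?thesis using Ext1_vanishes_iso[OF v] by (simp add: perp_left_def)
  qed
  then show "k \<in> perp" using assms by (auto simp: perp_def)
qed

lemma perp_iso_class: "M \<in> Obj C \<Longrightarrow> iso_class C M \<in> perp \<longleftrightarrow> Ext1_vanishes C M E"
proof -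
  assume M: "M \<in> Obj C"
  have "isomorphic C M (rep (iso_class C M))" "isomorphic C (rep (iso_class C M)) M"
    using rep[of "iso_class C M"] iso_class_eqD M by auto
  then show ?thesis using perp_iff[of "iso_class C M"] M Ext1_vanishes_iso unfolding isomorphic_def by fastforce
qed

lemma cls_perp: "cls \<in> perp"
  using perp_iso_class[OF E_obj] E_rigid by (simp add: cls_def)

lemma unit_perp: "unit_class \<in> perp"
proof -
  let ?Z = "SOME Z. is_zero_object C Z"
  have Z: "is_zero_object C ?Z" by (rule unit_zero)
  then have Zo: "?Z \<in> Obj C" by (simp add: is_zero_object_def)
  have "Ext1_vanishes C ?Z E"
    unfolding Ext1_vanishes_iff_section[OF Zo E_obj]
  proof (intro allI impI)
    fix K f g assume s: "ses C E f K g ?Z"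
    have K: "K \<in> Obj C" using cd_obj[of f] ses_arr[OF s] by simp
    have "g \<bullet> Null C ?Z K = Ident C ?Z"
      using zero_object_hom(1)[OF Z, of "Ident C ?Z"] ses_arr[OF s] Zo K by simp
    then show "\<exists>j. arr C j \<and> dm C j = ?Z \<and> cd C j = K \<and> g \<bullet> j = Ident C ?Z"
      using Zo K by (intro exI[of _ "Null C ?Z K"]) simp
  qed
  then show ?thesis using perp_iso_class[OF Zo] by (simp add: unit_class_def)
qed

lemma F_rep_ses:
  assumes "F m n k \<noteq> 0"
  shows "\<exists>f g. ses C (rep n) f (rep k) g (rep m)"
  using F_nonzero_ses[of "rep m" "rep n" "rep k"] rep F_classes[OF assms] assms by auto

lemma perp_closed: "F m n k \<noteq> 0 \<Longrightarrow> m \<in> perp \<Longrightarrow> n \<in> perp \<Longrightarrow> k \<in> perp"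
  using F_rep_ses[of m n k] F_classes[of m n k] perp_iff Ext1_vanishes_extension[OF _ _ _ E_obj] by blast

lemma hin_mono: "F m n k \<noteq> 0 \<Longrightarrow> hin m \<le> hin k"
  using F_rep_ses[of m n k] card_hom_le_middle' E_obj unfolding hin_def by blast

lemma hout_mono: "F m n k \<noteq> 0 \<Longrightarrow> hout n \<le> hout k"
  using F_rep_ses[of m n k] card_hom_le_middle E_obj unfolding hout_def by blast

lemma hin_cls:
  assumes "F cls n k \<noteq> 0"
  shows "hin k = q * hin n"
  using F_nonzero_ses[of E "rep n" "rep k"] rep F_classes[OF assms] assms card_hom_to_E
  by (fastforce simp: hin_def cls_def)

lemma hout_cls:
  assumes "F m cls k \<noteq> 0"
  shows "hout k = q * hout m"
  using F_nonzero_ses[of "rep m" E "rep k"] rep F_classes[OF assms] assms card_hom_from_E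
  by (fastforce simp: hout_def cls_def)

lemma hin_power: "k \<in> iso_classes C \<Longrightarrow> \<exists>n. hin k = q ^ n"
  unfolding hin_def by (rule card_hom_power) (rule rep)

lemma hout_power: "k \<in> iso_classes C \<Longrightarrow> \<exists>n. hout k = q ^ n"
  unfolding hout_def by (rule card_hom_power') (rule rep)

lemma unit_hin: "hin unit_class = 1" and unit_hout: "hout unit_class = 1"
proof -
  let ?Z = "SOME Z. is_zero_object C Z"
  define A where "A = rep unit_class"
  have A: "A \<in> Obj C" "iso_class C A = unit_class" using rep[OF unit_class_in] by (simp_all add: A_def)
  have Z: "is_zero_object C ?Z" by (rule unit_zero)
  then have Zo [simp]: "?Z \<in> Obj C" by (simp add: is_zero_object_def)
  have "isomorphic C A ?Z" using iso_class_eqD[of A ?Z] A by (simp add: unit_class_def)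
  then obtain h where h: "is_iso C A ?Z h" by (auto simp: isomorphic_def)
  obtain k where k: "is_iso C ?Z A k" "k \<bullet> h = Ident C A" using is_isoD(6)[OF h] by auto
  note [simp] = is_isoD(1-3)[OF h] is_isoD(1-3)[OF k(1)] A(1)
  have kn: "k = Null C ?Z A" using zero_object_hom(1)[OF Z, of k] by simp
  have id: "Ident C A = Null C A A" using k(2) unfolding kn by simp
  have 1: "x = Null C A E" if "arr C x" "dm C x = A" "cd C x = E" for x
  proof -
    have "x = x \<bullet> Ident C A" using that by simp
    then show ?thesis unfolding id using that by simp
  qed
  have 2: "x = Null C E A" if "arr C x" "cd C x = A" "dm C x = E" for x
  proof -
    have "x = Ident C A \<bullet> x" using that by simp
    then show ?thesis unfolding id using that by simp
  qed
  have "hom A E = {Null C A E}" "hom E A = {Null C E A}" using 1 2 by auto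
  then show "hin unit_class = 1" "hout unit_class = 1" by (simp_all add: hin_def hout_def flip: A_def)
qed

text \<open>Both Hall numbers are counts of exact pairs divided by |Aut E| |Aut M|. In the split
  case of \<open>exact_count_dichotomy\<close> the two products would be equal, so only the nonsplit
  case remains.\<close>

lemma exceptional_step:
  assumes m: "m \<in> perp" and ne: "F cls m k * of_nat (hout m) \<noteq> F m cls k * of_nat (hin m)"
  shows "F cls m k \<noteq> 0 \<and> F m cls k = 0 \<and> hout k = hout m \<and> ext k < ext m"
proof -
  have mc: "m \<in> iso_classes C" using m by (simp add: perp_def)
  have kc: "k \<in> iso_classes C" using ne F_classes by (metis mult_zero_left)
  define M where "M = rep m"
  define K where "K = rep k"
  have o: "M \<in> Obj C" "K \<in> Obj C" and c: "m = iso_class C M" "k = iso_class C K"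
    using rep[OF mc] rep[OF kc] by (simp_all add: M_def K_def)
  have v: "Ext1_vanishes C M E" using perp_iff[OF mc] m by (simp add: M_def)
  have 1: "F cls m k * of_nat (card (autos C E)) * of_nat (card (autos C M)) = of_nat (card (exact_pairs C M K E))"
    using F_exact_pairs[OF E_obj o] unfolding c cls_def .
  have 2: "F m cls k * of_nat (card (autos C M)) * of_nat (card (autos C E)) = of_nat (card (exact_pairs C E K M))"
    using F_exact_pairs[OF o(1) E_obj o(2)] unfolding c cls_def .
  show ?thesis
  proof (rule exact_count_dichotomy[OF o v])
    assume "card {(f, g). ses C M f K g E} * card (hom E M) = card {(f, g). ses C E f K g M} * card (hom M E)"
    then have "card (exact_pairs C M K E) * hout m = card (exact_pairs C E K M) * hin m"
      unfolding exact_pairs_def hout_def hin_def M_def .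
    then have "of_nat (card (exact_pairs C M K E)) * of_nat (hout m) = of_nat (card (exact_pairs C E K M)) * (of_nat (hin m) :: rat)"
      by (metis of_nat_mult)
    then have "(F cls m k * of_nat (hout m)) * (of_nat (card (autos C E)) * of_nat (card (autos C M)))
       = (F m cls k * of_nat (hin m)) * (of_nat (card (autos C E)) * of_nat (card (autos C M)))"
      unfolding 1[symmetric] 2[symmetric] by (simp add: algebra_simps)
    then show ?thesis using ne card_autos_pos[OF E_obj] card_autos_pos[OF o(1)] by simp
  next
    assume e: "{(f, g). ses C E f K g M} = {}"
      and ns: "\<And>f g. ses C M f K g E \<Longrightarrow> card (hom E K) = card (hom E M) \<and> card (Ext1 C E K) < card (Ext1 C E M)"
    have "F m cls k = 0" using 2 e card_autos_pos[OF E_obj] card_autos_pos[OF o(1)] by (simp add: exact_pairs_def)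
    moreover from this have nz: "F cls m k \<noteq> 0" using ne by auto
    moreover obtain f g where "ses C M f K g E" using F_nonzero_ses[OF E_obj o] nz unfolding c cls_def by auto
    ultimately show ?thesis using ns unfolding hout_def ext_def M_def K_def by blast
  qed
qed

end

section \<open>Convolution algebras\<close>

locale structure_constants =
  fixes I :: "'a set" and F :: "'a \<Rightarrow> 'a \<Rightarrow> 'a \<Rightarrow> rat" and u :: 'a
  assumes F_nonneg: "F m n k \<ge> 0"
    and F_I: "F m n k \<noteq> 0 \<Longrightarrow> m \<in> I \<and> n \<in> I \<and> k \<in> I"
    and finite_left: "finite {m. F m n k \<noteq> 0}"
    and finite_right: "finite {n. F m n k \<noteq> 0}"
    and finite_middle: "finite {k. F m n k \<noteq> 0}"
    and assoc: "(\<Sum>l | F m n l * F l p k \<noteq> 0. F m n l * F l p k) = (\<Sum>l | F n p l * F m l k \<noteq> 0. F n p l * F m l k)"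
    and u_in: "u \<in> I"
    and unit_left: "\<lbrakk>n \<in> I; k \<in> I\<rbrakk> \<Longrightarrow> F u n k = (if n = k then 1 else 0)"
    and unit_right: "\<lbrakk>n \<in> I; k \<in> I\<rbrakk> \<Longrightarrow> F n u k = (if n = k then 1 else 0)"
begin

definition conv :: "('a \<Rightarrow> rat) \<Rightarrow> ('a \<Rightarrow> rat) \<Rightarrow> 'a \<Rightarrow> rat" where
  "conv f g k = (\<Sum>(m, n) | f m * g n * F m n k \<noteq> 0. f m * g n * F m n k)"

text \<open>In \<open>F m n k\<close> the index n is the subobject and m the quotient. The condition
  says that each k has only finitely many subobject classes in the support of f. By
  \<open>finite_left\<close>, a product with f on the right is then a finite sum at every k,
  whatever the left factor.\<close>

definition subfin :: "('a \<Rightarrow> rat) \<Rightarrow> bool" where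
  "subfin f \<longleftrightarrow> (\<forall>k. f k \<noteq> 0 \<longrightarrow> k \<in> I) \<and> (\<forall>k. finite {n. f n \<noteq> 0 \<and> (\<exists>m. F m n k \<noteq> 0)})"

definition quofin :: "('a \<Rightarrow> rat) \<Rightarrow> bool" where
  "quofin f \<longleftrightarrow> (\<forall>k. f k \<noteq> 0 \<longrightarrow> k \<in> I) \<and> (\<forall>k. finite {m. f m \<noteq> 0 \<and> (\<exists>n. F m n k \<noteq> 0)})"

definition bifin :: "('a \<Rightarrow> rat) \<Rightarrow> bool" where
  "bifin f \<longleftrightarrow> subfin f \<and> quofin f"

definition delta :: "'a \<Rightarrow> 'a \<Rightarrow> rat" where
  "delta m = (\<lambda>k. if k = m then 1 else 0)"

lemma opposite: "structure_constants I (\<lambda>m n. F n m) u"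
proof
  fix m n p k
  show "(\<Sum>l | F n m l * F p l k \<noteq> 0. F n m l * F p l k) = (\<Sum>l | F p n l * F l m k \<noteq> 0. F p n l * F l m k)"
    by (rule assoc[symmetric])
  show "F n m k \<noteq> 0 \<Longrightarrow> m \<in> I \<and> n \<in> I \<and> k \<in> I" using F_I by blast
qed (simp_all add: F_nonneg finite_left finite_right finite_middle u_in unit_left unit_right)

lemma opposite_subfin: "structure_constants.subfin I (\<lambda>m n. F n m) f \<longleftrightarrow> quofin f"
  by (simp add: structure_constants.subfin_def[OF opposite] quofin_def)

lemma opposite_quofin: "structure_constants.quofin I (\<lambda>m n. F n m) f \<longleftrightarrow> subfin f"
  by (simp add: structure_constants.quofin_def[OF opposite] subfin_def)

lemma opposite_bifin: "structure_constants.bifin I (\<lambda>m n. F n m) f \<longleftrightarrow> bifin f"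
  by (auto simp: structure_constants.bifin_def[OF opposite] bifin_def opposite_subfin opposite_quofin)

lemma opposite_conv: "structure_constants.conv (\<lambda>m n. F n m) f g = conv g f"
proof
  fix k
  show "structure_constants.conv (\<lambda>m n. F n m) f g k = conv g f k"
    unfolding structure_constants.conv_def[OF opposite] conv_def
    by (rule sum.reindex_bij_witness[of _ prod.swap prod.swap]) (auto simp: mult.commute mult.left_commute)
qed

lemma conv_eq:
  assumes "finite A" "\<And>m n. f m \<noteq> 0 \<Longrightarrow> g n \<noteq> 0 \<Longrightarrow> F m n k \<noteq> 0 \<Longrightarrow> (m, n) \<in> A"
  shows "conv f g k = (\<Sum>(m, n)\<in>A. f m * g n * F m n k)"
  unfolding conv_def by (rule sum.mono_neutral_left) (use assms in auto)

section \<open>Finiteness and associativity of the convolution\<close>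

definition pairs :: "('a \<Rightarrow> rat) \<Rightarrow> 'a \<Rightarrow> ('a \<times> 'a) set" where
  "pairs g k = {(m, n). g n \<noteq> 0 \<and> F m n k \<noteq> 0}"

lemma finite_pairs: "subfin g \<Longrightarrow> finite (pairs g k)"
proof -
  assume g: "subfin g"
  have "pairs g k = (\<lambda>(n, m). (m, n)) ` Sigma {n. g n \<noteq> 0 \<and> (\<exists>m. F m n k \<noteq> 0)} (\<lambda>n. {m. F m n k \<noteq> 0})"
    by (auto simp: pairs_def image_iff)
  then show ?thesis using g finite_left by (simp add: subfin_def)
qed

lemma conv_pairs:
  assumes "subfin h" "\<And>n. g n \<noteq> 0 \<Longrightarrow> h n \<noteq> 0"
  shows "conv f g k = (\<Sum>(m, n)\<in>pairs h k. f m * g n * F m n k)"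
  by (rule conv_eq[OF finite_pairs[OF assms(1)]]) (use assms(2) in \<open>auto simp: pairs_def\<close>)

lemma conv_nonzero:
  assumes "conv f g k \<noteq> 0"
  obtains m n where "f m \<noteq> 0" "g n \<noteq> 0" "F m n k \<noteq> 0"
proof -
  obtain x where "x \<in> {(m, n). f m * g n * F m n k \<noteq> 0}"
    using assms unfolding conv_def by (metis (no_types, lifting) sum.not_neutral_contains_not_neutral)
  then show ?thesis using that by auto
qed

text \<open>The constants are nonnegative, so the sums in \<open>assoc\<close> admit no
  cancellation: one vanishes termwise exactly when the other does.\<close>

lemma assoc_nonzero:
  "(\<exists>l. F m n l \<noteq> 0 \<and> F l p k \<noteq> 0) \<longleftrightarrow> (\<exists>l. F n p l \<noteq> 0 \<and> F m l k \<noteq> 0)"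
proof -
  have f1: "finite {l. F m n l * F l p k \<noteq> 0}" by (rule finite_subset[OF _ finite_middle[of m n]]) auto
  have f2: "finite {l. F n p l * F m l k \<noteq> 0}" by (rule finite_subset[OF _ finite_middle[of n p]]) auto
  have "(\<forall>l. F m n l * F l p k = 0) \<longleftrightarrow> (\<Sum>l | F m n l * F l p k \<noteq> 0. F m n l * F l p k) = 0"
    using f1 F_nonneg by (subst sum_nonneg_eq_0_iff) auto
  also have "\<dots> \<longleftrightarrow> (\<Sum>l | F n p l * F m l k \<noteq> 0. F n p l * F m l k) = 0" by (simp only: assoc)
  also have "\<dots> \<longleftrightarrow> (\<forall>l. F n p l * F m l k = 0)"
    using f2 F_nonneg by (subst sum_nonneg_eq_0_iff) auto
  finally show ?thesis by (simp only: mult_eq_0_iff) blast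
qed

text \<open>Index triples that can contribute to a triple product at k, the leftmost factor being
  arbitrary. By \<open>assoc_nonzero\<close> this one set bounds both bracketings.\<close>

definition triples where
  "triples g h k = {(m, n, p). g n \<noteq> (0::rat) \<and> h p \<noteq> (0::rat) \<and> (\<exists>l. F m n l \<noteq> 0 \<and> F l p k \<noteq> 0)}"

lemma finite_triples:
  assumes "subfin g" "subfin h"
  shows "finite (triples g h k)"
proof -
  have "triples g h k \<subseteq> (\<lambda>((l, p), (m, n)). (m, n, p)) ` Sigma (pairs h k) (\<lambda>(l, p). pairs g l)"
    by (force simp: triples_def pairs_def image_iff)
  moreover have "finite (Sigma (pairs h k) (\<lambda>(l, p). pairs g l))"
    using finite_pairs assms by (intro finite_SigmaI) auto
  ultimately show ?thesis by (meson finite_imageI finite_subset)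
qed

lemma subfin_conv:
  assumes "subfin g" "subfin h"
  shows "subfin (conv g h)"
  unfolding subfin_def
proof (intro conjI allI impI)
  fix k assume "conv g h k \<noteq> 0"
  then show "k \<in> I" using conv_nonzero[of g h k] F_I by metis
next
  fix k
  have "{l. conv g h l \<noteq> 0 \<and> (\<exists>m. F m l k \<noteq> 0)} \<subseteq> (\<Union>(m, n, p)\<in>triples g h k. {l. F n p l \<noteq> 0})"
  proof
    fix l assume "l \<in> {l. conv g h l \<noteq> 0 \<and> (\<exists>m. F m l k \<noteq> 0)}"
    then obtain m where l: "conv g h l \<noteq> 0" "F m l k \<noteq> 0" by blast
    obtain n p where np: "g n \<noteq> 0" "h p \<noteq> 0" "F n p l \<noteq> 0" using conv_nonzero[OF l(1)] .
    have "\<exists>l. F m n l \<noteq> 0 \<and> F l p k \<noteq> 0" using assoc_nonzero[of m n p k] l(2) np(3) by blast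
    then have "(m, n, p) \<in> triples g h k" using np by (simp add: triples_def)
    then show "l \<in> (\<Union>(m, n, p)\<in>triples g h k. {l. F n p l \<noteq> 0})" using np(3) by blast
  qed
  moreover have "finite (\<Union>(m, n, p)\<in>triples g h k. {l. F n p l \<noteq> 0})"
    using finite_triples[OF assms] finite_middle by (intro finite_UN_I) auto
  ultimately show "finite {l. conv g h l \<noteq> 0 \<and> (\<exists>m. F m l k \<noteq> 0)}" by (rule finite_subset)
qed

text \<open>The leftmost factor is arbitrary, so that the lemma applies to a candidate inverse in
  \<open>hall_formal\<close> about which no finiteness is known.\<close>

lemma conv_assoc:
  assumes g: "subfin g" and h: "subfin h"
  shows "conv (conv f g) h = conv f (conv g h)"
proof
  fix k
  define T where "T = triples g h k"
  have T: "finite T" unfolding T_def by (rule finite_triples[OF g h])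
  define L where "L = fst ` pairs h k"
  have L: "finite L" unfolding L_def using finite_pairs[OF h] by simp
  define L' where "L' = (\<Union>(m, n, p)\<in>T. {l. F n p l \<noteq> 0})"
  have L': "finite L'" unfolding L'_def using T finite_middle by (intro finite_UN_I) auto
  \<comment> \<open>Every nonzero term has m in \<open>A\<close>, n in \<open>B\<close>, p in
    \<open>D\<close>, and l in \<open>L\<close> or \<open>L'\<close> according to the bracketing.
    The sums thus become sums over finite boxes, whose order can be exchanged.\<close>
  define A where "A = fst ` T"
  define B where "B = (fst \<circ> snd) ` T"
  define D where "D = (snd \<circ> snd) ` T"
  have fin: "finite A" "finite B" "finite D" using T by (simp_all add: A_def B_def D_def)
  have mem: "m \<in> A \<and> n \<in> B \<and> p \<in> D" if "g n \<noteq> 0" "h p \<noteq> 0" "F m n l \<noteq> 0" "F l p k \<noteq> 0" for m n p l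
  proof -
    have "(m, n, p) \<in> T" using that unfolding T_def triples_def by blast
    then show ?thesis unfolding A_def B_def D_def by force
  qed
  have mem': "m \<in> A \<and> n \<in> B \<and> p \<in> D \<and> l \<in> L'" if "g n \<noteq> 0" "h p \<noteq> 0" "F n p l \<noteq> 0" "F m l k \<noteq> 0" for m n p l
  proof -
    have "\<exists>l. F m n l \<noteq> 0 \<and> F l p k \<noteq> 0" using assoc_nonzero[of m n p k] that by blast
    then have t: "(m, n, p) \<in> T" using that unfolding T_def triples_def by blast
    then have "l \<in> L'" unfolding L'_def using that by blast
    then show ?thesis using t unfolding A_def B_def D_def by force
  qed
  let ?t = "\<lambda>m n p. f m * g n * h p"
  have hp: "pairs h k = {(l, p). h p \<noteq> 0 \<and> F l p k \<noteq> 0}" by (simp add: pairs_def)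
  have lhs1: "conv (conv f g) h k = (\<Sum>(l, p)\<in>pairs h k. conv f g l * h p * F l p k)"
    by (rule conv_pairs[OF h]) simp
  also have "\<dots> = (\<Sum>(l, p)\<in>pairs h k. \<Sum>(m, n)\<in>A \<times> B. ?t m n p * (F m n l * F l p k))"
  proof (rule sum.cong[OF refl], clarify)
    fix l p assume "(l, p) \<in> pairs h k"
    then have lp: "h p \<noteq> 0" "F l p k \<noteq> 0" by (auto simp: pairs_def)
    have "conv f g l = (\<Sum>(m, n)\<in>A \<times> B. f m * g n * F m n l)"
      by (rule conv_eq) (use fin mem lp in auto)
    then show "conv f g l * h p * F l p k = (\<Sum>(m, n)\<in>A \<times> B. ?t m n p * (F m n l * F l p k))"
      by (simp add: sum_distrib_left sum_distrib_right case_prod_unfold mult_ac)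
  qed
  also have "\<dots> = (\<Sum>(l, p)\<in>L \<times> D. \<Sum>(m, n)\<in>A \<times> B. ?t m n p * (F m n l * F l p k))"
  proof (rule sum.mono_neutral_cong)
    show "finite (pairs h k)" using finite_pairs[OF h] .
    show "finite (L \<times> D)" using L fin by simp
    fix x assume "x \<in> L \<times> D - pairs h k"
    then show "(case x of (l, p) \<Rightarrow> \<Sum>(m, n)\<in>A \<times> B. ?t m n p * (F m n l * F l p k)) = 0"
      by (auto simp: pairs_def case_prod_unfold)
  next
    fix x assume x: "x \<in> pairs h k - L \<times> D"
    obtain l p where [simp]: "x = (l, p)" by (cases x)
    have "l \<in> L" using x unfolding L_def by force
    then have "p \<notin> D" using x by auto
    then have "?t m n p * (F m n l * F l p k) = 0" for m n using mem[of n p m l] by auto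
    then have "(\<Sum>(m, n)\<in>A \<times> B. ?t m n p * (F m n l * F l p k)) = 0" by (intro sum.neutral) auto
    then show "(case x of (l, p) \<Rightarrow> \<Sum>(m, n)\<in>A \<times> B. ?t m n p * (F m n l * F l p k)) = 0" by simp
  qed simp
  also have "\<dots> = (\<Sum>p\<in>D. \<Sum>(m, n)\<in>A \<times> B. \<Sum>l\<in>L. ?t m n p * (F m n l * F l p k))"
  proof -
    have "(\<Sum>(l, p)\<in>L \<times> D. \<Sum>(m, n)\<in>A \<times> B. ?t m n p * (F m n l * F l p k))
      = (\<Sum>p\<in>D. \<Sum>l\<in>L. \<Sum>(m, n)\<in>A \<times> B. ?t m n p * (F m n l * F l p k))"
      by (rule trans[OF sum.cartesian_product[symmetric] sum.swap])
    also have "\<dots> = (\<Sum>p\<in>D. \<Sum>x\<in>A \<times> B. \<Sum>l\<in>L. case x of (m, n) \<Rightarrow> ?t m n p * (F m n l * F l p k))"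
      by (rule sum.cong[OF refl], rule sum.swap)
    finally show ?thesis by (simp add: case_prod_unfold)
  qed
  also have "\<dots> = (\<Sum>p\<in>D. \<Sum>(m, n)\<in>A \<times> B. ?t m n p * (\<Sum>l | F m n l * F l p k \<noteq> 0. F m n l * F l p k))"
  proof (rule sum.cong[OF refl], rule sum.cong[OF refl], clarify)
    fix p m n
    show "(\<Sum>l\<in>L. ?t m n p * (F m n l * F l p k)) = ?t m n p * (\<Sum>l | F m n l * F l p k \<noteq> 0. F m n l * F l p k)"
    proof (cases "h p = 0")
      case False
      then have "{l. F m n l * F l p k \<noteq> 0} \<subseteq> L" unfolding L_def pairs_def by force
      then have "(\<Sum>l | F m n l * F l p k \<noteq> 0. F m n l * F l p k) = (\<Sum>l\<in>L. F m n l * F l p k)"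
        using L by (intro sum.mono_neutral_left) auto
      then show ?thesis by (simp add: sum_distrib_left)
    qed simp
  qed
  finally have lhs: "conv (conv f g) h k = (\<Sum>p\<in>D. \<Sum>(m, n)\<in>A \<times> B. ?t m n p * (\<Sum>l | F m n l * F l p k \<noteq> 0. F m n l * F l p k))" .
  have "conv f (conv g h) k = (\<Sum>(m, l)\<in>A \<times> L'. f m * conv g h l * F m l k)"
  proof (rule conv_eq)
    fix m l assume "f m \<noteq> 0" "conv g h l \<noteq> 0" "F m l k \<noteq> 0"
    then obtain n p where "g n \<noteq> 0" "h p \<noteq> 0" "F n p l \<noteq> 0" using conv_nonzero by blast
    then show "(m, l) \<in> A \<times> L'" using mem'[of n p l m] \<open>F m l k \<noteq> 0\<close> by blast
  qed (use fin L' in simp)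
  also have "\<dots> = (\<Sum>(m, l)\<in>A \<times> L'. \<Sum>(n, p)\<in>B \<times> D. ?t m n p * (F n p l * F m l k))"
  proof (rule sum.cong[OF refl], clarify)
    fix m l
    show "f m * conv g h l * F m l k = (\<Sum>(n, p)\<in>B \<times> D. ?t m n p * (F n p l * F m l k))"
    proof (cases "F m l k = 0")
      case False
      have "conv g h l = (\<Sum>(n, p)\<in>B \<times> D. g n * h p * F n p l)"
        by (rule conv_eq) (use fin mem' False in auto)
      then show ?thesis by (simp add: sum_distrib_right sum_distrib_left case_prod_unfold mult_ac)
    qed (simp add: case_prod_unfold)
  qed
  also have "\<dots> = (\<Sum>p\<in>D. \<Sum>(m, n)\<in>A \<times> B. \<Sum>l\<in>L'. ?t m n p * (F n p l * F m l k))"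
  proof -
    have "(\<Sum>m\<in>A. \<Sum>l\<in>L'. \<Sum>n\<in>B. \<Sum>p\<in>D. ?t m n p * (F n p l * F m l k))
      = (\<Sum>m\<in>A. \<Sum>l\<in>L'. \<Sum>p\<in>D. \<Sum>n\<in>B. ?t m n p * (F n p l * F m l k))"
      by (rule sum.cong[OF refl], rule sum.cong[OF refl], rule sum.swap)
    also have "\<dots> = (\<Sum>m\<in>A. \<Sum>p\<in>D. \<Sum>l\<in>L'. \<Sum>n\<in>B. ?t m n p * (F n p l * F m l k))"
      by (rule sum.cong[OF refl], rule sum.swap)
    also have "\<dots> = (\<Sum>p\<in>D. \<Sum>m\<in>A. \<Sum>l\<in>L'. \<Sum>n\<in>B. ?t m n p * (F n p l * F m l k))"
      by (rule sum.swap)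
    also have "\<dots> = (\<Sum>p\<in>D. \<Sum>m\<in>A. \<Sum>n\<in>B. \<Sum>l\<in>L'. ?t m n p * (F n p l * F m l k))"
      by (rule sum.cong[OF refl], rule sum.cong[OF refl], rule sum.swap)
    finally show ?thesis by (simp only: sum.cartesian_product[symmetric])
  qed
  also have "\<dots> = (\<Sum>p\<in>D. \<Sum>(m, n)\<in>A \<times> B. ?t m n p * (\<Sum>l | F n p l * F m l k \<noteq> 0. F n p l * F m l k))"
  proof (rule sum.cong[OF refl], rule sum.cong[OF refl], clarify)
    fix p m n
    show "(\<Sum>l\<in>L'. ?t m n p * (F n p l * F m l k)) = ?t m n p * (\<Sum>l | F n p l * F m l k \<noteq> 0. F n p l * F m l k)"
    proof (cases "h p = 0 \<or> g n = 0")
      case False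
      then have "{l. F n p l * F m l k \<noteq> 0} \<subseteq> L'" using mem' by auto
      then have "(\<Sum>l | F n p l * F m l k \<noteq> 0. F n p l * F m l k) = (\<Sum>l\<in>L'. F n p l * F m l k)"
        using L' by (intro sum.mono_neutral_left) auto
      then show ?thesis by (simp add: sum_distrib_left)
    qed auto
  qed
  finally show "conv (conv f g) h k = conv f (conv g h) k" unfolding lhs by (simp only: assoc)
qed

lemma quofin_conv: "quofin g \<Longrightarrow> quofin h \<Longrightarrow> quofin (conv g h)"
  using structure_constants.subfin_conv[OF opposite, of h g] by (simp add: opposite_subfin opposite_conv)

lemma bifin_conv [simp]: "bifin g \<Longrightarrow> bifin h \<Longrightarrow> bifin (conv g h)"
  by (simp add: bifin_def subfin_conv quofin_conv)

lemma bifin_assoc: "bifin f \<Longrightarrow> bifin g \<Longrightarrow> bifin h \<Longrightarrow> conv (conv f g) h = conv f (conv g h)"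
  by (simp add: bifin_def conv_assoc)

section \<open>Closure properties and the ring of bifinite functions\<close>

lemma subfin_mono: "subfin f \<Longrightarrow> (\<And>k. g k \<noteq> 0 \<Longrightarrow> f k \<noteq> 0) \<Longrightarrow> subfin g"
  unfolding subfin_def by (blast intro: rev_finite_subset)

lemma subfin_finite: "finite {k. f k \<noteq> 0} \<Longrightarrow> (\<And>k. f k \<noteq> 0 \<Longrightarrow> k \<in> I) \<Longrightarrow> subfin f"
  unfolding subfin_def by (auto intro: rev_finite_subset)

lemma quofin_finite: "finite {k. f k \<noteq> 0} \<Longrightarrow> (\<And>k. f k \<noteq> 0 \<Longrightarrow> k \<in> I) \<Longrightarrow> quofin f"
  unfolding quofin_def by (auto intro: rev_finite_subset)

lemma bifin_finite: "finite {k. f k \<noteq> 0} \<Longrightarrow> (\<And>k. f k \<noteq> 0 \<Longrightarrow> k \<in> I) \<Longrightarrow> bifin f"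
  by (simp add: bifin_def subfin_finite quofin_finite)

lemma subfin_add: "subfin f \<Longrightarrow> subfin g \<Longrightarrow> subfin (\<lambda>k. \<bar>f k\<bar> + \<bar>g k\<bar>)"
  unfolding subfin_def
proof (intro conjI allI impI; elim conjE)
  fix k assume "\<forall>k. f k \<noteq> 0 \<longrightarrow> k \<in> I" "\<forall>k. g k \<noteq> 0 \<longrightarrow> k \<in> I" "\<bar>f k\<bar> + \<bar>g k\<bar> \<noteq> 0"
  then show "k \<in> I" by (metis abs_0 add.right_neutral)
next
  fix k assume "\<forall>k. finite {n. f n \<noteq> 0 \<and> (\<exists>m. F m n k \<noteq> 0)}" "\<forall>k. finite {n. g n \<noteq> 0 \<and> (\<exists>m. F m n k \<noteq> 0)}"
  then have "finite ({n. f n \<noteq> 0 \<and> (\<exists>m. F m n k \<noteq> 0)} \<union> {n. g n \<noteq> 0 \<and> (\<exists>m. F m n k \<noteq> 0)})" by blast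
  then show "finite {n. \<bar>f n\<bar> + \<bar>g n\<bar> \<noteq> 0 \<and> (\<exists>m. F m n k \<noteq> 0)}" by (rule rev_finite_subset) auto
qed

lemma quofin_add: "quofin f \<Longrightarrow> quofin g \<Longrightarrow> quofin (\<lambda>k. \<bar>f k\<bar> + \<bar>g k\<bar>)"
  using structure_constants.subfin_add[OF opposite] by (simp add: opposite_subfin)

lemma quofin_mono: "quofin f \<Longrightarrow> (\<And>k. g k \<noteq> 0 \<Longrightarrow> f k \<noteq> 0) \<Longrightarrow> quofin g"
  using structure_constants.subfin_mono[OF opposite] by (simp add: opposite_subfin)

lemma bifin_add [simp]: "bifin f \<Longrightarrow> bifin g \<Longrightarrow> bifin (\<lambda>k. f k + g k)"
  unfolding bifin_def
  by (auto intro: subfin_mono[OF subfin_add, of f g] quofin_mono[OF quofin_add, of f g])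

lemma bifin_smult [simp]: "bifin f \<Longrightarrow> bifin (\<lambda>k. c * f k)"
  unfolding bifin_def by (auto intro: subfin_mono[of f] quofin_mono[of f])

lemma bifin_zero [simp]: "bifin (\<lambda>k. 0)"
  by (rule bifin_finite) auto

lemma bifin_sum [simp]: "(\<And>i. i \<in> A \<Longrightarrow> bifin (f i)) \<Longrightarrow> bifin (\<lambda>k. \<Sum>i\<in>A. f i k)"
  by (induction A rule: infinite_finite_induct) auto

lemma bifin_delta [simp]: "m \<in> I \<Longrightarrow> bifin (delta m)"
  by (rule bifin_finite) (auto simp: delta_def split: if_splits)

lemma conv_add_left:
  assumes "bifin h"
  shows "conv (\<lambda>k. f k + g k) h k = conv f h k + conv g h k"
  using assms unfolding bifin_def
  by (simp add: conv_pairs[of h h] sum.distrib[symmetric] case_prod_unfold algebra_simps)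

lemma conv_smult_left: "conv (\<lambda>k. c * f k) h k = c * conv f h k" if "bifin h"
  using that unfolding bifin_def
  by (simp add: conv_pairs[of h h] sum_distrib_left case_prod_unfold algebra_simps)

lemma conv_zero_left [simp]: "conv (\<lambda>k. 0) h = (\<lambda>k. 0)"
  by (rule ext) (simp add: conv_def)

lemma conv_zero_right [simp]: "conv h (\<lambda>k. 0) = (\<lambda>k. 0)"
  by (rule ext) (simp add: conv_def)

lemma conv_add_right:
  assumes "bifin h"
  shows "conv h (\<lambda>k. f k + g k) k = conv h f k + conv h g k"
  using structure_constants.conv_add_left[OF opposite, of h f g k] assms by (simp add: opposite_bifin opposite_conv)

lemma conv_smult_right: "bifin h \<Longrightarrow> conv h (\<lambda>k. c * f k) k = c * conv h f k"
  using structure_constants.conv_smult_left[OF opposite, of h c f k] by (simp add: opposite_bifin opposite_conv)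

lemma conv_sum_left:
  "bifin h \<Longrightarrow> conv (\<lambda>k. \<Sum>i\<in>A. f i k) h k = (\<Sum>i\<in>A. conv (f i) h k)"
  by (induction A rule: infinite_finite_induct) (simp_all add: conv_add_left)

lemma conv_sum_right:
  "bifin h \<Longrightarrow> conv h (\<lambda>k. \<Sum>i\<in>A. f i k) k = (\<Sum>i\<in>A. conv h (f i) k)"
  by (induction A rule: infinite_finite_induct) (simp_all add: conv_add_right)

lemma conv_unit_left:
  assumes "\<And>k. f k \<noteq> 0 \<Longrightarrow> k \<in> I"
  shows "conv (delta u) f = f"
proof
  fix k
  have "conv (delta u) f k = (\<Sum>(m, n)\<in>{(u, k)}. delta u m * f n * F m n k)"
  proof (rule conv_eq)
    fix m n assume "delta u m \<noteq> 0" "f n \<noteq> 0" "F m n k \<noteq> 0"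
    then show "(m, n) \<in> {(u, k)}"
      using unit_left[of n k] F_I[of m n k] by (auto simp: delta_def split: if_splits)
  qed simp
  also have "\<dots> = f k" using unit_left[of k k] assms[of k] by (cases "f k = 0") (auto simp: delta_def)
  finally show "conv (delta u) f k = f k" .
qed

lemma conv_unit_right:
  assumes "\<And>k. f k \<noteq> 0 \<Longrightarrow> k \<in> I"
  shows "conv f (delta u) = f"
  using structure_constants.conv_unit_left[OF opposite, of f] assms
  by (simp add: structure_constants.delta_def[OF opposite] delta_def[abs_def] opposite_conv)

lemma bifin_I: "bifin f \<Longrightarrow> f k \<noteq> 0 \<Longrightarrow> k \<in> I"
  by (simp add: bifin_def subfin_def)

definition BF :: "('a \<Rightarrow> rat) ring" where
  "BF = \<lparr>carrier = Collect bifin, monoid.mult = conv, monoid.one = delta u,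
    ring.zero = (\<lambda>_. 0), ring.add = (\<lambda>f g k. f k + g k)\<rparr>"

lemma BF_simps [simp]: "carrier BF = Collect bifin" "x \<otimes>\<^bsub>BF\<^esub> y = conv x y" "\<one>\<^bsub>BF\<^esub> = delta u"
  "\<zero>\<^bsub>BF\<^esub> = (\<lambda>_. 0)" "x \<oplus>\<^bsub>BF\<^esub> y = (\<lambda>k. x k + y k)"
  by (simp_all add: BF_def)

lemma ring_BF: "ring BF"
proof (rule ringI)
  show "abelian_group BF"
  proof (rule abelian_groupI)
    fix f assume "f \<in> carrier BF"
    then have "(\<lambda>k. - 1 * f k) \<in> carrier BF" unfolding BF_simps mem_Collect_eq by (rule bifin_smult[of f "- 1"])
    then show "\<exists>y\<in>carrier BF. y \<oplus>\<^bsub>BF\<^esub> f = \<zero>\<^bsub>BF\<^esub>" by (intro bexI[of _ "\<lambda>k. - 1 * f k"]) auto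
  qed (auto simp: algebra_simps)
  show "Group.monoid BF"
    by (rule monoidI) (auto simp: bifin_assoc u_in intro!: conv_unit_left conv_unit_right dest: bifin_I)
qed (auto simp: conv_add_left conv_add_right)

end

section \<open>Power series in an exceptional class\<close>

lemma q_fact_Suc: "q_fact q (Suc n) = q_int q (Suc n) * q_fact q n"
  by (simp add: q_fact_def)

lemma q_int_pos: "q \<ge> 1 \<Longrightarrow> n > 0 \<Longrightarrow> q_int q n > 0"
  unfolding q_int_def by (rule sum_pos) auto

lemma q_fact_pos: "q \<ge> 1 \<Longrightarrow> q_fact q n > 0"
  unfolding q_fact_def by (rule prod_pos) (auto intro: q_int_pos)

lemma q_int_geometric: "(of_nat q - 1) * of_nat (q_int q n) = (of_nat q ^ n - 1 :: rat)"
  by (induction n) (simp_all add: q_int_def algebra_simps)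

lemma q_int_add: "q_int q (m + n) = q_int q m + q ^ m * q_int q n"
  by (induction n) (simp_all add: q_int_def algebra_simps power_add)

text \<open>What the Hall numbers know about E alone: \<open>a\<close> and \<open>b\<close> stand
  for |Hom(-,E)| and |Hom(E,-)|. Accordingly \<open>a\<close> grows from quotients and
  \<open>b\<close> from subobjects, and \<open>a_e\<close>, \<open>b_e\<close> reflect Ext^1(E,E) =
  0. Reversing the product exchanges \<open>a\<close> and \<open>b\<close>.\<close>

locale exceptional_algebra = structure_constants I F u
  for I :: "'a set" and F :: "'a \<Rightarrow> 'a \<Rightarrow> 'a \<Rightarrow> rat" and u :: 'a +
  fixes e :: 'a and q :: nat and a b :: "'a \<Rightarrow> nat"
  assumes e_in: "e \<in> I" and q_ge_2: "q \<ge> 2"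
    and a_mono: "F m n k \<noteq> 0 \<Longrightarrow> a m \<le> a k"
    and b_mono: "F m n k \<noteq> 0 \<Longrightarrow> b n \<le> b k"
    and a_e: "F e n k \<noteq> 0 \<Longrightarrow> a k = q * a n"
    and b_e: "F m e k \<noteq> 0 \<Longrightarrow> b k = q * b m"
    and a_u: "a u = 1" and b_u: "b u = 1"
    and a_power: "k \<in> I \<Longrightarrow> \<exists>n. a k = q ^ n"
    and b_power: "k \<in> I \<Longrightarrow> \<exists>n. b k = q ^ n"
begin

lemma opposite_exceptional: "exceptional_algebra I (\<lambda>m n. F n m) u e q b a"
proof -
  interpret op: structure_constants I "\<lambda>m n. F n m" u by (rule opposite)
  show ?thesis
    by unfold_locales (use e_in q_ge_2 a_mono b_mono a_e b_e a_u b_u a_power b_power in auto)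
qed

section \<open>Powers of the exceptional class\<close>

definition X :: "'a \<Rightarrow> rat" where "X = delta e"

lemma bifin_X [simp]: "bifin X" by (simp add: X_def e_in)

fun Xp :: "nat \<Rightarrow> 'a \<Rightarrow> rat" where
  "Xp 0 = delta u"
| "Xp (Suc n) = conv (Xp n) X"

lemma bifin_Xp [simp]: "bifin (Xp n)"
  by (induction n) (simp_all add: u_in)

lemma unit_l [simp]: "bifin f \<Longrightarrow> conv (delta u) f = f"
  and unit_r [simp]: "bifin f \<Longrightarrow> conv f (delta u) = f"
  by (auto intro!: conv_unit_left conv_unit_right dest: bifin_I)

lemma Xp_Suc_left: "Xp (Suc n) = conv X (Xp n)"
  by (induction n) (simp_all add: bifin_assoc)

lemma Xp_add: "Xp (m + n) = conv (Xp m) (Xp n)"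
  by (induction n) (simp_all add: bifin_assoc)

lemma finite_Xp: "finite {k. Xp n k \<noteq> 0}"
proof (induction n)
  case (Suc n)
  have "{k. Xp (Suc n) k \<noteq> 0} \<subseteq> (\<Union>m\<in>{k. Xp n k \<noteq> 0}. {k. F m e k \<noteq> 0})"
    by (auto elim!: conv_nonzero simp: X_def delta_def split: if_splits)
  then show ?case using Suc finite_middle by (meson finite_UN_I finite_subset)
qed (simp add: delta_def)

lemma b_Xp: "Xp n k \<noteq> 0 \<Longrightarrow> b k = q ^ n"
proof (induction n arbitrary: k)
  case (Suc n)
  from Suc.prems obtain m where "Xp n m \<noteq> 0" "F m e k \<noteq> 0"
    by (auto elim!: conv_nonzero simp: X_def delta_def split: if_splits)
  then show ?case using Suc.IH b_e by simp
qed (simp add: delta_def b_u split: if_splits)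

lemma a_Xp: "Xp n k \<noteq> 0 \<Longrightarrow> a k = q ^ n"
proof (induction n arbitrary: k)
  case (Suc n)
  from Suc.prems obtain m where "Xp n m \<noteq> 0" "F e m k \<noteq> 0"
    unfolding Xp_Suc_left by (auto elim!: conv_nonzero simp: X_def delta_def split: if_splits)
  then show ?case using Suc.IH a_e by simp
qed (simp add: delta_def a_u split: if_splits)

lemma q_power_less: "q ^ i \<le> m \<Longrightarrow> m < q ^ N \<Longrightarrow> i < N"
  using q_ge_2 by (meson leD le_trans linorder_not_less power_increasing one_le_numeral order.trans)

lemma less_q_power: "m < q ^ m"
  using q_ge_2 by (meson less_exp order_less_le_trans power_mono zero_le)

text \<open>Substitution of the class of E into a power series. By \<open>b_Xp\<close> a given class
  occurs in at most one power, so the sum has at most one term.\<close>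

definition \<phi> :: "rat fps \<Rightarrow> 'a \<Rightarrow> rat" where
  "\<phi> f k = (\<Sum>n | Xp n k \<noteq> 0. fps_nth f n * Xp n k)"

lemma phi_trunc_b: "b k < q ^ N \<Longrightarrow> \<phi> f k = (\<Sum>n<N. fps_nth f n * Xp n k)"
  unfolding \<phi>_def by (rule sum.mono_neutral_left) (use b_Xp q_power_less in \<open>fastforce+\<close>)

lemma phi_trunc_a: "a k < q ^ N \<Longrightarrow> \<phi> f k = (\<Sum>n<N. fps_nth f n * Xp n k)"
  unfolding \<phi>_def by (rule sum.mono_neutral_left) (use a_Xp q_power_less in \<open>fastforce+\<close>)

lemma phi_nonzero: "\<phi> f k \<noteq> 0 \<Longrightarrow> \<exists>n. Xp n k \<noteq> 0"
  by (rule ccontr) (simp add: \<phi>_def)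

text \<open>If the i-th power of X involves a subobject class of k, then q^i is at most b k, which
  leaves finitely many i; each power has finite support. For quotients the bound comes from
  \<open>a\<close>.\<close>

lemma bifin_phi [simp]: "bifin (\<phi> f)"
proof -
  have I: "k \<in> I" if "\<phi> f k \<noteq> 0" for k using phi_nonzero[OF that] bifin_I[OF bifin_Xp] by blast
  have "finite {n. \<phi> f n \<noteq> 0 \<and> (\<exists>m. F m n k \<noteq> 0)}" for k
  proof (rule finite_subset)
    show "{n. \<phi> f n \<noteq> 0 \<and> (\<exists>m. F m n k \<noteq> 0)} \<subseteq> (\<Union>i<b k. {n. Xp i n \<noteq> 0})"
    proof
      fix n assume "n \<in> {n. \<phi> f n \<noteq> 0 \<and> (\<exists>m. F m n k \<noteq> 0)}"
      then obtain m i where "F m n k \<noteq> 0" and i: "Xp i n \<noteq> 0" using phi_nonzero by blast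
      then have "q ^ i \<le> b k" using b_mono b_Xp by metis
      then have "i < b k" using q_power_less less_q_power by blast
      then show "n \<in> (\<Union>i<b k. {n. Xp i n \<noteq> 0})" using i by blast
    qed
    show "finite (\<Union>i<b k. {n. Xp i n \<noteq> 0})" using finite_Xp by blast
  qed
  moreover have "finite {m. \<phi> f m \<noteq> 0 \<and> (\<exists>n. F m n k \<noteq> 0)}" for k
  proof (rule finite_subset)
    show "{m. \<phi> f m \<noteq> 0 \<and> (\<exists>n. F m n k \<noteq> 0)} \<subseteq> (\<Union>i<a k. {n. Xp i n \<noteq> 0})"
    proof
      fix m assume "m \<in> {m. \<phi> f m \<noteq> 0 \<and> (\<exists>n. F m n k \<noteq> 0)}"
      then obtain n i where "F m n k \<noteq> 0" and i: "Xp i m \<noteq> 0" using phi_nonzero by blast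
      then have "q ^ i \<le> a k" using a_mono a_Xp by metis
      then have "i < a k" using q_power_less less_q_power by blast
      then show "m \<in> (\<Union>i<a k. {n. Xp i n \<noteq> 0})" using i by blast
    qed
    show "finite (\<Union>i<a k. {n. Xp i n \<noteq> 0})" using finite_Xp by blast
  qed
  ultimately show ?thesis using I by (auto simp: bifin_def subfin_def quofin_def)
qed

lemma conv_cong_left: "(\<And>m n. F m n k \<noteq> 0 \<Longrightarrow> f m = f' m) \<Longrightarrow> conv f g k = conv f' g k"
  unfolding conv_def by (rule sum.cong) auto

lemma conv_cong_right: "(\<And>m n. F m n k \<noteq> 0 \<Longrightarrow> g n = g' n) \<Longrightarrow> conv f g k = conv f g' k"
  unfolding conv_def by (rule sum.cong) auto

text \<open>A left factor involves quotients of k, so \<open>a\<close> decides where the series may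
  be truncated; for a right factor it is \<open>b\<close>.\<close>

lemma conv_phi_left:
  assumes "bifin z" "a k < q ^ N"
  shows "conv (\<phi> f) z k = (\<Sum>n<N. fps_nth f n * conv (Xp n) z k)"
proof -
  have "conv (\<phi> f) z k = conv (\<lambda>m. \<Sum>n<N. fps_nth f n * Xp n m) z k"
    by (rule conv_cong_left, rule phi_trunc_a) (meson a_mono assms(2) le_less_trans)
  then show ?thesis using assms(1) by (simp add: conv_sum_left conv_smult_left)
qed

lemma conv_phi_right:
  assumes "bifin z" "b k < q ^ N"
  shows "conv z (\<phi> f) k = (\<Sum>n<N. fps_nth f n * conv z (Xp n) k)"
proof -
  have "conv z (\<phi> f) k = conv z (\<lambda>m. \<Sum>n<N. fps_nth f n * Xp n m) k"
    by (rule conv_cong_right, rule phi_trunc_b) (meson b_mono assms(2) le_less_trans)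
  then show ?thesis using assms(1) by (simp add: conv_sum_right conv_smult_right)
qed

lemma conv_Xp_right_zero: "b k < q ^ n \<Longrightarrow> conv z (Xp n) k = 0"
proof (rule ccontr)
  assume lt: "b k < q ^ n" and "conv z (Xp n) k \<noteq> 0"
  then obtain m l where "Xp n l \<noteq> 0" "F m l k \<noteq> 0" by (metis conv_nonzero)
  then show False using b_Xp b_mono lt by (metis leD)
qed

lemma phi_add: "\<phi> (f + g) k = \<phi> f k + \<phi> g k"
  by (simp add: \<phi>_def sum.distrib algebra_simps)

lemma phi_const_mult: "\<phi> (fps_const c * f) k = c * \<phi> f k"
  by (simp add: \<phi>_def sum_distrib_left mult.assoc)

lemma phi_monom: "\<phi> (fps_X ^ n) = Xp n"
proof
  fix k
  have "\<phi> (fps_X ^ n) k = (\<Sum>i | Xp i k \<noteq> 0. if i = n then Xp n k else 0)"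
    unfolding \<phi>_def by (rule sum.cong) (auto simp: fps_X_power_nth)
  also have "\<dots> = Xp n k"
  proof -
    have "finite {i. Xp i k \<noteq> 0}"
      by (rule finite_subset[of _ "{..<b k}"]) (use b_Xp q_power_less less_q_power in \<open>fastforce+\<close>)
    then show ?thesis by (simp add: sum.delta)
  qed
  finally show "\<phi> (fps_X ^ n) k = Xp n k" .
qed

lemma phi_1: "\<phi> 1 = delta u"
  using phi_monom[of 0] by simp

lemma phi_X: "\<phi> fps_X = X"
  using phi_monom[of 1] by simp

text \<open>The Cauchy product, after both series are truncated at a common N. Since N < q^N, the
  maximum of a k and b k is large enough.\<close>

lemma phi_mult: "\<phi> (f * g) = conv (\<phi> f) (\<phi> g)"
proof
  fix k
  define N where "N = max (a k) (b k)"
  have aN: "a k < q ^ N" and bN: "b k < q ^ N"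
    using less_q_power[of N] by (simp_all add: N_def)
  have z: "n < N" if "Xp n k \<noteq> 0" for n
    using b_Xp[OF that] q_power_less[of n "b k" N] bN by simp
  have "conv (\<phi> f) (\<phi> g) k = (\<Sum>i<N. fps_nth f i * (\<Sum>j<N. fps_nth g j * Xp (i + j) k))"
    using conv_phi_left[OF bifin_phi aN] conv_phi_right[OF bifin_Xp bN] by (simp add: Xp_add)
  also have "\<dots> = (\<Sum>(i, j)\<in>{..<N} \<times> {..<N}. fps_nth f i * fps_nth g j * Xp (i + j) k)"
    by (simp add: sum_distrib_left mult.assoc sum.cartesian_product)
  \<comment> \<open>Terms of the square with i + j at least N vanish, because no such power of X
    involves k.\<close>
  also have "\<dots> = (\<Sum>(i, j)\<in>{(i, j). i + j < N}. fps_nth f i * fps_nth g j * Xp (i + j) k)"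
    by (rule sum.mono_neutral_right) (auto dest: z)
  also have "\<dots> = (\<Sum>n<N. \<Sum>i\<le>n. fps_nth f i * fps_nth g (n - i) * Xp (i + (n - i)) k)"
    by (rule sum.triangle_reindex)
  also have "\<dots> = (\<Sum>n<N. fps_nth (f * g) n * Xp n k)"
    by (simp add: fps_mult_nth sum_distrib_right atMost_atLeast0)
  also have "\<dots> = \<phi> (f * g) k" by (rule phi_trunc_b[OF bN, symmetric])
  finally show "\<phi> (f * g) k = conv (\<phi> f) (\<phi> g) k" by simp
qed

lemma conv_phi_comm: "conv (\<phi> f) (\<phi> g) = conv (\<phi> g) (\<phi> f)"
  by (simp flip: phi_mult add: mult.commute)

lemma opposite_Xp: "exceptional_algebra.Xp (\<lambda>m n. F n m) u e n = Xp n"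
proof (induction n)
  case 0
  show ?case by (simp only: exceptional_algebra.Xp.simps(1)[OF opposite_exceptional] Xp.simps(1))
next
  case (Suc n)
  show ?case
    unfolding exceptional_algebra.Xp.simps(2)[OF opposite_exceptional] Suc opposite_conv Xp_Suc_left ..
qed

lemma opposite_phi: "exceptional_algebra.\<phi> (\<lambda>m n. F n m) u e f = \<phi> f"
  by (rule ext) (simp add: exceptional_algebra.\<phi>_def[OF opposite_exceptional] \<phi>_def opposite_Xp)

text \<open>\<open>ex j\<close> is \<open>exp\<^sub>q(q\<^sup>j x)\<close>.\<close>

definition sj :: "int \<Rightarrow> rat fps" where
  "sj j = 1 + fps_const ((of_nat q - 1) * of_nat q powi j) * fps_X"

definition ex :: "int \<Rightarrow> rat fps" where
  "ex j = Abs_fps (\<lambda>n. (of_nat q powi j) ^ n / of_nat (q_fact q n))"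

lemma q_gr_0 [simp]: "0 < q" using q_ge_2 by simp

lemma q_fact_gr_0 [simp]: "0 < q_fact q n"
  using q_fact_pos[of q n] q_ge_2 by simp

lemma q_int_gr_0 [simp]: "0 < q_int q (Suc n)"
  using q_int_pos[of q "Suc n"] q_ge_2 by simp

text \<open>The q-difference equation exp_q(q x) = (1 + (q - 1) x) exp_q(x), with x rescaled by q^j.
  It is the origin of the family \<open>sj\<close>; on coefficients it amounts to (q - 1) [n]_q =
  q^n - 1.\<close>

lemma ex_Suc: "ex (j + 1) = ex j * sj j"
proof (rule fps_ext)
  fix n
  have p: "(of_nat q :: rat) powi (j + 1) = of_nat q powi j * of_nat q"
    using power_int_add_1[of "of_nat q :: rat" j] q_ge_2 by simp
  define c where "c = (of_nat q :: rat) powi j"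
  have s: "ex j * sj j = ex j + fps_const ((of_nat q - 1) * c) * (fps_X * ex j)"
    by (simp add: sj_def c_def algebra_simps)
  show "fps_nth (ex (j + 1)) n = fps_nth (ex j * sj j) n"
  proof (cases n)
    case 0
    then show ?thesis unfolding s by (simp add: ex_def)
  next
    case (Suc m)
    define f where "f = (of_nat (q_fact q m) :: rat)"
    define g where "g = (of_nat (q_int q (Suc m)) :: rat)"
    have fg: "f \<noteq> 0" "g \<noteq> 0" unfolding f_def g_def by simp_all
    have geo: "(of_nat q - 1) * g = of_nat q ^ Suc m - 1"
      unfolding g_def by (rule q_int_geometric)
    have "c ^ Suc m * of_nat q ^ Suc m / (g * f) = c ^ Suc m / (g * f) + (of_nat q - 1) * c * (c ^ m / f)"
    proof -
      have "(of_nat q - 1) * c * (c ^ m / f) = ((of_nat q - 1) * g) * c ^ Suc m / (g * f)" using fg by simp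
      then show ?thesis unfolding geo by (simp add: diff_divide_distrib algebra_simps)
    qed
    then show ?thesis unfolding s
      by (simp add: ex_def Suc p q_fact_Suc power_mult_distrib c_def[symmetric] f_def[symmetric] g_def[symmetric] del: power_Suc)
  qed
qed

lemma ex_unit: "inverse (ex j) * ex j = 1" "ex j * inverse (ex j) = 1"
proof -
  have "fps_nth (ex j) 0 \<noteq> 0" by (simp add: ex_def q_fact_def)
  then show "inverse (ex j) * ex j = 1" by (rule inverse_mult_eq_1)
  then show "ex j * inverse (ex j) = 1" by (simp add: mult.commute)
qed

lemma sj_unit: "inverse (sj j) * sj j = 1" "sj j * inverse (sj j) = 1"
proof -
  have "fps_nth (sj j) 0 \<noteq> 0" by (simp add: sj_def)
  then show "inverse (sj j) * sj j = 1" by (rule inverse_mult_eq_1)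
  then show "sj j * inverse (sj j) = 1" by (simp add: mult.commute)
qed

definition H :: "'a set \<Rightarrow> ('a \<Rightarrow> rat) set" where
  "H B = {y. finite {k. y k \<noteq> 0} \<and> (\<forall>k. y k \<noteq> 0 \<longrightarrow> k \<in> B)}"

text \<open>The denominators, kept as power series rather than as their values under
  \<open>\<phi>\<close> because there they commute and are invertible.\<close>

inductive_set sprod :: "rat fps set" where
  one: "1 \<in> sprod"
| mult: "f \<in> sprod \<Longrightarrow> sj j * f \<in> sprod"

text \<open>A concrete model of the localization: all functions generated by finite combinations of
  classes in B and the inverses of the \<open>sj\<close>. It will turn out to be the image of the
  abstract localization.\<close>

inductive_set loc :: "'a set \<Rightarrow> ('a \<Rightarrow> rat) set" for B where
  base: "y \<in> H B \<Longrightarrow> y \<in> loc B"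
| inv: "\<phi> (inverse (sj j)) \<in> loc B"
| add: "y \<in> loc B \<Longrightarrow> z \<in> loc B \<Longrightarrow> (\<lambda>k. y k + z k) \<in> loc B"
| mult: "y \<in> loc B \<Longrightarrow> z \<in> loc B \<Longrightarrow> conv y z \<in> loc B"

text \<open>\<open>good B\<close> collects what is needed about the subcategory with classes \<open>B\<close>: the two Ore conditions
  for the family \<open>sj\<close>, and stability of the localization under conjugation by the q-exponential.
  It is self-dual.\<close>

definition good :: "'a set \<Rightarrow> bool" where
  "good B \<longleftrightarrow> B \<subseteq> I \<and> u \<in> B \<and> e \<in> B \<and> (\<forall>m n k. F m n k \<noteq> 0 \<longrightarrow> m \<in> B \<longrightarrow> n \<in> B \<longrightarrow> k \<in> B) \<and>
    (\<forall>y\<in>H B. \<forall>j. \<exists>z\<in>H B. \<exists>f\<in>sprod. conv (\<phi> (sj j)) z = conv y (\<phi> f)) \<and>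
    (\<forall>y\<in>H B. \<forall>j. \<exists>z\<in>H B. \<exists>f\<in>sprod. conv z (\<phi> (sj j)) = conv (\<phi> f) y) \<and>
    (\<forall>y\<in>H B. conv (conv (\<phi> (ex 0)) y) (\<phi> (inverse (ex 0))) \<in> loc B) \<and>
    (\<forall>y\<in>H B. conv (conv (\<phi> (inverse (ex 0))) y) (\<phi> (ex 0)) \<in> loc B)"

lemma bifin_H: "y \<in> H B \<Longrightarrow> B \<subseteq> I \<Longrightarrow> bifin y"
  by (rule bifin_finite) (auto simp: H_def)

lemma bifin_loc: "y \<in> loc B \<Longrightarrow> B \<subseteq> I \<Longrightarrow> bifin y"
  by (induction rule: loc.induct) (auto intro: bifin_H)

lemma opposite_loc: "exceptional_algebra.loc (\<lambda>m n. F n m) u e q B = loc B"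
proof -
  interpret op: exceptional_algebra I "\<lambda>m n. F n m" u e q b a by (rule opposite_exceptional)
  have "y \<in> op.loc B \<Longrightarrow> y \<in> loc B" for y
    by (induction rule: op.loc.induct) (auto simp: opposite_phi opposite_conv intro: loc.intros)
  moreover have "y \<in> loc B \<Longrightarrow> y \<in> op.loc B" for y
  proof (induction rule: loc.induct)
    case (inv j)
    show ?case using op.loc.inv[of j] by (simp add: opposite_phi)
  next
    case (mult y z)
    show ?case using op.loc.mult[OF mult.IH(2,1)] by (simp add: opposite_conv)
  qed (auto intro: op.loc.intros)
  ultimately show ?thesis by blast
qed

text \<open>Reversing the product exchanges the two Ore conditions, and also conjugation by the
  q-exponential with conjugation by its inverse; the remaining clauses are symmetric.\<close>

lemma opposite_good: "exceptional_algebra.good I (\<lambda>m n. F n m) u e q B \<Longrightarrow> good B"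
  unfolding exceptional_algebra.good_def[OF opposite_exceptional] good_def
    opposite_conv opposite_phi opposite_loc
  by (auto simp: bifin_assoc bifin_H)

end

section \<open>The Ore condition and conjugation by the q-exponential\<close>

locale exceptional_subalgebra = exceptional_algebra I F u e q a b
  for I :: "'a set" and F and u e and q :: nat and a b :: "'a \<Rightarrow> nat" +
  fixes B :: "'a set"
  assumes B_I: "B \<subseteq> I" and u_B: "u \<in> B" and e_B: "e \<in> B"
    and B_closed: "\<lbrakk>F m n k \<noteq> 0; m \<in> B; n \<in> B\<rbrakk> \<Longrightarrow> k \<in> B"
begin

lemma q_int_neq_0 [simp]: "q_int q (Suc n) \<noteq> 0" and q_fact_neq_0 [simp]: "q_fact q n \<noteq> 0"
  using q_int_gr_0[of n] q_fact_gr_0[of n] by linarith+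

lemma H_bifin [simp]: "y \<in> H B \<Longrightarrow> bifin y"
  by (rule bifin_H[OF _ B_I])

lemma loc_bifin [simp]: "y \<in> loc B \<Longrightarrow> bifin y"
  by (rule bifin_loc[OF _ B_I])

lemma H_add: "y \<in> H B \<Longrightarrow> z \<in> H B \<Longrightarrow> (\<lambda>k. y k + z k) \<in> H B"
proof -
  assume yz: "y \<in> H B" "z \<in> H B"
  then have "finite ({k. y k \<noteq> 0} \<union> {k. z k \<noteq> 0})" by (simp add: H_def)
  then have "finite {k. y k + z k \<noteq> 0}" by (rule rev_finite_subset) auto
  then show ?thesis using yz unfolding H_def by (auto, metis add.right_neutral)
qed

lemma H_smult: "y \<in> H B \<Longrightarrow> (\<lambda>k. c * y k) \<in> H B"
  unfolding H_def by (auto intro: rev_finite_subset)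

lemma H_conv: "y \<in> H B \<Longrightarrow> z \<in> H B \<Longrightarrow> conv y z \<in> H B"
proof -
  assume yz: "y \<in> H B" "z \<in> H B"
  have "{k. conv y z k \<noteq> 0} \<subseteq> (\<Union>m\<in>{k. y k \<noteq> 0}. \<Union>n\<in>{k. z k \<noteq> 0}. {k. F m n k \<noteq> 0})"
    by (auto elim!: conv_nonzero)
  moreover have "finite (\<Union>m\<in>{k. y k \<noteq> 0}. \<Union>n\<in>{k. z k \<noteq> 0}. {k. F m n k \<noteq> 0})"
    using yz finite_middle by (auto simp: H_def)
  ultimately have "finite {k. conv y z k \<noteq> 0}" by (rule finite_subset)
  moreover have "k \<in> B" if nz: "conv y z k \<noteq> 0" for k
  proof -
    obtain m n where "y m \<noteq> 0" "z n \<noteq> 0" "F m n k \<noteq> 0" using conv_nonzero[OF nz] .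
    moreover from this have "m \<in> B" "n \<in> B" using yz by (simp_all add: H_def)
    ultimately show ?thesis using B_closed by blast
  qed
  ultimately show ?thesis by (simp add: H_def)
qed

lemma H_delta: "m \<in> B \<Longrightarrow> delta m \<in> H B"
  by (simp add: H_def delta_def)

lemma phi_sj: "\<phi> (sj j) k = delta u k + (of_nat q - 1) * of_nat q powi j * X k"
  unfolding sj_def by (simp add: phi_add phi_const_mult phi_1 phi_X)

lemma H_sj: "\<phi> (sj j) \<in> H B"
proof -
  have "\<phi> (sj j) = (\<lambda>k. delta u k + (of_nat q - 1) * of_nat q powi j * X k)" by (rule ext) (rule phi_sj)
  then show ?thesis using H_add H_smult H_delta u_B e_B by (simp add: X_def)
qed

lemma H_sprod: "f \<in> sprod \<Longrightarrow> \<phi> f \<in> H B"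
  by (induction rule: sprod.induct) (simp_all add: phi_1 phi_mult H_delta u_B H_conv H_sj)

lemma sprod_mult: "f \<in> sprod \<Longrightarrow> g \<in> sprod \<Longrightarrow> f * g \<in> sprod"
  by (induction rule: sprod.induct) (simp_all add: mult.assoc sprod.intros)

lemma sprod_sj: "sj j \<in> sprod"
  using sprod.mult[OF sprod.one, of j] by simp

lemma conj_add:
  assumes "bifin f" "bifin g"
  shows "conv (conv f (\<lambda>k. y k + z k)) g = (\<lambda>k. conv (conv f y) g k + conv (conv f z) g k)"
proof -
  have *: "conv f (\<lambda>k. y k + z k) = (\<lambda>k. conv f y k + conv f z k)"
    by (rule ext) (rule conv_add_right[OF assms(1)])
  show ?thesis unfolding * by (rule ext) (rule conv_add_left[OF assms(2)])
qed

end

text \<open>Here \<open>x\<close> stands for |Ext^1(E,-)|. The assumption \<open>step\<close> says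
  that at each class k the products [E][m] and [m][E] agree up to the factor a m / b m, unless k
  comes from a nonsplit extension of E by m.\<close>

locale exceptional_perp = exceptional_subalgebra I F u e q a b B
  for I :: "'a set" and F and u e and q :: nat and a b :: "'a \<Rightarrow> nat" and B +
  fixes x :: "'a \<Rightarrow> nat"
  assumes step: "\<lbrakk>m \<in> B; F e m k * of_nat (b m) \<noteq> F m e k * of_nat (a m)\<rbrakk> \<Longrightarrow>
        F e m k \<noteq> 0 \<and> b k = b m \<and> x k < x m"
begin

text \<open>Elements homogeneous of degree i: on split terms left multiplication by X is q^i times
  right multiplication. The bound d on \<open>x\<close> is the induction parameter, limiting how
  many q-commutators can be nonzero.\<close>

definition Vd :: "int \<Rightarrow> nat \<Rightarrow> ('a \<Rightarrow> rat) set" where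
  "Vd i d = {y \<in> H B. \<forall>k. y k \<noteq> 0 \<longrightarrow> of_nat (a k) = (of_nat q powi i :: rat) * of_nat (b k) \<and> x k \<le> d}"

definition Dq :: "int \<Rightarrow> ('a \<Rightarrow> rat) \<Rightarrow> 'a \<Rightarrow> rat" where
  "Dq i y k = conv X y k - of_nat q powi i * conv y X k"

lemma b_nonzero: "k \<in> I \<Longrightarrow> b k \<noteq> 0"
proof -
  assume "k \<in> I"
  from b_power[OF this] obtain n where n: "b k = q ^ n" ..
  show ?thesis unfolding n by simp
qed

lemma X_apply: "X m = (if m = e then 1 else 0)"
  unfolding X_def delta_def by (rule refl)

lemma conv_X_left:
  assumes "y \<in> H B"
  shows "conv X y k = (\<Sum>m | y m \<noteq> 0. y m * F e m k)"
proof -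
  have "conv X y k = (\<Sum>(m, n)\<in>{e} \<times> {m. y m \<noteq> 0}. X m * y n * F m n k)"
  proof (rule conv_eq)
    show "finite ({e} \<times> {m. y m \<noteq> 0})" using assms by (simp add: H_def)
    show "(m, n) \<in> {e} \<times> {m. y m \<noteq> 0}" if "X m \<noteq> 0" "y n \<noteq> 0" for m n
      using that by (simp add: X_apply split: if_splits)
  qed
  also have "\<dots> = (\<Sum>m | y m \<noteq> 0. y m * F e m k)"
    unfolding sum.cartesian_product[symmetric] by (simp add: X_apply)
  finally show ?thesis .
qed

lemma conv_X_right:
  assumes "y \<in> H B"
  shows "conv y X k = (\<Sum>m | y m \<noteq> 0. y m * F m e k)"
proof -
  have "conv y X k = (\<Sum>(m, n)\<in>{m. y m \<noteq> 0} \<times> {e}. y m * X n * F m n k)"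
  proof (rule conv_eq)
    show "finite ({m. y m \<noteq> 0} \<times> {e})" using assms by (simp add: H_def)
    show "(m, n) \<in> {m. y m \<noteq> 0} \<times> {e}" if "y m \<noteq> 0" "X n \<noteq> 0" for m n
      using that by (simp add: X_apply split: if_splits)
  qed
  also have "\<dots> = (\<Sum>m | y m \<noteq> 0. y m * F m e k)"
    unfolding sum.cartesian_product[symmetric] by (simp add: X_apply)
  finally show ?thesis .
qed

text \<open>In degree i the split terms satisfy F e m k = q^i F m e k and cancel in
  \<open>Dq i y\<close>, so only nonsplit extensions contribute.\<close>

lemma Dq_nonzero:
  assumes y: "y \<in> Vd i d" and nz: "Dq i y k \<noteq> 0"
  shows "\<exists>m. y m \<noteq> 0 \<and> F e m k \<noteq> 0 \<and> b k = b m \<and> x k < x m"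
proof -
  have yH: "y \<in> H B" using y by (simp add: Vd_def)
  have "Dq i y k = (\<Sum>m | y m \<noteq> 0. y m * (F e m k - of_nat q powi i * F m e k))"
    unfolding Dq_def conv_X_left[OF yH] conv_X_right[OF yH]
    by (simp add: sum_distrib_left sum_subtractf[symmetric] algebra_simps)
  then obtain m where m: "y m \<noteq> 0" "F e m k - of_nat q powi i * F m e k \<noteq> 0"
    using nz by (metis (mono_tags, lifting) mem_Collect_eq mult_zero_right sum.neutral)
  have mB: "m \<in> B" using m yH by (simp add: H_def)
  have am: "of_nat (a m) = (of_nat q powi i :: rat) * of_nat (b m)" using y m by (simp add: Vd_def)
  have "F e m k * of_nat (b m) \<noteq> F m e k * of_nat (a m)"
  proof
    assume "F e m k * of_nat (b m) = F m e k * of_nat (a m)"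
    then have "(F e m k - of_nat q powi i * F m e k) * of_nat (b m) = 0" unfolding am by (simp add: algebra_simps)
    then show False using m b_nonzero[of m] mB B_I by auto
  qed
  then show ?thesis using step[OF mB] m by blast
qed

lemma Dq_H: "y \<in> H B \<Longrightarrow> Dq i y \<in> H B"
proof -
  assume y: "y \<in> H B"
  have "X \<in> H B" unfolding X_def by (rule H_delta[OF e_B])
  then have "(\<lambda>k. conv X y k + (- (of_nat q powi i)) * conv y X k) \<in> H B"
    using y by (intro H_add H_smult H_conv)
  then show ?thesis by (simp add: Dq_def[abs_def])
qed

text \<open>On the surviving terms \<open>a\<close> is multiplied by q, by \<open>a_e\<close>, and
  \<open>b\<close> is unchanged, so the degree rises by one; \<open>x\<close> drops
  strictly.\<close>

lemma Dq_Vd: "y \<in> Vd i (Suc d) \<Longrightarrow> Dq i y \<in> Vd (i + 1) d"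
proof -
  assume y: "y \<in> Vd i (Suc d)"
  have yH: "y \<in> H B" using y by (simp add: Vd_def)
  have "of_nat (a k) = (of_nat q powi (i + 1) :: rat) * of_nat (b k) \<and> x k \<le> d" if nz: "Dq i y k \<noteq> 0" for k
  proof -
    obtain m where m: "y m \<noteq> 0" "F e m k \<noteq> 0" "b k = b m" "x k < x m" using Dq_nonzero[OF y nz] by auto
    have "of_nat (a m) = (of_nat q powi i :: rat) * of_nat (b m)" "x m \<le> Suc d" using y m by (simp_all add: Vd_def)
    moreover have "a k = q * a m" using a_e m by blast
    moreover have "(of_nat q :: rat) powi (i + 1) = of_nat q powi i * of_nat q"
      using power_int_add_1[of "of_nat q :: rat" i] q_ge_2 by simp
    ultimately show ?thesis using m by simp
  qed
  then show ?thesis using Dq_H[OF yH] by (simp add: Vd_def)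
qed

lemma Dq_Vd_0: "y \<in> Vd i 0 \<Longrightarrow> Dq i y = (\<lambda>k. 0)"
proof
  fix k assume y: "y \<in> Vd i 0"
  show "Dq i y k = 0"
  proof (rule ccontr)
    assume "Dq i y k \<noteq> 0"
    then obtain m where "y m \<noteq> 0" "x k < x m" using Dq_nonzero[OF y] by blast
    then show False using y by (auto simp: Vd_def)
  qed
qed

lemma Vd_smult: "y \<in> Vd i d \<Longrightarrow> (\<lambda>k. c * y k) \<in> Vd i d"
  using H_smult by (auto simp: Vd_def)

text \<open>Both counts of a class are powers of q, so their quotient is an integral, possibly
  negative, power and a single class is homogeneous.\<close>

lemma delta_Vd: "m \<in> B \<Longrightarrow> \<exists>i. delta m \<in> Vd i (x m)"
proof -
  assume m: "m \<in> B"
  then have "m \<in> I" using B_I by blast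
  then obtain s t where st: "a m = q ^ s" "b m = q ^ t" using a_power[of m] b_power[of m] by auto
  then have "of_nat (a m) = (of_nat q powi (int s - int t) :: rat) * of_nat (b m)"
    unfolding st by (simp add: power_int_diff)
  then have "delta m \<in> Vd (int s - int t) (x m)"
    using H_delta[OF m] by (auto simp: Vd_def delta_def)
  then show ?thesis by blast
qed

lemma H_induct [consumes 1, case_names zero add]:
  assumes "y \<in> H B" "P (\<lambda>k. 0)"
    and "\<And>i d y z. y \<in> Vd i d \<Longrightarrow> z \<in> H B \<Longrightarrow> P z \<Longrightarrow> P (\<lambda>k. y k + z k)"
  shows "P y"
proof -
  have ind: "P y" if "finite S" "{k. y k \<noteq> 0} = S" "y \<in> H B" for S y
    using that
  proof (induction S arbitrary: y rule: finite_induct)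
    case empty
    then have "y = (\<lambda>k. 0)" by auto
    then show ?case using assms(2) by simp
  next
    case (insert m S)
    define z where "z = (\<lambda>k. if k = m then 0 else y k)"
    have m: "m \<in> B" using insert.prems by (auto simp: H_def)
    have zs: "{k. z k \<noteq> 0} = S" using insert.prems(1) insert.hyps(2) by (auto simp: z_def)
    have zH: "z \<in> H B" using insert.prems insert.hyps(1) zs by (auto simp: H_def z_def)
    obtain i where "delta m \<in> Vd i (x m)" using delta_Vd[OF m] by blast
    then have "(\<lambda>k. y m * delta m k) \<in> Vd i (x m)" by (rule Vd_smult)
    from assms(3)[OF this zH insert.IH[OF zs zH]]
    have "P (\<lambda>k. y m * delta m k + z k)" .
    moreover have "(\<lambda>k. y m * delta m k + z k) = y" by (auto simp: z_def delta_def)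
    ultimately show ?case by simp
  qed
  have "finite {k. y k \<noteq> 0}" using assms(1) by (simp add: H_def)
  from ind[OF this refl assms(1)] show ?thesis .
qed

text \<open>Moving 1 + c X past y replaces c by c q^i, at the price of c times the q-commutator. The
  resulting shift of j by i, which can have either sign, is why the family is indexed by all
  integers.\<close>

lemma sj_commute:
  assumes y: "y \<in> Vd i d"
  shows "conv (\<phi> (sj j)) y k = conv y (\<phi> (sj (j + i))) k + (of_nat q - 1) * of_nat q powi j * Dq i y k"
proof -
  have yH [simp]: "bifin y" using y by (simp add: Vd_def)
  have s: "\<phi> (sj j) = (\<lambda>k. delta u k + (of_nat q - 1) * of_nat q powi j * X k)" for j by (rule ext) (rule phi_sj)
  have p: "(of_nat q :: rat) powi (j + i) = of_nat q powi j * of_nat q powi i" by (rule power_int_add) (use q_ge_2 in simp)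
  show ?thesis
    unfolding s Dq_def
    by (simp only: conv_add_left[OF yH] conv_add_right[OF yH] conv_smult_left[OF yH] conv_smult_right[OF yH]
        unit_l[OF yH] unit_r[OF yH] p) (simp add: algebra_simps)
qed

text \<open>Induction on the depth: the equation is first solved for the q-commutator of y, whose
  depth is smaller.\<close>

lemma ore_right_Vd: "y \<in> Vd i d \<Longrightarrow> \<exists>z\<in>H B. \<exists>f\<in>sprod. conv (\<phi> (sj j)) z = conv y (\<phi> f)"
proof (induction d arbitrary: i y)
  case 0
  have "conv (\<phi> (sj j)) y = conv y (\<phi> (sj (j + i)))"
    using sj_commute[OF 0] Dq_Vd_0[OF 0] by (intro ext) simp
  then show ?case using 0 sprod_sj by (auto simp: Vd_def)
next
  case (Suc d)
  have y: "y \<in> H B" and [simp]: "bifin y" using Suc.prems by (simp_all add: Vd_def)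
  define c where "c = (of_nat q - 1) * (of_nat q :: rat) powi j"
  obtain z f where z: "z \<in> H B" "f \<in> sprod" and eq: "conv (\<phi> (sj j)) z = conv (Dq i y) (\<phi> f)"
    using Suc.IH[OF Dq_Vd[OF Suc.prems]] by blast
  note [simp] = H_bifin[OF z(1)] H_bifin[OF Dq_H[OF y]]
  have s: "conv (\<phi> (sj j)) y = (\<lambda>k. conv y (\<phi> (sj (j + i))) k + c * Dq i y k)"
    unfolding c_def by (rule ext) (rule sj_commute[OF Suc.prems])
  \<comment> \<open>The correction by \<open>z\<close> removes the q-commutator that appears when
    \<open>sj j\<close> is moved past y, leaving y times \<open>sj (j + i)\<close> times f.\<close>
  define w where "w = (\<lambda>k. conv y (\<phi> f) k + (- c) * z k)"
  have "w \<in> H B" unfolding w_def by (intro H_add H_smult H_conv y z H_sprod)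
  moreover have "conv (\<phi> (sj j)) w = conv y (\<phi> (sj (j + i) * f))"
  proof
    fix k
    have "conv (\<phi> (sj j)) w k = conv (conv (\<phi> (sj j)) y) (\<phi> f) k + (- c) * conv (Dq i y) (\<phi> f) k"
      unfolding w_def eq[symmetric] by (simp add: conv_add_right conv_smult_right bifin_assoc del: mult_minus_left)
    also have "\<dots> = conv y (\<phi> (sj (j + i) * f)) k"
      unfolding s phi_mult by (simp add: conv_add_left conv_smult_left bifin_assoc)
    finally show "conv (\<phi> (sj j)) w k = conv y (\<phi> (sj (j + i) * f)) k" .
  qed
  ultimately show ?case using sprod.mult[OF z(2)] by blast
qed

text \<open>Although the commutation rule moves denominators from left to right, it also serves this
  side: starting from \<open>sj (j - i)\<close> the factor that appears on the right is
  \<open>sj j\<close>.\<close>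

lemma ore_left_Vd: "y \<in> Vd i d \<Longrightarrow> \<exists>z\<in>H B. \<exists>f\<in>sprod. conv z (\<phi> (sj j)) = conv (\<phi> f) y"
proof (induction d arbitrary: i y)
  case 0
  have "conv (\<phi> (sj (j - i))) y = conv y (\<phi> (sj j))"
    using sj_commute[OF 0, of "j - i"] Dq_Vd_0[OF 0] by (intro ext) simp
  then show ?case using 0 sprod_sj by (metis (mono_tags, lifting) Vd_def mem_Collect_eq)
next
  case (Suc d)
  have y: "y \<in> H B" and [simp]: "bifin y" using Suc.prems by (simp_all add: Vd_def)
  define c where "c = (of_nat q - 1) * (of_nat q :: rat) powi (j - i)"
  obtain z f where z: "z \<in> H B" "f \<in> sprod" and eq: "conv z (\<phi> (sj j)) = conv (\<phi> f) (Dq i y)"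
    using Suc.IH[OF Dq_Vd[OF Suc.prems]] by blast
  note [simp] = H_bifin[OF z(1)] H_bifin[OF Dq_H[OF y]]
  have s: "conv (\<phi> (sj (j - i))) y = (\<lambda>k. conv y (\<phi> (sj j)) k + c * Dq i y k)"
    unfolding c_def using sj_commute[OF Suc.prems, of "j - i"] by (intro ext) simp
  define w where "w = (\<lambda>k. conv (\<phi> f) y k + c * z k)"
  have "w \<in> H B" unfolding w_def by (intro H_add H_smult H_conv y z H_sprod)
  moreover have "conv w (\<phi> (sj j)) = conv (\<phi> (sj (j - i) * f)) y"
  proof
    fix k
    have "conv w (\<phi> (sj j)) k = conv (\<phi> f) (conv y (\<phi> (sj j))) k + c * conv (\<phi> f) (Dq i y) k"
      unfolding w_def eq[symmetric] by (simp add: conv_add_left conv_smult_left bifin_assoc)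
    also have "\<dots> = conv (\<phi> f) (conv (\<phi> (sj (j - i))) y) k"
      unfolding s by (simp add: conv_add_right conv_smult_right)
    also have "\<dots> = conv (\<phi> (sj (j - i) * f)) y k"
      unfolding mult.commute[of _ f] phi_mult by (simp add: bifin_assoc)
    finally show "conv w (\<phi> (sj j)) k = conv (\<phi> (sj (j - i) * f)) y k" .
  qed
  ultimately show ?case using sprod.mult[OF z(2)] by blast
qed

lemma ore_right: "y \<in> H B \<Longrightarrow> \<exists>z\<in>H B. \<exists>f\<in>sprod. conv (\<phi> (sj j)) z = conv y (\<phi> f)"
proof (induction rule: H_induct)
  case zero
  have "(\<lambda>k. 0) \<in> H B" by (simp add: H_def)
  then show ?case using sprod.one by (intro bexI[of _ "\<lambda>k. 0"] bexI[of _ 1]) simp_all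
next
  case (add i d y y')
  have [simp]: "bifin y" "bifin y'" using add by (simp_all add: Vd_def)
  obtain z f where z: "z \<in> H B" "f \<in> sprod" and eq: "conv (\<phi> (sj j)) z = conv y (\<phi> f)" using ore_right_Vd[OF add(1)] by blast
  obtain z' f' where z': "z' \<in> H B" "f' \<in> sprod" and eq': "conv (\<phi> (sj j)) z' = conv y' (\<phi> f')" using add by blast
  note [simp] = H_bifin[OF z(1)] H_bifin[OF z'(1)]
  \<comment> \<open>Series in X commute, so f f' is a common denominator for the two
    summands.\<close>
  define w where "w = (\<lambda>k. conv z (\<phi> f') k + conv z' (\<phi> f) k)"
  have "w \<in> H B" unfolding w_def by (intro H_add H_conv z z' H_sprod)
  moreover have "conv (\<phi> (sj j)) w = conv (\<lambda>k. y k + y' k) (\<phi> (f * f'))"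
  proof
    fix k
    have "conv (\<phi> (sj j)) w k = conv (conv (\<phi> (sj j)) z) (\<phi> f') k + conv (conv (\<phi> (sj j)) z') (\<phi> f) k"
      unfolding w_def by (simp add: conv_add_right bifin_assoc)
    also have "\<dots> = conv y (\<phi> (f * f')) k + conv y' (\<phi> (f * f')) k"
      unfolding eq eq' by (simp add: bifin_assoc phi_mult conv_phi_comm[of f' f])
    finally show "conv (\<phi> (sj j)) w k = conv (\<lambda>k. y k + y' k) (\<phi> (f * f')) k" by (simp add: conv_add_left)
  qed
  ultimately show ?case using sprod_mult[OF z(2) z'(2)] by blast
qed

lemma ore_left: "y \<in> H B \<Longrightarrow> \<exists>z\<in>H B. \<exists>f\<in>sprod. conv z (\<phi> (sj j)) = conv (\<phi> f) y"
proof (induction rule: H_induct)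
  case zero
  have "(\<lambda>k. 0) \<in> H B" by (simp add: H_def)
  then show ?case using sprod.one by (intro bexI[of _ "\<lambda>k. 0"] bexI[of _ 1]) simp_all
next
  case (add i d y y')
  have [simp]: "bifin y" "bifin y'" using add by (simp_all add: Vd_def)
  obtain z f where z: "z \<in> H B" "f \<in> sprod" and eq: "conv z (\<phi> (sj j)) = conv (\<phi> f) y" using ore_left_Vd[OF add(1)] by blast
  obtain z' f' where z': "z' \<in> H B" "f' \<in> sprod" and eq': "conv z' (\<phi> (sj j)) = conv (\<phi> f') y'" using add by blast
  note [simp] = H_bifin[OF z(1)] H_bifin[OF z'(1)]
  define w where "w = (\<lambda>k. conv (\<phi> f') z k + conv (\<phi> f) z' k)"
  have "w \<in> H B" unfolding w_def by (intro H_add H_conv z z' H_sprod)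
  moreover have "conv w (\<phi> (sj j)) = conv (\<phi> (f * f')) (\<lambda>k. y k + y' k)"
  proof
    fix k
    have "conv w (\<phi> (sj j)) k = conv (\<phi> f') (conv z (\<phi> (sj j))) k + conv (\<phi> f) (conv z' (\<phi> (sj j))) k"
      unfolding w_def by (simp add: conv_add_left bifin_assoc)
    also have "\<dots> = conv (\<phi> (f * f')) y k + conv (\<phi> (f * f')) y' k"
      unfolding eq eq' phi_mult by (simp add: bifin_assoc[symmetric] conv_phi_comm[of f' f])
    finally show "conv w (\<phi> (sj j)) k = conv (\<phi> (f * f')) (\<lambda>k. y k + y' k) k" by (simp add: conv_add_right)
  qed
  ultimately show ?case using sprod_mult[OF z(2) z'(2)] by blast
qed

text \<open>The q-binomial expansion of \<open>x\<^sup>n y\<close> for \<open>y\<close> homogeneous of degree \<open>i\<close>; \<open>bb i y k\<close> is the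
  \<open>k\<close>-th iterated q-commutator of \<open>x\<close> and \<open>y\<close>, divided by \<open>[k]\<^sub>q!\<close>.\<close>

primrec bb :: "int \<Rightarrow> ('a \<Rightarrow> rat) \<Rightarrow> nat \<Rightarrow> 'a \<Rightarrow> rat" where
  "bb i y 0 = y"
| "bb i y (Suc k) = (\<lambda>l. (1 / of_nat (q_int q (Suc k))) * Dq (i + int k) (bb i y k) l)"

lemma bb_H: "y \<in> H B \<Longrightarrow> bb i y k \<in> H B"
  by (induction k) (simp_all add: H_smult Dq_H del: times_divide_eq_left)

lemma bb_Vd: "y \<in> Vd i d \<Longrightarrow> k \<le> d \<Longrightarrow> bb i y k \<in> Vd (i + int k) (d - k)"
proof (induction k)
  case (Suc k)
  then have "bb i y k \<in> Vd (i + int k) (Suc (d - Suc k))" by (simp add: Suc_diff_Suc)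
  note Vd_smult[OF Dq_Vd[OF this], of "1 / of_nat (q_int q (Suc k))"]
  moreover have "i + int (Suc k) = i + int k + 1" by simp
  ultimately show ?case by (simp only: bb.simps)
qed simp

lemma bb_zero: "y \<in> Vd i d \<Longrightarrow> d < k \<Longrightarrow> bb i y k = (\<lambda>l. 0)"
proof (induction k)
  case (Suc k)
  have "Dq (i + int k) (bb i y k) = (\<lambda>l. 0)"
  proof (cases "d = k")
    case True
    then show ?thesis using bb_Vd[OF Suc.prems(1), of k] by (intro Dq_Vd_0) simp
  next
    case False
    then have "bb i y k = (\<lambda>l. 0)" using Suc by simp
    then show ?thesis by (simp add: Dq_def[abs_def])
  qed
  then show ?case by simp
qed simp

lemma X_bb:
  assumes "y \<in> H B"
  shows "conv X (bb i y k) l = of_nat q powi (i + int k) * conv (bb i y k) X l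
    + of_nat (q_int q (Suc k)) * bb i y (Suc k) l"
  by (simp add: Dq_def)

text \<open>With bb_k for \<open>bb i y k\<close>, the relation X bb_k = q^(i+k) bb_k X + [k+1]_q
  bb_(k+1) reduces the induction on n to the Pascal-type identity q^k [n+1-k]_q + [k]_q = [n+1]_q.
  Homogeneity of y enters only later, when it makes the bb_k vanish for large k.\<close>

lemma q_binomial:
  assumes y: "y \<in> H B"
  shows "conv (Xp n) y l / of_nat (q_fact q n) =
    (\<Sum>k\<le>n. (of_nat q powi i) ^ (n - k) / of_nat (q_fact q (n - k)) * conv (bb i y k) (Xp (n - k)) l)"
proof (induction n arbitrary: l)
  case 0
  then show ?case using y by simp
next
  case (Suc n)
  define t where "t = (of_nat q powi i :: rat)"
  define c where "c m = t ^ m / of_nat (q_fact q m)" for m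
  define G where "G k m = conv (bb i y k) (Xp m) l" for k m
  have bbB [simp]: "bifin (bb i y k)" for k using bb_H[OF y] by simp
  have yH [simp]: "bifin y" using y by simp
  have IH: "conv (Xp n) y = (\<lambda>l. of_nat (q_fact q n) * (\<Sum>k\<le>n. c (n - k) * conv (bb i y k) (Xp (n - k)) l))"
    using Suc.IH by (intro ext) (simp add: c_def t_def field_simps)
  have qk: "(of_nat q :: rat) powi (i + int k) = t * of_nat q ^ k" for k
    unfolding t_def by (subst power_int_add) (use q_ge_2 in simp_all)
  have XG: "conv X (conv (bb i y k) (Xp m)) l = t * of_nat q ^ k * G k (Suc m) + of_nat (q_int q (Suc k)) * G (Suc k) m" for k m
  proof -
    have xb: "conv X (bb i y k) = (\<lambda>l. t * of_nat q ^ k * conv (bb i y k) X l + of_nat (q_int q (Suc k)) * bb i y (Suc k) l)"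
      by (rule ext) (simp only: X_bb[OF y] qk)
    have e1: "conv X (conv (bb i y k) (Xp m)) = conv (conv X (bb i y k)) (Xp m)"
      by (rule bifin_assoc[OF bifin_X bbB bifin_Xp, symmetric])
    have e2: "conv (conv X (bb i y k)) (Xp m) l = t * of_nat q ^ k * conv (conv (bb i y k) X) (Xp m) l + of_nat (q_int q (Suc k)) * G (Suc k) m"
      unfolding xb G_def by (simp only: conv_add_left conv_smult_left bifin_Xp)
    have e3: "conv (conv (bb i y k) X) (Xp m) l = G k (Suc m)"
      unfolding G_def Xp_Suc_left bifin_assoc[OF bbB bifin_X bifin_Xp] by (rule refl)
    show ?thesis unfolding e1 e2 e3 by (rule refl)
  qed
  have cS: "c m * t = of_nat (q_int q (Suc m)) * c (Suc m)" for m
    by (simp add: c_def q_fact_Suc)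
  have "conv (Xp (Suc n)) y l = conv X (conv (Xp n) y) l"
    unfolding Xp_Suc_left using yH bifin_assoc[OF bifin_X bifin_Xp, of y n] by simp
  also have "\<dots> = of_nat (q_fact q n) * (\<Sum>k\<le>n. c (n - k) * conv X (conv (bb i y k) (Xp (n - k))) l)"
    unfolding IH by (simp add: conv_smult_right conv_sum_right)
  also have "(\<Sum>k\<le>n. c (n - k) * conv X (conv (bb i y k) (Xp (n - k))) l)
    = (\<Sum>k\<le>n. c (n - k) * t * of_nat q ^ k * G k (Suc n - k)) + (\<Sum>k\<le>n. c (n - k) * of_nat (q_int q (Suc k)) * G (Suc k) (n - k))"
    unfolding XG by (simp add: sum.distrib[symmetric] algebra_simps Suc_diff_le)
  also have "(\<Sum>k\<le>n. c (n - k) * t * of_nat q ^ k * G k (Suc n - k))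
    = (\<Sum>k\<le>n. of_nat (q_int q (Suc n - k)) * of_nat q ^ k * (c (Suc n - k) * G k (Suc n - k)))"
    unfolding cS by (rule sum.cong) (simp_all add: Suc_diff_le)
  \<comment> \<open>Both sums are brought to the range k \<le> n + 1. The added term carries the
    factor [0]_q = 0: here it is k = n + 1, in the shifted sum below it is k = 0.\<close>
  also have "\<dots> = (\<Sum>k\<le>Suc n. of_nat (q_int q (Suc n - k)) * of_nat q ^ k * (c (Suc n - k) * G k (Suc n - k)))"
    by (simp add: q_int_def)
  also have "(\<Sum>k\<le>n. c (n - k) * of_nat (q_int q (Suc k)) * G (Suc k) (n - k))
    = (\<Sum>k\<le>Suc n. of_nat (q_int q k) * (c (Suc n - k) * G k (Suc n - k)))"
    unfolding sum.atMost_Suc_shift by (simp add: q_int_def[of q 0] mult_ac)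
  also have "(\<Sum>k\<le>Suc n. of_nat (q_int q (Suc n - k)) * of_nat q ^ k * (c (Suc n - k) * G k (Suc n - k)))
      + (\<Sum>k\<le>Suc n. of_nat (q_int q k) * (c (Suc n - k) * G k (Suc n - k)))
    = (\<Sum>k\<le>Suc n. of_nat (q_int q (Suc n)) * (c (Suc n - k) * G k (Suc n - k)))"
  proof -
    have "of_nat (q_int q (Suc n - k)) * of_nat q ^ k + of_nat (q_int q k) = (of_nat (q_int q (Suc n)) :: rat)" if "k \<le> Suc n" for k
    proof -
      have "q_int q (Suc n) = q_int q k + q ^ k * q_int q (Suc n - k)"
        using q_int_add[of q k "Suc n - k"] that by simp
      then show ?thesis by simp
    qed
    then show ?thesis
      by (simp only: sum.distrib[symmetric] distrib_right[symmetric]) (rule sum.cong, simp_all only: atMost_iff)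
  qed
  finally have "conv (Xp (Suc n)) y l = of_nat (q_fact q n) * (of_nat (q_int q (Suc n)) * (\<Sum>k\<le>Suc n. c (Suc n - k) * G k (Suc n - k)))"
    by (simp only: sum_distrib_left)
  then show ?case by (simp add: q_fact_Suc c_def G_def t_def)
qed

text \<open>Summing the q-binomial formula over n and regrouping by n = j + m separates the
  q-commutators from an exponential series in q^i X; the first factor is a finite sum because
  \<open>bb i y j\<close> vanishes for j > d.\<close>

theorem exp_conj:
  assumes y: "y \<in> Vd i d"
  shows "conv (\<phi> (ex 0)) y = conv (\<lambda>k. \<Sum>j\<le>d. bb i y j k) (\<phi> (ex i))"
proof
  fix k
  have yH: "y \<in> H B" using y by (simp add: Vd_def)
  have [simp]: "bifin y" using yH by simp
  have bbB [simp]: "bifin (bb i y j)" for j using bb_H[OF yH] by simp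
  define N where "N = max (a k) (b k)"
  \<comment> \<open>Large enough for the triangle j + m < M to contain the rectangle j \<le> d, m <
    N, outside which the terms vanish at k.\<close>
  define M where "M = Suc (N + d)"
  have bN: "b k < q ^ N" using less_q_power[of N] by (simp add: N_def)
  have aM: "a k < q ^ M" using less_q_power[of M] by (simp add: N_def M_def)
  define t where "t j m = (of_nat q powi i) ^ m / of_nat (q_fact q m) * conv (bb i y j) (Xp m) k" for j m
  have t0: "j \<le> d \<and> m < N" if "t j m \<noteq> 0" for j m
  proof
    show "j \<le> d" using that bb_zero[OF y, of j] by (force simp: t_def)
    show "m < N"
    proof (rule ccontr)
      assume "\<not> m < N"
      then have "q ^ N \<le> q ^ m" using q_ge_2 by (intro power_increasing) auto
      then have "conv (bb i y j) (Xp m) k = 0" using bN by (intro conv_Xp_right_zero) simp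
      then show False using that by (simp add: t_def)
    qed
  qed
  have "conv (\<phi> (ex 0)) y k = (\<Sum>n<M. conv (Xp n) y k / of_nat (q_fact q n))"
    using conv_phi_left[OF _ aM, of y "ex 0"] by (simp add: ex_def)
  also have "\<dots> = (\<Sum>n<M. \<Sum>j\<le>n. t j (n - j))"
    unfolding q_binomial[OF yH, where i = i] t_def ..
  also have "\<dots> = (\<Sum>(j, m)\<in>{(j, m). j + m < M}. t j m)"
    by (rule sum.triangle_reindex[symmetric])
  also have "\<dots> = (\<Sum>(j, m)\<in>{..d} \<times> {..<N}. t j m)"
  proof (rule sum.mono_neutral_right)
    show "finite {(j, m). j + m < M}"
      by (rule finite_subset[of _ "{..M} \<times> {..M}"]) auto
    show "{..d} \<times> {..<N} \<subseteq> {(j, m). j + m < M}" by (auto simp: M_def)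
    show "\<forall>p\<in>{(j, m). j + m < M} - {..d} \<times> {..<N}. (case p of (j, m) \<Rightarrow> t j m) = 0"
      using t0 by fastforce
  qed
  also have "\<dots> = (\<Sum>j\<le>d. \<Sum>m<N. t j m)" by (simp add: sum.cartesian_product)
  also have "\<dots> = (\<Sum>j\<le>d. conv (bb i y j) (\<phi> (ex i)) k)"
  proof (rule sum.cong[OF refl])
    fix j
    show "(\<Sum>m<N. t j m) = conv (bb i y j) (\<phi> (ex i)) k"
      using conv_phi_right[OF bbB bN, of j "ex i"] by (simp add: t_def ex_def)
  qed
  also have "\<dots> = conv (\<lambda>k. \<Sum>j\<le>d. bb i y j k) (\<phi> (ex i)) k" by (simp add: conv_sum_left)
  finally show "conv (\<phi> (ex 0)) y k = conv (\<lambda>k. \<Sum>j\<le>d. bb i y j k) (\<phi> (ex i)) k" .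
qed

section \<open>Conjugation by the q-exponential and the localization\<close>

lemma loc_smult: "y \<in> loc B \<Longrightarrow> (\<lambda>k. c * y k) \<in> loc B"
proof -
  assume y: "y \<in> loc B"
  have "(\<lambda>k. c * delta u k) \<in> H B" by (rule H_smult[OF H_delta[OF u_B]])
  then have "conv (\<lambda>k. c * delta u k) y \<in> loc B" using y loc.intros by blast
  moreover have "conv (\<lambda>k. c * delta u k) y = (\<lambda>k. c * y k)"
    using y by (intro ext) (simp add: conv_smult_left)
  ultimately show ?thesis by simp
qed

lemma loc_sum: "(\<And>j. j \<in> A \<Longrightarrow> f j \<in> loc B) \<Longrightarrow> (\<lambda>k. \<Sum>j\<in>A. f j k) \<in> loc B"
proof (induction A rule: infinite_finite_induct)
  case (insert j A)
  then show ?case using loc.add[of "f j" B "\<lambda>k. \<Sum>j\<in>A. f j k"] by simp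
qed (auto intro!: loc.base simp: H_def)

lemma loc_phi_mult: "\<phi> f \<in> loc B \<Longrightarrow> \<phi> g \<in> loc B \<Longrightarrow> \<phi> (f * g) \<in> loc B"
  unfolding phi_mult by (rule loc.mult)

lemma loc_sj: "\<phi> (sj j) \<in> loc B"
  by (rule loc.base) (rule H_sj)

text \<open>By \<open>ex_Suc\<close> consecutive series \<open>ex j\<close> differ by the factor
  \<open>sj j\<close>, so both quotients telescope into products of \<open>sj\<close> and their
  inverses. The induction runs upwards and downwards from 0.\<close>

lemma ex_ratio_loc: "\<phi> (ex i * inverse (ex 0)) \<in> loc B" "\<phi> (ex 0 * inverse (ex i)) \<in> loc B"
proof -
  have 0: "\<phi> (ex 0 * inverse (ex 0)) \<in> loc B"
    unfolding ex_unit phi_1 by (rule loc.base) (rule H_delta[OF u_B])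
  have s1: "ex (j + 1) * g = (ex j * g) * sj j" for j g by (simp add: ex_Suc mult_ac)
  have s2: "ex j * g = (ex (j + 1) * g) * inverse (sj j)" for j g
    unfolding s1 by (simp add: mult.assoc sj_unit)
  have inv: "inverse (ex (j + 1)) = inverse (ex j) * inverse (sj j)" for j
    by (simp add: ex_Suc fps_inverse_mult)
  have inv2: "inverse (ex j) = inverse (ex (j + 1)) * sj j" for j
    unfolding inv by (simp add: mult.assoc sj_unit)
  show "\<phi> (ex i * inverse (ex 0)) \<in> loc B"
  proof (induction i rule: int_induct[of _ 0])
    case (step1 i)
    show ?case unfolding s1 by (rule loc_phi_mult[OF step1(2) loc_sj])
  next
    case (step2 i)
    have "i - 1 + 1 = i" by simp
    then show ?case unfolding s2[of "i - 1"] using loc_phi_mult[OF step2(2) loc.inv, of "i - 1"] by simp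
  qed (rule 0)
  show "\<phi> (ex 0 * inverse (ex i)) \<in> loc B"
  proof (induction i rule: int_induct[of _ 0])
    case (step1 i)
    have "\<phi> ((ex 0 * inverse (ex i)) * inverse (sj i)) \<in> loc B" by (rule loc_phi_mult[OF step1(2) loc.inv])
    then show ?case unfolding inv by (simp add: mult.assoc)
  next
    case (step2 i)
    have "\<phi> ((ex 0 * inverse (ex i)) * sj (i - 1)) \<in> loc B" by (rule loc_phi_mult[OF step2(2) loc_sj])
    moreover have "i - 1 + 1 = i" by simp
    ultimately show ?case unfolding inv2[of "i - 1"] by (simp add: mult.assoc)
  qed (rule 0)
qed

lemma loc_H: "y \<in> H B \<Longrightarrow> y \<in> loc B" by (rule loc.base)

lemma bb_sum_split: "(\<lambda>k. \<Sum>j\<le>d. bb i y j k) = (\<lambda>k. y k + (\<Sum>j\<in>{1..d}. bb i y j k))"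
proof
  fix k
  have "{..d} = insert 0 {1..d}" by auto
  then show "(\<Sum>j\<le>d. bb i y j k) = y k + (\<Sum>j\<in>{1..d}. bb i y j k)" by simp
qed

lemma conj_Vd:
  assumes y: "y \<in> Vd i d"
  shows "conv (conv (\<phi> (ex 0)) y) (\<phi> (inverse (ex 0))) \<in> loc B"
proof -
  have yH: "y \<in> H B" using y by (simp add: Vd_def)
  have z: "(\<lambda>k. \<Sum>j\<le>d. bb i y j k) \<in> loc B" by (rule loc_sum) (rule loc_H[OF bb_H[OF yH]])
  have "conv (conv (\<phi> (ex 0)) y) (\<phi> (inverse (ex 0))) = conv (\<lambda>k. \<Sum>j\<le>d. bb i y j k) (\<phi> (ex i * inverse (ex 0)))"
    unfolding exp_conj[OF y] phi_mult by (rule bifin_assoc) (use z in simp_all)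
  then show ?thesis using loc.mult[OF z ex_ratio_loc(1)] by simp
qed

text \<open>With E for the exponential and z1 for the sum of the \<open>bb i y j\<close> over j
  \<ge> 1, \<open>exp_conj\<close> reads E y = (y + z1) \<open>ex i\<close>. Solving gives E^-1 y E
  = y R - E^-1 z1 E, where R is the quotient of E by \<open>ex i\<close>; the terms of z1 have
  smaller depth.\<close>

lemma conj_inv_Vd: "y \<in> Vd i d \<Longrightarrow> conv (conv (\<phi> (inverse (ex 0))) y) (\<phi> (ex 0)) \<in> loc B"
proof (induction d arbitrary: i y rule: less_induct)
  case (less d)
  define E where "E = \<phi> (ex 0)"
  define E' where "E' = \<phi> (inverse (ex 0))"
  have EE: "conv E' E = delta u" unfolding E_def E'_def by (simp flip: phi_mult add: ex_unit phi_1)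
  have bE [simp]: "bifin E" "bifin E'" by (simp_all add: E_def E'_def)
  have yH: "y \<in> H B" using less.prems by (simp add: Vd_def)
  have [simp]: "bifin y" using yH by simp
  have bbB [simp]: "bifin (bb i y j)" for j using bb_H[OF yH] by simp
  define z1 where "z1 = (\<lambda>k. \<Sum>j\<in>{1..d}. bb i y j k)"
  have z1 [simp]: "bifin z1" by (simp add: z1_def)
  define R where "R = \<phi> (ex 0 * inverse (ex i))"
  have R [simp]: "bifin R" by (simp add: R_def)
  have ER: "conv (\<phi> (ex i)) R = E"
    unfolding R_def E_def by (simp flip: phi_mult add: mult.left_commute[of "ex i"] ex_unit)
  have bs: "(\<lambda>k. \<Sum>j\<le>d. bb i y j k) = (\<lambda>k. y k + z1 k)" unfolding bb_sum_split z1_def by (rule refl)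
  have "conv E y = conv (\<lambda>k. y k + z1 k) (\<phi> (ex i))"
    unfolding E_def exp_conj[OF less.prems] bs by (rule refl)
  then have "conv (conv E y) R = conv (\<lambda>k. y k + z1 k) E"
    by (simp add: bifin_assoc ER)
  then have "conv E' (conv (conv E y) R) = conv E' (conv (\<lambda>k. y k + z1 k) E)" by simp
  moreover have "conv E' (conv (conv E y) R) = conv y R"
  proof -
    have "conv E' (conv (conv E y) R) = conv (conv (conv E' E) y) R" by (simp add: bifin_assoc)
    then show ?thesis by (simp add: EE)
  qed
  moreover have "conv E' (conv (\<lambda>k. y k + z1 k) E) = (\<lambda>k. conv (conv E' y) E k + conv (conv E' z1) E k)"
  proof -
    have A: "conv E' (conv (\<lambda>k. y k + z1 k) E) = conv (conv E' (\<lambda>k. y k + z1 k)) E"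
      by (rule bifin_assoc[symmetric]) simp_all
    have A': "conv E' (\<lambda>k. y k + z1 k) = (\<lambda>k. conv E' y k + conv E' z1 k)"
      by (rule ext) (rule conv_add_right[OF bE(2)])
    show ?thesis unfolding A A' by (rule ext) (rule conv_add_left[OF bE(1)])
  qed
  ultimately have eq: "conv (conv E' y) E = (\<lambda>k. conv y R k + (-1) * conv (conv E' z1) E k)"
    by (simp add: fun_eq_iff)
  have yR: "conv y R \<in> loc B" unfolding R_def by (rule loc.mult[OF loc_H[OF yH] ex_ratio_loc(2)])
  have z1E: "conv (conv E' z1) E \<in> loc B"
  proof -
    have "conv (conv E' z1) E = (\<lambda>k. \<Sum>j\<in>{1..d}. conv (conv E' (bb i y j)) E k)"
    proof -
      have "conv E' z1 = (\<lambda>k. \<Sum>j\<in>{1..d}. conv E' (bb i y j) k)"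
        unfolding z1_def by (rule ext) (simp add: conv_sum_right)
      then show ?thesis by (intro ext) (simp add: conv_sum_left)
    qed
    moreover have "conv (conv E' (bb i y j)) E \<in> loc B" if "j \<in> {1..d}" for j
      unfolding E_def E'_def using that by (intro less.IH[OF _ bb_Vd[OF less.prems]]) auto
    ultimately show ?thesis using loc_sum[of "{1..d}" "\<lambda>j. conv (conv E' (bb i y j)) E"] by simp
  qed
  show ?case unfolding E_def[symmetric] E'_def[symmetric] eq by (rule loc.add[OF yR loc_smult[OF z1E]])
qed

lemma conj_H: "y \<in> H B \<Longrightarrow> conv (conv (\<phi> (ex 0)) y) (\<phi> (inverse (ex 0))) \<in> loc B"
proof (induction rule: H_induct)
  case zero
  then show ?case by (simp add: loc.base H_def)
next
  case (add i d y z)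
  show ?case unfolding conj_add[OF bifin_phi bifin_phi] by (rule loc.add[OF conj_Vd[OF add(1)] add(3)])
qed

lemma conj_inv_H: "y \<in> H B \<Longrightarrow> conv (conv (\<phi> (inverse (ex 0))) y) (\<phi> (ex 0)) \<in> loc B"
proof (induction rule: H_induct)
  case zero
  then show ?case by (simp add: loc.base H_def)
next
  case (add i d y z)
  show ?case unfolding conj_add[OF bifin_phi bifin_phi] by (rule loc.add[OF conj_inv_Vd[OF add(1)] add(3)])
qed

theorem good_B: "good B"
  unfolding good_def using B_I u_B e_B B_closed ore_right ore_left conj_H conj_inv_H by blast

end

section \<open>Evaluation homomorphisms and localizations\<close>

text \<open>Words under concatenation, so that \<open>free_ring X\<close> is a subring of the monoid ring of words.\<close>

instantiation list :: (type) monoid_add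
begin
definition zero_list :: "'a list" where "zero_list = []"
definition plus_list :: "'a list \<Rightarrow> 'a list \<Rightarrow> 'a list" where "plus_list = (@)"
instance by standard (simp_all add: zero_list_def plus_list_def)
end

section \<open>Monoid rings and their evaluation homomorphisms\<close>

definition monoid_ring :: "'w::monoid_add set \<Rightarrow> ('w \<Rightarrow>\<^sub>0 int) ring" where
  "monoid_ring W = \<lparr>carrier = {f. Poly_Mapping.keys f \<subseteq> W}, monoid.mult = (*), monoid.one = 1,
     ring.zero = 0, ring.add = (+)\<rparr>"

lemma monoid_ring_simps [simp]:
  "carrier (monoid_ring W) = {f. Poly_Mapping.keys f \<subseteq> W}" "x \<otimes>\<^bsub>monoid_ring W\<^esub> y = x * y"
  "\<one>\<^bsub>monoid_ring W\<^esub> = 1" "\<zero>\<^bsub>monoid_ring W\<^esub> = 0" "x \<oplus>\<^bsub>monoid_ring W\<^esub> y = x + y"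
  by (simp_all add: monoid_ring_def)

lemma sum_single_keys: "(\<Sum>u\<in>Poly_Mapping.keys p. Poly_Mapping.single u (Poly_Mapping.lookup p u)) = p"
  for p :: "'w \<Rightarrow>\<^sub>0 int"
proof (rule poly_mapping_eqI)
  fix k
  have "Poly_Mapping.lookup (\<Sum>u\<in>Poly_Mapping.keys p. Poly_Mapping.single u (Poly_Mapping.lookup p u)) k
    = (\<Sum>u\<in>Poly_Mapping.keys p. if u = k then Poly_Mapping.lookup p k else 0)"
    unfolding lookup_sum by (rule sum.cong) (auto simp: lookup_single when_def)
  then show "Poly_Mapping.lookup (\<Sum>u\<in>Poly_Mapping.keys p. Poly_Mapping.single u (Poly_Mapping.lookup p u)) k
    = Poly_Mapping.lookup p k"
    by (simp add: in_keys_iff)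
qed

lemma times_eq_double_sum:
  fixes f g :: "'w::monoid_add \<Rightarrow>\<^sub>0 int"
  shows "f * g = (\<Sum>u\<in>Poly_Mapping.keys f. \<Sum>v\<in>Poly_Mapping.keys g.
    Poly_Mapping.single (u + v) (Poly_Mapping.lookup f u * Poly_Mapping.lookup g v))"
proof -
  have "f * g = (\<Sum>u\<in>Poly_Mapping.keys f. Poly_Mapping.single u (Poly_Mapping.lookup f u))
      * (\<Sum>v\<in>Poly_Mapping.keys g. Poly_Mapping.single v (Poly_Mapping.lookup g v))"
    by (simp only: sum_single_keys)
  then show ?thesis by (simp add: sum_product mult_single)
qed

lemma free_ring_eq_monoid_ring: "free_ring X = monoid_ring (lists X)"
  unfolding free_ring_def monoid_ring_def times_eq_double_sum plus_list_def
  by (auto simp: zero_list_def[symmetric] subset_iff in_lists_conv_set)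

lemma int_mpoly_ring_eq_monoid_ring: "int_mpoly_ring = monoid_ring UNIV"
  by (simp add: int_mpoly_ring_def monoid_ring_def)

lemma ring_monoid_ring:
  assumes "0 \<in> W" "\<And>u v. u \<in> W \<Longrightarrow> v \<in> W \<Longrightarrow> u + v \<in> W"
  shows "ring (monoid_ring W)"
proof (rule ringI)
  have mult: "Poly_Mapping.keys (x * y) \<subseteq> W" if "Poly_Mapping.keys x \<subseteq> W" "Poly_Mapping.keys y \<subseteq> W" for x y :: "'a \<Rightarrow>\<^sub>0 int"
    using keys_mult[of x y] that assms(2) by blast
  have add: "Poly_Mapping.keys (x + y) \<subseteq> W" if "Poly_Mapping.keys x \<subseteq> W" "Poly_Mapping.keys y \<subseteq> W" for x y :: "'a \<Rightarrow>\<^sub>0 int"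
    using keys_add[of x y] that by blast
  show "abelian_group (monoid_ring W)"
  proof (rule abelian_groupI)
    fix x assume "x \<in> carrier (monoid_ring W)"
    then show "\<exists>y\<in>carrier (monoid_ring W). y \<oplus>\<^bsub>monoid_ring W\<^esub> x = \<zero>\<^bsub>monoid_ring W\<^esub>"
      by (intro bexI[of _ "- x"]) simp_all
  qed (simp_all add: add add.assoc add.commute)
  show "Group.monoid (monoid_ring W)"
    by (rule monoidI) (simp_all add: mult mult.assoc assms(1))
qed (simp_all add: distrib_left distrib_right)

lemma monoid_ring_minus:
  assumes "0 \<in> W" "\<And>u v. u \<in> W \<Longrightarrow> v \<in> W \<Longrightarrow> u + v \<in> W"
    and "x \<in> carrier (monoid_ring W)" "y \<in> carrier (monoid_ring W)"
  shows "x \<ominus>\<^bsub>monoid_ring W\<^esub> y = x - y"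
proof -
  interpret ring "monoid_ring W" by (rule ring_monoid_ring[OF assms(1,2)])
  have "- y \<in> carrier (monoid_ring W)" using assms(4) by simp
  then have "\<ominus>\<^bsub>monoid_ring W\<^esub> y = - y" using assms(4) by (intro minus_equality) simp_all
  then show ?thesis by (simp add: a_minus_def)
qed

text \<open>Evaluation only asks for a multiplicative map on the monoid, and the target may be
  noncommutative. Words and commutative monomials are both covered.\<close>

locale monoid_ring_eval = ring T for T :: "('t, 'z) ring_scheme" (structure) +
  fixes W :: "'w::monoid_add set" and \<mu> :: "'w \<Rightarrow> 't"
  assumes W0: "0 \<in> W" and Wadd: "\<And>u v. u \<in> W \<Longrightarrow> v \<in> W \<Longrightarrow> u + v \<in> W"
    and mu_closed: "\<And>w. w \<in> W \<Longrightarrow> \<mu> w \<in> carrier T"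
    and mu_0: "\<mu> 0 = \<one>" and mu_add: "\<And>u v. u \<in> W \<Longrightarrow> v \<in> W \<Longrightarrow> \<mu> (u + v) = \<mu> u \<otimes> \<mu> v"
begin

definition ev :: "('w \<Rightarrow>\<^sub>0 int) \<Rightarrow> 't" where
  "ev p = (\<Oplus>w\<in>Poly_Mapping.keys p. [Poly_Mapping.lookup p w] \<cdot> \<mu> w)"

lemma term_closed: "w \<in> W \<Longrightarrow> [(c::int)] \<cdot> \<mu> w \<in> carrier T"
  using mu_closed by (simp add: add.int_pow_closed)

lemma ev_superset:
  assumes "finite A" "Poly_Mapping.keys p \<subseteq> A" "A \<subseteq> W"
  shows "ev p = (\<Oplus>w\<in>A. [Poly_Mapping.lookup p w] \<cdot> \<mu> w)"
  unfolding ev_def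
proof (rule add.finprod_mono_neutral_cong_left)
  fix w assume "w \<in> A - Poly_Mapping.keys p"
  then show "[Poly_Mapping.lookup p w] \<cdot> \<mu> w = \<zero>" by (simp add: in_keys_iff add_pow_int_ge)
qed (use assms term_closed in auto)

lemma ev_closed: "Poly_Mapping.keys p \<subseteq> W \<Longrightarrow> ev p \<in> carrier T"
  unfolding ev_def using term_closed by (intro finsum_closed) auto

lemma ev_add:
  assumes "Poly_Mapping.keys p \<subseteq> W" "Poly_Mapping.keys r \<subseteq> W"
  shows "ev (p + r) = ev p \<oplus> ev r"
proof -
  define A where "A = Poly_Mapping.keys p \<union> Poly_Mapping.keys r"
  have A: "finite A" "A \<subseteq> W" using assms by (auto simp: A_def)
  have "ev (p + r) = (\<Oplus>w\<in>A. [Poly_Mapping.lookup (p + r) w] \<cdot> \<mu> w)"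
    using A keys_add[of p r] by (intro ev_superset) (auto simp: A_def)
  also have "\<dots> = (\<Oplus>w\<in>A. [Poly_Mapping.lookup p w] \<cdot> \<mu> w \<oplus> [Poly_Mapping.lookup r w] \<cdot> \<mu> w)"
    using A mu_closed by (intro finsum_cong') (auto simp: lookup_add add.int_pow_mult intro!: term_closed)
  also have "\<dots> = (\<Oplus>w\<in>A. [Poly_Mapping.lookup p w] \<cdot> \<mu> w) \<oplus> (\<Oplus>w\<in>A. [Poly_Mapping.lookup r w] \<cdot> \<mu> w)"
    using A term_closed by (intro finsum_addf) auto
  also have "\<dots> = ev p \<oplus> ev r"
    using ev_superset[of A p] ev_superset[of A r] A by (simp add: A_def)
  finally show ?thesis .
qed

lemma ev_single: "w \<in> W \<Longrightarrow> ev (Poly_Mapping.single w c) = [c] \<cdot> \<mu> w"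
  using ev_superset[of "{w}" "Poly_Mapping.single w c"] term_closed mu_closed by simp

lemma ev_0: "ev 0 = \<zero>"
  by (simp add: ev_def)

lemma keys_sum_subset: "finite A \<Longrightarrow> (\<And>i. i \<in> A \<Longrightarrow> Poly_Mapping.keys (f i) \<subseteq> W) \<Longrightarrow> Poly_Mapping.keys (\<Sum>i\<in>A. f i) \<subseteq> W"
proof (induction A rule: finite_induct)
  case (insert i A)
  then show ?case using keys_add[of "f i" "\<Sum>i\<in>A. f i"] by fastforce
qed simp

lemma ev_sum:
  assumes "finite A" "\<And>i. i \<in> A \<Longrightarrow> Poly_Mapping.keys (f i) \<subseteq> W"
  shows "ev (\<Sum>i\<in>A. f i) = (\<Oplus>i\<in>A. ev (f i))"
  using assms
proof (induction A rule: finite_induct)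
  case (insert i A)
  have "ev (\<Sum>i\<in>insert i A. f i) = ev (f i) \<oplus> ev (\<Sum>i\<in>A. f i)"
    using insert by (simp add: ev_add keys_sum_subset)
  also have "\<dots> = ev (f i) \<oplus> (\<Oplus>i\<in>A. ev (f i))" using insert by simp
  also have "\<dots> = (\<Oplus>i\<in>insert i A. ev (f i))"
    using insert ev_closed by (subst finsum_insert) auto
  finally show ?case .
qed (simp add: ev_0)

lemma ev_mult:
  assumes "Poly_Mapping.keys p \<subseteq> W" "Poly_Mapping.keys r \<subseteq> W"
  shows "ev (p * r) = ev p \<otimes> ev r"
proof -
  let ?t = "\<lambda>u v. Poly_Mapping.single (u + v) (Poly_Mapping.lookup p u * Poly_Mapping.lookup r v)"
  let ?P = "\<lambda>u. [Poly_Mapping.lookup p u] \<cdot> \<mu> u" and ?R = "\<lambda>v. [Poly_Mapping.lookup r v] \<cdot> \<mu> v"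
  have kt: "Poly_Mapping.keys (?t u v) \<subseteq> W" if "u \<in> Poly_Mapping.keys p" "v \<in> Poly_Mapping.keys r" for u v
    using that assms Wadd by (auto simp: subset_iff)
  have et: "ev (?t u v) = ?P u \<otimes> ?R v" if "u \<in> Poly_Mapping.keys p" "v \<in> Poly_Mapping.keys r" for u v
  proof -
    have uv: "u \<in> W" "v \<in> W" using that assms by auto
    have "ev (?t u v) = [(Poly_Mapping.lookup p u * Poly_Mapping.lookup r v)] \<cdot> (\<mu> u \<otimes> \<mu> v)"
      using ev_single[OF Wadd[OF uv]] mu_add[OF uv] by simp
    also have "\<dots> = [Poly_Mapping.lookup r v] \<cdot> ([Poly_Mapping.lookup p u] \<cdot> (\<mu> u \<otimes> \<mu> v))"
      using mu_closed uv by (simp add: add.int_pow_pow mult.commute)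
    also have "\<dots> = ?P u \<otimes> ?R v"
      using mu_closed uv term_closed by (simp add: add_pow_ldistr_int add_pow_rdistr_int)
    finally show ?thesis .
  qed
  have "ev (p * r) = (\<Oplus>u\<in>Poly_Mapping.keys p. ev (\<Sum>v\<in>Poly_Mapping.keys r. ?t u v))"
    unfolding times_eq_double_sum using kt by (intro ev_sum keys_sum_subset) auto
  also have "\<dots> = (\<Oplus>u\<in>Poly_Mapping.keys p. ?P u \<otimes> ev r)"
  proof (rule finsum_cong')
    show "(\<lambda>u. ?P u \<otimes> ev r) \<in> Poly_Mapping.keys p \<rightarrow> carrier T" using assms term_closed ev_closed by auto
    fix u assume u: "u \<in> Poly_Mapping.keys p"
    then have uW: "u \<in> W" using assms by auto
    have "ev (\<Sum>v\<in>Poly_Mapping.keys r. ?t u v) = (\<Oplus>v\<in>Poly_Mapping.keys r. ev (?t u v))"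
      using kt[OF u] by (intro ev_sum) auto
    also have "\<dots> = (\<Oplus>v\<in>Poly_Mapping.keys r. ?P u \<otimes> ?R v)"
      using et[OF u] term_closed assms uW by (intro finsum_cong') auto
    also have "\<dots> = ?P u \<otimes> ev r"
      unfolding ev_def[of r] using term_closed assms uW by (intro finsum_rdistr[symmetric]) auto
    finally show "ev (\<Sum>v\<in>Poly_Mapping.keys r. ?t u v) = ?P u \<otimes> ev r" .
  qed simp
  also have "\<dots> = ev p \<otimes> ev r"
    unfolding ev_def[of p] using term_closed assms ev_closed by (intro finsum_ldistr[symmetric]) auto
  finally show ?thesis .
qed

lemma ev_hom: "ev \<in> ring_hom (monoid_ring W) T"
proof (rule ring_hom_memI)
  show "ev \<one>\<^bsub>monoid_ring W\<^esub> = \<one>"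
    using ev_single[OF W0, of 1] mu_0 by simp
qed (simp_all add: ev_closed ev_add ev_mult)

end

text \<open>Together 1 and -1 generate all integer coefficients additively, so scalars need no case
  of their own.\<close>

lemma monoid_ring_induct [consumes 1, case_names one minus_one gen add mult]:
  fixes p :: "'w::monoid_add \<Rightarrow>\<^sub>0 int"
  assumes "Poly_Mapping.keys p \<subseteq> W"
    and one: "P 1" and mone: "P (- 1)"
    and gen: "\<And>w. w \<in> W \<Longrightarrow> P (Poly_Mapping.single w 1)"
    and add: "\<And>p r. P p \<Longrightarrow> P r \<Longrightarrow> P (p + r)"
    and mult: "\<And>p r. P p \<Longrightarrow> P r \<Longrightarrow> P (p * r)"
  shows "P p"
proof -
  have zero: "P 0" using add[OF one mone] by simp
  have "P (of_nat n)" "P (- of_nat n)" for n :: nat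
  proof (induction n)
    case (Suc n)
    { case 1 show ?case using add[OF one] Suc by simp }
    { case 2
      have "- of_nat (Suc n) = - 1 + - (of_nat n :: 'w \<Rightarrow>\<^sub>0 int)" by simp
      then show ?case using add[OF mone Suc(2)] by (simp only:) }
  qed (simp_all add: zero)
  then have int: "P (of_int c)" for c :: int by (cases c rule: int_cases2) simp_all
  have s: "P (Poly_Mapping.single w c)" if "w \<in> W" for w c
    using mult[OF int[of c] gen[OF that]] by (simp add: mult_single flip: single_of_int)
  have "P (\<Sum>u\<in>A. Poly_Mapping.single u (Poly_Mapping.lookup p u))" if "finite A" "A \<subseteq> W" for A
    using that by (induction A rule: finite_induct) (simp_all add: zero add s)
  from this[OF finite_keys assms(1)] show ?thesis by (simp only: sum_single_keys)
qed

text \<open>The kernel of h is an ideal containing S, hence contains the generated ideal. So h is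
  constant on cosets, and the choice of a representative is harmless.\<close>

lemma ring_hom_factor:
  assumes R: "ring R" and T: "ring T" and h: "h \<in> ring_hom R T" and S: "S \<subseteq> carrier R"
    and zero: "\<And>s. s \<in> S \<Longrightarrow> h s = \<zero>\<^bsub>T\<^esub>"
  shows "\<exists>g\<in>ring_hom (R Quot (Idl\<^bsub>R\<^esub> S)) T. \<forall>r\<in>carrier R. g (Idl\<^bsub>R\<^esub> S +>\<^bsub>R\<^esub> r) = h r"
proof -
  interpret R: ring R by (rule R)
  interpret T: ring T by (rule T)
  interpret h: ring_hom_ring R T h by (rule ring_hom_ringI2[OF R T h])
  define J where "J = Idl\<^bsub>R\<^esub> S"
  interpret J: ideal J R unfolding J_def by (rule R.genideal_ideal[OF S])
  have "S \<subseteq> a_kernel R T h" unfolding a_kernel_def' using S zero by blast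
  then have JK: "J \<subseteq> a_kernel R T h" unfolding J_def by (rule R.genideal_minimal[OF h.kernel_is_ideal])
  define g where "g c = h (SOME x. x \<in> c)" for c
  have g: "g (J +>\<^bsub>R\<^esub> r) = h r" if r: "r \<in> carrier R" for r
  proof -
    have "r \<in> J +>\<^bsub>R\<^esub> r" using r by (rule J.a_rcos_self)
    then have "(SOME x. x \<in> J +>\<^bsub>R\<^esub> r) \<in> J +>\<^bsub>R\<^esub> r" by (rule someI)
    then obtain j where j: "j \<in> J" "(SOME x. x \<in> J +>\<^bsub>R\<^esub> r) = j \<oplus>\<^bsub>R\<^esub> r" unfolding a_r_coset_def' by blast
    have hj: "h j = \<zero>\<^bsub>T\<^esub>" "j \<in> carrier R" using JK j(1) unfolding a_kernel_def' by blast+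
    show ?thesis unfolding g_def j(2) h.hom_add[OF hj(2) r] hj(1) by (rule T.l_zero[OF h.hom_closed[OF r]])
  qed
  have pi: "(+>\<^bsub>R\<^esub>) J \<in> ring_hom R (R Quot J)" by (rule J.rcos_ring_hom)
  have surj: "\<exists>r\<in>carrier R. c = J +>\<^bsub>R\<^esub> r" if "c \<in> carrier (R Quot J)" for c
    using that by (auto simp: FactRing_def A_RCOSETS_def')
  have "g \<in> ring_hom (R Quot J) T"
  proof (rule ring_hom_memI)
    fix c assume "c \<in> carrier (R Quot J)"
    then obtain r where "r \<in> carrier R" "c = J +>\<^bsub>R\<^esub> r" using surj by blast
    then show "g c \<in> carrier T" using g[of r] h.hom_closed[of r] by simp
  next
    fix c d assume "c \<in> carrier (R Quot J)" "d \<in> carrier (R Quot J)"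
    then obtain r s where rs: "r \<in> carrier R" "s \<in> carrier R" "c = J +>\<^bsub>R\<^esub> r" "d = J +>\<^bsub>R\<^esub> s" using surj by metis
    show "g (c \<otimes>\<^bsub>R Quot J\<^esub> d) = g c \<otimes>\<^bsub>T\<^esub> g d"
      unfolding rs(3,4) ring_hom_mult[OF pi rs(1,2), symmetric] g[OF rs(1)] g[OF rs(2)] g[OF R.m_closed[OF rs(1,2)]]
      by (rule h.hom_mult[OF rs(1,2)])
    show "g (c \<oplus>\<^bsub>R Quot J\<^esub> d) = g c \<oplus>\<^bsub>T\<^esub> g d"
      unfolding rs(3,4) ring_hom_add[OF pi rs(1,2), symmetric] g[OF rs(1)] g[OF rs(2)] g[OF R.a_closed[OF rs(1,2)]]
      by (rule h.hom_add[OF rs(1,2)])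
  next
    show "g \<one>\<^bsub>R Quot J\<^esub> = \<one>\<^bsub>T\<^esub>"
      unfolding ring_hom_one[OF pi, symmetric] g[OF R.one_closed] by (rule h.hom_one)
  qed
  then show ?thesis using g unfolding J_def by blast
qed

lemma quotient_surj:
  assumes "c \<in> carrier (R Quot J)"
  obtains r where "r \<in> carrier R" "c = J +>\<^bsub>R\<^esub> r"
  using assms by (auto simp: FactRing_def A_RCOSETS_def')

section \<open>Free rings\<close>

lemma ring_free_ring: "ring (free_ring X)"
  unfolding free_ring_eq_monoid_ring
  by (rule ring_monoid_ring) (auto simp: zero_list_def plus_list_def)

lemma fr_var_closed: "x \<in> X \<Longrightarrow> fr_var x \<in> carrier (free_ring X)"
  unfolding free_ring_eq_monoid_ring by (simp add: fr_var_def)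

lemma free_ring_minus: "f \<in> carrier (free_ring X) \<Longrightarrow> g \<in> carrier (free_ring X) \<Longrightarrow> f \<ominus>\<^bsub>free_ring X\<^esub> g = f - g"
  unfolding free_ring_eq_monoid_ring
  by (rule monoid_ring_minus) (auto simp: zero_list_def plus_list_def)

lemma free_ring_add: "f \<oplus>\<^bsub>free_ring X\<^esub> g = f + g"
  by (simp add: free_ring_def)

lemma free_ring_eval:
  assumes T: "ring T" and v: "\<And>x. x \<in> X \<Longrightarrow> v x \<in> carrier T"
  shows "\<exists>h\<in>ring_hom (free_ring X) T. \<forall>x\<in>X. h (fr_var x) = v x"
proof -
  interpret T: ring T by (rule T)
  define \<mu> where "\<mu> w = foldr (\<lambda>x y. v x \<otimes>\<^bsub>T\<^esub> y) w \<one>\<^bsub>T\<^esub>" for w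
  have c: "w \<in> lists X \<Longrightarrow> \<mu> w \<in> carrier T" for w
    by (induction w) (auto simp: \<mu>_def v)
  have a: "u \<in> lists X \<Longrightarrow> w \<in> lists X \<Longrightarrow> \<mu> (u @ w) = \<mu> u \<otimes>\<^bsub>T\<^esub> \<mu> w" for u w
  proof (induction u)
    case Nil
    then show ?case using c[of w] by (simp add: \<mu>_def)
  next
    case (Cons x u)
    then show ?case using c[of u] c[of w] v[of x] by (simp add: \<mu>_def T.m_assoc)
  qed
  interpret m: monoid_ring_eval T "lists X" \<mu>
  proof
    show "\<mu> 0 = \<one>\<^bsub>T\<^esub>" by (simp add: \<mu>_def zero_list_def)
  qed (auto simp: c a zero_list_def plus_list_def)
  have "m.ev (fr_var x) = v x" if "x \<in> X" for x
    using m.ev_single[of "[x]" 1] that v by (simp add: fr_var_def \<mu>_def)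
  then show ?thesis unfolding free_ring_eq_monoid_ring using m.ev_hom by blast
qed

lemma free_ring_induct [consumes 1, case_names one minus_one var add mult]:
  assumes "f \<in> carrier (free_ring X)" and "P \<one>\<^bsub>free_ring X\<^esub>" "P (\<ominus>\<^bsub>free_ring X\<^esub> \<one>\<^bsub>free_ring X\<^esub>)"
    and var: "\<And>x. x \<in> X \<Longrightarrow> P (fr_var x)"
    and add: "\<And>f g. f \<in> carrier (free_ring X) \<Longrightarrow> g \<in> carrier (free_ring X) \<Longrightarrow> P f \<Longrightarrow> P g \<Longrightarrow> P (f \<oplus>\<^bsub>free_ring X\<^esub> g)"
    and mult: "\<And>f g. f \<in> carrier (free_ring X) \<Longrightarrow> g \<in> carrier (free_ring X) \<Longrightarrow> P f \<Longrightarrow> P g \<Longrightarrow> P (f \<otimes>\<^bsub>free_ring X\<^esub> g)"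
  shows "P f"
proof -
  interpret fr: ring "free_ring X" by (rule ring_free_ring)
  define Q where "Q f \<longleftrightarrow> f \<in> carrier (free_ring X) \<and> P f" for f
  have m: "f \<otimes>\<^bsub>free_ring X\<^esub> g = f * g" and o: "\<one>\<^bsub>free_ring X\<^esub> = 1" and p: "f \<oplus>\<^bsub>free_ring X\<^esub> g = f + g" for f g
    by (simp_all add: free_ring_eq_monoid_ring)
  have mo: "\<ominus>\<^bsub>free_ring X\<^esub> \<one>\<^bsub>free_ring X\<^esub> = - 1"
    using free_ring_minus[OF fr.zero_closed fr.one_closed] unfolding a_minus_def
    by (simp add: o) (simp add: free_ring_def)
  have Qo: "Q 1" using assms(2) fr.one_closed by (simp add: Q_def o)
  have Qmo: "Q (- 1)" using assms(3) fr.a_inv_closed[OF fr.one_closed] unfolding Q_def mo by simp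
  have Qa: "Q f \<Longrightarrow> Q g \<Longrightarrow> Q (f + g)" for f g using add fr.a_closed unfolding Q_def p by blast
  have Qm: "Q f \<Longrightarrow> Q g \<Longrightarrow> Q (f * g)" for f g using mult fr.m_closed unfolding Q_def m by blast
  have Qw: "Q (Poly_Mapping.single w 1)" if "w \<in> lists X" for w
    using that
  proof (induction w)
    case Nil
    then show ?case using Qo by (metis single_one zero_list_def)
  next
    case (Cons x w)
    have "Poly_Mapping.single (x # w) 1 = fr_var x * Poly_Mapping.single w 1"
      by (simp add: fr_var_def mult_single plus_list_def)
    moreover have "Q (fr_var x)" using Cons var fr_var_closed by (auto simp: Q_def)
    ultimately show ?case using Qm Cons by auto
  qed
  have "Q f"
    by (rule monoid_ring_induct[of f "lists X" Q]) (use assms(1) Qo Qmo Qa Qm Qw in \<open>auto simp: free_ring_eq_monoid_ring\<close>)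
  then show ?thesis by (simp add: Q_def)
qed

section \<open>Free products of rings\<close>

context
  fixes R :: "'r ring" and S :: "'s ring"
  assumes R: "ring R" and S: "ring S"
begin

abbreviation (input) "FX \<equiv> Sum_Type.Plus (carrier R) (carrier S)"

lemma free_product_relations_subset:
  "hom_relations FX Inl R \<union> hom_relations FX Inr S \<subseteq> carrier (free_ring FX)"
proof -
  interpret R: ring R by (rule R)
  interpret S: ring S by (rule S)
  interpret fr: ring "free_ring FX" by (rule ring_free_ring)
  have d: "f - g \<in> carrier (free_ring FX)" if "f \<in> carrier (free_ring FX)" "g \<in> carrier (free_ring FX)" for f g
    using free_ring_minus[OF that] fr.minus_closed[OF that] by simp
  have p: "f + g \<in> carrier (free_ring FX)" if "f \<in> carrier (free_ring FX)" "g \<in> carrier (free_ring FX)" for f g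
    using fr.a_closed[OF that] by (simp add: free_ring_add)
  show ?thesis
    unfolding hom_relations_def
    by (auto intro!: d p fr_var_closed fr.m_closed fr.one_closed)
qed

lemma ideal_free_product: "ideal (free_product_ideal R S) (free_ring FX)"
  unfolding free_product_ideal_def Let_def
  by (rule ring.genideal_ideal[OF ring_free_ring free_product_relations_subset])

lemma ring_free_product: "ring (free_product R S)"
  unfolding free_product_def by (rule ideal.quotient_is_ring[OF ideal_free_product])

lemma free_product_proj: "(+>\<^bsub>free_ring FX\<^esub>) (free_product_ideal R S) \<in> ring_hom (free_ring FX) (free_product R S)"
  unfolding free_product_def by (rule ideal.rcos_ring_hom[OF ideal_free_product])

lemma free_product_relation:
  assumes "f - g \<in> hom_relations FX Inl R \<union> hom_relations FX Inr S"
    and "f \<in> carrier (free_ring FX)" "g \<in> carrier (free_ring FX)"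
  shows "free_product_ideal R S +>\<^bsub>free_ring FX\<^esub> f = free_product_ideal R S +>\<^bsub>free_ring FX\<^esub> g"
proof -
  have "f - g \<in> free_product_ideal R S"
    unfolding free_product_ideal_def Let_def
    using assms(1) ring.genideal_self[OF ring_free_ring free_product_relations_subset] by blast
  then show ?thesis
    using ring.quotient_eq_iff_same_a_r_cos[OF ring_free_ring ideal_free_product assms(2,3)]
      free_ring_minus[OF assms(2,3)] by simp
qed

lemma fp_left_hom: "fp_left R S \<in> ring_hom R (free_product R S)"
proof -
  interpret R: ring R by (rule R)
  interpret fr: ring "free_ring FX" by (rule ring_free_ring)
  note pi = free_product_proj
  have v: "a \<in> carrier R \<Longrightarrow> fr_var (Inl a) \<in> carrier (free_ring FX)" for a by (rule fr_var_closed) (rule InlI)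
  show ?thesis
  proof (rule ring_hom_memI)
    fix a assume "a \<in> carrier R"
    then show "fp_left R S a \<in> carrier (free_product R S)"
      unfolding fp_left_def using ring_hom_closed[OF pi] v by blast
  next
    fix a b assume ab: "a \<in> carrier R" "b \<in> carrier R"
    show "fp_left R S (a \<otimes>\<^bsub>R\<^esub> b) = fp_left R S a \<otimes>\<^bsub>free_product R S\<^esub> fp_left R S b"
      unfolding fp_left_def ring_hom_mult[OF pi v[OF ab(1)] v[OF ab(2)], symmetric]
    proof (rule free_product_relation)
      show "fr_var (Inl (a \<otimes>\<^bsub>R\<^esub> b)) - (fr_var (Inl a) \<otimes>\<^bsub>free_ring FX\<^esub> fr_var (Inl b))
        \<in> hom_relations FX Inl R \<union> hom_relations FX Inr S"
        unfolding hom_relations_def using ab by blast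
    qed (use ab v in auto)
    show "fp_left R S (a \<oplus>\<^bsub>R\<^esub> b) = fp_left R S a \<oplus>\<^bsub>free_product R S\<^esub> fp_left R S b"
      unfolding fp_left_def ring_hom_add[OF pi v[OF ab(1)] v[OF ab(2)], symmetric]
    proof (rule free_product_relation)
      show "fr_var (Inl (a \<oplus>\<^bsub>R\<^esub> b)) - (fr_var (Inl a) \<oplus>\<^bsub>free_ring FX\<^esub> fr_var (Inl b))
        \<in> hom_relations FX Inl R \<union> hom_relations FX Inr S"
        unfolding free_ring_add hom_relations_def using ab by blast
    qed (use ab v in auto)
  next
    show "fp_left R S \<one>\<^bsub>R\<^esub> = \<one>\<^bsub>free_product R S\<^esub>"
      unfolding fp_left_def ring_hom_one[OF pi, symmetric]
    proof (rule free_product_relation)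
      show "fr_var (Inl \<one>\<^bsub>R\<^esub>) - \<one>\<^bsub>free_ring FX\<^esub> \<in> hom_relations FX Inl R \<union> hom_relations FX Inr S"
        unfolding hom_relations_def by blast
    qed (use v in auto)
  qed
qed

lemma fp_right_hom: "fp_right R S \<in> ring_hom S (free_product R S)"
proof -
  interpret S: ring S by (rule S)
  interpret fr: ring "free_ring FX" by (rule ring_free_ring)
  note pi = free_product_proj
  have v: "a \<in> carrier S \<Longrightarrow> fr_var (Inr a) \<in> carrier (free_ring FX)" for a by (rule fr_var_closed) (rule InrI)
  show ?thesis
  proof (rule ring_hom_memI)
    fix a assume "a \<in> carrier S"
    then show "fp_right R S a \<in> carrier (free_product R S)"
      unfolding fp_right_def using ring_hom_closed[OF pi] v by blast
  next
    fix a b assume ab: "a \<in> carrier S" "b \<in> carrier S"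
    show "fp_right R S (a \<otimes>\<^bsub>S\<^esub> b) = fp_right R S a \<otimes>\<^bsub>free_product R S\<^esub> fp_right R S b"
      unfolding fp_right_def ring_hom_mult[OF pi v[OF ab(1)] v[OF ab(2)], symmetric]
    proof (rule free_product_relation)
      show "fr_var (Inr (a \<otimes>\<^bsub>S\<^esub> b)) - (fr_var (Inr a) \<otimes>\<^bsub>free_ring FX\<^esub> fr_var (Inr b))
        \<in> hom_relations FX Inl R \<union> hom_relations FX Inr S"
        unfolding hom_relations_def using ab by blast
    qed (use ab v in auto)
    show "fp_right R S (a \<oplus>\<^bsub>S\<^esub> b) = fp_right R S a \<oplus>\<^bsub>free_product R S\<^esub> fp_right R S b"
      unfolding fp_right_def ring_hom_add[OF pi v[OF ab(1)] v[OF ab(2)], symmetric]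
    proof (rule free_product_relation)
      show "fr_var (Inr (a \<oplus>\<^bsub>S\<^esub> b)) - (fr_var (Inr a) \<oplus>\<^bsub>free_ring FX\<^esub> fr_var (Inr b))
        \<in> hom_relations FX Inl R \<union> hom_relations FX Inr S"
        unfolding free_ring_add hom_relations_def using ab by blast
    qed (use ab v in auto)
  next
    show "fp_right R S \<one>\<^bsub>S\<^esub> = \<one>\<^bsub>free_product R S\<^esub>"
      unfolding fp_right_def ring_hom_one[OF pi, symmetric]
    proof (rule free_product_relation)
      show "fr_var (Inr \<one>\<^bsub>S\<^esub>) - \<one>\<^bsub>free_ring FX\<^esub> \<in> hom_relations FX Inl R \<union> hom_relations FX Inr S"
        unfolding hom_relations_def by blast
    qed (use v in auto)
  qed
qed

lemma free_product_universal:
  assumes T: "ring T" and f: "f \<in> ring_hom R T" and g: "g \<in> ring_hom S T"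
  shows "\<exists>h\<in>ring_hom (free_product R S) T. (\<forall>r\<in>carrier R. h (fp_left R S r) = f r) \<and> (\<forall>s\<in>carrier S. h (fp_right R S s) = g s)"
proof -
  interpret R: ring R by (rule R)
  interpret S: ring S by (rule S)
  interpret T: ring T by (rule T)
  have "\<And>x. x \<in> FX \<Longrightarrow> case_sum f g x \<in> carrier T"
    using ring_hom_closed[OF f] ring_hom_closed[OF g] by auto
  then obtain h where h: "h \<in> ring_hom (free_ring FX) T" and hv: "\<And>x. x \<in> FX \<Longrightarrow> h (fr_var x) = case_sum f g x"
    using free_ring_eval[OF T, of FX "case_sum f g"] by blast
  interpret fr: ring "free_ring FX" by (rule ring_free_ring)
  interpret h: ring_hom_ring "free_ring FX" T h by (rule ring_hom_ringI2[OF fr.ring_axioms T h])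
  have hm: "h (x - y) = \<zero>\<^bsub>T\<^esub>" if "x \<in> carrier (free_ring FX)" "y \<in> carrier (free_ring FX)" "h x = h y" for x y
    using that free_ring_minus[OF that(1,2)] by (metis T.r_neg a_minus_def h.hom_a_inv h.hom_add h.hom_closed fr.a_inv_closed)
  have v: "x \<in> FX \<Longrightarrow> fr_var x \<in> carrier (free_ring FX)" for x by (rule fr_var_closed)
  have "h s = \<zero>\<^bsub>T\<^esub>" if s: "s \<in> hom_relations FX Inl R \<union> hom_relations FX Inr S" for s
  proof -
    have add: "h (fr_var x + fr_var y) = h (fr_var x) \<oplus>\<^bsub>T\<^esub> h (fr_var y)" "fr_var x + fr_var y \<in> carrier (free_ring FX)"
      if "x \<in> FX" "y \<in> FX" for x y
      using h.hom_add[OF v[OF that(1)] v[OF that(2)]] fr.a_closed[OF v[OF that(1)] v[OF that(2)]] by (simp_all add: free_ring_add)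
    have mul: "h (fr_var x \<otimes>\<^bsub>free_ring FX\<^esub> fr_var y) = h (fr_var x) \<otimes>\<^bsub>T\<^esub> h (fr_var y)"
      if "x \<in> FX" "y \<in> FX" for x y
      using h.hom_mult[OF v[OF that(1)] v[OF that(2)]] .
    have hl: "r \<in> carrier R \<Longrightarrow> h (fr_var (Inl r)) = f r" for r using hv[of "Inl r"] by auto
    have hr: "r \<in> carrier S \<Longrightarrow> h (fr_var (Inr r)) = g r" for r using hv[of "Inr r"] by auto
    have l: "r \<in> carrier R \<Longrightarrow> Inl r \<in> FX" for r by (rule InlI)
    have r: "r \<in> carrier S \<Longrightarrow> Inr r \<in> FX" for r by (rule InrI)
    show ?thesis
      using s unfolding hom_relations_def
    proof (elim UnE CollectE exE conjE)
      fix a b assume ab: "a \<in> carrier R" "b \<in> carrier R"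
      { assume "s = fr_var (Inl (a \<oplus>\<^bsub>R\<^esub> b)) - (fr_var (Inl a) + fr_var (Inl b))"
        then show ?thesis using ab by (auto intro!: hm v add(2) l simp: add(1)[OF l l] hl ring_hom_add[OF f]) }
      { assume "s = fr_var (Inl (a \<otimes>\<^bsub>R\<^esub> b)) - fr_var (Inl a) \<otimes>\<^bsub>free_ring FX\<^esub> fr_var (Inl b)"
        then show ?thesis using ab by (auto intro!: hm v l simp: mul[OF l l] hl ring_hom_mult[OF f]) }
    next
      fix a b assume ab: "a \<in> carrier S" "b \<in> carrier S"
      { assume "s = fr_var (Inr (a \<oplus>\<^bsub>S\<^esub> b)) - (fr_var (Inr a) + fr_var (Inr b))"
        then show ?thesis using ab by (auto intro!: hm v add(2) r simp: add(1)[OF r r] hr ring_hom_add[OF g]) }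
      { assume "s = fr_var (Inr (a \<otimes>\<^bsub>S\<^esub> b)) - fr_var (Inr a) \<otimes>\<^bsub>free_ring FX\<^esub> fr_var (Inr b)"
        then show ?thesis using ab by (auto intro!: hm v r simp: mul[OF r r] hr ring_hom_mult[OF g]) }
    next
      assume "s \<in> {fr_var (Inl \<one>\<^bsub>R\<^esub>) - \<one>\<^bsub>free_ring FX\<^esub>}"
      then show ?thesis by (auto intro!: hm v l simp: hl ring_hom_one[OF f])
    next
      assume "s \<in> {fr_var (Inr \<one>\<^bsub>S\<^esub>) - \<one>\<^bsub>free_ring FX\<^esub>}"
      then show ?thesis by (auto intro!: hm v r simp: hr ring_hom_one[OF g])
    qed
  qed
  from ring_hom_factor[OF ring_free_ring T h free_product_relations_subset this]
  obtain k where k: "k \<in> ring_hom (free_product R S) T"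
    "\<And>r. r \<in> carrier (free_ring FX) \<Longrightarrow> k (free_product_ideal R S +>\<^bsub>free_ring FX\<^esub> r) = h r"
    unfolding free_product_def free_product_ideal_def Let_def by blast
  show ?thesis
  proof (intro bexI[OF _ k(1)] conjI ballI)
    fix r assume "r \<in> carrier R"
    then have "Inl r \<in> FX" by (rule InlI)
    then show "k (fp_left R S r) = f r" unfolding fp_left_def k(2)[OF v[OF \<open>Inl r \<in> FX\<close>]] using hv by simp
  next
    fix s assume "s \<in> carrier S"
    then have "Inr s \<in> FX" by (rule InrI)
    then show "k (fp_right R S s) = g s" unfolding fp_right_def k(2)[OF v[OF \<open>Inr s \<in> FX\<close>]] using hv by simp
  qed
qed

lemma free_product_induct [consumes 1, case_names left right add mult]:
  assumes "c \<in> carrier (free_product R S)"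
    and left: "\<And>r. r \<in> carrier R \<Longrightarrow> P (fp_left R S r)" and right: "\<And>s. s \<in> carrier S \<Longrightarrow> P (fp_right R S s)"
    and add: "\<And>x y. x \<in> carrier (free_product R S) \<Longrightarrow> y \<in> carrier (free_product R S) \<Longrightarrow> P x \<Longrightarrow> P y \<Longrightarrow> P (x \<oplus>\<^bsub>free_product R S\<^esub> y)"
    and mult: "\<And>x y. x \<in> carrier (free_product R S) \<Longrightarrow> y \<in> carrier (free_product R S) \<Longrightarrow> P x \<Longrightarrow> P y \<Longrightarrow> P (x \<otimes>\<^bsub>free_product R S\<^esub> y)"
  shows "P c"
proof -
  interpret R: ring R by (rule R)
  interpret fr: ring "free_ring FX" by (rule ring_free_ring)
  interpret fp: ring "free_product R S" by (rule ring_free_product)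
  let ?pi = "\<lambda>f. free_product_ideal R S +>\<^bsub>free_ring FX\<^esub> f"
  interpret pi: ring_hom_ring "free_ring FX" "free_product R S" ?pi
    by (rule ring_hom_ringI2[OF fr.ring_axioms fp.ring_axioms free_product_proj])
  interpret l: ring_hom_ring R "free_product R S" "fp_left R S"
    by (rule ring_hom_ringI2[OF R fp.ring_axioms fp_left_hom])
  obtain f where f: "f \<in> carrier (free_ring FX)" "c = ?pi f"
    using assms(1) unfolding free_product_def by (rule quotient_surj)
  have "P (?pi f)"
    using f(1)
  proof (induction rule: free_ring_induct)
    case one
    then show ?case using left[OF R.one_closed] l.hom_one pi.hom_one by simp
  next
    case minus_one
    then show ?case using left[OF R.a_inv_closed[OF R.one_closed]] l.hom_one pi.hom_one by simp
  next
    case (var x)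
    then show ?case using left right by (auto simp: fp_left_def fp_right_def)
  next
    case (add f g)
    then show ?case using assms(4) pi.hom_closed by simp
  next
    case (mult f g)
    then show ?case using assms(5) pi.hom_closed by simp
  qed
  then show ?thesis using f(2) by simp
qed

end

section \<open>Polynomial rings over the integers\<close>

lemma ring_int_mpoly_ring: "ring int_mpoly_ring"
  unfolding int_mpoly_ring_eq_monoid_ring by (rule ring_monoid_ring) auto

lemma int_mpoly_induct [case_names one minus_one var add mult]:
  fixes p :: "('i \<Rightarrow>\<^sub>0 nat) \<Rightarrow>\<^sub>0 int"
  assumes one: "P 1" and mone: "P (- 1)" and var: "\<And>i. P (mpoly_var i)"
    and add: "\<And>p r. P p \<Longrightarrow> P r \<Longrightarrow> P (p + r)" and mult: "\<And>p r. P p \<Longrightarrow> P r \<Longrightarrow> P (p * r)"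
  shows "P p"
proof -
  have s: "P (Poly_Mapping.single (Poly_Mapping.single i n) 1)" for i n
  proof (induction n)
    case (Suc n)
    have "Poly_Mapping.single (Poly_Mapping.single i (Suc n)) 1 = mpoly_var i * Poly_Mapping.single (Poly_Mapping.single i n) (1::int)"
      by (simp add: mpoly_var_def mult_single flip: single_add)
    then show ?case using mult[OF var Suc] by simp
  qed (simp add: one)
  have e: "P (Poly_Mapping.single (\<Sum>i\<in>A. Poly_Mapping.single i (d i)) 1)" if "finite A" for A and d :: "'i \<Rightarrow> nat"
    using that
  proof (induction A rule: finite_induct)
    case (insert i A)
    have "Poly_Mapping.single (\<Sum>i\<in>insert i A. Poly_Mapping.single i (d i)) 1
      = Poly_Mapping.single (Poly_Mapping.single i (d i)) 1 * Poly_Mapping.single (\<Sum>i\<in>A. Poly_Mapping.single i (d i)) (1::int)"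
      using insert by (simp add: mult_single)
    then show ?case using mult[OF s insert.IH] by simp
  qed (simp add: one)
  have "P (Poly_Mapping.single w 1)" for w
  proof -
    have "(\<Sum>i\<in>Poly_Mapping.keys w. Poly_Mapping.single i (Poly_Mapping.lookup w i)) = w"
    proof (rule poly_mapping_eqI)
      fix k
      have "Poly_Mapping.lookup (\<Sum>u\<in>Poly_Mapping.keys w. Poly_Mapping.single u (Poly_Mapping.lookup w u)) k
        = (\<Sum>u\<in>Poly_Mapping.keys w. if u = k then Poly_Mapping.lookup w k else 0)"
        unfolding lookup_sum by (rule sum.cong) (auto simp: lookup_single when_def)
      then show "Poly_Mapping.lookup (\<Sum>u\<in>Poly_Mapping.keys w. Poly_Mapping.single u (Poly_Mapping.lookup w u)) k
        = Poly_Mapping.lookup w k"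
        by (simp add: in_keys_iff)
    qed
    then show ?thesis using e[where A = "Poly_Mapping.keys w" and d = "Poly_Mapping.lookup w"] by simp
  qed
  then show ?thesis
    by (intro monoid_ring_induct[of p UNIV P]) (use assms in auto)
qed

text \<open>The variables need commuting values in a ring that may be noncommutative. They are taken
  from a commutative ring and carried over by the multiplicative map \<psi>; in the application this
  ring consists of power series and \<psi> is \<open>\<phi>\<close>.\<close>

lemma int_mpoly_eval:
  fixes g :: "'i \<Rightarrow> 'c::comm_ring_1" and T :: "('t, 'z) ring_scheme"
  assumes T: "ring T" and closed: "\<And>x. \<psi> x \<in> carrier T" and one: "\<psi> 1 = \<one>\<^bsub>T\<^esub>"
    and mult: "\<And>x y. \<psi> (x * y) = \<psi> x \<otimes>\<^bsub>T\<^esub> \<psi> y"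
  shows "\<exists>h\<in>ring_hom int_mpoly_ring T. \<forall>i. h (mpoly_var i) = \<psi> (g i)"
proof -
  interpret T: ring T by (rule T)
  define \<nu> where "\<nu> w = (\<Prod>i\<in>Poly_Mapping.keys w. g i ^ Poly_Mapping.lookup w i)" for w :: "'i \<Rightarrow>\<^sub>0 nat"
  have sup: "\<nu> w = (\<Prod>i\<in>A. g i ^ Poly_Mapping.lookup w i)" if "finite A" "Poly_Mapping.keys w \<subseteq> A" for w A
    unfolding \<nu>_def by (rule prod.mono_neutral_left) (use that in \<open>auto simp: in_keys_iff\<close>)
  have add: "\<nu> (u + w) = \<nu> u * \<nu> w" for u w
  proof -
    let ?A = "Poly_Mapping.keys u \<union> Poly_Mapping.keys w"
    have "\<nu> (u + w) = (\<Prod>i\<in>?A. g i ^ Poly_Mapping.lookup (u + w) i)"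
      by (rule sup) (use keys_add[of u w] in auto)
    also have "\<dots> = (\<Prod>i\<in>?A. g i ^ Poly_Mapping.lookup u i) * (\<Prod>i\<in>?A. g i ^ Poly_Mapping.lookup w i)"
      by (simp add: lookup_add power_add prod.distrib)
    also have "\<dots> = \<nu> u * \<nu> w" using sup[of ?A u] sup[of ?A w] by simp
    finally show ?thesis .
  qed
  interpret m: monoid_ring_eval T UNIV "\<lambda>w. \<psi> (\<nu> w)"
    by unfold_locales (simp_all add: closed add mult, simp add: \<nu>_def one)
  have "m.ev (mpoly_var i) = \<psi> (g i)" for i
    using m.ev_single[of "Poly_Mapping.single i 1" 1] closed by (simp add: mpoly_var_def \<nu>_def)
  then show ?thesis unfolding int_mpoly_ring_eq_monoid_ring using m.ev_hom by blast
qed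

section \<open>Localization by generators and relations\<close>

definition localization_inv :: "'r ring \<Rightarrow> ('i \<Rightarrow> 'r) \<Rightarrow> 'i \<Rightarrow> (('r + (('i \<Rightarrow>\<^sub>0 nat) \<Rightarrow>\<^sub>0 int)) list \<Rightarrow>\<^sub>0 int) set set" where
  "localization_inv R a i = localization_ideal R a +>\<^bsub>free_product R int_mpoly_ring\<^esub> fp_right R int_mpoly_ring (mpoly_var i)"

context
  fixes R :: "'r ring" and a :: "'i \<Rightarrow> 'r"
  assumes R: "ring R" and a: "\<And>i. a i \<in> carrier R"
begin

abbreviation (input) "FP \<equiv> free_product R (int_mpoly_ring :: (('i \<Rightarrow>\<^sub>0 nat) \<Rightarrow>\<^sub>0 int) ring)"
abbreviation (input) "fl \<equiv> fp_left R (int_mpoly_ring :: (('i \<Rightarrow>\<^sub>0 nat) \<Rightarrow>\<^sub>0 int) ring)"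
abbreviation (input) "fx \<equiv> \<lambda>i. fp_right R (int_mpoly_ring :: (('i \<Rightarrow>\<^sub>0 nat) \<Rightarrow>\<^sub>0 int) ring) (mpoly_var i)"
abbreviation (input) "rels \<equiv> range (\<lambda>i. fl (a i) \<otimes>\<^bsub>FP\<^esub> fx i \<ominus>\<^bsub>FP\<^esub> \<one>\<^bsub>FP\<^esub>) \<union> range (\<lambda>i. fx i \<otimes>\<^bsub>FP\<^esub> fl (a i) \<ominus>\<^bsub>FP\<^esub> \<one>\<^bsub>FP\<^esub>)"

lemma ring_FP: "ring FP" by (rule ring_free_product[OF R ring_int_mpoly_ring])

lemma fl_hom: "fl \<in> ring_hom R FP" by (rule fp_left_hom[OF R ring_int_mpoly_ring])

lemma fr_hom: "fp_right R int_mpoly_ring \<in> ring_hom int_mpoly_ring FP" by (rule fp_right_hom[OF R ring_int_mpoly_ring])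

lemma fx_closed: "fx i \<in> carrier FP"
  by (rule ring_hom_closed[OF fr_hom]) (simp add: int_mpoly_ring_def)

lemma rels_subset: "rels \<subseteq> carrier FP"
proof -
  interpret fp: ring FP by (rule ring_FP)
  show ?thesis using fx_closed ring_hom_closed[OF fl_hom a] by auto
qed

lemma localization_ideal_eq: "localization_ideal R a = Idl\<^bsub>FP\<^esub> rels"
  by (simp add: localization_ideal_def Let_def)

lemma ideal_localization: "ideal (localization_ideal R a) FP"
  unfolding localization_ideal_eq by (rule ring.genideal_ideal[OF ring_FP rels_subset])

lemma ring_localization: "ring (localization R a)"
  unfolding localization_def by (rule ideal.quotient_is_ring[OF ideal_localization])

lemma localization_proj: "(+>\<^bsub>FP\<^esub>) (localization_ideal R a) \<in> ring_hom FP (localization R a)"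
  unfolding localization_def by (rule ideal.rcos_ring_hom[OF ideal_localization])

lemma localization_map_hom: "localization_map R a \<in> ring_hom R (localization R a)"
proof -
  have "localization_map R a = (\<lambda>r. localization_ideal R a +>\<^bsub>FP\<^esub> fl r)" by (rule ext) (simp add: localization_map_def)
  then show ?thesis using ring_hom_trans[OF fl_hom localization_proj] by (simp add: comp_def)
qed

lemma localization_inv_closed: "localization_inv R a i \<in> carrier (localization R a)"
  unfolding localization_inv_def by (rule ring_hom_closed[OF localization_proj fx_closed])

lemma localization_inverse:
  "localization_map R a (a i) \<otimes>\<^bsub>localization R a\<^esub> localization_inv R a i = \<one>\<^bsub>localization R a\<^esub>"
  "localization_inv R a i \<otimes>\<^bsub>localization R a\<^esub> localization_map R a (a i) = \<one>\<^bsub>localization R a\<^esub>"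
proof -
  interpret fp: ring FP by (rule ring_FP)
  have flc: "fl (a i) \<in> carrier FP" by (rule ring_hom_closed[OF fl_hom a])
  have rel: "localization_ideal R a +>\<^bsub>FP\<^esub> y = localization_ideal R a +>\<^bsub>FP\<^esub> \<one>\<^bsub>FP\<^esub>"
    if "y \<in> carrier FP" "y \<ominus>\<^bsub>FP\<^esub> \<one>\<^bsub>FP\<^esub> \<in> rels" for y
  proof -
    have "y \<ominus>\<^bsub>FP\<^esub> \<one>\<^bsub>FP\<^esub> \<in> localization_ideal R a"
      unfolding localization_ideal_eq using that(2) fp.genideal_self[OF rels_subset] by blast
    then show ?thesis using fp.quotient_eq_iff_same_a_r_cos[OF ideal_localization that(1) fp.one_closed] by simp
  qed
  show "localization_map R a (a i) \<otimes>\<^bsub>localization R a\<^esub> localization_inv R a i = \<one>\<^bsub>localization R a\<^esub>"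
    unfolding localization_map_def localization_inv_def ring_hom_mult[OF localization_proj flc fx_closed, symmetric]
      ring_hom_one[OF localization_proj, symmetric]
    by (rule rel) (use flc fx_closed in auto)
  show "localization_inv R a i \<otimes>\<^bsub>localization R a\<^esub> localization_map R a (a i) = \<one>\<^bsub>localization R a\<^esub>"
    unfolding localization_map_def localization_inv_def ring_hom_mult[OF localization_proj fx_closed flc, symmetric]
      ring_hom_one[OF localization_proj, symmetric]
    by (rule rel) (use flc fx_closed in auto)
qed

text \<open>The inverses are prescribed by a homomorphism on the polynomial ring and not merely as a
  family, since the free product already makes the adjoined variables commute.\<close>

lemma localization_universal:
  assumes T: "ring T" and f: "f \<in> ring_hom R T" and g: "g \<in> ring_hom int_mpoly_ring T"
    and inv: "\<And>i. f (a i) \<otimes>\<^bsub>T\<^esub> g (mpoly_var i) = \<one>\<^bsub>T\<^esub>" "\<And>i. g (mpoly_var i) \<otimes>\<^bsub>T\<^esub> f (a i) = \<one>\<^bsub>T\<^esub>"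
  shows "\<exists>h\<in>ring_hom (localization R a) T. (\<forall>r\<in>carrier R. h (localization_map R a r) = f r) \<and>
    (\<forall>i. h (localization_inv R a i) = g (mpoly_var i))"
proof -
  interpret T: ring T by (rule T)
  obtain h where h: "h \<in> ring_hom FP T" and hl: "\<And>r. r \<in> carrier R \<Longrightarrow> h (fl r) = f r"
    and hr: "\<And>p. p \<in> carrier int_mpoly_ring \<Longrightarrow> h (fp_right R int_mpoly_ring p) = g p"
    using free_product_universal[OF R ring_int_mpoly_ring T f g] by blast
  interpret fp: ring FP by (rule ring_FP)
  interpret h: ring_hom_ring FP T h by (rule ring_hom_ringI2[OF fp.ring_axioms T h])
  have hx: "h (fx i) = g (mpoly_var i)" for i by (rule hr) (simp add: int_mpoly_ring_def)
  have "h s = \<zero>\<^bsub>T\<^esub>" if "s \<in> rels" for s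
  proof -
    have flc: "fl (a i) \<in> carrier FP" for i by (rule ring_hom_closed[OF fl_hom a])
    have d: "h (y \<ominus>\<^bsub>FP\<^esub> \<one>\<^bsub>FP\<^esub>) = \<zero>\<^bsub>T\<^esub>" if "y \<in> carrier FP" "h y = \<one>\<^bsub>T\<^esub>" for y
      unfolding a_minus_def using that by (simp add: T.r_neg)
    show ?thesis using that flc fx_closed by (auto intro!: d simp: hl[OF a] hx inv)
  qed
  from ring_hom_factor[OF ring_FP T h rels_subset this]
  obtain k where k: "k \<in> ring_hom (localization R a) T"
    "\<And>r. r \<in> carrier FP \<Longrightarrow> k (localization_ideal R a +>\<^bsub>FP\<^esub> r) = h r"
    unfolding localization_def localization_ideal_eq by blast
  show ?thesis
    by (rule bexI[OF _ k(1)])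
      (auto simp: localization_map_def localization_inv_def k(2) fx_closed ring_hom_closed[OF fl_hom] hl hx)
qed

text \<open>The localization is generated by the image of R and the adjoined inverses; negatives are
  obtained by multiplying with the image of -1 from R.\<close>

lemma localization_induct [consumes 1, case_names base inv add mult]:
  assumes "c \<in> carrier (localization R a)"
    and base: "\<And>r. r \<in> carrier R \<Longrightarrow> P (localization_map R a r)" and inv: "\<And>i. P (localization_inv R a i)"
    and add: "\<And>x y. x \<in> carrier (localization R a) \<Longrightarrow> y \<in> carrier (localization R a) \<Longrightarrow> P x \<Longrightarrow> P y \<Longrightarrow> P (x \<oplus>\<^bsub>localization R a\<^esub> y)"
    and mult: "\<And>x y. x \<in> carrier (localization R a) \<Longrightarrow> y \<in> carrier (localization R a) \<Longrightarrow> P x \<Longrightarrow> P y \<Longrightarrow> P (x \<otimes>\<^bsub>localization R a\<^esub> y)"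
  shows "P c"
proof -
  interpret R: ring R by (rule R)
  interpret fp: ring FP by (rule ring_FP)
  interpret L: ring "localization R a" by (rule ring_localization)
  let ?pi = "\<lambda>f. localization_ideal R a +>\<^bsub>FP\<^esub> f"
  interpret pi: ring_hom_ring FP "localization R a" ?pi
    by (rule ring_hom_ringI2[OF fp.ring_axioms L.ring_axioms localization_proj])
  interpret l: ring_hom_ring R "localization R a" "localization_map R a"
    by (rule ring_hom_ringI2[OF R L.ring_axioms localization_map_hom])
  interpret r: ring_hom_ring int_mpoly_ring FP "fp_right R int_mpoly_ring"
    by (rule ring_hom_ringI2[OF ring_int_mpoly_ring fp.ring_axioms fr_hom])
  have ic: "p \<in> carrier int_mpoly_ring" for p :: "('i \<Rightarrow>\<^sub>0 nat) \<Rightarrow>\<^sub>0 int" by (simp add: int_mpoly_ring_def)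
  have im: "p * s = p \<otimes>\<^bsub>int_mpoly_ring\<^esub> s" "p + s = p \<oplus>\<^bsub>int_mpoly_ring\<^esub> s" "1 = \<one>\<^bsub>int_mpoly_ring\<^esub>" for p s :: "('i \<Rightarrow>\<^sub>0 nat) \<Rightarrow>\<^sub>0 int"
    by (simp_all add: int_mpoly_ring_def)
  have mone: "- 1 = \<ominus>\<^bsub>int_mpoly_ring\<^esub> \<one>\<^bsub>int_mpoly_ring :: (('i \<Rightarrow>\<^sub>0 nat) \<Rightarrow>\<^sub>0 int) ring\<^esub>"
    by (rule r.R.minus_equality[symmetric]) (simp_all add: int_mpoly_ring_def)
  have one: "P \<one>\<^bsub>localization R a\<^esub>" using base[OF R.one_closed] l.hom_one by simp
  have minus_one: "P (\<ominus>\<^bsub>localization R a\<^esub> \<one>\<^bsub>localization R a\<^esub>)"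
    using base[OF R.a_inv_closed[OF R.one_closed]] l.hom_one by simp
  have rp: "P (?pi (fp_right R int_mpoly_ring p))" for p :: "('i \<Rightarrow>\<^sub>0 nat) \<Rightarrow>\<^sub>0 int"
  proof (induction p rule: int_mpoly_induct)
    case one
    show ?case unfolding im r.hom_one pi.hom_one by (rule \<open>P \<one>\<^bsub>localization R a\<^esub>\<close>)
  next
    case minus_one
    show ?case unfolding mone using \<open>P (\<ominus>\<^bsub>localization R a\<^esub> \<one>\<^bsub>localization R a\<^esub>)\<close> by simp
  next
    case (var i)
    show ?case using inv[of i] by (simp add: localization_inv_def)
  next
    case (add p s)
    then show ?case unfolding im using assms(4) ic pi.hom_closed r.hom_closed by simp
  next
    case (mult p s)
    then show ?case unfolding im using assms(5) ic pi.hom_closed r.hom_closed by simp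
  qed
  obtain f where f: "f \<in> carrier FP" "c = ?pi f"
    using assms(1) unfolding localization_def by (rule quotient_surj)
  have "P (?pi f)"
  proof (rule free_product_induct[OF R ring_int_mpoly_ring f(1), of "\<lambda>f. P (?pi f)"])
    show "P (?pi (fl r))" if "r \<in> carrier R" for r using base[OF that] by (simp add: localization_map_def)
    show "P (?pi (fp_right R int_mpoly_ring s))" for s :: "('i \<Rightarrow>\<^sub>0 nat) \<Rightarrow>\<^sub>0 int" by (rule rp)
    fix x y assume "x \<in> carrier FP" "y \<in> carrier FP" "P (?pi x)" "P (?pi y)"
    then show "P (?pi (x \<oplus>\<^bsub>FP\<^esub> y))" "P (?pi (x \<otimes>\<^bsub>FP\<^esub> y))"
      using assms(4)[of "?pi x" "?pi y"] assms(5)[of "?pi x" "?pi y"] pi.hom_closed by simp_all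
  qed
  then show ?thesis using f(2) by simp
qed

end

section \<open>The localized Hall algebra\<close>

context exceptional_object
begin

lemma structure_constants_F: "structure_constants (iso_classes C) F unit_class"
proof
  fix m n p k
  show "F m n k \<ge> 0" by (rule F_nonneg)
  show "F m n k \<noteq> 0 \<Longrightarrow> m \<in> iso_classes C \<and> n \<in> iso_classes C \<and> k \<in> iso_classes C" by (rule F_classes)
  show "finite {m. F m n k \<noteq> 0}" by (rule finite_F_left)
  show "finite {n. F m n k \<noteq> 0}" by (rule finite_F_right)
  show "finite {k. F m n k \<noteq> 0}" by (rule finite_F_middle)
  show "(\<Sum>l | F m n l * F l p k \<noteq> 0. F m n l * F l p k) = (\<Sum>l | F n p l * F m l k \<noteq> 0. F n p l * F m l k)"
    by (rule F_assoc)
  show "unit_class \<in> iso_classes C" by (rule unit_class_in)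
  show "n \<in> iso_classes C \<Longrightarrow> k \<in> iso_classes C \<Longrightarrow> F unit_class n k = (if n = k then 1 else 0)" by (rule F_unit_left)
  show "n \<in> iso_classes C \<Longrightarrow> k \<in> iso_classes C \<Longrightarrow> F n unit_class k = (if n = k then 1 else 0)" by (rule F_unit_right)
qed

lemma exceptional_algebra_F: "exceptional_algebra (iso_classes C) F unit_class cls q hin hout"
proof (intro exceptional_algebra.intro structure_constants_F exceptional_algebra_axioms.intro)
  fix m n k
  show "cls \<in> iso_classes C" by (rule cls_in)
  show "2 \<le> q" by (rule q_ge_2)
  show "F m n k \<noteq> 0 \<Longrightarrow> hin m \<le> hin k" by (rule hin_mono)
  show "F m n k \<noteq> 0 \<Longrightarrow> hout n \<le> hout k" by (rule hout_mono)
  show "F cls n k \<noteq> 0 \<Longrightarrow> hin k = q * hin n" by (rule hin_cls)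
  show "F m cls k \<noteq> 0 \<Longrightarrow> hout k = q * hout m" by (rule hout_cls)
  show "hin unit_class = 1" by (rule unit_hin)
  show "hout unit_class = 1" by (rule unit_hout)
  show "k \<in> iso_classes C \<Longrightarrow> \<exists>n. hin k = q ^ n" by (rule hin_power)
  show "k \<in> iso_classes C \<Longrightarrow> \<exists>n. hout k = q ^ n" by (rule hout_power)
qed

lemma exceptional_perp_F: "exceptional_perp (iso_classes C) F unit_class cls q hin hout perp ext"
proof (intro exceptional_perp.intro exceptional_subalgebra.intro exceptional_algebra_F
    exceptional_subalgebra_axioms.intro exceptional_perp_axioms.intro)
  fix m n k
  show "perp \<subseteq> iso_classes C" by (auto simp: perp_def)
  show "unit_class \<in> perp" by (rule unit_perp)
  show "cls \<in> perp" by (rule cls_perp)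
  show "F m n k \<noteq> 0 \<Longrightarrow> m \<in> perp \<Longrightarrow> n \<in> perp \<Longrightarrow> k \<in> perp" by (rule perp_closed)
  assume "m \<in> perp" "F cls m k * of_nat (hout m) \<noteq> F m cls k * of_nat (hin m)"
  from exceptional_step[OF this] show "F cls m k \<noteq> 0 \<and> hout k = hout m \<and> ext k < ext m" by blast
qed

sublocale A: exceptional_algebra "iso_classes C" F unit_class cls q hin hout
  by (rule exceptional_algebra_F)

lemma good_left: "A.good perp"
  by (rule exceptional_perp.good_B[OF exceptional_perp_F])

definition perp' :: "'o set set" where "perp' = {k \<in> iso_classes C. k \<subseteq> perp_right C E}"

lemma perp_left_op_cat: "perp_left (op_cat C) E = perp_right C E"
  using op_Ext1_vanishes[of E] by (auto simp: perp_left_def perp_right_def)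

text \<open>Over the opposite category Ext^1(-,E) becomes Ext^1(E,-) and the structure constants
  have their two factors exchanged, so \<open>good_left\<close> for that category is transferred by
  \<open>A.opposite_good\<close>.\<close>

lemma good_right: "A.good perp'"
proof -
  interpret op: exceptional_object "op_cat C" E by (rule op_exceptional)
  have F: "op.F = (\<lambda>m n. F n m)" by (intro HOL.ext) (rule F_op_cat)
  have cl: "op.cls = cls" by (simp add: op.cls_def cls_def iso_class_op_cat)
  have p: "op.perp = perp'" by (simp add: op.perp_def perp'_def iso_classes_op_cat perp_left_op_cat)
  have q: "q_obj (op_cat C) E = q" by (simp add: q_obj_def)
  have "exceptional_algebra.good (iso_classes (op_cat C)) op.F op.unit_class op.cls (q_obj (op_cat C) E) op.perp"
    by (rule op.good_left)
  then have "exceptional_algebra.good (iso_classes C) (\<lambda>m n. F n m) unit_class cls q perp'"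
    unfolding F cl p q iso_classes_op_cat unit_class_op_cat .
  then show ?thesis by (rule A.opposite_good)
qed

lemma hall_mult_conv: "hall_mult C = A.conv"
proof (intro HOL.ext)
  fix f g k
  show "hall_mult C f g k = A.conv f g k"
  proof (cases "k \<in> iso_classes C")
    case True
    have "{(m, n). m \<in> iso_classes C \<and> n \<in> iso_classes C \<and> f m * g n * of_nat (hall_number C m n k) \<noteq> 0}
      = {(m, n). f m * g n * F m n k \<noteq> 0}"
      using True by (auto simp: F_def split: if_splits)
    then show ?thesis using True unfolding hall_mult_def A.conv_def by (auto simp: F_def intro!: sum.cong)
  next
    case False
    then have "F m n k = 0" for m n using F_classes by blast
    then show ?thesis using False by (simp add: hall_mult_def A.conv_def)
  qed
qed

lemma hall_formal_simps:
  "carrier (hall_formal C) = {f. \<forall>k. f k \<noteq> 0 \<longrightarrow> k \<in> iso_classes C}"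
  "monoid.mult (hall_formal C) = A.conv" "\<one>\<^bsub>hall_formal C\<^esub> = A.delta unit_class"
  "\<zero>\<^bsub>hall_formal C\<^esub> = (\<lambda>_. 0)" "ring.add (hall_formal C) = (\<lambda>f g k. f k + g k)"
  by (simp_all add: hall_formal_def hall_mult_conv hall_basis_def[abs_def] A.delta_def[abs_def] unit_class_def)

lemma hall_basis_X: "hall_basis C E = A.X"
  by (rule HOL.ext) (simp add: hall_basis_def A.X_def A.delta_def flip: cls_def)

lemma S_elem_phi: "S_elem C E j = A.\<phi> (A.sj j)"
  by (rule HOL.ext)
    (simp add: S_elem_def hall_formal_simps hall_basis_X A.sj_def A.phi_add A.phi_const_mult A.phi_1 A.phi_X)

lemma X_pow: "A.X [^]\<^bsub>hall_formal C\<^esub> n = A.Xp n"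
proof (induction n)
  case 0
  show ?case by (simp add: nat_pow_def hall_formal_simps)
next
  case (Suc n)
  then show ?case by (simp add: nat_pow_def hall_formal_simps)
qed

lemma q_exp_phi: "q_exp C q (hall_basis C E) = A.\<phi> (A.ex 0)"
  by (rule HOL.ext) (simp add: q_exp_def hall_basis_X X_pow A.\<phi>_def A.ex_def)

abbreviation "expE \<equiv> A.\<phi> (A.ex 0)"
abbreviation "expI \<equiv> A.\<phi> (inverse (A.ex 0))"

lemma expE_inverse: "A.conv expE expI = A.delta unit_class" "A.conv expI expE = A.delta unit_class"
  by (simp_all flip: A.phi_mult add: A.ex_unit A.phi_1)

lemma bifin_formal: "A.bifin f \<Longrightarrow> f \<in> carrier (hall_formal C)"
  using A.bifin_I by (auto simp: hall_formal_simps)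

lemma expE_Units: "expE \<in> Units (hall_formal C)"
  unfolding Units_def using bifin_formal[OF A.bifin_phi] expE_inverse
  by (auto simp: hall_formal_simps(2,3))

text \<open>\<open>hall_formal C\<close> is not associative in general, but products with elements of finite type on the
  right are, which is enough for the uniqueness of the inverse.\<close>

lemma inv_expE: "inv\<^bsub>hall_formal C\<^esub> expE = expI"
  unfolding m_inv_def
proof (rule the_equality)
  show "expI \<in> carrier (hall_formal C) \<and> expE \<otimes>\<^bsub>hall_formal C\<^esub> expI = \<one>\<^bsub>hall_formal C\<^esub> \<and>
      expI \<otimes>\<^bsub>hall_formal C\<^esub> expE = \<one>\<^bsub>hall_formal C\<^esub>"
    using bifin_formal[OF A.bifin_phi] expE_inverse by (simp add: hall_formal_simps(2,3))
  fix y assume y: "y \<in> carrier (hall_formal C) \<and> expE \<otimes>\<^bsub>hall_formal C\<^esub> y = \<one>\<^bsub>hall_formal C\<^esub> \<and>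
      y \<otimes>\<^bsub>hall_formal C\<^esub> expE = \<one>\<^bsub>hall_formal C\<^esub>"
  have sf: "A.subfin expE" "A.subfin expI" using A.bifin_phi by (simp_all add: A.bifin_def)
  have yI: "y k \<noteq> 0 \<Longrightarrow> k \<in> iso_classes C" for k using y by (simp add: hall_formal_simps(1))
  have "y = A.conv y (A.conv expE expI)" using A.conv_unit_right[OF yI] by (simp add: expE_inverse)
  also have "\<dots> = A.conv (A.conv y expE) expI" by (rule A.conv_assoc[OF sf, symmetric])
  also have "A.conv y expE = A.delta unit_class" using y by (simp add: hall_formal_simps(2,3))
  finally show "y = expI" by simp
qed

text \<open>\<open>A.BF\<close> and \<open>hall_formal C\<close> have the same operations and unit;
  only the carrier grows.\<close>

lemma ring_hom_BF_formal:
  assumes "f \<in> ring_hom L A.BF"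
  shows "f \<in> ring_hom L (hall_formal C)"
proof (rule ring_hom_memI)
  show "x \<in> carrier L \<Longrightarrow> f x \<in> carrier (hall_formal C)" for x
    using ring_hom_closed[OF assms] bifin_formal by auto
  show "f \<one>\<^bsub>L\<^esub> = \<one>\<^bsub>hall_formal C\<^esub>" using ring_hom_one[OF assms] by (simp add: hall_formal_simps(3))
qed (use ring_hom_mult[OF assms] ring_hom_add[OF assms] in \<open>simp_all add: hall_formal_simps(2,5)\<close>)

subsection \<open>The grading\<close>

abbreviation "G \<equiv> free_Abelian_group (iso_classes C)"
abbreviation "N \<equiv> generate G (K0_relations C)"

lemma K0_relations_subset: "K0_relations C \<subseteq> carrier G"
proof
  fix r assume "r \<in> K0_relations C"
  then obtain K M M' f g where r: "r = frag_of (iso_class C K) - frag_of (iso_class C M) - frag_of (iso_class C M')"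
    and "(K, f, g) \<in> extensions C M M'" by (auto simp: K0_relations_def)
  then have s: "ses C M' f K g M" by (simp add: extensions_iff_ses)
  have o: "M' \<in> Obj C" "K \<in> Obj C" "M \<in> Obj C"
    using dm_obj[of f] cd_obj[of f] cd_obj[of g] ses_arr[OF s] by simp_all
  then have "Poly_Mapping.keys r \<subseteq> {iso_class C K, iso_class C M, iso_class C M'}"
    unfolding r using keys_diff[of "frag_of (iso_class C K) - frag_of (iso_class C M)" "frag_of (iso_class C M')"]
      keys_diff[of "frag_of (iso_class C K)" "frag_of (iso_class C M)"] by (auto simp: keys_frag_of)
  then show "r \<in> carrier G" using o by auto
qed

lemma subgroup_N: "subgroup N G"
  using group.generate_is_subgroup[OF group_free_Abelian_group K0_relations_subset] .

lemma normal_N: "N \<lhd> G"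
  by (rule comm_group.subgroup_imp_normal[OF abelian_free_Abelian_group subgroup_N])

lemma comm_group_K0: "comm_group (K0 C)"
  unfolding K0_def by (rule comm_group.abelian_FactGroup[OF abelian_free_Abelian_group subgroup_N])

sublocale K: comm_group "K0 C" by (rule comm_group_K0)

lemma K0_hom: "(\<lambda>x. N #>\<^bsub>G\<^esub> x) \<in> Group.hom G (K0 C)"
  unfolding K0_def by (rule normal.r_coset_hom_Mod[OF normal_N])

lemma K0_class_closed: "k \<in> iso_classes C \<Longrightarrow> K0_class C k \<in> carrier (K0 C)"
  unfolding K0_class_def using K0_hom by (auto simp: Group.hom_def Pi_def keys_frag_of)

lemma K0_class_mult:
  assumes "F m n k \<noteq> 0"
  shows "K0_class C k = K0_class C m \<otimes>\<^bsub>K0 C\<^esub> K0_class C n"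
proof -
  let ?h = "\<lambda>x. N #>\<^bsub>G\<^esub> x"
  have c: "m \<in> iso_classes C" "n \<in> iso_classes C" "k \<in> iso_classes C" using F_classes[OF assms] by auto
  obtain f g where s: "ses C (rep n) f (rep k) g (rep m)" using F_rep_ses[OF assms] by blast
  define r where "r = frag_of k - frag_of m - frag_of n"
  have "(rep k, f, g) \<in> extensions C (rep m) (rep n)" using s by (simp add: extensions_iff_ses)
  moreover have "r = frag_of (iso_class C (rep k)) - frag_of (iso_class C (rep m)) - frag_of (iso_class C (rep n))"
    using rep(2)[OF c(1)] rep(2)[OF c(2)] rep(2)[OF c(3)] by (simp add: r_def)
  ultimately have "r \<in> K0_relations C" unfolding K0_relations_def by blast
  then have rN: "r \<in> N" by (rule generate.incl)
  have cr: "r \<in> carrier G" using rN subgroup.mem_carrier[OF subgroup_N] by blast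
  have cc: "frag_of m \<in> carrier G" "frag_of n \<in> carrier G" using c by (simp_all add: keys_frag_of)
  have "?h r = N" by (rule group.coset_join2[OF group_free_Abelian_group cr subgroup_N rN])
  then have hr: "?h r = \<one>\<^bsub>K0 C\<^esub>" by (simp add: K0_def FactGroup_def)
  have m: "?h (x + y) = ?h x \<otimes>\<^bsub>K0 C\<^esub> ?h y" if "x \<in> carrier G" "y \<in> carrier G" for x y
    using hom_mult[OF K0_hom that] by simp
  have "frag_of k = r + (frag_of m + frag_of n)" by (simp add: r_def)
  then have "?h (frag_of k) = ?h r \<otimes>\<^bsub>K0 C\<^esub> (?h (frag_of m) \<otimes>\<^bsub>K0 C\<^esub> ?h (frag_of n))"
    using m[OF cr, of "frag_of m + frag_of n"] m[OF cc] group.is_monoid[OF group_free_Abelian_group]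
      monoid.m_closed[OF group.is_monoid[OF group_free_Abelian_group] cc] by simp
  then show ?thesis
    unfolding K0_class_def hr using hom_in_carrier[OF K0_hom cc(1)] hom_in_carrier[OF K0_hom cc(2)] by simp
qed

lemma K0_class_Xp: "A.Xp i k \<noteq> 0 \<Longrightarrow> K0_class C k = K0_class C cls [^]\<^bsub>K0 C\<^esub> i"
proof (induction i arbitrary: k)
  case 0
  then have k: "k = unit_class" by (simp add: A.delta_def split: if_splits)
  have "F unit_class unit_class unit_class \<noteq> 0" using F_unit_left[of unit_class unit_class] by simp
  from K0_class_mult[OF this] K0_class_closed[OF unit_class_in]
  have "K0_class C unit_class = \<one>\<^bsub>K0 C\<^esub>" by (metis K.l_cancel_one')
  then show ?case unfolding k by simp
next
  case (Suc i)
  then obtain m where "A.Xp i m \<noteq> 0" "F m cls k \<noteq> 0"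
    by (auto elim!: A.conv_nonzero simp: A.X_def A.delta_def split: if_splits)
  then show ?case using Suc.IH K0_class_mult by simp
qed

text \<open>When the class of E has infinite order its powers in K_0 are distinct. A fixed degree
  then meets the support of at most one power of X, and that support is finite.\<close>

lemma phi_finite_degree:
  assumes tf: "\<And>n::nat. n > 0 \<Longrightarrow> K0_class C cls [^]\<^bsub>K0 C\<^esub> n \<noteq> \<one>\<^bsub>K0 C\<^esub>"
  shows "finite {k. A.\<phi> f k \<noteq> 0 \<and> K0_class C k = \<gamma>}"
proof -
  let ?e = "K0_class C cls"
  have e: "?e \<in> carrier (K0 C)" by (rule K0_class_closed) simp
  have inj: "i = j" if "?e [^]\<^bsub>K0 C\<^esub> i = ?e [^]\<^bsub>K0 C\<^esub> j" for i j :: nat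
    using that
  proof (induction i j rule: linorder_wlog)
    case (le i j)
    have "?e [^]\<^bsub>K0 C\<^esub> i \<otimes>\<^bsub>K0 C\<^esub> ?e [^]\<^bsub>K0 C\<^esub> (j - i) = ?e [^]\<^bsub>K0 C\<^esub> i"
      unfolding K.nat_pow_mult[OF e] using le by simp
    then have "?e [^]\<^bsub>K0 C\<^esub> (j - i) = \<one>\<^bsub>K0 C\<^esub>"
      using K.l_cancel_one[of "?e [^]\<^bsub>K0 C\<^esub> i" "?e [^]\<^bsub>K0 C\<^esub> (j - i)"] e by simp
    then have "\<not> j - i > 0" using tf by blast
    then show ?case using le by simp
  qed simp
  show ?thesis
  proof (cases "\<exists>i. \<gamma> = ?e [^]\<^bsub>K0 C\<^esub> (i::nat)")
    case True
    then obtain i :: nat where i: "\<gamma> = ?e [^]\<^bsub>K0 C\<^esub> i" by blast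
    have "{k. A.\<phi> f k \<noteq> 0 \<and> K0_class C k = \<gamma>} \<subseteq> {k. A.Xp i k \<noteq> 0}"
    proof
      fix k assume "k \<in> {k. A.\<phi> f k \<noteq> 0 \<and> K0_class C k = \<gamma>}"
      then obtain j where j: "A.Xp j k \<noteq> 0" "K0_class C k = \<gamma>" using A.phi_nonzero by blast
      then have "j = i" using K0_class_Xp[OF j(1)] inj i by simp
      then show "k \<in> {k. A.Xp i k \<noteq> 0}" using j by simp
    qed
    then show ?thesis using A.finite_Xp finite_subset by blast
  next
    case False
    then have "{k. A.\<phi> f k \<noteq> 0 \<and> K0_class C k = \<gamma>} = {}" using A.phi_nonzero K0_class_Xp by blast
    then show ?thesis by (metis finite.emptyI)
  qed
qed

text \<open>For each m in the finite support of h the degree of the other factor is forced, so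
  \<open>phi_finite_degree\<close> applies once per m.\<close>

lemma conv_phi_finite_degree:
  assumes tf: "\<And>n::nat. n > 0 \<Longrightarrow> K0_class C cls [^]\<^bsub>K0 C\<^esub> n \<noteq> \<one>\<^bsub>K0 C\<^esub>"
    and h: "finite {k. h k \<noteq> 0}"
  shows "finite {k. A.conv h (A.\<phi> f) k \<noteq> 0 \<and> K0_class C k = \<gamma>}"
proof (rule finite_subset)
  let ?S = "\<lambda>m. {n. A.\<phi> f n \<noteq> 0 \<and> K0_class C n = inv\<^bsub>K0 C\<^esub> (K0_class C m) \<otimes>\<^bsub>K0 C\<^esub> \<gamma>}"
  show "{k. A.conv h (A.\<phi> f) k \<noteq> 0 \<and> K0_class C k = \<gamma>} \<subseteq> (\<Union>m\<in>{k. h k \<noteq> 0}. \<Union>n\<in>?S m. {k. F m n k \<noteq> 0})"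
  proof
    fix k assume "k \<in> {k. A.conv h (A.\<phi> f) k \<noteq> 0 \<and> K0_class C k = \<gamma>}"
    then obtain m n where mn: "h m \<noteq> 0" "A.\<phi> f n \<noteq> 0" "F m n k \<noteq> 0" and k: "K0_class C k = \<gamma>"
      by (auto elim!: A.conv_nonzero)
    have c: "K0_class C m \<in> carrier (K0 C)" "K0_class C n \<in> carrier (K0 C)"
      using K0_class_closed F_classes[OF mn(3)] by auto
    have "\<gamma> = K0_class C m \<otimes>\<^bsub>K0 C\<^esub> K0_class C n" using K0_class_mult[OF mn(3)] k by simp
    then have "inv\<^bsub>K0 C\<^esub> (K0_class C m) \<otimes>\<^bsub>K0 C\<^esub> \<gamma> = K0_class C n" using c by (simp add: K.inv_solve_left')
    then show "k \<in> (\<Union>m\<in>{k. h k \<noteq> 0}. \<Union>n\<in>?S m. {k. F m n k \<noteq> 0})" using mn by auto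
  qed
  show "finite (\<Union>m\<in>{k. h k \<noteq> 0}. \<Union>n\<in>?S m. {k. F m n k \<noteq> 0})"
    using h phi_finite_degree[OF tf] finite_F_middle by (intro finite_UN_I) auto
qed

lemma hall_completion_iff:
  "f \<in> carrier (hall_completion C) \<longleftrightarrow> (\<forall>k. f k \<noteq> 0 \<longrightarrow> k \<in> iso_classes C) \<and>
    (\<forall>\<gamma>\<in>carrier (K0 C). finite {k. f k \<noteq> 0 \<and> K0_class C k = \<gamma>})"
  by (simp add: hall_completion_def hall_formal_simps(1))

lemma phi_completion:
  assumes "\<And>n::nat. n > 0 \<Longrightarrow> K0_class C cls [^]\<^bsub>K0 C\<^esub> n \<noteq> \<one>\<^bsub>K0 C\<^esub>"
  shows "A.\<phi> f \<in> carrier (hall_completion C)"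
  unfolding hall_completion_iff using phi_finite_degree[OF assms] A.bifin_I[OF A.bifin_phi] by blast

end

subsection \<open>The automorphism\<close>

text \<open>Serves both perpendicular subcategories at once, through the self-dual predicate
  \<open>good\<close>.\<close>

locale good_subcategory = exceptional_object C E for C :: "('o, 'm) category" and E :: 'o +
  fixes Bs :: "'o set"
  assumes good: "A.good {k \<in> iso_classes C. k \<subseteq> Bs}"
begin

abbreviation "P \<equiv> {k \<in> iso_classes C. k \<subseteq> Bs}"
abbreviation "R \<equiv> hall_subalgebra C Bs"

sublocale S: exceptional_subalgebra "iso_classes C" F unit_class cls q hin hout P
proof
  show "P \<subseteq> iso_classes C" by auto
  show "unit_class \<in> P" "cls \<in> P" using good unfolding A.good_def by blast+
  show "k \<in> P" if "F m n k \<noteq> 0" "m \<in> P" "n \<in> P" for m n k using good that unfolding A.good_def by blast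
qed

lemma carrier_R: "carrier R = A.H P"
  by (auto simp: hall_subalgebra_def hall_algebra_def hall_formal_simps(1) A.H_def)

lemma R_eq: "R = A.BF\<lparr>carrier := A.H P\<rparr>"
proof -
  have "hall_basis C (SOME Z. is_zero_object C Z) = A.delta unit_class"
    by (rule HOL.ext) (simp add: hall_basis_def A.delta_def unit_class_def)
  then show ?thesis
    using carrier_R by (simp add: hall_subalgebra_def hall_algebra_def hall_formal_def A.BF_def hall_mult_conv)
qed

lemma ring_R: "ring R"
proof -
  interpret BF: ring A.BF by (rule A.ring_BF)
  have "subring (A.H P) A.BF"
  proof (rule BF.subringI)
    show "A.H P \<subseteq> carrier A.BF" using S.H_bifin by auto
    show "\<one>\<^bsub>A.BF\<^esub> \<in> A.H P" using S.H_delta[OF S.u_B] by simp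
    fix h assume h: "h \<in> A.H P"
    have "\<ominus>\<^bsub>A.BF\<^esub> h = (\<lambda>k. - 1 * h k)"
      using S.H_bifin[OF h] S.H_bifin[OF S.H_smult[OF h, of "- 1"]] by (intro BF.minus_equality) auto
    then show "\<ominus>\<^bsub>A.BF\<^esub> h \<in> A.H P" using S.H_smult[OF h, of "- 1"] by simp
    fix h' assume h': "h' \<in> A.H P"
    show "h \<otimes>\<^bsub>A.BF\<^esub> h' \<in> A.H P" using S.H_conv[OF h h'] by simp
    show "h \<oplus>\<^bsub>A.BF\<^esub> h' \<in> A.H P" using S.H_add[OF h h'] by simp
  qed
  then show ?thesis unfolding R_eq by (rule BF.subring_is_ring)
qed

lemma R_simps: "x \<otimes>\<^bsub>R\<^esub> y = A.conv x y" "\<one>\<^bsub>R\<^esub> = A.delta unit_class" "\<zero>\<^bsub>R\<^esub> = (\<lambda>_. 0)" "x \<oplus>\<^bsub>R\<^esub> y = (\<lambda>k. x k + y k)"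
  unfolding R_eq by simp_all

lemma S_elem_R: "S_elem C E j \<in> carrier R"
  unfolding S_elem_phi carrier_R by (rule S.H_sj)

abbreviation "L \<equiv> localization R (S_elem C E)"
abbreviation "lm \<equiv> localization_map R (S_elem C E)"
abbreviation "li \<equiv> localization_inv R (S_elem C E)"

text \<open>Each element is the value of a power series with constant term 1, hence a unit in the
  larger ring \<open>A.BF\<close>, and units are not zero divisors.\<close>

lemma commuting_regular: "commuting_regular_family R (S_elem C E)"
  unfolding commuting_regular_family_def regular_element_def
proof (intro conjI allI ballI impI)
  fix i j :: int and x assume x: "x \<in> carrier R"
  then have bx [simp]: "A.bifin x" by (simp add: carrier_R)
  let ?s = "A.\<phi> (A.sj i)" and ?t = "A.\<phi> (inverse (A.sj i))"
  have st: "A.conv ?t ?s = A.delta unit_class" "A.conv ?s ?t = A.delta unit_class"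
    by (simp_all flip: A.phi_mult add: A.sj_unit A.phi_1)
  { assume "S_elem C E i \<otimes>\<^bsub>R\<^esub> x = \<zero>\<^bsub>R\<^esub>"
    then have "A.conv ?t (A.conv ?s x) = (\<lambda>_. 0)" by (simp add: R_simps S_elem_phi)
    moreover have "A.conv ?t (A.conv ?s x) = A.conv (A.conv ?t ?s) x" by (rule A.bifin_assoc[symmetric]) simp_all
    ultimately show "x = \<zero>\<^bsub>R\<^esub>" by (simp add: st R_simps) }
  { assume "x \<otimes>\<^bsub>R\<^esub> S_elem C E i = \<zero>\<^bsub>R\<^esub>"
    then have "A.conv (A.conv x ?s) ?t = (\<lambda>_. 0)" by (simp add: R_simps S_elem_phi)
    moreover have "A.conv (A.conv x ?s) ?t = A.conv x (A.conv ?s ?t)" by (rule A.bifin_assoc) simp_all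
    ultimately show "x = \<zero>\<^bsub>R\<^esub>" by (simp add: st R_simps) }
next
  fix i j :: int
  show "S_elem C E i \<in> carrier R" by (rule S_elem_R)
  show "S_elem C E i \<otimes>\<^bsub>R\<^esub> S_elem C E j = S_elem C E j \<otimes>\<^bsub>R\<^esub> S_elem C E i"
    unfolding S_elem_phi R_simps by (rule A.conv_phi_comm)
qed

text \<open>\<open>A.BF\<close> already contains inverses of the family, as values of inverse power
  series, so the universal property applies. Injectivity has to wait for denominators.\<close>

lemma localization_embedding:
  "\<exists>\<iota>\<in>ring_hom L A.BF. (\<forall>r\<in>carrier R. \<iota> (lm r) = r) \<and> (\<forall>j. \<iota> (li j) = A.\<phi> (inverse (A.sj j)))"
proof -
  interpret BF: ring A.BF by (rule A.ring_BF)
  have id: "(\<lambda>x. x) \<in> ring_hom R A.BF"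
    by (rule ring_hom_memI) (auto simp: carrier_R R_simps)
  obtain g where g: "g \<in> ring_hom int_mpoly_ring A.BF" "\<And>j::int. g (mpoly_var j) = A.\<phi> (inverse (A.sj j))"
    using int_mpoly_eval[OF A.ring_BF, of A.\<phi> "\<lambda>j. inverse (A.sj j)"] by (auto simp: A.phi_1 A.phi_mult)
  have "\<exists>h\<in>ring_hom L A.BF. (\<forall>r\<in>carrier R. h (lm r) = (\<lambda>x. x) r) \<and> (\<forall>j. h (li j) = g (mpoly_var j))"
  proof (rule localization_universal[where a="S_elem C E", OF ring_R S_elem_R A.ring_BF id g(1)])
    fix j
    show "S_elem C E j \<otimes>\<^bsub>A.BF\<^esub> g (mpoly_var j) = \<one>\<^bsub>A.BF\<^esub>" "g (mpoly_var j) \<otimes>\<^bsub>A.BF\<^esub> S_elem C E j = \<one>\<^bsub>A.BF\<^esub>"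
      unfolding g(2) S_elem_phi by (simp_all flip: A.phi_mult add: A.sj_unit A.phi_1)
  qed
  then show ?thesis by (simp add: g(2))
qed

lemma right_ore:
  assumes "h \<in> carrier R"
  obtains w f where "w \<in> carrier R" "f \<in> A.sprod" "A.conv (A.\<phi> (A.sj j)) w = A.conv h (A.\<phi> f)"
proof -
  have "\<forall>h\<in>A.H P. \<forall>j. \<exists>w\<in>A.H P. \<exists>f\<in>A.sprod. A.conv (A.\<phi> (A.sj j)) w = A.conv h (A.\<phi> f)"
    using good unfolding A.good_def by (elim conjE)
  from bspec[OF this assms[unfolded carrier_R]] show thesis using that[unfolded carrier_R] by blast
qed

lemma ring_L: "ring L" by (rule ring_localization[OF ring_R S_elem_R])

lemma sprod_H: "f \<in> A.sprod \<Longrightarrow> A.\<phi> f \<in> carrier R"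
  unfolding carrier_R by (rule S.H_sprod)

lemma lm_hom: "lm \<in> ring_hom R L" by (rule localization_map_hom[where a="S_elem C E", OF ring_R S_elem_R])

lemma lm_closed: "x \<in> carrier R \<Longrightarrow> lm x \<in> carrier L" by (rule ring_hom_closed[OF lm_hom])

lemma lm_conv: "x \<in> carrier R \<Longrightarrow> y \<in> carrier R \<Longrightarrow> lm x \<otimes>\<^bsub>L\<^esub> lm y = lm (A.conv x y)"
  using ring_hom_mult[OF lm_hom, of x y] by (simp add: R_simps)

lemma sprod_right_unit:
  assumes "f \<in> A.sprod"
  shows "\<exists>g\<in>carrier L. lm (A.\<phi> f) \<otimes>\<^bsub>L\<^esub> g = \<one>\<^bsub>L\<^esub>"
  using assms
proof (induction rule: A.sprod.induct)
  case one
  interpret L: ring L by (rule ring_L)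
  show ?case using ring_hom_one[OF lm_hom] by (intro bexI[of _ "\<one>\<^bsub>L\<^esub>"]) (simp_all add: A.phi_1 R_simps)
next
  case (mult f j)
  interpret L: ring L by (rule ring_L)
  obtain g where g: "g \<in> carrier L" "lm (A.\<phi> f) \<otimes>\<^bsub>L\<^esub> g = \<one>\<^bsub>L\<^esub>" using mult.IH by blast
  have lj: "li j \<in> carrier L" by (rule localization_inv_closed[where a="S_elem C E", OF ring_R S_elem_R])
  have c: "lm (A.\<phi> f) \<in> carrier L" "lm (A.\<phi> (A.sj j)) \<in> carrier L"
    using lm_closed[OF sprod_H[OF mult.hyps]] lm_closed[OF S_elem_R[of j]] by (simp_all add: S_elem_phi)
  have e: "lm (A.\<phi> (A.sj j * f)) = lm (A.\<phi> (A.sj j)) \<otimes>\<^bsub>L\<^esub> lm (A.\<phi> f)"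
    using lm_conv[OF S_elem_R[of j] sprod_H[OF mult.hyps]] by (simp add: S_elem_phi A.phi_mult)
  have "lm (A.\<phi> (A.sj j * f)) \<otimes>\<^bsub>L\<^esub> (g \<otimes>\<^bsub>L\<^esub> li j) = lm (A.\<phi> (A.sj j)) \<otimes>\<^bsub>L\<^esub> ((lm (A.\<phi> f) \<otimes>\<^bsub>L\<^esub> g) \<otimes>\<^bsub>L\<^esub> li j)"
    unfolding e using c g(1) lj by (simp add: L.m_assoc)
  also have "\<dots> = \<one>\<^bsub>L\<^esub>"
    using localization_inverse(1)[where a="S_elem C E", OF ring_R S_elem_R, of j] lj by (simp add: g(2) S_elem_phi)
  finally show ?case using g(1) lj by (intro bexI[of _ "g \<otimes>\<^bsub>L\<^esub> li j"]) auto
qed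

text \<open>The claim is strengthened: left multiplication by y preserves the set \<open>D\<close>
  of all elements that have a right denominator. In this form the case of a product is immediate,
  and the result for y follows by applying it to 1.\<close>

lemma right_denominator:
  assumes "y \<in> carrier L"
  shows "\<exists>f\<in>A.sprod. \<exists>h\<in>carrier R. y \<otimes>\<^bsub>L\<^esub> lm (A.\<phi> f) = lm h"
proof -
  interpret L: ring L by (rule ring_L)
  note sc = lm_closed[OF sprod_H]
  define D where "D = {y \<in> carrier L. \<exists>f\<in>A.sprod. \<exists>h\<in>carrier R. y \<otimes>\<^bsub>L\<^esub> lm (A.\<phi> f) = lm h}"
  have "\<forall>z\<in>D. y \<otimes>\<^bsub>L\<^esub> z \<in> D"
    using assms
  proof (induction rule: localization_induct[where a="S_elem C E", OF ring_R S_elem_R, consumes 1, case_names 1 2 3 4])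
    case (1 r)
    show ?case
    proof
      fix z assume "z \<in> D"
      then obtain f h where z: "z \<in> carrier L" "f \<in> A.sprod" "h \<in> carrier R" "z \<otimes>\<^bsub>L\<^esub> lm (A.\<phi> f) = lm h"
        by (auto simp: D_def)
      have "(lm r \<otimes>\<^bsub>L\<^esub> z) \<otimes>\<^bsub>L\<^esub> lm (A.\<phi> f) = lm (A.conv r h)"
        using z 1 sc[OF z(2)] lm_closed[OF 1] by (simp add: L.m_assoc lm_conv)
      moreover have "A.conv r h \<in> carrier R" using S.H_conv 1 z(3) by (simp add: carrier_R)
      ultimately show "lm r \<otimes>\<^bsub>L\<^esub> z \<in> D" using z lm_closed[OF 1] unfolding D_def by auto
    qed
  next
    case (2 j)
    have lj: "li j \<in> carrier L" by (rule localization_inv_closed[where a="S_elem C E", OF ring_R S_elem_R])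
    have lsj: "lm (A.\<phi> (A.sj j)) \<in> carrier L" using lm_closed[OF S_elem_R[of j]] by (simp add: S_elem_phi)
    show ?case
    proof
      fix z assume "z \<in> D"
      then obtain f h where z: "z \<in> carrier L" "f \<in> A.sprod" "h \<in> carrier R" "z \<otimes>\<^bsub>L\<^esub> lm (A.\<phi> f) = lm h"
        by (auto simp: D_def)
      \<comment> \<open>The Ore condition s w = h s', with s from \<open>sj j\<close> and s' from
        \<open>f'\<close>, rewrites s^-1 h as w s'^-1, moving the denominator to the right.\<close>
      obtain w f' where w: "w \<in> carrier R" "f' \<in> A.sprod" "A.conv (A.\<phi> (A.sj j)) w = A.conv h (A.\<phi> f')"
        using right_ore[OF z(3)] .
      note cl = z(1) sc[OF z(2)] sc[OF w(2)] lm_closed[OF z(3)] lm_closed[OF w(1)] lj lsj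
      have "lm (A.\<phi> (f * f')) = lm (A.\<phi> f) \<otimes>\<^bsub>L\<^esub> lm (A.\<phi> f')"
        using lm_conv[OF sprod_H[OF z(2)] sprod_H[OF w(2)]] by (simp add: A.phi_mult)
      then have "(li j \<otimes>\<^bsub>L\<^esub> z) \<otimes>\<^bsub>L\<^esub> lm (A.\<phi> (f * f')) = li j \<otimes>\<^bsub>L\<^esub> ((z \<otimes>\<^bsub>L\<^esub> lm (A.\<phi> f)) \<otimes>\<^bsub>L\<^esub> lm (A.\<phi> f'))"
        using cl by (simp add: L.m_assoc)
      also have "(z \<otimes>\<^bsub>L\<^esub> lm (A.\<phi> f)) \<otimes>\<^bsub>L\<^esub> lm (A.\<phi> f') = lm (A.\<phi> (A.sj j)) \<otimes>\<^bsub>L\<^esub> lm w"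
        unfolding z(4) using lm_conv[OF z(3) sprod_H[OF w(2)]] lm_conv[OF S_elem_R[of j] w(1)] w(3) by (simp add: S_elem_phi)
      also have "li j \<otimes>\<^bsub>L\<^esub> (lm (A.\<phi> (A.sj j)) \<otimes>\<^bsub>L\<^esub> lm w) = (li j \<otimes>\<^bsub>L\<^esub> lm (A.\<phi> (A.sj j))) \<otimes>\<^bsub>L\<^esub> lm w"
        using cl by (simp add: L.m_assoc)
      also have "\<dots> = lm w" using localization_inverse(2)[where a="S_elem C E", OF ring_R S_elem_R, of j] cl by (simp add: S_elem_phi)
      finally show "li j \<otimes>\<^bsub>L\<^esub> z \<in> D" using cl w S.sprod_mult[OF z(2) w(2)] unfolding D_def by auto
    qed
  next
    case (3 x y)
    show ?case
    proof
      fix z assume zD: "z \<in> D"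
      then have zc: "z \<in> carrier L" by (simp add: D_def)
      obtain f h where f: "f \<in> A.sprod" "h \<in> carrier R" "(x \<otimes>\<^bsub>L\<^esub> z) \<otimes>\<^bsub>L\<^esub> lm (A.\<phi> f) = lm h" using bspec[OF 3(3) zD] by (auto simp: D_def)
      obtain g k where g: "g \<in> A.sprod" "k \<in> carrier R" "(y \<otimes>\<^bsub>L\<^esub> z) \<otimes>\<^bsub>L\<^esub> lm (A.\<phi> g) = lm k" using bspec[OF 3(4) zD] by (auto simp: D_def)
      define a where "a = x \<otimes>\<^bsub>L\<^esub> z"
      define b where "b = y \<otimes>\<^bsub>L\<^esub> z"
      note cl = sc[OF f(1)] sc[OF g(1)] lm_closed[OF f(2)] lm_closed[OF g(2)]
      have ab: "a \<in> carrier L" "b \<in> carrier L" using 3(1,2) zc by (simp_all add: a_def b_def)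
      have e1: "lm (A.\<phi> (f * g)) = lm (A.\<phi> f) \<otimes>\<^bsub>L\<^esub> lm (A.\<phi> g)"
        using lm_conv[OF sprod_H[OF f(1)] sprod_H[OF g(1)]] by (simp add: A.phi_mult)
      have e2: "lm (A.\<phi> (f * g)) = lm (A.\<phi> g) \<otimes>\<^bsub>L\<^esub> lm (A.\<phi> f)"
        using lm_conv[OF sprod_H[OF g(1)] sprod_H[OF f(1)]] by (simp add: A.phi_mult mult.commute[of f g])
      have "a \<otimes>\<^bsub>L\<^esub> lm (A.\<phi> (f * g)) = lm (A.conv h (A.\<phi> g))"
        unfolding e1 using f g ab cl lm_conv[OF f(2) sprod_H[OF g(1)]] by (simp add: L.m_assoc[symmetric] a_def)
      moreover have "b \<otimes>\<^bsub>L\<^esub> lm (A.\<phi> (f * g)) = lm (A.conv k (A.\<phi> f))"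
        unfolding e2 using f g ab cl lm_conv[OF g(2) sprod_H[OF f(1)]] by (simp add: L.m_assoc[symmetric] b_def)
      moreover have hk: "A.conv h (A.\<phi> g) \<in> carrier R" "A.conv k (A.\<phi> f) \<in> carrier R"
        using S.H_conv f(2) g(2) sprod_H[OF f(1)] sprod_H[OF g(1)] by (simp_all add: carrier_R)
      ultimately have "(a \<oplus>\<^bsub>L\<^esub> b) \<otimes>\<^bsub>L\<^esub> lm (A.\<phi> (f * g)) = lm (A.conv h (A.\<phi> g) \<oplus>\<^bsub>R\<^esub> A.conv k (A.\<phi> f))"
        using ab sc[OF S.sprod_mult[OF f(1) g(1)]] ring_hom_add[OF lm_hom hk] by (simp add: L.l_distr)
      moreover have "A.conv h (A.\<phi> g) \<oplus>\<^bsub>R\<^esub> A.conv k (A.\<phi> f) \<in> carrier R"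
        using ring.ring_simprules(1)[OF ring_R hk] .
      ultimately have "a \<oplus>\<^bsub>L\<^esub> b \<in> D" using ab S.sprod_mult[OF f(1) g(1)] unfolding D_def by auto
      then show "(x \<oplus>\<^bsub>L\<^esub> y) \<otimes>\<^bsub>L\<^esub> z \<in> D" using 3(1,2) zc by (simp add: L.l_distr a_def b_def)
    qed
  next
    case (4 x y)
    show ?case
    proof
      fix z assume zD: "z \<in> D"
      then have "(x \<otimes>\<^bsub>L\<^esub> y) \<otimes>\<^bsub>L\<^esub> z = x \<otimes>\<^bsub>L\<^esub> (y \<otimes>\<^bsub>L\<^esub> z)" using 4(1,2) by (simp add: D_def L.m_assoc)
      then show "(x \<otimes>\<^bsub>L\<^esub> y) \<otimes>\<^bsub>L\<^esub> z \<in> D" using 4(3,4) zD by simp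
    qed
  qed
  moreover have "\<one>\<^bsub>L\<^esub> \<in> D"
  proof -
    have "\<one>\<^bsub>L\<^esub> \<otimes>\<^bsub>L\<^esub> lm (A.\<phi> 1) = lm (A.\<phi> 1)" using sc[OF A.sprod.one] by simp
    then show ?thesis using A.sprod.one sprod_H[OF A.sprod.one] unfolding D_def by auto
  qed
  ultimately have "y \<otimes>\<^bsub>L\<^esub> \<one>\<^bsub>L\<^esub> \<in> D" by blast
  then show ?thesis using assms by (simp add: D_def)
qed

definition Ad :: "('o set \<Rightarrow> rat) \<Rightarrow> 'o set \<Rightarrow> rat" where "Ad z = A.conv (A.conv expE z) expI"
definition Ad' :: "('o set \<Rightarrow> rat) \<Rightarrow> 'o set \<Rightarrow> rat" where "Ad' z = A.conv (A.conv expI z) expE"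

text \<open>Conjugation respects sums and products and fixes the inverses of the \<open>sj\<close>,
  which are series in X. So stability has to be known on finite combinations only.\<close>

lemma sandwich_loc:
  assumes E: "A.conv (A.\<phi> f) (A.\<phi> g) = A.delta unit_class" "A.conv (A.\<phi> g) (A.\<phi> f) = A.delta unit_class"
    and H: "\<And>y. y \<in> A.H P \<Longrightarrow> A.conv (A.conv (A.\<phi> f) y) (A.\<phi> g) \<in> A.loc P"
  shows "z \<in> A.loc P \<Longrightarrow> A.conv (A.conv (A.\<phi> f) z) (A.\<phi> g) \<in> A.loc P"
proof (induction rule: A.loc.induct)
  case (base y)
  then show ?case by (rule H)
next
  case (inv j)
  have "A.conv (A.conv (A.\<phi> f) (A.\<phi> (inverse (A.sj j)))) (A.\<phi> g) = A.conv (A.\<phi> (inverse (A.sj j))) (A.conv (A.\<phi> f) (A.\<phi> g))"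
    by (subst A.conv_phi_comm[of f]) (simp add: A.bifin_assoc)
  then show ?case using A.loc.inv[of j P] by (simp add: E)
next
  case (add y z)
  show ?case unfolding S.conj_add[OF A.bifin_phi A.bifin_phi] by (rule A.loc.add[OF add.IH])
next
  case (mult y z)
  note b [simp] = S.loc_bifin[OF mult.hyps(1)] S.loc_bifin[OF mult.hyps(2)]
  have "A.conv (A.conv (A.conv (A.\<phi> f) y) (A.\<phi> g)) (A.conv (A.conv (A.\<phi> f) z) (A.\<phi> g))
    = A.conv (A.\<phi> f) (A.conv y (A.conv (A.conv (A.\<phi> g) (A.\<phi> f)) (A.conv z (A.\<phi> g))))"
    by (simp add: A.bifin_assoc)
  also have "\<dots> = A.conv (A.conv (A.\<phi> f) (A.conv y z)) (A.\<phi> g)" unfolding E by (simp add: A.bifin_assoc)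
  finally show ?case using A.loc.mult[OF mult.IH] by simp
qed

lemma Ad_loc: "z \<in> A.loc P \<Longrightarrow> Ad z \<in> A.loc P"
  unfolding Ad_def by (rule sandwich_loc[OF expE_inverse]) (use good in \<open>simp_all add: A.good_def\<close>)

lemma Ad'_loc: "z \<in> A.loc P \<Longrightarrow> Ad' z \<in> A.loc P"
  unfolding Ad'_def by (rule sandwich_loc[OF expE_inverse(2,1)]) (use good in \<open>simp_all add: A.good_def\<close>)

lemma Ad'_Ad: assumes [simp]: "A.bifin z" shows "Ad' (Ad z) = z" "Ad (Ad' z) = z"
proof -
  have "Ad' (Ad z) = A.conv (A.conv expI expE) (A.conv z (A.conv expI expE))" by (simp add: Ad_def Ad'_def A.bifin_assoc)
  then show "Ad' (Ad z) = z" by (simp add: expE_inverse)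
  have "Ad (Ad' z) = A.conv (A.conv expE expI) (A.conv z (A.conv expE expI))" by (simp add: Ad_def Ad'_def A.bifin_assoc)
  then show "Ad (Ad' z) = z" by (simp add: expE_inverse)
qed

lemma Ad_mult: assumes [simp]: "A.bifin y" "A.bifin z" shows "Ad (A.conv y z) = A.conv (Ad y) (Ad z)"
proof -
  have "A.conv (Ad y) (Ad z) = A.conv expE (A.conv y (A.conv (A.conv expI expE) (A.conv z expI)))"
    by (simp add: Ad_def A.bifin_assoc)
  then show ?thesis by (simp add: expE_inverse Ad_def A.bifin_assoc)
qed

lemma Ad_add: "Ad (\<lambda>k. y k + z k) = (\<lambda>k. Ad y k + Ad z k)"
  unfolding Ad_def by (rule S.conj_add) simp_all

lemma Ad_one: "Ad (A.delta unit_class) = A.delta unit_class"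
  by (simp add: Ad_def expE_inverse)

text \<open>Conjugation lives in the ring of series, where the exponential exists. It is pulled back
  along the embedding, whose image is exactly \<open>A.loc P\<close> and therefore stable.\<close>

theorem conjugation_automorphism:
  "\<exists>\<iota>\<in>ring_hom L (hall_formal C). (\<forall>x\<in>carrier R. \<iota> (lm x) = x) \<and> inj_on \<iota> (carrier L) \<and>
    ((\<forall>n::nat. n > 0 \<longrightarrow> K0_class C cls [^]\<^bsub>K0 C\<^esub> n \<noteq> \<one>\<^bsub>K0 C\<^esub>) \<longrightarrow>
      expE \<in> carrier (hall_completion C) \<and> expI \<in> carrier (hall_completion C) \<and> \<iota> ` carrier L \<subseteq> carrier (hall_completion C)) \<and>
    (\<exists>\<Phi>\<in>ring_iso L L. \<forall>y\<in>carrier L. \<iota> (\<Phi> y) = A.conv (A.conv expE (\<iota> y)) expI)"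
proof -
  interpret L: ring L by (rule ring_L)
  obtain \<iota> where i: "\<iota> \<in> ring_hom L A.BF" and il: "\<And>r. r \<in> carrier R \<Longrightarrow> \<iota> (lm r) = r"
    and ii: "\<And>j. \<iota> (li j) = A.\<phi> (inverse (A.sj j))"
    using localization_embedding by blast
  interpret i: ring_hom_ring L A.BF \<iota> by (rule ring_hom_ringI2[OF ring_L A.ring_BF i])
  have im: "\<iota> (x \<otimes>\<^bsub>L\<^esub> y) = A.conv (\<iota> x) (\<iota> y)" if "x \<in> carrier L" "y \<in> carrier L" for x y
    using i.hom_mult[OF that] by simp
  have ia: "\<iota> (x \<oplus>\<^bsub>L\<^esub> y) = (\<lambda>k. \<iota> x k + \<iota> y k)" if "x \<in> carrier L" "y \<in> carrier L" for x y
    using i.hom_add[OF that] by simp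
  have ib [simp]: "A.bifin (\<iota> x)" if "x \<in> carrier L" for x using i.hom_closed[OF that] by simp
  have lj: "li j \<in> carrier L" for j by (rule localization_inv_closed[where a="S_elem C E", OF ring_R S_elem_R])
  \<comment> \<open>If \<open>\<iota>\<close> kills d, clearing the denominator turns d into the
    image of some h in R. There \<open>\<iota>\<close> is the identity, so h = 0, and the
    denominator is right invertible in L, so d = 0.\<close>
  have inj: "inj_on \<iota> (carrier L)"
  proof (rule inj_onI)
    fix x y assume xy: "x \<in> carrier L" "y \<in> carrier L" "\<iota> x = \<iota> y"
    define d where "d = x \<ominus>\<^bsub>L\<^esub> y"
    have d: "d \<in> carrier L" using xy by (simp add: d_def)
    have id: "\<iota> d = (\<lambda>_. 0)"
      using xy i.hom_closed[OF xy(2)] i.S.r_neg[OF i.hom_closed[OF xy(2)]] by (simp add: d_def a_minus_def)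
    obtain f h where f: "f \<in> A.sprod" "h \<in> carrier R" "d \<otimes>\<^bsub>L\<^esub> lm (A.\<phi> f) = lm h" using right_denominator[OF d] by blast
    have fc: "lm (A.\<phi> f) \<in> carrier L" by (rule lm_closed[OF sprod_H[OF f(1)]])
    have "h = A.conv (\<iota> d) (\<iota> (lm (A.\<phi> f)))" using il[OF f(2)] im[OF d fc] f(3) by simp
    then have "h = \<zero>\<^bsub>R\<^esub>" unfolding id by (simp add: R_simps)
    moreover have "lm \<zero>\<^bsub>R\<^esub> = \<zero>\<^bsub>L\<^esub>" by (rule ring_hom_zero[OF lm_hom ring_R ring_L])
    ultimately have dz: "d \<otimes>\<^bsub>L\<^esub> lm (A.\<phi> f) = \<zero>\<^bsub>L\<^esub>" using f(3) by simp
    obtain g where g: "g \<in> carrier L" "lm (A.\<phi> f) \<otimes>\<^bsub>L\<^esub> g = \<one>\<^bsub>L\<^esub>" using sprod_right_unit[OF f(1)] by blast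
    have "d = (d \<otimes>\<^bsub>L\<^esub> lm (A.\<phi> f)) \<otimes>\<^bsub>L\<^esub> g" using d g fc by (simp add: L.m_assoc)
    then have "d = \<zero>\<^bsub>L\<^esub>" using dz g by simp
    then show "x = y" using xy by (simp add: d_def)
  qed
  have image: "\<iota> ` carrier L = A.loc P"
  proof
    show "\<iota> ` carrier L \<subseteq> A.loc P"
    proof clarify
      fix y assume "y \<in> carrier L"
      then show "\<iota> y \<in> A.loc P"
      proof (induction rule: localization_induct[where a="S_elem C E", OF ring_R S_elem_R, consumes 1, case_names 1 2 3 4])
        case (1 r)
        then show ?case using A.loc.base by (simp add: il carrier_R)
      next
        case (2 j)
        show ?case unfolding ii by (rule A.loc.inv)
      next
        case (3 x y)
        then show ?case using A.loc.add by (simp add: ia)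
      next
        case (4 x y)
        then show ?case using A.loc.mult by (simp add: im)
      qed
    qed
    show "A.loc P \<subseteq> \<iota> ` carrier L"
    proof
      fix z assume "z \<in> A.loc P"
      then show "z \<in> \<iota> ` carrier L"
      proof (induction rule: A.loc.induct)
        case (base y)
        then have y: "y \<in> carrier R" by (simp add: carrier_R)
        from imageI[OF lm_closed[OF y], of \<iota>] show ?case using il[OF y] by simp
      next
        case (inv j)
        from imageI[OF lj[of j], of \<iota>] show ?case using ii[of j] by simp
      next
        case (add y z)
        obtain v w where vw: "v \<in> carrier L" "y = \<iota> v" "w \<in> carrier L" "z = \<iota> w" using add.IH by auto
        from imageI[OF L.a_closed[OF vw(1,3)], of \<iota>] show ?case using ia[OF vw(1,3)] vw(2,4) by simp
      next
        case (mult y z)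
        obtain v w where vw: "v \<in> carrier L" "y = \<iota> v" "w \<in> carrier L" "z = \<iota> w" using mult.IH by auto
        from imageI[OF L.m_closed[OF vw(1,3)], of \<iota>] show ?case using im[OF vw(1,3)] vw(2,4) by simp
      qed
    qed
  qed
  have compl: "expE \<in> carrier (hall_completion C) \<and> expI \<in> carrier (hall_completion C) \<and> \<iota> ` carrier L \<subseteq> carrier (hall_completion C)"
    if tf: "\<forall>n::nat. n > 0 \<longrightarrow> K0_class C cls [^]\<^bsub>K0 C\<^esub> n \<noteq> \<one>\<^bsub>K0 C\<^esub>"
  proof (intro conjI image_subsetI)
    show "expE \<in> carrier (hall_completion C)" "expI \<in> carrier (hall_completion C)"
      by (rule phi_completion, use tf in blast)+
    fix y assume y: "y \<in> carrier L"
    \<comment> \<open>The image of y equals h times the inverse of f, with h finite and f of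
      constant term 1. This reduces finiteness in each degree to
      \<open>conv_phi_finite_degree\<close>.\<close>
    obtain f h where f: "f \<in> A.sprod" "h \<in> carrier R" "y \<otimes>\<^bsub>L\<^esub> lm (A.\<phi> f) = lm h" using right_denominator[OF y] by blast
    have fc: "lm (A.\<phi> f) \<in> carrier L" by (rule lm_closed[OF sprod_H[OF f(1)]])
    have h: "h = A.conv (\<iota> y) (A.\<phi> f)"
      using il[OF f(2)] im[OF y fc] f(3) il[OF sprod_H[OF f(1)]] by simp
    have "fps_nth f 0 = 1" using f(1) by (induction rule: A.sprod.induct) (simp_all add: A.sj_def)
    then have "f * inverse f = 1" using inverse_mult_eq_1[of f] by (simp add: mult.commute)
    then have "A.conv h (A.\<phi> (inverse f)) = \<iota> y"
      unfolding h using y by (simp add: A.bifin_assoc A.phi_1 flip: A.phi_mult)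
    moreover have "finite {k. h k \<noteq> 0}" using f(2) by (simp add: carrier_R A.H_def)
    ultimately have "finite {k. \<iota> y k \<noteq> 0 \<and> K0_class C k = \<gamma>}" for \<gamma>
      using conv_phi_finite_degree[of h "inverse f" \<gamma>] tf by simp
    then show "\<iota> y \<in> carrier (hall_completion C)"
      unfolding hall_completion_iff using A.bifin_I[OF ib[OF y]] by blast
  qed
  define \<Phi> where "\<Phi> y = the_inv_into (carrier L) \<iota> (Ad (\<iota> y))" for y
  have Adi: "Ad (\<iota> y) \<in> \<iota> ` carrier L" if "y \<in> carrier L" for y
    unfolding image by (rule Ad_loc) (use that image in blast)
  have i\<Phi>: "\<iota> (\<Phi> y) = Ad (\<iota> y)" if "y \<in> carrier L" for y
    unfolding \<Phi>_def by (rule f_the_inv_into_f[OF inj Adi[OF that]])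
  have \<Phi>c: "\<Phi> y \<in> carrier L" if "y \<in> carrier L" for y
    unfolding \<Phi>_def by (rule the_inv_into_into[OF inj Adi[OF that] order_refl])
  have eqI: "x = y" if "\<iota> x = \<iota> y" "x \<in> carrier L" "y \<in> carrier L" for x y
    using inj that by (rule inj_onD)
  have "\<Phi> \<in> ring_hom L L"
  proof (rule ring_hom_memI)
    fix x y assume xy: "x \<in> carrier L" "y \<in> carrier L"
    show "\<Phi> x \<in> carrier L" by (rule \<Phi>c[OF xy(1)])
    show "\<Phi> (x \<otimes>\<^bsub>L\<^esub> y) = \<Phi> x \<otimes>\<^bsub>L\<^esub> \<Phi> y"
      by (rule eqI) (use xy in \<open>simp_all add: i\<Phi> im \<Phi>c Ad_mult\<close>)
    show "\<Phi> (x \<oplus>\<^bsub>L\<^esub> y) = \<Phi> x \<oplus>\<^bsub>L\<^esub> \<Phi> y"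
      by (rule eqI) (use xy in \<open>simp_all add: i\<Phi> ia \<Phi>c Ad_add\<close>)
  next
    have "\<iota> \<one>\<^bsub>L\<^esub> = A.delta unit_class" using i.hom_one by simp
    then show "\<Phi> \<one>\<^bsub>L\<^esub> = \<one>\<^bsub>L\<^esub>"
      by (intro eqI) (simp_all add: i\<Phi> Ad_one \<Phi>c)
  qed
  moreover have "bij_betw \<Phi> (carrier L) (carrier L)"
  proof (rule bij_betwI')
    fix x y assume xy: "x \<in> carrier L" "y \<in> carrier L"
    show "(\<Phi> x = \<Phi> y) = (x = y)"
    proof
      assume "\<Phi> x = \<Phi> y"
      then have "Ad' (Ad (\<iota> x)) = Ad' (Ad (\<iota> y))" using i\<Phi>[OF xy(1)] i\<Phi>[OF xy(2)] by simp
      then show "x = y" using xy by (intro eqI) (simp_all add: Ad'_Ad)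
    qed simp
  next
    fix x assume "x \<in> carrier L"
    then show "\<Phi> x \<in> carrier L" by (rule \<Phi>c)
  next
    fix y assume y: "y \<in> carrier L"
    \<comment> \<open>Surjectivity rests on stability under the inverse conjugation, which does not
      follow from stability under conjugation itself.\<close>
    then have "Ad' (\<iota> y) \<in> \<iota> ` carrier L" unfolding image by (intro Ad'_loc) (use image in blast)
    then obtain x where x: "x \<in> carrier L" "\<iota> x = Ad' (\<iota> y)" by auto
    have "y = \<Phi> x" by (rule eqI) (use x y in \<open>simp_all add: i\<Phi> \<Phi>c Ad'_Ad\<close>)
    then show "\<exists>x\<in>carrier L. y = \<Phi> x" using x by blast
  qed
  ultimately have "\<Phi> \<in> ring_iso L L" by (simp add: ring_iso_def)
  then show ?thesis
    using ring_hom_BF_formal[OF i] il inj compl i\<Phi> unfolding Ad_def by blast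
qed

end

theorem theorem1p8:
  fixes C :: "('o, 'm) category" and E :: 'o
  assumes "finitary_abelian_category C"
    and "E \<in> Obj C"
    and "Ext1_vanishes C E E"
    and "field (End_ring C E)"
  shows "let expE = q_exp C (q_obj C E) (hall_basis C E) in
    range (S_elem C E) \<subseteq> carrier (hall_subalgebra C (perp_left C E))
                            \<inter> carrier (hall_subalgebra C (perp_right C E)) \<and>
    expE \<in> Units (hall_formal C) \<and>
    (\<forall>B \<in> {perp_left C E, perp_right C E}.
       let H = hall_subalgebra C B;
           L = localization H (S_elem C E)
       in commuting_regular_family H (S_elem C E) \<and>
          (\<exists>\<iota> \<in> ring_hom L (hall_formal C).
             (\<forall>x \<in> carrier H. \<iota> (localization_map H (S_elem C E) x) = x) \<and>
             inj_on \<iota> (carrier L) \<and>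
             ((\<forall>n::nat. n > 0 \<longrightarrow>
                 K0_class C (iso_class C E) [^]\<^bsub>K0 C\<^esub> n \<noteq> \<one>\<^bsub>K0 C\<^esub>) \<longrightarrow>
               expE \<in> carrier (hall_completion C) \<and>
               inv\<^bsub>hall_formal C\<^esub> expE \<in> carrier (hall_completion C) \<and>
               \<iota> ` carrier L \<subseteq> carrier (hall_completion C)) \<and>
             (\<exists>\<Phi> \<in> ring_iso L L. \<forall>y \<in> carrier L.
                \<iota> (\<Phi> y) = expE \<otimes>\<^bsub>hall_formal C\<^esub> \<iota> y \<otimes>\<^bsub>hall_formal C\<^esub> inv\<^bsub>hall_formal C\<^esub> expE)))"
proof -
  interpret finitary_abelian_category C by fact
  interpret D: field "End_ring C E" by fact
  interpret exceptional_object C E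
  proof
    show "E \<in> Obj C" "Ext1_vanishes C E E" by fact+
    show "Ident C E \<noteq> Null C E E" using D.one_not_zero by (simp add: End_ring_def)
    fix u assume u: "arr C u" "dm C u = E" "cd C u = E" "u \<noteq> Null C E E"
    then have "u \<in> Units (End_ring C E)" unfolding D.field_Units by (simp add: End_ring_def)
    then obtain v where "v \<in> hom E E" "v \<bullet> u = Ident C E" "u \<bullet> v = Ident C E"
      by (auto simp: Units_def End_ring_def)
    then show "is_iso C E E u" using u by (intro is_isoI[of u v]) simp_all
  qed
  have l: "good_subcategory C E (perp_left C E)"
    by (rule good_subcategory.intro[OF exceptional_object_axioms good_subcategory_axioms.intro[OF good_left[unfolded perp_def]]])
  have r: "good_subcategory C E (perp_right C E)"
    by (rule good_subcategory.intro[OF exceptional_object_axioms good_subcategory_axioms.intro[OF good_right[unfolded perp'_def]]])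
  show ?thesis
    unfolding Let_def q_exp_phi inv_expE hall_formal_simps(2) ball_simps cls_def[symmetric]
    by (intro conjI expE_Units TrueI le_infI image_subsetI good_subcategory.S_elem_R[OF l] good_subcategory.S_elem_R[OF r]
        good_subcategory.commuting_regular[OF l] good_subcategory.commuting_regular[OF r]
        good_subcategory.conjugation_automorphism[OF l] good_subcategory.conjugation_automorphism[OF r])
qed

end
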